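(* Let $H$ satisfy the structural assumptions listed in the context, and let $(m,u)$ be a solution (in the sense defined in the context) of the mean-field game system $$H(x,Du,m)=0,\qquad -\operatorname{div}\big(m\,D_pH(x,Du,m)\big)=0\qquad\text{in }\Omega .$$ Then the value function $u$ is locally Hölder continuous in $\Omega$ (as usual, $u$ being identified with its continuous representative).
   Context: Setting. $\Omega\subset\mathbb{R}^d$ is open and connected, and $H:\Omega\times\mathbb{R}^d\times(0,\infty)\to\mathbb{R}$, $H=H(x,p,m)$, is measurable and differentiable in $p$; $D_pH$ denotes the gradient in the variable $p$. For almost every $x\in\Omega$ the maps $(p,m)\mapsto H(x,p,m)$ and $(p,m)\mapsto D_pH(x,p,m)$ are continuous on $\mathbb{R}^d\times(0,\infty)$. $Du$ and $\operatorname{div}$ refer to the variable $x$. Structural assumptions on $H$. Real parameters satisfy $\alpha>1$, $0\le\tau<1$, $\beta>\frac{\tau}{\alpha-1}$; set $\delta:=\frac{\beta+\tau}{\alpha}$ (so $\beta>\delta$), and let $\epsilon>0$ satisfy $\beta-\delta>\epsilon$. There is a (sufficiently large) constant $C>0$ such that for all $x\in\Omega$, $p\in\mathbb{R}^d$, $m>0$: (1) $|D_pH(x,p,m)|\le C\left(\frac1m+\frac1{m^\tau}\right)|p|^{\alpha-1}+C\left(m^{\beta-\delta}+\frac1m\right)$; (2) $D_pH(x,p,m)\cdot p\ge C^{-1}\frac{1}{m^\tau+1}|p|^\alpha-C\left(m^{\beta-\delta-\epsilon}+1\right)|p|$; (3) $H(x,0,m)\ge -C(m^\beta+1)$ for $m>0$,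 and $H(x,0,m)\le -C^{-1}m^\beta$ for $m\ge C$. Exponent $\gamma$. $\gamma:=\frac{\beta+1}{\delta}=\frac{\beta+1}{\beta+\tau}\,\alpha$; one has $\gamma>\alpha>1$. Set-valued extension to $m=0$. For a continuous map $F:\mathbb{R}^d\times(0,\infty)\to\mathbb{R}^{n}$, extend $F$ to a set-valued map on $\mathbb{R}^d\times[0,\infty)$ by taking the closure of its graph: for $m>0$, $F(p,m)$ is the singleton of its value, and $F(p,0)$ is the set of all $z\in\mathbb{R}^n$ for which there is a sequence $(p_k,m_k)\in\mathbb{R}^d\times(0,\infty)$ with $(p_k,m_k)\to(p,0)$ and $F(p_k,m_k)\to z$. For a.e. $x$ apply this to $(p,m)\mapsto H(x,p,m)$ and to the product map $(p,m)\mapsto mD_pH(x,p,m)$ (the product is formed first and then extended). Given $(m,u)$, admissible $h$ and $j$ are measurable functions on $\Omega$ (with values in $\mathbb{R}$ and $\mathbb{R}^d$) such that, for a.e. $x$, $h(x)\in H(x,Du(x),m(x))$ and $j(x)\in m(x)D_pH(x,Du(x),m(x))$, the right-hand sides being these set-valued extensions. Solution. A pair $(m,u)$ with $m\in L^{\beta+1}_{\mathrm{loc}}(\Omega)$, $m\ge0$, $u\in W^{1,\gamma}_{\mathrm{loc}}(\Omega)$ is a solution if: (i) for some admissible $h$, $h\le0$ a.e. in $\Omega$ and $h=0$ a.e. in $\{x\in\Omega: m(x)>0\}$; and (ii) for some admissible $j$, $\int_\Omega j\cdot D\phi=0$ for all smooth $\phi$ compactly supported in $\Omega$. (Any admissible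 $j$ belongs to $L^{\gamma/(\gamma-1)}_{\mathrm{loc}}(\Omega)$, so the integral makes sense.) *)

theory Defs
  imports "HOL-Analysis.Analysis"
begin

section \<open>Gradients and test functions\<close>

definition grad :: "('a::real_inner \<Rightarrow> real) \<Rightarrow> 'a \<Rightarrow> 'a" where
  "grad f x = (THE D. GDERIV f x :> D)"

lemma grad_eq:
  assumes "GDERIV f x :> D"
  shows "grad f x = D"
  unfolding grad_def
proof (rule the_equality)
  show "GDERIV f x :> D" by (fact assms)
next
  fix E assume "GDERIV f x :> E"
  then have "(\<lambda>h. h \<bullet> E) = (\<lambda>h. h \<bullet> D)"
    using assms unfolding gderiv_def by (rule has_derivative_unique)
  then have "h \<bullet> E = h \<bullet> D" for h
    by (rule fun_cong)
  then show "E = D"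
    by (metis inner_commute vector_eq_rdot)
qed

lemma GDERIV_grad:
  fixes f :: "'a::euclidean_space \<Rightarrow> real"
  assumes "f differentiable (at x)"
  shows "GDERIV f x :> grad f x"
proof -
  obtain f' where f': "(f has_derivative f') (at x)"
    using assms unfolding differentiable_def by blast
  interpret linear f' using f' by (rule has_derivative_linear)
  have "f' = (\<lambda>h. h \<bullet> adjoint f' 1)"
    using adjoint_works[OF linear_axioms, of _ 1] by (auto simp: fun_eq_iff)
  then have "GDERIV f x :> adjoint f' 1"
    using f' unfolding gderiv_def by simp
  then show ?thesis
    using grad_eq by metis
qed

primrec times_cont_diff :: "nat \<Rightarrow> ('a::euclidean_space \<Rightarrow> real) \<Rightarrow> bool" where
  "times_cont_diff 0 f \<longleftrightarrow> continuous_on UNIV f"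
| "times_cont_diff (Suc k) f \<longleftrightarrow>
     f differentiable_on UNIV \<and> (\<forall>b\<in>Basis. times_cont_diff k (\<lambda>x. grad f x \<bullet> b))"

definition smooth :: "('a::euclidean_space \<Rightarrow> real) \<Rightarrow> bool" where
  "smooth f \<longleftrightarrow> (\<forall>k. times_cont_diff k f)"

text \<open>Elements of \<open>C\<^sub>c\<^sup>\<infinity>(\<Omega>)\<close>, extended by zero to the whole space.\<close>

definition test_function :: "'a::euclidean_space set \<Rightarrow> ('a \<Rightarrow> real) \<Rightarrow> bool" where
  "test_function \<Omega> \<phi> \<longleftrightarrow>
     smooth \<phi> \<and> compact (closure {x. \<phi> x \<noteq> 0}) \<and> closure {x. \<phi> x \<noteq> 0} \<subseteq> \<Omega>"


section \<open>Local Lebesgue and Sobolev spaces\<close>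

definition Lp_loc ::
    "'a::euclidean_space set \<Rightarrow> real \<Rightarrow> ('a \<Rightarrow> 'b::euclidean_space) \<Rightarrow> bool" where
  "Lp_loc \<Omega> q f \<longleftrightarrow>
     f \<in> borel_measurable (lebesgue_on \<Omega>) \<and>
     (\<forall>K. compact K \<and> K \<subseteq> \<Omega> \<longrightarrow> integrable (lebesgue_on K) (\<lambda>x. norm (f x) powr q))"

text \<open>Local integrability is part of the definition because the Bochner integral of a
  non-integrable function is \<open>0\<close> by convention.\<close>

definition has_weak_gradient ::
    "'a::euclidean_space set \<Rightarrow> ('a \<Rightarrow> real) \<Rightarrow> ('a \<Rightarrow> 'a) \<Rightarrow> bool" where
  "has_weak_gradient \<Omega> u G \<longleftrightarrow>
     Lp_loc \<Omega> 1 u \<and> Lp_loc \<Omega> 1 G \<and>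
     (\<forall>\<phi>. test_function \<Omega> \<phi> \<longrightarrow>
        (LINT x|lebesgue_on \<Omega>. u x *\<^sub>R grad \<phi> x) = - (LINT x|lebesgue_on \<Omega>. \<phi> x *\<^sub>R G x))"

text \<open>\<open>u \<in> W\<^sup>1\<^sup>,\<^sup>q\<^sub>l\<^sub>o\<^sub>c(\<Omega>)\<close>, with (a representative of) its weak gradient \<open>Du\<close>.\<close>

definition W1_loc ::
    "'a::euclidean_space set \<Rightarrow> real \<Rightarrow> ('a \<Rightarrow> real) \<Rightarrow> ('a \<Rightarrow> 'a) \<Rightarrow> bool" where
  "W1_loc \<Omega> q u Du \<longleftrightarrow> Lp_loc \<Omega> q u \<and> Lp_loc \<Omega> q Du \<and> has_weak_gradient \<Omega> u Du"


section \<open>The Hamiltonian, its set-valued extension, and solutions\<close>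

text \<open>A Hamiltonian \<open>H x p m\<close> is only meaningful for \<open>x \<in> \<Omega>\<close> and \<open>m > 0\<close>; its values elsewhere are
  never used.\<close>

definition D\<^sub>p :: "('a::real_inner \<Rightarrow> 'a \<Rightarrow> real \<Rightarrow> real) \<Rightarrow> 'a \<Rightarrow> 'a \<Rightarrow> real \<Rightarrow> 'a" where
  "D\<^sub>p H x p m = grad (\<lambda>q. H x q m) p"

definition graph_ext ::
    "('a::topological_space \<Rightarrow> real \<Rightarrow> 'b::topological_space) \<Rightarrow> 'a \<Rightarrow> real \<Rightarrow> 'b set" where
  "graph_ext F p m =
     (if m > 0 then {F p m}
      else if m = 0 then
        {z. \<exists>P M. (\<forall>k::nat. M k > 0) \<and> P \<longlonglongrightarrow> p \<and> M \<longlonglongrightarrow> 0 \<and> (\<lambda>k. F (P k) (M k)) \<longlonglongrightarrow> z}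
      else {})"

definition admissible ::
    "'a::euclidean_space set \<Rightarrow> ('a \<Rightarrow> 'a \<Rightarrow> real \<Rightarrow> 'b::euclidean_space) \<Rightarrow>
     ('a \<Rightarrow> 'a) \<Rightarrow> ('a \<Rightarrow> real) \<Rightarrow> ('a \<Rightarrow> 'b) \<Rightarrow> bool" where
  "admissible \<Omega> F Du m f \<longleftrightarrow>
     f \<in> borel_measurable (lebesgue_on \<Omega>) \<and>
     (AE x in lebesgue_on \<Omega>. f x \<in> graph_ext (F x) (Du x) (m x))"

text \<open>\<open>Du\<close> is unique up to null sets, so it is immaterial which representative is chosen. The
  integrability of \<open>j \<bullet> D\<phi>\<close> is not required here: it follows from the growth
  conditions on \<open>H\<close> together with \<open>m \<in> L\<^sup>\<beta>\<^sup>+\<^sup>1\<^sub>l\<^sub>o\<^sub>c\<close> and \<open>Du \<in> L\<^sup>\<gamma>\<^sub>l\<^sub>o\<^sub>c\<close>.\<close>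

definition mfg_solution ::
    "'a::euclidean_space set \<Rightarrow> ('a \<Rightarrow> 'a \<Rightarrow> real \<Rightarrow> real) \<Rightarrow> real \<Rightarrow> real \<Rightarrow>
     ('a \<Rightarrow> real) \<Rightarrow> ('a \<Rightarrow> real) \<Rightarrow> bool" where
  "mfg_solution \<Omega> H \<beta> \<gamma> m u \<longleftrightarrow>
     Lp_loc \<Omega> (\<beta> + 1) m \<and>
     (AE x in lebesgue_on \<Omega>. m x \<ge> 0) \<and>
     (\<exists>Du. W1_loc \<Omega> \<gamma> u Du \<and>
        (\<exists>h. admissible \<Omega> H Du m h \<and>
           (AE x in lebesgue_on \<Omega>. h x \<le> 0) \<and>
           (AE x in lebesgue_on \<Omega>. m x > 0 \<longrightarrow> h x = 0)) \<and>
        (\<exists>j. admissible \<Omega> (\<lambda>x p \<mu>. \<mu> *\<^sub>R D\<^sub>p H x p \<mu>) Du m j \<and>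
           (\<forall>\<phi>. test_function \<Omega> \<phi> \<longrightarrow> (LINT x|lebesgue_on \<Omega>. j x \<bullet> grad \<phi> x) = 0)))"


section \<open>Hoelder continuity\<close>

text \<open>One exponent for all of \<open>\<Omega>\<close>; only the constant depends on the compact subset.\<close>

definition locally_Hoelder_on :: "'a::metric_space set \<Rightarrow> ('a \<Rightarrow> 'b::metric_space) \<Rightarrow> bool" where
  "locally_Hoelder_on \<Omega> v \<longleftrightarrow>
     (\<exists>\<theta>. 0 < \<theta> \<and> \<theta> \<le> 1 \<and>
        (\<forall>K. compact K \<and> K \<subseteq> \<Omega> \<longrightarrow>
           (\<exists>L. \<forall>x\<in>K. \<forall>y\<in>K. dist (v x) (v y) \<le> L * dist x y powr \<theta>)))"

end

theory Submission
  imports Defs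
begin

text \<open>
  On the set where the Hamilton-Jacobi equation \<open>H(x,Du,m) = 0\<close> holds, the density is a disguised
  power of the gradient. Integrating the coercivity condition along the ray from \<open>0\<close> to \<open>p\<close> shows that
  \<open>H \<le> 1\<close> forces \<open>\<bar>p\<bar> \<le> K max(1,m)\<^sup>\<delta>\<close>, and the growth condition together with the negativity of
  \<open>H(x,0,m)\<close> for large \<open>m\<close> shows that \<open>H = 0\<close> forces \<open>\<bar>p\<bar> \<ge> \<kappa> m\<^sup>\<delta>\<close> there. Hence \<open>\<bar>Du\<bar>\<close> is comparable with
  \<open>m\<^sup>\<delta>\<close> where \<open>m\<close> is large and bounded elsewhere. The exponent relations \<open>\<delta>\<alpha> = \<beta> + \<tau>\<close> and
  \<open>\<delta>\<gamma> = \<beta> + 1\<close> then turn the two bounds on \<open>D\<^sub>pH\<close> into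
  \<open>c \<bar>Du\<bar>\<^sup>\<gamma> - A \<le> j \<bullet> Du\<close> and \<open>\<bar>j\<bar> \<le> A (\<bar>Du\<bar>\<^sup>\<gamma>\<^sup>-\<^sup>1 + 1)\<close>
  for the flux \<open>j \<in> m D\<^sub>pH\<close>, also at points of vanishing density, where the set-valued extension is
  controlled by passing to the limit (\<open>flux_structure\<close>). Since \<open>div j = 0\<close>, the function \<open>u\<close> solves an
  equation with the structure of the \<open>\<gamma>\<close>-Laplacian, and the assertion becomes an instance of the
  De Giorgi-Ladyzhenskaya-Uraltseva theorem for such equations (\<open>hoelder_representative\<close>).

  The regularity proof runs as follows. Testing the equation with \<open>\<eta>\<^sup>N (u - k)\<^sup>+\<close> gives Caccioppoli's
  inequality on super-level sets (\<open>caccioppoli\<close>). Combined with a Faber-Krahn inequality it bounds the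
  \<open>L\<^sup>\<gamma>\<close> excess of \<open>u\<close> over a level on a ball by a power larger than one of the excess over a smaller level
  on a larger ball (\<open>dg_step\<close>), and the iteration of such an estimate yields a local bound
  (\<open>de_giorgi_sup_bound\<close>). If \<open>u\<close> lies below the middle of its range on half of a ball, the isoperimetric
  inequality of De Giorgi and a pigeonhole argument over dyadic levels show that \<open>u\<close> is close to its
  supremum only on a set of small measure (\<open>shrink\<close>), so the sup bound lowers the supremum by a fixed
  fraction of the oscillation (\<open>sup_reduction\<close>). One of \<open>u\<close> and \<open>-u\<close> always qualifies, so the oscillation
  decays geometrically on shrinking balls, which is Hoelder continuity of the essential limes superior.

  The Sobolev space enters only through approximation by continuously differentiable functions. For these,
  \<open>\<parallel>f(\<cdot> + h) - f\<parallel> \<le> \<bar>h\<bar> \<parallel>Df\<parallel>\<close> in \<open>L\<^sup>p\<close>, and averaging this translation estimate over \<open>h\<close> in a ball gives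
  both the Faber-Krahn and the isoperimetric inequality.
\<close>

section \<open>Elementary inequalities\<close>

lemma powr_add_le:
  fixes a b p :: real
  assumes "0 \<le> a" "0 \<le> b" "0 \<le> p"
  shows "(a + b) powr p \<le> 2 powr p * (a powr p + b powr p)"
proof -
  have "(a + b) powr p \<le> (2 * max a b) powr p"
    using assms by (intro powr_mono2) auto
  also have "\<dots> = 2 powr p * max a b powr p"
    using assms by (simp add: powr_mult)
  also have "\<dots> \<le> 2 powr p * (a powr p + b powr p)"
    by (intro mult_left_mono) (auto simp: max_def)
  finally show ?thesis .
qed

lemma norm_powr_add_le:
  fixes a b :: "'b::real_normed_vector"
  assumes "0 \<le> p"
  shows "norm (a + b) powr p \<le> 2 powr p * (norm a powr p + norm b powr p)"
  using powr_add_le[of "norm a" "norm b" p] assms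
    powr_mono2[of p "norm (a + b)" "norm a + norm b"] norm_triangle_ineq[of a b]
  by auto

text \<open>Young's inequality with a free weight. Comparing \<open>t\<close> with \<open>\<kappa> s\<close> gives it directly, at the
  price of a constant that is not optimal.\<close>

lemma powr_mult_le_split:
  fixes s t \<kappa> p :: real
  assumes "0 \<le> s" "0 \<le> t" "0 < \<kappa>" "1 \<le> p"
  shows "s powr (p - 1) * t \<le> \<kappa> * s powr p + \<kappa> powr (1 - p) * t powr p"
proof (cases "t \<le> \<kappa> * s")
  case True
  have "s powr (p - 1) * t \<le> s powr (p - 1) * (\<kappa> * s)"
    using True by (intro mult_left_mono) auto
  also have "\<dots> = \<kappa> * s powr p"
    using assms by (simp add: powr_mult_base mult.left_commute mult.commute[of _ s])
  finally show ?thesis by (simp add: add_increasing2)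
next
  case False
  then have s: "s \<le> t / \<kappa>"
    using assms by (auto simp: field_simps)
  have t: "0 < t"
    using False assms mult_nonneg_nonneg[of \<kappa> s] by linarith
  have "s powr (p - 1) * t \<le> (t / \<kappa>) powr (p - 1) * t"
    using s assms by (intro mult_right_mono powr_mono2) auto
  also have "\<dots> = \<kappa> powr (1 - p) * (t powr (p - 1) * t)"
    using assms t by (simp add: powr_divide field_simps powr_diff)
  also have "t powr (p - 1) * t = t powr p"
    using t by (simp add: powr_diff)
  finally show ?thesis using assms by (simp add: add_increasing)
qed

lemma le_powr_split:
  fixes t \<kappa> p :: real
  assumes "0 \<le> t" "0 < \<kappa>" "1 \<le> p"
  shows "t \<le> \<kappa> + \<kappa> powr (1 - p) * t powr p"
  using powr_mult_le_split[of 1 t \<kappa> p] assms by simp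

text \<open>The graph of the convex function \<open>s\<^sup>p\<close> lies above its tangent at \<open>a\<close>; in this form it is Young's
  inequality for the product \<open>s a\<^sup>p\<^sup>-\<^sup>1\<close>.\<close>

lemma powr_tangent_le:
  fixes a s p :: real
  assumes "0 \<le> a" "0 \<le> s" "1 \<le> p"
  shows "a powr p + p * a powr (p - 1) * (s - a) \<le> s powr p"
proof (cases "p = 1")
  case True
  then show ?thesis using assms by (cases "a = 0") auto
next
  case False
  then have p: "1 < p" using assms by auto
  define q where "q = p / (p - 1)"
  have q: "1 < q" "1 / p + 1 / q = 1" using p by (auto simp: q_def field_simps)
  have "s * a powr (p - 1) \<le> s powr p / p + (a powr (p - 1)) powr q / q"
    using Youngs_inequality[of s p q "a powr (p-1)"] Youngs_inequality[of p q s "a powr (p-1)"] p q assms by simp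
  also have "(a powr (p - 1)) powr q = a powr p"
    using p by (simp add: powr_powr q_def)
  finally have "p * (s * a powr (p - 1)) \<le> s powr p + (p - 1) * a powr p"
    using p by (simp add: q_def field_simps)
  moreover have "a powr (p - 1) * a = a powr p"
    using assms p by (cases "a = 0") (auto simp: powr_diff)
  ultimately show ?thesis by (simp add: algebra_simps)
qed

text \<open>Jensen's inequality for a probability density \<open>w\<close>: integrate the tangent inequality at the mean.\<close>

lemma powr_weighted_integral_le:
  fixes f w :: "'a \<Rightarrow> real"
  assumes "1 \<le> p" "\<And>x. 0 \<le> f x" "\<And>x. 0 \<le> w x" "integrable M w" "(LINT x|M. w x) = 1"
    "integrable M (\<lambda>x. w x * f x)" "integrable M (\<lambda>x. w x * f x powr p)"
  shows "(LINT x|M. w x * f x) powr p \<le> (LINT x|M. w x * f x powr p)"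
proof -
  define a where "a = (LINT x|M. w x * f x)"
  have a: "0 \<le> a" unfolding a_def using assms by (intro integral_nonneg_AE) auto
  have eq: "w x * (a powr p + p * a powr (p - 1) * (f x - a)) =
     a powr p * w x + (p * a powr (p - 1)) * (w x * f x - a * w x)" for x
    by (simp add: algebra_simps)
  have "(LINT x|M. w x * (a powr p + p * a powr (p - 1) * (f x - a))) \<le> (LINT x|M. w x * f x powr p)"
    using assms a by (intro integral_mono mult_left_mono powr_tangent_le)
      (auto simp: eq intro!: Bochner_Integration.integrable_add Bochner_Integration.integrable_diff integrable_mult_right)
  also have "(LINT x|M. w x * (a powr p + p * a powr (p - 1) * (f x - a))) = a powr p"
    unfolding eq using assms by (simp add: a_def)
  finally show ?thesis by (simp add: a_def)
qed

section \<open>A smooth bump function\<close>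

text \<open>The powers of \<open>1/t\<close> are included so that the family is closed under differentiation.\<close>

definition flat_exp :: "nat \<Rightarrow> real \<Rightarrow> real" where
  "flat_exp k t = (if t > 0 then exp (- inverse t) * inverse t ^ k else 0)"

lemma flat_exp_DERIV:
  "DERIV (flat_exp k) t :> flat_exp (k + 2) t - real k * flat_exp (k + 1) t"
proof (cases "t = 0")
  case True
  have "((\<lambda>h. flat_exp k h / h) \<longlongrightarrow> 0) (at_left 0)"
    by (rule tendsto_eventually) (auto simp: eventually_at_filter flat_exp_def)
  moreover have "((\<lambda>h. flat_exp k h / h) \<longlongrightarrow> 0) (at_right 0)"
  proof (rule Lim_transform_eventually)
    show "((\<lambda>h::real. exp (- inverse h) * inverse h ^ k / h) \<longlongrightarrow> 0) (at_right 0)"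
      using filterlim_compose[OF tendsto_power_div_exp_0[of "Suc k"] filterlim_inverse_at_top_right]
      by (simp add: exp_minus divide_inverse mult_ac)
    show "\<forall>\<^sub>F h in at_right 0. exp (- inverse h) * inverse h ^ k / h = flat_exp k h / h"
      by (auto simp: eventually_at_filter flat_exp_def)
  qed
  ultimately have "((\<lambda>h. flat_exp k h / h) \<longlongrightarrow> 0) (at 0)"
    by (simp add: filterlim_split_at)
  then show ?thesis using True
    by (simp add: DERIV_def flat_exp_def)
next
  case False
  show ?thesis
  proof (cases "t > 0")
    case True
    have "DERIV (\<lambda>t. exp (- inverse t) * inverse t ^ k) t
        :> flat_exp (k + 2) t - real k * flat_exp (k + 1) t"
      using True
      by (auto intro!: derivative_eq_intros simp: flat_exp_def power2_eq_square)
        (cases k; simp add: field_simps)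
    then show ?thesis
      by (rule has_field_derivative_transform_within_open[where S="{0<..}"])
        (use True in \<open>auto simp: flat_exp_def\<close>)
  next
    case f2: False
    have "DERIV (\<lambda>t. 0) t :> flat_exp (k + 2) t - real k * flat_exp (k + 1) t"
      using f2 by (auto simp: flat_exp_def)
    then show ?thesis
      by (rule has_field_derivative_transform_within_open[where S="{..<0}"])
        (use f2 False in \<open>auto simp: flat_exp_def\<close>)
  qed
qed

text \<open>Products of polynomials with \<open>flat_exp k (1 - \<bar>x\<bar>\<^sup>2)\<close>, and their sums. Smoothness of the bump function needs an
  induction over the order of differentiation, which works because this class contains its own partial
  derivatives.\<close>

inductive_set bump_class :: "('a::euclidean_space \<Rightarrow> real) set" where
  base: "(\<lambda>x. flat_exp k (1 - x \<bullet> x)) \<in> bump_class"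
| mult: "f \<in> bump_class \<Longrightarrow> (\<lambda>x. (x \<bullet> b) * f x) \<in> bump_class"
| scale: "f \<in> bump_class \<Longrightarrow> (\<lambda>x. c * f x) \<in> bump_class"
| add: "f \<in> bump_class \<Longrightarrow> g \<in> bump_class \<Longrightarrow> (\<lambda>x. f x + g x) \<in> bump_class"

lemma bump_class_grad:
  assumes "f \<in> bump_class"
  shows "\<exists>G. (\<forall>x. GDERIV f x :> G x) \<and> (\<forall>b. (\<lambda>x. G x \<bullet> b) \<in> bump_class)"
  using assms
proof induction
  case (base k)
  let ?F = "\<lambda>x::'a. flat_exp (k + 2) (1 - x \<bullet> x) - real k * flat_exp (k + 1) (1 - x \<bullet> x)"
  have "GDERIV (\<lambda>x::'a. flat_exp k (1 - x \<bullet> x)) x :> ?F x *\<^sub>R (- (2 *\<^sub>R x))" for x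
  proof (rule GDERIV_DERIV_compose[OF _ flat_exp_DERIV])
    show "GDERIV (\<lambda>x::'a. 1 - x \<bullet> x) x :> - (2 *\<^sub>R x)"
      unfolding gderiv_def
      by (auto intro!: derivative_eq_intros simp: inner_commute)
  qed
  moreover have "(\<lambda>x. (?F x *\<^sub>R (- (2 *\<^sub>R x))) \<bullet> b) \<in> bump_class" for b
  proof -
    have "(\<lambda>x. (-2) * ((x \<bullet> b) * (flat_exp (k + 2) (1 - x \<bullet> x)
        + (- real k) * flat_exp (k + 1) (1 - x \<bullet> x)))) \<in> bump_class"
      by (intro bump_class.intros)
    then show ?thesis by (simp add: algebra_simps)
  qed
  ultimately show ?case by (intro exI[of _ "\<lambda>x. ?F x *\<^sub>R (- (2 *\<^sub>R x))"]) blast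
next
  case (mult f c)
  then obtain G where G: "\<And>x. GDERIV f x :> G x" "\<And>b. (\<lambda>x. G x \<bullet> b) \<in> bump_class" by auto
  have c: "GDERIV (\<lambda>x. x \<bullet> c) x :> c" for x
    unfolding gderiv_def by (auto intro!: derivative_eq_intros)
  show ?case
  proof (intro exI[of _ "\<lambda>x. (x \<bullet> c) *\<^sub>R G x + f x *\<^sub>R c"] conjI allI)
    show "GDERIV (\<lambda>x. (x \<bullet> c) * f x) x :> (x \<bullet> c) *\<^sub>R G x + f x *\<^sub>R c" for x
      by (rule GDERIV_mult[OF c G(1)])
    have "(\<lambda>x. (x \<bullet> c) * (G x \<bullet> b) + (c \<bullet> b) * f x) \<in> bump_class" for b
      by (intro bump_class.intros G mult)
    then show "(\<lambda>x. ((x \<bullet> c) *\<^sub>R G x + f x *\<^sub>R c) \<bullet> b) \<in> bump_class" for b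
      by (simp add: inner_add_left mult.commute)
  qed
next
  case (scale f c)
  then obtain G where G: "\<And>x. GDERIV f x :> G x" "\<And>b. (\<lambda>x. G x \<bullet> b) \<in> bump_class" by auto
  show ?case
    using GDERIV_mult[OF GDERIV_const G(1), of c] bump_class.scale[OF G(2), of c]
    by (intro exI[of _ "\<lambda>x. c *\<^sub>R G x"]) auto
next
  case (add f g)
  then obtain G G' where "\<And>x. GDERIV f x :> G x" "\<And>b. (\<lambda>x. G x \<bullet> b) \<in> bump_class"
    "\<And>x. GDERIV g x :> G' x" "\<And>b. (\<lambda>x. G' x \<bullet> b) \<in> bump_class" by blast
  then show ?case
    by (intro exI[of _ "\<lambda>x. G x + G' x"]) (auto simp: inner_add_left intro!: GDERIV_add bump_class.add)
qed

lemma GDERIV_differentiable: "GDERIV f x :> D \<Longrightarrow> f differentiable (at x)"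
  unfolding gderiv_def differentiable_def by blast

lemma GDERIV_isCont: "GDERIV f x :> D \<Longrightarrow> isCont f x"
  unfolding gderiv_def by (rule has_derivative_continuous)

lemma times_cont_diff_Suc_GDERIV:
  assumes "\<And>x. GDERIV f x :> G x"
  shows "times_cont_diff (Suc k) f \<longleftrightarrow> (\<forall>b\<in>Basis. times_cont_diff k (\<lambda>x. G x \<bullet> b))"
proof -
  have "grad f = G" using grad_eq[OF assms] by auto
  moreover have "f differentiable_on UNIV"
    using GDERIV_differentiable[OF assms] by (simp add: differentiable_on_def)
  ultimately show ?thesis by simp
qed

lemma times_cont_diff_bump_class:
  "f \<in> bump_class \<Longrightarrow> times_cont_diff k f"
proof (induction k arbitrary: f)
  case 0
  then obtain G where "\<And>x. GDERIV f x :> G x" using bump_class_grad by blast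
  then show ?case by (auto simp: continuous_on_eq_continuous_at intro: GDERIV_isCont)
next
  case (Suc k)
  then obtain G where "\<And>x. GDERIV f x :> G x" "\<And>b. (\<lambda>x. G x \<bullet> b) \<in> bump_class"
    using bump_class_grad by blast
  then show ?case using times_cont_diff_Suc_GDERIV[of f G] Suc.IH by blast
qed

definition bump :: "'a::euclidean_space \<Rightarrow> real" where
  "bump x = flat_exp 0 (1 - x \<bullet> x)"

lemma smooth_bump: "smooth bump"
  unfolding smooth_def
  by (intro allI times_cont_diff_bump_class) (simp add: bump_def[abs_def] bump_class.base[of 0])

lemma bump_nonneg: "0 \<le> bump x"
  by (simp add: bump_def flat_exp_def)

lemma bump_pos_iff: "0 < bump x \<longleftrightarrow> norm x < 1"
  by (simp add: bump_def flat_exp_def dot_square_norm abs_square_less_1)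

lemma times_cont_diff_affine:
  fixes f :: "'a::euclidean_space \<Rightarrow> real"
  assumes "times_cont_diff k f"
  shows "times_cont_diff k (\<lambda>y. c * f (x0 + a *\<^sub>R y))"
  using assms
proof (induction k arbitrary: f c)
  case 0
  then have "continuous_on UNIV f" by simp
  then show ?case
    by (auto intro!: continuous_intros continuous_on_compose2[of UNIV f])
next
  case (Suc k)
  have G: "GDERIV f x :> grad f x" for x
    using Suc.prems by (intro GDERIV_grad) (auto simp: differentiable_on_def)
  have "GDERIV (\<lambda>y. c * f (x0 + a *\<^sub>R y)) y :> (c * a) *\<^sub>R grad f (x0 + a *\<^sub>R y)" for y
  proof -
    have "((\<lambda>y. c * f (x0 + a *\<^sub>R y)) has_derivative (\<lambda>h. c * ((a *\<^sub>R h) \<bullet> grad f (x0 + a *\<^sub>R y)))) (at y)"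
      by (intro has_derivative_mult_right has_derivative_compose[OF _ G[unfolded gderiv_def]])
        (auto intro!: derivative_eq_intros)
    then show ?thesis unfolding gderiv_def by (simp add: mult_ac)
  qed
  moreover have "times_cont_diff k (\<lambda>y. (c * a) * (grad f (x0 + a *\<^sub>R y) \<bullet> b))" if "b \<in> Basis" for b
    using Suc.IH[of "\<lambda>x. grad f x \<bullet> b" "c * a"] Suc.prems that by simp
  ultimately show ?case
    by (subst times_cont_diff_Suc_GDERIV) auto
qed

lemma smooth_affine: "smooth f \<Longrightarrow> smooth (\<lambda>y. c * f (x0 + a *\<^sub>R y))"
  unfolding smooth_def using times_cont_diff_affine by blast

section \<open>Convolution with a smooth kernel\<close>

definition C1 :: "('a::euclidean_space \<Rightarrow> real) \<Rightarrow> ('a \<Rightarrow> 'a) \<Rightarrow> bool" where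
  "C1 f g \<longleftrightarrow> (\<forall>x. GDERIV f x :> g x) \<and> continuous_on UNIV g"

lemma C1_GDERIV: "C1 f g \<Longrightarrow> GDERIV f x :> g x"
  and C1_continuous_grad: "C1 f g \<Longrightarrow> continuous_on UNIV g"
  by (auto simp: C1_def)

lemma C1_continuous: "C1 f g \<Longrightarrow> continuous_on UNIV f"
  by (auto simp: C1_def continuous_on_eq_continuous_at intro: GDERIV_isCont)

lemma C1_zero_outside:
  assumes "C1 f g" "open U" "\<And>x. x \<in> U \<Longrightarrow> f x = 0" "x \<in> U"
  shows "g x = 0"
proof -
  have "GDERIV f x :> 0"
  proof -
    have "(f has_derivative (\<lambda>h. 0)) (at x)"
      by (rule has_derivative_transform_within_open[of "\<lambda>_. 0" _ x UNIV U]) (use assms in auto)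
    then show ?thesis by (simp add: gderiv_def)
  qed
  then show ?thesis using assms(1) grad_eq C1_GDERIV by metis
qed

lemma compact_support_uniformly_continuous:
  fixes k :: "'a::euclidean_space \<Rightarrow> 'b::real_normed_vector"
  assumes k: "continuous_on UNIV k" and R: "\<And>x. norm x > R \<Longrightarrow> k x = 0" and e: "0 < e"
  obtains d where "0 < d" "\<And>x y. norm (x - y) < d \<Longrightarrow> norm (k x - k y) < e"
proof -
  have "uniformly_continuous_on (cball 0 (R + 1)) k"
    by (rule compact_uniformly_continuous) (auto intro: continuous_on_subset[OF k])
  then obtain d where d: "d > 0"
    "\<And>x y. x \<in> cball 0 (R + 1) \<Longrightarrow> y \<in> cball 0 (R + 1) \<Longrightarrow> dist y x < d \<Longrightarrow> dist (k y) (k x) < e"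
    using e unfolding uniformly_continuous_on_def by metis
  show thesis
  proof (rule that[of "min d 1"])
    fix x y :: 'a assume xy: "norm (x - y) < min d 1"
    show "norm (k x - k y) < e"
    proof (cases "norm x \<le> R + 1 \<and> norm y \<le> R + 1")
      case True
      then show ?thesis using d(2)[of y x] xy by (auto simp: dist_norm)
    next
      case False
      then have "norm x > R" "norm y > R"
        using xy norm_triangle_ineq2[of x y] norm_triangle_ineq3[of x y] by auto
      then show ?thesis using R e by simp
    qed
  qed (use d in auto)
qed

lemma compact_support_bounded:
  fixes k :: "'a::euclidean_space \<Rightarrow> 'b::real_normed_vector"
  assumes k: "continuous_on UNIV k" and R: "\<And>x. norm x > R \<Longrightarrow> k x = 0"
  obtains B where "0 \<le> B" "\<And>x. norm (k x) \<le> B"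
proof -
  have "bounded (k ` cball 0 R)"
    by (intro compact_imp_bounded compact_continuous_image continuous_on_subset[OF k]) auto
  then obtain B where B: "\<And>x. norm x \<le> R \<Longrightarrow> norm (k x) \<le> B"
    unfolding bounded_iff by (metis imageI mem_cball_0)
  show thesis
  proof (rule that[of "max B 0"])
    show "norm (k x) \<le> max B 0" for x
      using B[of x] R[of x] by (cases "norm x \<le> R") auto
  qed auto
qed

lemma integrable_bounded_mult:
  fixes f :: "'a::euclidean_space \<Rightarrow> 'b::euclidean_space" and k :: "'a \<Rightarrow> real"
  assumes "integrable lborel f" "k \<in> borel_measurable lborel" "\<And>x. \<bar>k x\<bar> \<le> B"
  shows "integrable lborel (\<lambda>x. k x *\<^sub>R f x)"
proof (rule Bochner_Integration.integrable_bound[of _ "\<lambda>x. B * norm (f x)"])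
  show "(\<lambda>x. k x *\<^sub>R f x) \<in> borel_measurable lborel" using assms by measurable
  show "AE x in lborel. norm (k x *\<^sub>R f x) \<le> norm (B * norm (f x))"
  proof (rule AE_I2)
    fix x
    have "\<bar>k x\<bar> * norm (f x) \<le> \<bar>B\<bar> * norm (f x)"
      using assms(3)[of x] by (intro mult_right_mono) auto
    then show "norm (k x *\<^sub>R f x) \<le> norm (B * norm (f x))" by (simp add: abs_mult)
  qed
qed (use assms in auto)

lemma integrable_bounded_vec_mult:
  fixes f :: "'a::euclidean_space \<Rightarrow> real" and k :: "'a \<Rightarrow> 'b::euclidean_space"
  assumes "integrable lborel f" "k \<in> borel_measurable lborel" "\<And>x. norm (k x) \<le> B"
  shows "integrable lborel (\<lambda>x. f x *\<^sub>R k x)"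
proof (rule Bochner_Integration.integrable_bound[of _ "\<lambda>x. B * norm (f x)"])
  show "(\<lambda>x. f x *\<^sub>R k x) \<in> borel_measurable lborel" using assms by measurable
  show "AE x in lborel. norm (f x *\<^sub>R k x) \<le> norm (B * norm (f x))"
  proof (rule AE_I2)
    fix x
    have "\<bar>f x\<bar> * norm (k x) \<le> \<bar>f x\<bar> * \<bar>B\<bar>" using assms(3)[of x] by (intro mult_left_mono) auto
    then show "norm (f x *\<^sub>R k x) \<le> norm (B * norm (f x))" by (simp add: abs_mult mult.commute)
  qed
qed (use assms in auto)

lemma lint_norm_le:
  fixes f :: "'c \<Rightarrow> 'b::euclidean_space"
  assumes "integrable M f" "integrable M g" "\<And>x. norm (f x) \<le> g x"
  shows "norm (LINT x|M. f x) \<le> (LINT x|M. g x)"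
  by (rule order_trans[OF integral_norm_bound]) (use assms in \<open>auto intro!: integral_mono\<close>)

text \<open>Uniform continuity of the gradient makes the first order remainder small uniformly in the base point;
  this is what allows differentiation under a convolution integral.\<close>

lemma C1_linearization:
  fixes k :: "'a::euclidean_space \<Rightarrow> real"
  assumes k: "C1 k g" and d: "\<And>x y. norm (x - y) < d \<Longrightarrow> norm (g x - g y) < e" and h: "norm h < d"
  shows "\<bar>k (z + h) - k z - h \<bullet> g z\<bar> \<le> norm h * e"
proof -
  have "norm (k (z + h) - k z - (z + h - z) \<bullet> g z) \<le> norm (z + h - z) * e"
  proof (rule differentiable_bound_linearization[where f' = "\<lambda>x h. h \<bullet> g x" and S = "ball z d"])
    have "0 < d" using h norm_ge_zero[of h] by linarith
    then show "z \<in> ball z d" by simp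
    fix t :: real assume "t \<in> {0..1}"
    then have "norm (t *\<^sub>R h) \<le> norm h" by (simp add: mult_left_le_one_le)
    then show "z + t *\<^sub>R (z + h - z) \<in> ball z d" using h by (simp add: dist_norm)
  next
    fix x assume x: "x \<in> ball z d"
    show "(k has_derivative (\<lambda>h. h \<bullet> g x)) (at x within ball z d)"
      using C1_GDERIV[OF k] has_derivative_at_withinI unfolding gderiv_def by blast
    show "onorm ((\<lambda>h. h \<bullet> g x) - (\<lambda>h. h \<bullet> g z)) \<le> e"
    proof (rule onorm_le)
      fix v
      have "norm (g x - g z) < e" using x d by (simp add: dist_norm norm_minus_commute)
      then show "norm (((\<lambda>h. h \<bullet> g x) - (\<lambda>h. h \<bullet> g z)) v) \<le> e * norm v"
        using Cauchy_Schwarz_ineq2[of v "g x - g z"]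
          mult_left_mono[of "norm (g x - g z)" e "norm v"]
        by (simp add: inner_diff_right mult.commute)
    qed
  qed
  then show ?thesis by simp
qed

lemma convolution_C1:
  fixes f :: "'a::euclidean_space \<Rightarrow> real" and k :: "'a \<Rightarrow> real"
  assumes f: "integrable lborel f" and k: "C1 k g" and R: "\<And>x. norm x > R \<Longrightarrow> k x = 0"
  shows "C1 (\<lambda>x. LINT y|lborel. f y * k (x - y)) (\<lambda>x. LINT y|lborel. f y *\<^sub>R g (x - y))"
proof -
  note kc = C1_continuous[OF k] and gc = C1_continuous_grad[OF k]
  have gR: "g x = 0" if "norm x > R" for x
  proof (rule C1_zero_outside[OF k, of "- cball 0 R"])
    show "open (- cball (0::'a) R)" by auto
  qed (use R that in auto)
  obtain B where B: "0 \<le> B" "\<And>x. norm (k x) \<le> B" using compact_support_bounded[OF kc R] by blast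
  obtain B' where B': "0 \<le> B'" "\<And>x. norm (g x) \<le> B'" using compact_support_bounded[OF gc gR] by blast
  define A where "A = (LINT y|lborel. \<bar>f y\<bar>)"
  have A: "0 \<le> A" by (simp add: A_def)
  have [measurable]: "k \<in> borel_measurable borel" "g \<in> borel_measurable borel"
    using kc gc borel_measurable_continuous_onI by auto
  have [measurable]: "f \<in> borel_measurable borel" using f by auto
  have ik: "integrable lborel (\<lambda>y. f y * k (x - y))" for x
    using integrable_bounded_vec_mult[OF f, of "\<lambda>y. k (x - y)" B] B by simp
  have ig: "integrable lborel (\<lambda>y. f y *\<^sub>R g (x - y))" for x
    by (rule integrable_bounded_vec_mult[OF f, of _ B']) (use B' in auto)
  have small: "\<exists>d>0. \<forall>x y. norm (x - y) < d \<longrightarrow> norm (g x - g y) < e" if "0 < e" for e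
    using compact_support_uniformly_continuous[OF gc gR that] by metis
  have e1: "e / (A + 1) * A \<le> e" "0 < e / (A + 1)" if "0 < e" for e
    using that A by (auto simp: field_simps)
  have der: "GDERIV (\<lambda>x. LINT y|lborel. f y * k (x - y)) x :> (LINT y|lborel. f y *\<^sub>R g (x - y))" for x
    unfolding gderiv_def has_derivative_at_alt
  proof (intro conjI allI impI)
    show "bounded_linear (\<lambda>h. h \<bullet> (LINT y|lborel. f y *\<^sub>R g (x - y)))"
      by (rule bounded_linear_inner_left)
    fix e :: real assume e: "0 < e"
    obtain d where d: "d > 0" "\<And>x y. norm (x - y) < d \<Longrightarrow> norm (g x - g y) < e / (A + 1)"
      using small[OF e1(2)[OF e]] by blast
    show "\<exists>d>0. \<forall>z. norm (z - x) < d \<longrightarrow> norm ((LINT y|lborel. f y * k (z - y)) - (LINT y|lborel. f y * k (x - y)) -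
         (z - x) \<bullet> (LINT y|lborel. f y *\<^sub>R g (x - y))) \<le> e * norm (z - x)"
    proof (intro exI[of _ d] conjI allI impI d(1))
      fix z assume z: "norm (z - x) < d"
      define h where "h = z - x"
      have zz: "z - y = (x - y) + h" for y by (simp add: h_def)
      have lin: "\<bar>k (z - y) - k (x - y) - h \<bullet> g (x - y)\<bar> \<le> norm h * (e / (A + 1))" for y
        unfolding zz by (rule C1_linearization[OF k d(2)]) (use z in \<open>auto simp: h_def\<close>)
      have "norm (LINT y|lborel. f y * (k (z - y) - k (x - y) - h \<bullet> g (x - y)))
          \<le> (LINT y|lborel. \<bar>f y\<bar> * (norm h * (e / (A + 1))))"
      proof (rule lint_norm_le)
        have "integrable lborel (\<lambda>y. f y * k (z - y) - f y * k (x - y) - h \<bullet> (f y *\<^sub>R g (x - y)))"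
          by (intro Bochner_Integration.integrable_diff ik integrable_inner_right ig)
        then show "integrable lborel (\<lambda>y. f y * (k (z - y) - k (x - y) - h \<bullet> g (x - y)))"
          by (simp add: right_diff_distrib)
        show "integrable lborel (\<lambda>y. \<bar>f y\<bar> * (norm h * (e / (A + 1))))" using f by auto
        show "norm (f y * (k (z - y) - k (x - y) - h \<bullet> g (x - y))) \<le> \<bar>f y\<bar> * (norm h * (e / (A + 1)))" for y
          using mult_left_mono[OF lin, of "\<bar>f y\<bar>"] by (simp add: abs_mult)
      qed
      also have "(LINT y|lborel. f y * (k (z - y) - k (x - y) - h \<bullet> g (x - y))) =
         (LINT y|lborel. f y * k (z - y) - f y * k (x - y) - h \<bullet> (f y *\<^sub>R g (x - y)))"
        by (intro Bochner_Integration.integral_cong refl) (simp add: right_diff_distrib)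
      also have "\<dots> = (LINT y|lborel. f y * k (z - y)) - (LINT y|lborel. f y * k (x - y)) -
         h \<bullet> (LINT y|lborel. f y *\<^sub>R g (x - y))"
        by (simp only: Bochner_Integration.integral_diff Bochner_Integration.integrable_diff ik
            integrable_inner_right[OF ig] integral_inner_right[OF ig])
      also have "(LINT y|lborel. \<bar>f y\<bar> * (norm h * (e / (A + 1)))) = e / (A + 1) * A * norm h"
        by (simp add: A_def)
      also have "\<dots> \<le> e * norm h" using e1[OF e] by (intro mult_right_mono) auto
      finally show "norm ((LINT y|lborel. f y * k (z - y)) - (LINT y|lborel. f y * k (x - y)) -
         (z - x) \<bullet> (LINT y|lborel. f y *\<^sub>R g (x - y))) \<le> e * norm (z - x)" by (simp add: h_def)
    qed
  qed
  have "continuous_on UNIV (\<lambda>x. LINT y|lborel. f y *\<^sub>R g (x - y))"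
    unfolding continuous_on_iff
  proof (intro ballI allI impI)
    fix x :: 'a and e :: real assume e: "0 < e"
    obtain d where d: "d > 0" "\<And>x y. norm (x - y) < d \<Longrightarrow> norm (g x - g y) < e / 2 / (A + 1)"
      using small[OF e1(2)[of "e/2"]] e by auto
    show "\<exists>d>0. \<forall>x'\<in>UNIV. dist x' x < d \<longrightarrow>
       dist (LINT y|lborel. f y *\<^sub>R g (x' - y)) (LINT y|lborel. f y *\<^sub>R g (x - y)) < e"
    proof (intro exI[of _ d] conjI ballI impI d(1))
      fix z assume z: "dist z x < d"
      have "norm (LINT y|lborel. f y *\<^sub>R g (z - y) - f y *\<^sub>R g (x - y))
          \<le> (LINT y|lborel. \<bar>f y\<bar> * (e / 2 / (A + 1)))"
      proof (rule lint_norm_le)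
        show "integrable lborel (\<lambda>y. f y *\<^sub>R g (z - y) - f y *\<^sub>R g (x - y))"
          by (intro Bochner_Integration.integrable_diff ig)
        show "integrable lborel (\<lambda>y. \<bar>f y\<bar> * (e / 2 / (A + 1)))" using f by auto
        fix y
        have "norm (g (z - y) - g (x - y)) \<le> e / 2 / (A + 1)"
          using d(2)[of "z - y" "x - y"] z by (simp add: dist_norm)
        from mult_left_mono[OF this, of "\<bar>f y\<bar>"]
        show "norm (f y *\<^sub>R g (z - y) - f y *\<^sub>R g (x - y)) \<le> \<bar>f y\<bar> * (e / 2 / (A + 1))"
          by (simp add: scaleR_diff_right[symmetric])
      qed
      also have "\<dots> = e / 2 / (A + 1) * A" by (simp add: A_def)
      also have "\<dots> \<le> e / 2" by (rule e1(1)) (use e in simp)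
      also have "\<dots> < e" using e by simp
      finally show "dist (LINT y|lborel. f y *\<^sub>R g (z - y)) (LINT y|lborel. f y *\<^sub>R g (x - y)) < e"
        using ig by (simp add: dist_norm Bochner_Integration.integral_diff)
    qed
  qed
  with der show ?thesis by (auto simp: C1_def)
qed

lemma smooth_C1_grad:
  assumes "smooth k" shows "C1 k (grad k)"
proof -
  have "k differentiable_on UNIV" using assms unfolding smooth_def by (metis times_cont_diff.simps(2))
  then have "GDERIV k x :> grad k x" for x
    by (intro GDERIV_grad) (simp add: differentiable_on_def)
  moreover have "continuous_on UNIV (grad k)"
  proof -
    have "continuous_on UNIV (\<lambda>x. grad k x \<bullet> b)" if "b \<in> Basis" for b
    proof -
      have "times_cont_diff (Suc 0) k" using assms unfolding smooth_def by blast
      then show ?thesis using that by simp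
    qed
    then show ?thesis using continuous_on_componentwise by blast
  qed
  ultimately show ?thesis by (simp add: C1_def)
qed

lemma smooth_grad_inner:
  assumes "smooth k" "b \<in> Basis" shows "smooth (\<lambda>x. grad k x \<bullet> b)"
  unfolding smooth_def
proof
  fix n
  have "times_cont_diff (Suc n) k" using assms unfolding smooth_def by blast
  then show "times_cont_diff n (\<lambda>x. grad k x \<bullet> b)" using assms(2) by simp
qed

text \<open>All derivatives fall on the kernel, so the induction over the order generalises over the kernel.\<close>

lemma smooth_convolution:
  fixes f :: "'a::euclidean_space \<Rightarrow> real"
  assumes f: "integrable lborel f" and "smooth k" "\<And>x. norm x > R \<Longrightarrow> k x = 0"
  shows "smooth (\<lambda>x. LINT y|lborel. f y * k (x - y))"
proof -
  have "times_cont_diff n (\<lambda>x. LINT y|lborel. f y * k (x - y))" for n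
    using assms(2,3)
  proof (induction n arbitrary: k)
    case 0
    show ?case using C1_continuous[OF convolution_C1[OF f smooth_C1_grad[OF 0(1)] 0(2)]] by simp
  next
    case (Suc n)
    note c = convolution_C1[OF f smooth_C1_grad[OF Suc.prems(1)] Suc.prems(2)]
    have gR: "grad k x = 0" if "norm x > R" for x
      by (rule C1_zero_outside[OF smooth_C1_grad[OF Suc.prems(1)], of "- cball 0 R"])
        (use Suc.prems that in auto)
    obtain B where B: "\<And>x. norm (grad k x) \<le> B"
      using compact_support_bounded[OF C1_continuous_grad[OF smooth_C1_grad[OF Suc.prems(1)]] gR] by blast
    have [measurable]: "grad k \<in> borel_measurable borel"
      using C1_continuous_grad[OF smooth_C1_grad[OF Suc.prems(1)]] borel_measurable_continuous_onI by auto
    have ig: "integrable lborel (\<lambda>y. f y *\<^sub>R grad k (x - y))" for x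
      by (rule integrable_bounded_vec_mult[OF f _ B]) auto
    have "times_cont_diff n (\<lambda>x. (LINT y|lborel. f y *\<^sub>R grad k (x - y)) \<bullet> b)" if b: "b \<in> Basis" for b
    proof -
      have "(\<lambda>x. (LINT y|lborel. f y *\<^sub>R grad k (x - y)) \<bullet> b)
          = (\<lambda>x. LINT y|lborel. f y * (grad k (x - y) \<bullet> b))"
        using ig by (subst integral_inner_left[symmetric]) auto
      then show ?thesis
        using Suc.IH[OF smooth_grad_inner[OF Suc.prems(1) b]] gR by simp
    qed
    then show ?case
      by (subst times_cont_diff_Suc_GDERIV[OF C1_GDERIV[OF c]]) auto
  qed
  then show ?thesis by (simp add: smooth_def)
qed

subsection \<open>Mollification\<close>

definition mollifier :: "real \<Rightarrow> 'a::euclidean_space \<Rightarrow> real" where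
  "mollifier e x = bump ((1 / e) *\<^sub>R x) / (LINT y|lborel. bump ((1 / e) *\<^sub>R (y::'a)))"

definition mollify :: "real \<Rightarrow> ('a::euclidean_space \<Rightarrow> 'b::euclidean_space) \<Rightarrow> 'a \<Rightarrow> 'b" where
  "mollify e f x = (LINT y|lborel. mollifier e (x - y) *\<^sub>R f y)"

context
  fixes e :: real assumes e: "0 < e"
begin

lemma smooth_mollifier: "smooth (mollifier e :: 'a::euclidean_space \<Rightarrow> real)"
  using smooth_affine[OF smooth_bump, of "1 / (LINT y|lborel. bump ((1 / e) *\<^sub>R (y::'a)))" 0 "1 / e"]
  by (simp add: mollifier_def[abs_def])

lemma mollifier_nonneg: "0 \<le> mollifier e x"
  unfolding mollifier_def by (intro divide_nonneg_nonneg Bochner_Integration.integral_nonneg bump_nonneg)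

lemma mollifier_eq_0: "e \<le> norm x \<Longrightarrow> mollifier e x = 0"
  using bump_pos_iff[of "(1 / e) *\<^sub>R x"] bump_nonneg[of "(1 / e) *\<^sub>R x"] e
  by (auto simp: mollifier_def field_simps less_le)

lemma mollifier_minus: "mollifier e (- x) = mollifier e x"
  by (simp add: mollifier_def bump_def)

lemma mollifier_commute: "mollifier e (x - y) = mollifier e (y - x)"
  using mollifier_minus[of "x - y"] by simp

lemma mollifier_measurable [measurable]:
  "(mollifier e :: 'a::euclidean_space \<Rightarrow> real) \<in> borel_measurable borel"
  using C1_continuous[OF smooth_C1_grad[OF smooth_mollifier]] borel_measurable_continuous_onI by blast

lemma integrable_continuous_compact_support:
  fixes k :: "'a::euclidean_space \<Rightarrow> 'b::euclidean_space"
  assumes k: "continuous_on UNIV k" and R: "\<And>x. norm x > R \<Longrightarrow> k x = 0"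
  shows "integrable lborel k"
proof -
  have "integrable lborel (\<lambda>x. indicator (cball 0 R) x *\<^sub>R k x)"
    by (rule borel_integrable_compact) (auto intro: continuous_on_subset[OF k])
  moreover have "(\<lambda>x. indicator (cball 0 R) x *\<^sub>R k x) = k"
    using R by (auto simp: indicator_def fun_eq_iff not_le)
  ultimately show ?thesis by simp
qed

lemma integrable_mollifier: "integrable lborel (mollifier e :: 'a::euclidean_space \<Rightarrow> real)"
  by (rule integrable_continuous_compact_support[OF C1_continuous[OF smooth_C1_grad[OF smooth_mollifier]], of e])
    (simp add: mollifier_eq_0)

lemma integral_mollifier: "(LINT x|lborel. mollifier e (x::'a::euclidean_space)) = 1"
proof -
  let ?b = "\<lambda>x::'a. bump ((1 / e) *\<^sub>R x) :: real"
  have sm: "smooth ?b" using smooth_affine[OF smooth_bump, of 1 0 "1/e"] by simp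
  have c: "continuous_on UNIV ?b" by (rule C1_continuous[OF smooth_C1_grad[OF sm]])
  have pos: "0 < ?b x \<longleftrightarrow> norm x < e" for x
    using e by (simp add: bump_pos_iff field_simps)
  have z: "?b x = 0" if "norm x > e" for x
    using pos[of x] bump_nonneg[of "(1/e) *\<^sub>R x"] that by force
  have i: "integrable lborel ?b" by (rule integrable_continuous_compact_support[OF c z])
  have "(LINT x|lborel. ?b x) \<noteq> 0"
  proof
    assume "(LINT x|lborel. ?b x) = 0"
    then have "AE x in lborel. ?b x = 0"
      by (subst (asm) integral_nonneg_eq_0_iff_AE[OF i]) (auto simp: bump_nonneg)
    then have "AE x in lborel. x \<notin> ball (0::'a) e" using pos by (auto elim!: eventually_mono) force
    then have "emeasure lborel (ball (0::'a) e) = 0"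
      by (subst (asm) AE_iff_measurable[of "ball 0 e"]) auto
    then show False using content_ball_pos[OF e, of "0::'a"] by (simp add: measure_def)
  qed
  then show ?thesis by (simp add: mollifier_def[abs_def])
qed

end

lemma lborel_reflect:
  fixes x :: "'a::euclidean_space"
  shows "distr lborel borel (\<lambda>y. x - y) = lborel"
proof -
  have "lborel = density (distr lborel borel (\<lambda>y. x + (-1) *\<^sub>R y)) (\<lambda>_. \<bar>-1::real\<bar>^DIM('a))"
    by (rule lborel_affine) simp
  then show ?thesis by (simp add: density_1)
qed

lemma lborel_integral_reflect:
  fixes x :: "'a::euclidean_space" and f :: "'a \<Rightarrow> 'b::euclidean_space"
  assumes [measurable]: "f \<in> borel_measurable borel"
  shows "(LINT y|lborel. f (x - y)) = (LINT y|lborel. f y)"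
  by (subst (2) lborel_reflect[of x, symmetric]) (simp add: integral_distr)

lemma lborel_nn_integral_translate:
  fixes x :: "'a::euclidean_space"
  assumes [measurable]: "f \<in> borel_measurable borel"
  shows "(\<integral>\<^sup>+y. f (x + y) \<partial>lborel) = (\<integral>\<^sup>+y. f y \<partial>lborel)"
  by (subst (2) lborel_distr_plus[of x, symmetric]) (simp add: nn_integral_distr)

lemma lborel_integrable_reflect:
  fixes x :: "'a::euclidean_space" and f :: "'a \<Rightarrow> 'b::euclidean_space"
  assumes "integrable lborel f"
  shows "integrable lborel (\<lambda>y. f (x - y))"
proof -
  have "integrable (distr lborel borel (\<lambda>y. x - y)) f" using assms by (simp add: lborel_reflect)
  then show ?thesis by (subst (asm) integrable_distr_eq) (use assms in auto)
qed

section \<open>Convergence of mollifications\<close>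

lemma nn_integral_dominated_convergence_diff:
  fixes u' :: "_ \<Rightarrow> _::{real_normed_vector, second_countable_topology}"
  assumes "\<And>i. u i \<in> borel_measurable M" "u' \<in> borel_measurable M" "w \<in> borel_measurable M"
    and "\<And>j. AE x in M. norm (u j x) \<le> w x" "(\<integral>\<^sup>+x. w x \<partial>M) < \<infinity>"
    and "AE x in M. (\<lambda>i. u i x) \<longlonglongrightarrow> u' x"
  shows "(\<lambda>i. (\<integral>\<^sup>+x. norm (u i x - u' x) \<partial>M)) \<longlonglongrightarrow> 0"
  using nn_integral_dominated_convergence_norm[OF assms] by (simp add: norm_minus_commute)

lemma mult_divide_add_one_le:
  fixes a b :: real
  assumes "0 \<le> a" "0 \<le> b" shows "a * (b / (a + 1)) \<le> b"
proof -
  have "a * (b / (a + 1)) = b * (a / (a + 1))" by simp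
  also have "\<dots> \<le> b * 1" using assms by (intro mult_left_mono) auto
  finally show ?thesis by simp
qed

text \<open>Inner regularity replaces \<open>A\<close> by a closed set, whose indicator is the limit of tent functions of the
  distance.\<close>

lemma indicator_L1_approx:
  fixes A :: "'a::euclidean_space set" and c :: "'b::euclidean_space"
  assumes A: "A \<in> sets borel" "A \<subseteq> cball 0 R" and e: "0 < \<eta>"
  shows "\<exists>g R. continuous_on UNIV g \<and> (\<forall>x. norm x > R \<longrightarrow> g x = 0) \<and>
     (\<integral>\<^sup>+x. norm (indicator A x *\<^sub>R c - g x) \<partial>lborel) < ennreal \<eta>"
proof -
  have Al: "A \<in> sets lebesgue" using A by auto
  have pos: "0 < \<eta> / 2 / (norm c + 1)" using e by (intro divide_pos_pos add_nonneg_pos) auto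
  obtain T where T: "closed T" "T \<subseteq> A" "A - T \<in> lmeasurable"
      "emeasure lebesgue (A - T) < ennreal (\<eta> / 2 / (norm c + 1))"
    by (rule sets_lebesgue_inner_closed[OF Al pos])
  \<comment> \<open>The tent functions \<open>max 0 (1 - n dist(x, T))\<close> decrease to the indicator of the closed set \<open>T\<close>.\<close>
  define k where "k n x = max 0 (1 - real n * infdist x T)" for n and x :: 'a
  have [measurable]: "cball (0::'a) (R + 1) \<in> sets borel" by (simp add: borel_closed)
  have Tb[measurable]: "T \<in> sets borel" using T by auto
  note [measurable] = A(1)
  have kc: "continuous_on UNIV (k n)" for n
    unfolding k_def by (intro continuous_intros)
  have [measurable]: "k n \<in> borel_measurable borel" for n
    using kc borel_measurable_continuous_onI by blast
  show ?thesis
  proof (cases "T = {}")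
    case True
    have "(\<integral>\<^sup>+x. norm (indicator A x *\<^sub>R c - 0) \<partial>lborel) = (\<integral>\<^sup>+x. ennreal (norm c) * indicator A x \<partial>lborel)"
      by (intro nn_integral_cong) (auto simp: indicator_def)
    also have "\<dots> = ennreal (norm c) * emeasure lborel A" by (simp add: nn_integral_cmult_indicator)
    also have "\<dots> \<le> ennreal (norm c) * ennreal (\<eta> / 2 / (norm c + 1))"
      using T(4) True A(1) by (intro mult_left_mono) auto
    also have "\<dots> = ennreal (norm c * (\<eta> / 2 / (norm c + 1)))"
      using e by (simp add: ennreal_mult[symmetric])
    also have "\<dots> \<le> ennreal (\<eta> / 2)"
      using e by (intro ennreal_leI mult_divide_add_one_le) auto
    also have "\<dots> < ennreal \<eta>" using e by (simp add: ennreal_lessI)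
    finally show ?thesis by (intro exI[of _ "\<lambda>_. 0"]) auto
  next
    case False
    have kR: "k n x = 0" if "norm x > R + 1" "1 \<le> n" for n x
    proof -
      have "R + 1 - R \<le> infdist x T"
        unfolding infdist_notempty[OF False]
      proof (rule cINF_greatest[OF False])
        fix t assume "t \<in> T"
        then have "norm t \<le> R" using T A by auto
        then show "R + 1 - R \<le> dist x t" using that(1) norm_triangle_ineq2[of x t] by (simp add: dist_norm)
      qed
      then have "1 * 1 \<le> real n * infdist x T" using that by (intro mult_mono) auto
      then show ?thesis by (simp add: k_def)
    qed
    have "(\<lambda>n. \<integral>\<^sup>+x. norm (k (Suc n) x *\<^sub>R c - indicator T x *\<^sub>R c) \<partial>lborel) \<longlonglongrightarrow> ennreal 0"
      unfolding ennreal_0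
    proof (rule nn_integral_dominated_convergence_diff[where w="\<lambda>x::'a. norm c * indicator (cball 0 (R+1)) x"])
      show "AE x in lborel. norm (k (Suc n) x *\<^sub>R c) \<le> norm c * indicator (cball 0 (R+1)) x" for n
      proof (rule AE_I2)
        fix x
        have "0 \<le> k (Suc n) x" "k (Suc n) x \<le> 1" by (auto simp: k_def infdist_nonneg)
        then show "norm (k (Suc n) x *\<^sub>R c) \<le> norm c * indicator (cball 0 (R+1)) x"
          using kR[of x "Suc n"] by (auto simp: indicator_def mult_left_le_one_le)
      qed
      show "(\<integral>\<^sup>+(x::'a). ennreal (norm c * indicator (cball 0 (R+1)) x) \<partial>lborel) < \<infinity>"
        using emeasure_lborel_cball_finite[of "0::'a" "R+1"]
        by (auto simp add: ennreal_mult nn_integral_cmult_indicator ennreal_indicator ennreal_mult_less_top)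
      show "AE x in lborel. (\<lambda>n. k (Suc n) x *\<^sub>R c) \<longlonglongrightarrow> indicator T x *\<^sub>R c"
      proof (intro AE_I2 tendsto_intros)
        fix x
        show "(\<lambda>n. k (Suc n) x) \<longlonglongrightarrow> indicator T x"
        proof (cases "x \<in> T")
          case True
          then show ?thesis by (simp add: k_def)
        next
          case F: False
          then have d: "infdist x T > 0"
            using in_closed_iff_infdist_zero[OF T(1) False] infdist_nonneg[of x T] by force
          obtain N where N: "1 / infdist x T < real N" using reals_Archimedean2 by blast
          have "k (Suc n) x = 0" if "N \<le> n" for n
          proof -
            have "1 \<le> real N * infdist x T" using N d by (simp add: field_simps)
            also have "\<dots> \<le> real (Suc n) * infdist x T"
              using that d by (intro mult_right_mono) auto
            finally show ?thesis by (simp add: k_def)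
          qed
          then have "\<forall>\<^sub>F n in sequentially. k (Suc n) x = 0"
            using eventually_sequentially by blast
          then show ?thesis using F by (simp add: tendsto_eventually)
        qed
      qed
    qed auto
    then have "\<forall>\<^sub>F n in sequentially. (\<integral>\<^sup>+x. norm (k (Suc n) x *\<^sub>R c - indicator T x *\<^sub>R c) \<partial>lborel) < ennreal (\<eta>/2)"
      using e by (intro order_tendstoD(2)) auto
    then obtain n where n: "(\<integral>\<^sup>+x. norm (k (Suc n) x *\<^sub>R c - indicator T x *\<^sub>R c) \<partial>lborel) < ennreal (\<eta>/2)"
      using eventually_happens'[OF sequentially_bot] by blast
    have "(\<integral>\<^sup>+x. norm (indicator A x *\<^sub>R c - k (Suc n) x *\<^sub>R c) \<partial>lborel) \<le>
      (\<integral>\<^sup>+x. ennreal (norm c) * indicator (A - T) x + norm (k (Suc n) x *\<^sub>R c - indicator T x *\<^sub>R c) \<partial>lborel)"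
    proof (intro nn_integral_mono)
      fix x
      have "norm (indicator A x *\<^sub>R c - k (Suc n) x *\<^sub>R c) \<le> norm c * indicator (A - T) x + norm (k (Suc n) x *\<^sub>R c - indicator T x *\<^sub>R c)"
        using T(2) norm_triangle_ineq4[of c "k (Suc n) x *\<^sub>R c"] by (auto simp: indicator_def norm_minus_commute)
      then show "ennreal (norm (indicator A x *\<^sub>R c - k (Suc n) x *\<^sub>R c)) \<le> ennreal (norm c) * indicator (A - T) x + norm (k (Suc n) x *\<^sub>R c - indicator T x *\<^sub>R c)"
        by (simp add: ennreal_mult[symmetric] ennreal_plus[symmetric] ennreal_indicator[symmetric] del: ennreal_plus)
    qed
    also have "\<dots> = ennreal (norm c) * emeasure lborel (A - T) + (\<integral>\<^sup>+x. norm (k (Suc n) x *\<^sub>R c - indicator T x *\<^sub>R c) \<partial>lborel)"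
      by (subst nn_integral_add) (auto simp: nn_integral_cmult_indicator)
    also have "ennreal (norm c) * emeasure lborel (A - T) \<le> ennreal (norm c) * ennreal (\<eta> / 2 / (norm c + 1))"
      using T(4) A(1) by (intro mult_left_mono) auto
    also have "\<dots> \<le> ennreal (\<eta> / 2)"
      using e mult_divide_add_one_le[of "norm c" "\<eta>/2"] by (simp add: ennreal_mult[symmetric] ennreal_leI)
    also have "ennreal (\<eta>/2) + (\<integral>\<^sup>+x. norm (k (Suc n) x *\<^sub>R c - indicator T x *\<^sub>R c) \<partial>lborel)
       < ennreal (\<eta>/2) + ennreal (\<eta>/2)"
      using n by (simp add: ennreal_add_left_cancel_less)
    also have "\<dots> = ennreal \<eta>" using e by (simp add: ennreal_plus[symmetric] del: ennreal_plus)
    finally show ?thesis using kR[of _ "Suc n"]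
      by (intro exI[of _ "\<lambda>x. k (Suc n) x *\<^sub>R c"] exI[of _ "R + 1"])
        (auto intro!: continuous_intros kc simp: less_le_trans)
  qed
qed

text \<open>By induction over integrable functions, only indicators of sets of finite measure have to be
  approximated, and these can be cut down to bounded sets first.\<close>

lemma L1_dense_continuous:
  fixes f :: "'a::euclidean_space \<Rightarrow> 'b::euclidean_space"
  assumes "integrable lborel f" "0 < \<eta>"
  shows "\<exists>g R. continuous_on UNIV g \<and> (\<forall>x. norm x > R \<longrightarrow> g x = 0) \<and>
     (\<integral>\<^sup>+x. norm (f x - g x) \<partial>lborel) < ennreal \<eta>"
  using assms
proof (induction f arbitrary: \<eta> rule: integrable_induct)
  case (base A c)
  have lim: "(\<lambda>n. \<integral>\<^sup>+x. norm (indicator (A \<inter> cball 0 (real n)) x *\<^sub>R c - indicator A x *\<^sub>R c) \<partial>(lborel::'a measure)) \<longlonglongrightarrow> ennreal 0"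
    unfolding ennreal_0
  proof (rule nn_integral_dominated_convergence_diff[where w="\<lambda>x. norm c * indicator A x" and
        u="\<lambda>n x. indicator (A \<inter> cball 0 (real n)) x *\<^sub>R c" and u'="\<lambda>x. indicator A x *\<^sub>R c"])
    show "(\<integral>\<^sup>+x. ennreal (norm c * indicator A x) \<partial>lborel) < \<infinity>"
      using base by (simp add: ennreal_mult nn_integral_cmult ennreal_indicator ennreal_mult_less_top)
    show "AE x in lborel. (\<lambda>n. indicator (A \<inter> cball 0 (real n)) x *\<^sub>R c) \<longlonglongrightarrow> indicator A x *\<^sub>R c"
    proof (intro AE_I2 tendsto_eventually)
      fix x :: 'a
      obtain N where "norm x < real N" using reals_Archimedean2 by blast
      then have "indicator (A \<inter> cball 0 (real n)) x *\<^sub>R c = indicator A x *\<^sub>R c" if "N \<le> n" for n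
        using that by (auto simp: indicator_def)
      then show "\<forall>\<^sub>F n in sequentially. indicator (A \<inter> cball 0 (real n)) x *\<^sub>R c = indicator A x *\<^sub>R c"
        using eventually_sequentially by blast
    qed
  qed (use base in \<open>auto simp: indicator_def\<close>)
  have "\<forall>\<^sub>F n in sequentially. (\<integral>\<^sup>+x. norm (indicator (A \<inter> cball 0 (real n)) x *\<^sub>R c - indicator A x *\<^sub>R c) \<partial>lborel) < ennreal (\<eta>/2)"
    using base by (intro order_tendstoD(2)[OF lim]) auto
  then obtain n where n: "(\<integral>\<^sup>+x. norm (indicator (A \<inter> cball 0 (real n)) x *\<^sub>R c - indicator A x *\<^sub>R c) \<partial>lborel) < ennreal (\<eta>/2)"
    using eventually_happens'[OF sequentially_bot] by blast
  have [measurable]: "A \<in> sets borel" using base by auto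
  then have [measurable]: "A \<inter> cball 0 (real n) \<in> sets borel" by auto
  obtain g R where g: "continuous_on UNIV g" "\<forall>x. norm x > R \<longrightarrow> g x = 0"
     "(\<integral>\<^sup>+x. norm (indicator (A \<inter> cball 0 (real n)) x *\<^sub>R c - g x) \<partial>lborel) < ennreal (\<eta>/2)"
    using indicator_L1_approx[of "A \<inter> cball 0 (real n)" "real n" "\<eta>/2" c] base by auto
  have [measurable]: "g \<in> borel_measurable borel" using g borel_measurable_continuous_onI by blast
  have tri: "norm (a - b) \<le> norm (z - a) + norm (z - b)" for a b z :: 'b
    using dist_triangle3[of a b z] by (simp add: dist_norm)
  have "(\<integral>\<^sup>+x. norm (indicator A x *\<^sub>R c - g x) \<partial>lborel) \<le>
     (\<integral>\<^sup>+x. ennreal (norm (indicator (A \<inter> cball 0 (real n)) x *\<^sub>R c - indicator A x *\<^sub>R c)) +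
        norm (indicator (A \<inter> cball 0 (real n)) x *\<^sub>R c - g x) \<partial>lborel)"
    by (intro nn_integral_mono, subst ennreal_plus[symmetric])
      (simp_all add: ennreal_leI tri del: ennreal_plus)
  also have "\<dots> = (\<integral>\<^sup>+x. norm (indicator (A \<inter> cball 0 (real n)) x *\<^sub>R c - indicator A x *\<^sub>R c) \<partial>lborel) +
    (\<integral>\<^sup>+x. norm (indicator (A \<inter> cball 0 (real n)) x *\<^sub>R c - g x) \<partial>lborel)"
    by (rule nn_integral_add) measurable
  also have "\<dots> < ennreal (\<eta>/2) + ennreal (\<eta>/2)" using n g(3) by (rule add_strict_mono)
  also have "\<dots> = ennreal \<eta>" using base by (simp add: ennreal_plus[symmetric] del: ennreal_plus)
  finally show ?case using g by blast
next
  case (add f f')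
  obtain g R where g: "continuous_on UNIV g" "\<forall>x. norm x > R \<longrightarrow> g x = 0"
     "(\<integral>\<^sup>+x. norm (f x - g x) \<partial>lborel) < ennreal (\<eta>/2)"
    using add.IH(1)[of "\<eta>/2"] add.prems by auto
  obtain g' R' where g': "continuous_on UNIV g'" "\<forall>x. norm x > R' \<longrightarrow> g' x = 0"
     "(\<integral>\<^sup>+x. norm (f' x - g' x) \<partial>lborel) < ennreal (\<eta>/2)"
    using add.IH(2)[of "\<eta>/2"] add.prems by auto
  have [measurable]: "g \<in> borel_measurable borel" "g' \<in> borel_measurable borel"
    using g g' borel_measurable_continuous_onI by blast+
  have [measurable]: "f \<in> borel_measurable borel" "f' \<in> borel_measurable borel"
    using add.hyps by auto
  have "(\<integral>\<^sup>+x. norm (f x + f' x - (g x + g' x)) \<partial>lborel) \<le>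
     (\<integral>\<^sup>+x. ennreal (norm (f x - g x)) + norm (f' x - g' x) \<partial>lborel)"
    by (intro nn_integral_mono, subst ennreal_plus[symmetric])
      (auto intro!: ennreal_leI norm_diff_triangle_ineq simp del: ennreal_plus)
  also have "\<dots> = (\<integral>\<^sup>+x. norm (f x - g x) \<partial>lborel) + (\<integral>\<^sup>+x. norm (f' x - g' x) \<partial>lborel)"
    by (rule nn_integral_add) auto
  also have "\<dots> < ennreal (\<eta>/2) + ennreal (\<eta>/2)" using g(3) g'(3) by (rule add_strict_mono)
  also have "\<dots> = ennreal \<eta>" using add.prems by (simp add: ennreal_plus[symmetric] del: ennreal_plus)
  finally show ?case using g g'
    by (intro exI[of _ "\<lambda>x. g x + g' x"] exI[of _ "max R R'"]) (auto intro!: continuous_intros)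
next
  case (lim f s)
  have [measurable]: "f \<in> borel_measurable borel" "\<And>i. s i \<in> borel_measurable borel"
    using lim.hyps by auto
  have lim': "(\<lambda>n. \<integral>\<^sup>+x. norm (s n x - f x) \<partial>lborel) \<longlonglongrightarrow> ennreal 0"
    unfolding ennreal_0
  proof (rule nn_integral_dominated_convergence_diff[where w="\<lambda>x. 2 * norm (f x)"])
    show "(\<integral>\<^sup>+x. ennreal (2 * norm (f x)) \<partial>lborel) < \<infinity>"
      using lim.hyps
      by (simp add: integrable_iff_bounded ennreal_mult nn_integral_cmult ennreal_mult_less_top)
  qed (use lim.hyps in auto)
  have "\<forall>\<^sub>F n in sequentially. (\<integral>\<^sup>+x. norm (s n x - f x) \<partial>lborel) < ennreal (\<eta>/2)"
    using lim.prems by (intro order_tendstoD(2)[OF lim']) auto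
  then obtain n where n: "(\<integral>\<^sup>+x. norm (s n x - f x) \<partial>lborel) < ennreal (\<eta>/2)"
    using eventually_happens'[OF sequentially_bot] by blast
  obtain g R where g: "continuous_on UNIV g" "\<forall>x. norm x > R \<longrightarrow> g x = 0"
     "(\<integral>\<^sup>+x. norm (s n x - g x) \<partial>lborel) < ennreal (\<eta>/2)"
    using lim.IH[of "\<eta>/2" n] lim.prems by auto
  have [measurable]: "g \<in> borel_measurable borel" using g borel_measurable_continuous_onI by blast
  have "(\<integral>\<^sup>+x. norm (f x - g x) \<partial>lborel) \<le>
     (\<integral>\<^sup>+x. ennreal (norm (s n x - f x)) + norm (s n x - g x) \<partial>lborel)"
    by (intro nn_integral_mono, subst ennreal_plus[symmetric])
      (auto intro!: ennreal_leI norm_diff_triangle_le[of "f _" "s n _"] simp: norm_minus_commute simp del: ennreal_plus)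
  also have "\<dots> = (\<integral>\<^sup>+x. norm (s n x - f x) \<partial>lborel) + (\<integral>\<^sup>+x. norm (s n x - g x) \<partial>lborel)"
    by (rule nn_integral_add) auto
  also have "\<dots> < ennreal (\<eta>/2) + ennreal (\<eta>/2)" using n g(3) by (rule add_strict_mono)
  also have "\<dots> = ennreal \<eta>" using lim.prems by (simp add: ennreal_plus[symmetric] del: ennreal_plus)
  finally show ?case using g by blast
qed

lemma mollify_eq_reflect:
  fixes f :: "'a::euclidean_space \<Rightarrow> 'b::euclidean_space"
  assumes e: "0 < e" and [measurable]: "f \<in> borel_measurable borel"
  shows "mollify e f x = (LINT y|lborel. mollifier e y *\<^sub>R f (x - y))"
proof -
  have [measurable]: "mollifier e \<in> borel_measurable borel" by (rule mollifier_measurable[OF e])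
  show ?thesis unfolding mollify_def
    by (subst lborel_integral_reflect[of "\<lambda>y. mollifier e y *\<^sub>R f (x - y)" x, symmetric]) auto
qed

lemma mollifier_integrable_mult:
  fixes f :: "'a::euclidean_space \<Rightarrow> 'b::euclidean_space"
  assumes e: "0 < e" and f: "integrable lborel f"
  shows "integrable lborel (\<lambda>y. mollifier e (x - y) *\<^sub>R f y)"
proof -
  have [measurable]: "mollifier e \<in> borel_measurable borel" by (rule mollifier_measurable[OF e])
  obtain B where "\<And>x::'a. norm (mollifier e x) \<le> B"
    using compact_support_bounded[OF C1_continuous[OF smooth_C1_grad[OF smooth_mollifier[OF e]]], of e]
      mollifier_eq_0[OF e] by (metis less_imp_le)
  then show ?thesis by (intro integrable_bounded_mult[OF f, of _ B]) auto
qed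

lemma mollify_measurable [measurable]:
  fixes f :: "'a::euclidean_space \<Rightarrow> 'b::euclidean_space"
  assumes e: "0 < e" and [measurable]: "f \<in> borel_measurable borel"
  shows "mollify e f \<in> borel_measurable borel"
proof -
  have [measurable]: "mollifier e \<in> borel_measurable borel" by (rule mollifier_measurable[OF e])
  show ?thesis unfolding mollify_def[abs_def] by measurable
qed

lemma mollifier_integral_shift:
  fixes x :: "'a::euclidean_space"
  assumes e: "0 < e"
  shows "integrable lborel (\<lambda>y. mollifier e (x - y))" "(LINT y|lborel. mollifier e (x - y)) = 1"
proof -
  have [measurable]: "(mollifier e :: 'a \<Rightarrow> real) \<in> borel_measurable borel" by (rule mollifier_measurable[OF e])
  show "integrable lborel (\<lambda>y. mollifier e (x - y))"
    by (rule lborel_integrable_reflect[OF integrable_mollifier[OF e]])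
  show "(LINT y|lborel. mollifier e (x - y)) = 1"
    by (subst lborel_integral_reflect) (auto simp: integral_mollifier[OF e])
qed

text \<open>Mollification contracts \<open>L\<^sup>p\<close>: Jensen's inequality pointwise, then Fubini.\<close>

lemma nn_integral_mollify_powr_le:
  fixes f :: "'a::euclidean_space \<Rightarrow> 'b::euclidean_space"
  assumes e: "0 < e" and p: "1 \<le> p" and f: "integrable lborel f"
    and fp: "integrable lborel (\<lambda>x. norm (f x) powr p)"
  shows "(\<integral>\<^sup>+x. norm (mollify e f x) powr p \<partial>lborel) \<le> (\<integral>\<^sup>+x. norm (f x) powr p \<partial>lborel)"
proof -
  have [measurable]: "(mollifier e :: 'a \<Rightarrow> real) \<in> borel_measurable borel" by (rule mollifier_measurable[OF e])
  have [measurable]: "f \<in> borel_measurable borel" using f by auto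
  have i1: "integrable lborel (\<lambda>y. mollifier e (x - y) * norm (f y))" for x :: 'a
    using mollifier_integrable_mult[OF e integrable_norm[OF f], of x] by simp
  have ip: "integrable lborel (\<lambda>y. mollifier e (x - y) * norm (f y) powr p)" for x :: 'a
    using mollifier_integrable_mult[OF e fp, of x] by simp
  have pt: "norm (mollify e f x) powr p \<le> (LINT y|lborel. mollifier e (x - y) * norm (f y) powr p)" for x
  proof -
    have "norm (mollify e f x) \<le> (LINT y|lborel. mollifier e (x - y) * norm (f y))"
      unfolding mollify_def
      by (rule lint_norm_le[OF mollifier_integrable_mult[OF e f] i1]) (simp add: mollifier_nonneg[OF e])
    then have "norm (mollify e f x) powr p \<le> (LINT y|lborel. mollifier e (x - y) * norm (f y)) powr p"
      using p by (intro powr_mono2) auto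
    also have "\<dots> \<le> (LINT y|lborel. mollifier e (x - y) * norm (f y) powr p)"
      by (rule powr_weighted_integral_le[OF p _ _ mollifier_integral_shift[OF e] i1 ip])
        (auto simp: mollifier_nonneg[OF e])
    finally show ?thesis .
  qed
  have "(\<integral>\<^sup>+x. norm (mollify e f x) powr p \<partial>lborel) \<le>
      (\<integral>\<^sup>+x. (\<integral>\<^sup>+y. ennreal (mollifier e (x - y)) * ennreal (norm (f y) powr p) \<partial>lborel) \<partial>lborel)"
  proof (rule nn_integral_mono)
    fix x
    have "ennreal (norm (mollify e f x) powr p) \<le> ennreal (LINT y|lborel. mollifier e (x - y) * norm (f y) powr p)"
      by (rule ennreal_leI[OF pt])
    also have "\<dots> = (\<integral>\<^sup>+y. mollifier e (x - y) * norm (f y) powr p \<partial>lborel)"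
      by (rule nn_integral_eq_integral[symmetric, OF ip]) (auto simp: mollifier_nonneg[OF e])
    finally show "ennreal (norm (mollify e f x) powr p) \<le>
       (\<integral>\<^sup>+y. ennreal (mollifier e (x - y)) * ennreal (norm (f y) powr p) \<partial>lborel)"
      by (simp add: ennreal_mult mollifier_nonneg[OF e])
  qed
  also have "\<dots> = (\<integral>\<^sup>+y. (\<integral>\<^sup>+x. ennreal (mollifier e (x - y)) * ennreal (norm (f y) powr p) \<partial>lborel) \<partial>lborel)"
    by (rule lborel_pair.Fubini'[symmetric]) measurable
  also have "\<dots> = (\<integral>\<^sup>+y. norm (f y) powr p \<partial>lborel)"
  proof (rule nn_integral_cong)
    fix y :: 'a
    have "(\<integral>\<^sup>+x. ennreal (mollifier e (x - y)) \<partial>lborel) = ennreal (LINT x|lborel. mollifier e (y - x))"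
      using mollifier_integral_shift(1)[OF e, of y]
      by (simp add: mollifier_commute[OF e, of _ y] nn_integral_eq_integral mollifier_nonneg[OF e])
    then show "(\<integral>\<^sup>+x. ennreal (mollifier e (x - y)) * ennreal (norm (f y) powr p) \<partial>lborel) = ennreal (norm (f y) powr p)"
      by (simp add: nn_integral_multc mollifier_integral_shift(2)[OF e])
  qed
  finally show ?thesis .
qed

lemma mollify_diff:
  fixes f g :: "'a::euclidean_space \<Rightarrow> 'b::euclidean_space"
  assumes "0 < e" "integrable lborel f" "integrable lborel g"
  shows "mollify e (\<lambda>x. f x - g x) x = mollify e f x - mollify e g x"
  unfolding mollify_def
  by (simp add: scaleR_diff_right mollifier_integrable_mult assms)

text \<open>A mollified value is an average over a small ball.\<close>

lemma mollify_in_ball: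
  fixes f :: "'a::euclidean_space \<Rightarrow> 'b::euclidean_space"
  assumes e: "0 < e" and f: "integrable lborel f"
    and AE: "AE y in lborel. norm (x - y) < e \<longrightarrow> norm (f y - c) \<le> r"
  shows "norm (mollify e f x - c) \<le> r"
proof -
  note im = mollifier_integral_shift[OF e, of x]
  have ic: "integrable lborel (\<lambda>y. mollifier e (x - y) *\<^sub>R (f y - c))"
    using mollifier_integrable_mult[OF e f, of x] im
    by (simp add: scaleR_diff_right)
  have eq: "mollify e f x - c = (LINT y|lborel. mollifier e (x - y) *\<^sub>R (f y - c))"
    using mollifier_integrable_mult[OF e f, of x] im
    by (simp add: scaleR_diff_right mollify_def integral_scaleR_left)
  have "norm (mollify e f x - c) \<le> (LINT y|lborel. norm (mollifier e (x - y) *\<^sub>R (f y - c)))"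
    unfolding eq by (rule integral_norm_bound)
  also have "\<dots> \<le> (LINT y|lborel. mollifier e (x - y) * r)"
  proof (rule integral_mono_AE)
    show "AE y in lborel. norm (mollifier e (x - y) *\<^sub>R (f y - c)) \<le> mollifier e (x - y) * r"
      using AE
    proof eventually_elim
      case (elim y)
      then show ?case
        using mollifier_eq_0[OF e, of "x - y"] mollifier_nonneg[OF e, of "x - y"]
        by (cases "norm (x - y) < e") (auto intro: mult_left_mono)
    qed
  qed (use integrable_norm[OF ic] im in \<open>simp_all only: integrable_mult_left\<close>)
  also have "\<dots> = r" using im by simp
  finally show ?thesis .
qed

text \<open>For continuous functions of compact support the convergence is uniform; the contraction property
  transfers it to the \<open>L\<^sup>1\<close> closure.\<close>

lemma mollify_L1_tendsto:
  fixes f :: "'a::euclidean_space \<Rightarrow> 'b::euclidean_space"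
  assumes f: "integrable lborel f" and \<eta>: "0 < \<eta>"
  shows "\<exists>d>0. \<forall>e. 0 < e \<and> e < d \<longrightarrow> (\<integral>\<^sup>+x. norm (mollify e f x - f x) \<partial>lborel) \<le> ennreal \<eta>"
proof -
  obtain g R0 where g: "continuous_on UNIV g" "\<forall>x. norm x > R0 \<longrightarrow> g x = 0"
     "(\<integral>\<^sup>+x. norm (f x - g x) \<partial>lborel) < ennreal (\<eta>/3)"
    using L1_dense_continuous[OF f, of "\<eta>/3"] \<eta> by auto
  define R where "R = max R0 0"
  have gR: "g x = 0" if "norm x > R" for x using g(2) that by (auto simp: R_def)
  have ig: "integrable lborel g" by (rule integrable_continuous_compact_support[OF zero_less_one g(1) gR])
  have [measurable]: "f \<in> borel_measurable borel" "g \<in> borel_measurable borel" using f ig by auto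
  define V where "V = measure lborel (cball (0::'a) (R + 1))"
  have V: "0 \<le> V" by (simp add: V_def)
  obtain d where d: "d > 0" "\<And>x y. norm (x - y) < d \<Longrightarrow> norm (g x - g y) < \<eta> / 3 / (V + 1)"
    by (rule compact_support_uniformly_continuous[OF g(1) gR, where e = "\<eta> / 3 / (V + 1)"]) (use \<eta> V in auto)
  show ?thesis
  proof (intro exI[of _ "min d 1"] conjI allI impI)
    show "0 < min d 1" using d by auto
    fix e :: real assume "0 < e \<and> e < min d 1"
    then have e: "0 < e" "e < d" "e < 1" by auto
    note [measurable] = mollify_measurable[OF e(1)]
    have 1: "(\<integral>\<^sup>+x. norm (mollify e f x - mollify e g x) \<partial>lborel) \<le> ennreal (\<eta>/3)"
    proof -
      have ifg: "integrable lborel (\<lambda>x. f x - g x)" using f ig by auto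
      have "(\<integral>\<^sup>+x. norm (mollify e (\<lambda>x. f x - g x) x) powr 1 \<partial>lborel) \<le> (\<integral>\<^sup>+x. norm (f x - g x) powr 1 \<partial>lborel)"
        by (rule nn_integral_mollify_powr_le[OF e(1) order_refl ifg]) (use ifg in simp)
      then show ?thesis using g(3) by (simp add: mollify_diff[OF e(1) f ig])
    qed
    have 2: "(\<integral>\<^sup>+x. norm (mollify e g x - g x) \<partial>lborel) \<le> ennreal (\<eta>/3)"
    proof -
      have pt: "norm (mollify e g x - g x) \<le> \<eta> / 3 / (V + 1) * indicator (cball 0 (R + 1)) x" for x
      proof (cases "norm x \<le> R + 1")
        case True
        have "norm (mollify e g x - g x) \<le> \<eta> / 3 / (V + 1)"
          by (rule mollify_in_ball[OF e(1) ig]) (use d(2) e in \<open>auto simp: norm_minus_commute intro!: AE_I2 less_imp_le\<close>)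
        then show ?thesis using True by simp
      next
        case False
        have "norm (mollify e g x - 0) \<le> 0"
        proof (rule mollify_in_ball[OF e(1) ig], intro AE_I2 impI)
          fix y assume "norm (x - y) < e"
          then have "norm y > R" using False e norm_triangle_ineq2[of x y] by auto
          then show "norm (g y - 0) \<le> 0" using gR by simp
        qed
        moreover have "g x = 0" using False by (intro gR) simp
        ultimately show ?thesis using False by simp
      qed
      have "(\<integral>\<^sup>+x. norm (mollify e g x - g x) \<partial>lborel) \<le> (\<integral>\<^sup>+(x::'a). ennreal (\<eta> / 3 / (V + 1)) * indicator (cball 0 (R + 1)) x \<partial>lborel)"
      proof (rule nn_integral_mono)
        fix x
        show "ennreal (norm (mollify e g x - g x)) \<le> ennreal (\<eta> / 3 / (V + 1)) * indicator (cball 0 (R + 1)) x"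
          using ennreal_leI[OF pt[of x]] by (cases "x \<in> cball 0 (R + 1)") auto
      qed
      also have "\<dots> = ennreal (\<eta> / 3 / (V + 1)) * ennreal V"
        unfolding V_def using emeasure_lborel_cball_finite[of "0::'a" "R+1"]
        by (subst nn_integral_cmult_indicator) (auto simp: emeasure_eq_ennreal_measure)
      also have "\<dots> \<le> ennreal (\<eta>/3)"
        using \<eta> V mult_divide_add_one_le[of V "\<eta>/3"] by (simp add: ennreal_mult[symmetric] ennreal_leI mult.commute)
      finally show ?thesis .
    qed
    have "(\<integral>\<^sup>+x. norm (mollify e f x - f x) \<partial>lborel) \<le>
       (\<integral>\<^sup>+x. ennreal (norm (mollify e f x - mollify e g x)) + (ennreal (norm (mollify e g x - g x)) + ennreal (norm (f x - g x))) \<partial>lborel)"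
    proof (rule nn_integral_mono)
      fix x
      have "norm (mollify e f x - f x) \<le> norm (mollify e f x - mollify e g x) + (norm (mollify e g x - g x) + norm (f x - g x))"
        using norm_triangle_ineq4[of "(mollify e f x - mollify e g x) + (mollify e g x - g x)" "f x - g x"]
          norm_triangle_ineq[of "mollify e f x - mollify e g x" "mollify e g x - g x"] by simp
      then show "ennreal (norm (mollify e f x - f x)) \<le> ennreal (norm (mollify e f x - mollify e g x)) + (ennreal (norm (mollify e g x - g x)) + ennreal (norm (f x - g x)))"
        by (simp add: ennreal_plus[symmetric] del: ennreal_plus)
    qed
    also have "\<dots> = (\<integral>\<^sup>+x. norm (mollify e f x - mollify e g x) \<partial>lborel) + ((\<integral>\<^sup>+x. norm (mollify e g x - g x) \<partial>lborel) + (\<integral>\<^sup>+x. norm (f x - g x) \<partial>lborel))"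
      by (subst nn_integral_add; (subst nn_integral_add)?) auto
    also have "\<dots> \<le> ennreal (\<eta>/3) + (ennreal (\<eta>/3) + ennreal (\<eta>/3))"
      using 1 2 g(3) by (intro add_mono) auto
    also have "\<dots> = ennreal \<eta>" using \<eta> by (simp add: ennreal_plus[symmetric] del: ennreal_plus)
    finally show "(\<integral>\<^sup>+x. norm (mollify e f x - f x) \<partial>lborel) \<le> ennreal \<eta>" .
  qed
qed

lemma nn_integral_powr_add_le:
  fixes a b :: "'c \<Rightarrow> 'b::euclidean_space"
  assumes p: "0 \<le> p" and [measurable]: "a \<in> borel_measurable M" "b \<in> borel_measurable M"
  shows "(\<integral>\<^sup>+x. norm (a x + b x) powr p \<partial>M)
    \<le> ennreal (2 powr p) * ((\<integral>\<^sup>+x. norm (a x) powr p \<partial>M) + (\<integral>\<^sup>+x. norm (b x) powr p \<partial>M))"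
proof -
  have "(\<integral>\<^sup>+x. norm (a x + b x) powr p \<partial>M)
      \<le> (\<integral>\<^sup>+x. ennreal (2 powr p) * (ennreal (norm (a x) powr p) + ennreal (norm (b x) powr p)) \<partial>M)"
    by (intro nn_integral_mono)
      (simp add: ennreal_mult[symmetric] ennreal_plus[symmetric] ennreal_leI norm_powr_add_le[OF p] del: ennreal_plus)
  also have "\<dots> = ennreal (2 powr p) * ((\<integral>\<^sup>+x. norm (a x) powr p \<partial>M) + (\<integral>\<^sup>+x. norm (b x) powr p \<partial>M))"
    by (simp add: nn_integral_cmult nn_integral_add)
  finally show ?thesis .
qed

text \<open>The nonnegative integral is used so that convergence to zero does not presuppose integrability of the
  differences.\<close>

definition Lp_tendsto :: "real \<Rightarrow> 'c measure \<Rightarrow> (nat \<Rightarrow> 'c \<Rightarrow> 'b::euclidean_space) \<Rightarrow> ('c \<Rightarrow> 'b) \<Rightarrow> bool" where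
  "Lp_tendsto p M fs f \<longleftrightarrow> (\<lambda>n. \<integral>\<^sup>+x. norm (fs n x - f x) powr p \<partial>M) \<longlonglongrightarrow> 0"

lemma Lp_tendsto_add:
  assumes "0 \<le> p" "Lp_tendsto p M fs f" "Lp_tendsto p M gs g"
    and [measurable]: "\<And>n. fs n \<in> borel_measurable M" "\<And>n. gs n \<in> borel_measurable M"
    "f \<in> borel_measurable M" "g \<in> borel_measurable M"
  shows "Lp_tendsto p M (\<lambda>n x. fs n x + gs n x) (\<lambda>x. f x + g x)"
  unfolding Lp_tendsto_def
proof (rule tendsto_sandwich[OF _ _ tendsto_const])
  show "\<forall>\<^sub>F n in sequentially. (\<integral>\<^sup>+x. norm (fs n x + gs n x - (f x + g x)) powr p \<partial>M) \<le>
     ennreal (2 powr p) * ((\<integral>\<^sup>+x. norm (fs n x - f x) powr p \<partial>M) + (\<integral>\<^sup>+x. norm (gs n x - g x) powr p \<partial>M))"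
    using nn_integral_powr_add_le[OF assms(1), of "\<lambda>x. fs n x - f x" M "\<lambda>x. gs n x - g x" for n]
    by (intro always_eventually allI) (simp add: add_diff_add)
  have "(\<lambda>n. ennreal (2 powr p) * ((\<integral>\<^sup>+x. norm (fs n x - f x) powr p \<partial>M) + (\<integral>\<^sup>+x. norm (gs n x - g x) powr p \<partial>M)))
     \<longlonglongrightarrow> ennreal (2 powr p) * (0 + 0)"
    using assms(2,3) unfolding Lp_tendsto_def
    by (intro ennreal_tendsto_cmult tendsto_add) auto
  then show "(\<lambda>n. ennreal (2 powr p) * ((\<integral>\<^sup>+x. norm (fs n x - f x) powr p \<partial>M) + (\<integral>\<^sup>+x. norm (gs n x - g x) powr p \<partial>M))) \<longlonglongrightarrow> 0"
    by simp
qed auto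

lemma ennreal_tendsto_0_iff:
  fixes f :: "nat \<Rightarrow> ennreal"
  shows "f \<longlonglongrightarrow> 0 \<longleftrightarrow> (\<forall>\<eta>>0. \<forall>\<^sub>F n in sequentially. f n \<le> ennreal \<eta>)"
proof
  assume f: "f \<longlonglongrightarrow> 0"
  show "\<forall>\<eta>>0. \<forall>\<^sub>F n in sequentially. f n \<le> ennreal \<eta>"
  proof (intro allI impI)
    fix \<eta> :: real assume "0 < \<eta>"
    then have "\<forall>\<^sub>F n in sequentially. f n < ennreal \<eta>"
      by (intro order_tendstoD(2)[OF f]) simp
    then show "\<forall>\<^sub>F n in sequentially. f n \<le> ennreal \<eta>"
      by (rule eventually_mono) simp
  qed
next
  assume h: "\<forall>\<eta>>0. \<forall>\<^sub>F n in sequentially. f n \<le> ennreal \<eta>"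
  show "f \<longlonglongrightarrow> 0"
  proof (rule order_tendstoI)
    fix a :: ennreal assume "0 < a"
    then obtain r where r: "0 < r" "ennreal r < a"
      by (metis ennreal_less_zero_iff dense ennreal_cases less_top_ennreal order_less_trans order_less_asym top.not_eq_extremum)
    then show "\<forall>\<^sub>F n in sequentially. f n < a"
      using h by (auto elim!: allE[of _ r] eventually_mono)
  qed auto
qed

lemma Lp_truncation_tendsto:
  fixes f :: "'c \<Rightarrow> 'b::euclidean_space"
  assumes p: "1 \<le> p" and fp: "integrable M (\<lambda>x. norm (f x) powr p)" and [measurable]: "f \<in> borel_measurable M"
  shows "(\<lambda>n::nat. \<integral>\<^sup>+x. norm (f x - (if norm (f x) \<le> real n then f x else 0)) powr p \<partial>M) \<longlonglongrightarrow> 0"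
proof -
  have "(\<lambda>n::nat. \<integral>\<^sup>+x. norm (f x - (if norm (f x) \<le> real n then f x else 0)) powr p \<partial>M) \<longlonglongrightarrow> (\<integral>\<^sup>+x. 0 \<partial>M)"
  proof (rule nn_integral_dominated_convergence[where w="\<lambda>x. ennreal (norm (f x) powr p)"])
    show "(\<integral>\<^sup>+x. ennreal (norm (f x) powr p) \<partial>M) < \<infinity>"
      using fp by (simp add: integrable_iff_bounded)
    show "AE x in M. (\<lambda>n. ennreal (norm (f x - (if norm (f x) \<le> real n then f x else 0)) powr p)) \<longlonglongrightarrow> 0"
    proof (intro AE_I2 tendsto_eventually)
      fix x
      obtain N where N: "norm (f x) < real N" using reals_Archimedean2 by blast
      have "ennreal (norm (f x - (if norm (f x) \<le> real n then f x else 0)) powr p) = 0" if "N \<le> n" for n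
        using that N p by simp
      then show "\<forall>\<^sub>F n in sequentially. ennreal (norm (f x - (if norm (f x) \<le> real n then f x else 0)) powr p) = 0"
        using eventually_sequentially by blast
    qed
  qed auto
  then show ?thesis by simp
qed

text \<open>Split \<open>f\<close> into a bounded truncation and a remainder that is small in \<open>L\<^sup>p\<close>. For bounded functions the
  \<open>L\<^sup>p\<close> error is controlled by the \<open>L\<^sup>1\<close> error, and on the remainder mollification is a contraction.\<close>

lemma mollify_Lp_tendsto:
  fixes f :: "'a::euclidean_space \<Rightarrow> 'b::euclidean_space"
  assumes p: "1 \<le> p" and f: "integrable lborel f" and fp: "integrable lborel (\<lambda>x. norm (f x) powr p)"
    and e: "\<And>n. 0 < e n" "e \<longlonglongrightarrow> 0"
  shows "Lp_tendsto p lborel (\<lambda>n. mollify (e n) f) f"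
proof -
  have [measurable]: "f \<in> borel_measurable borel" using f by auto
  define F where "F k x = (if norm (f x) \<le> real k then f x else 0)" for k :: nat and x
  have [measurable]: "F k \<in> borel_measurable borel" for k unfolding F_def by measurable
  have iF: "integrable lborel (F k)" for k
    by (rule Bochner_Integration.integrable_bound[OF f]) (auto simp: F_def)
  have Fb: "norm (F k x) \<le> real k" for k x by (auto simp: F_def)
  note [measurable] = mollify_measurable[OF e(1)]
  show ?thesis
    unfolding Lp_tendsto_def ennreal_tendsto_0_iff
  proof (intro allI impI)
    fix \<eta> :: real assume \<eta>: "0 < \<eta>"
    define c where "c = 2 powr p"
    have c: "1 \<le> c" using p by (simp add: c_def ge_one_powr_ge_zero)
    define \<eta>' where "\<eta>' = \<eta> / (c * (1 + c * 2))"
    have \<eta>': "0 < \<eta>'" using \<eta> c by (simp add: \<eta>'_def add_pos_pos)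
    have "\<forall>\<^sub>F k in sequentially. (\<integral>\<^sup>+x. norm (f x - F k x) powr p \<partial>lborel) \<le> ennreal \<eta>'"
      using Lp_truncation_tendsto[OF p fp] \<eta>' by (simp add: F_def ennreal_tendsto_0_iff)
    then obtain k where k: "(\<integral>\<^sup>+x. norm (f x - F k x) powr p \<partial>lborel) \<le> ennreal \<eta>'"
      using eventually_happens'[OF sequentially_bot] by blast
    define B where "B = (2 * real k) powr (p - 1)"
    have B: "0 \<le> B" by (simp add: B_def)
    obtain d where d: "d > 0" "\<And>e. 0 < e \<Longrightarrow> e < d \<Longrightarrow>
        (\<integral>\<^sup>+x. norm (mollify e (F k) x - F k x) \<partial>lborel) \<le> ennreal (\<eta>' / (B + 1))"
      using mollify_L1_tendsto[OF iF, of "\<eta>' / (B + 1)" k] \<eta>' B by auto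
    have "\<forall>\<^sub>F n in sequentially. e n < d" using e(2) d(1) by (rule order_tendstoD)
    then show "\<forall>\<^sub>F n in sequentially. (\<integral>\<^sup>+x. norm (mollify (e n) f x - f x) powr p \<partial>lborel) \<le> ennreal \<eta>"
    proof eventually_elim
      case (elim n)
      define a where "a x = mollify (e n) (\<lambda>x. f x - F k x) x" for x
      define b where "b x = mollify (e n) (F k) x - F k x" for x
      define h where "h x = F k x - f x" for x
      have [measurable]: "a \<in> borel_measurable borel" "b \<in> borel_measurable borel" "h \<in> borel_measurable borel"
        unfolding a_def b_def h_def by measurable
      have eq: "mollify (e n) f x - f x = a x + (b x + h x)" for x
        unfolding a_def b_def h_def using mollify_diff[OF e(1) f iF] by simp
      have A: "(\<integral>\<^sup>+x. norm (a x) powr p \<partial>lborel) \<le> ennreal \<eta>'"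
      proof -
        have i1: "integrable lborel (\<lambda>x. f x - F k x)" using f iF by auto
        have "integrable lborel (\<lambda>x. norm (f x - F k x) powr p)"
          by (rule Bochner_Integration.integrable_bound[OF fp]) (use p in \<open>auto simp: F_def\<close>)
        from nn_integral_mollify_powr_le[OF e(1) p i1 this, of n] k
        show ?thesis unfolding a_def by (rule order_trans)
      qed
      have Bb: "(\<integral>\<^sup>+x. norm (b x) powr p \<partial>lborel) \<le> ennreal \<eta>'"
      proof -
        have bk: "norm (b x) \<le> 2 * real k" for x
        proof -
          have "norm (mollify (e n) (F k) x - 0) \<le> real k"
            by (rule mollify_in_ball[OF e(1) iF]) (use Fb in auto)
          then show ?thesis using norm_triangle_ineq4[of "mollify (e n) (F k) x" "F k x"] Fb[of k x]
            by (simp add: b_def)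
        qed
        have "norm (b x) powr p \<le> B * norm (b x)" for x
        proof -
          have "norm (b x) powr p = norm (b x) powr (p - 1) * norm (b x)"
            using p by (cases "b x = 0") (auto simp: powr_diff)
          also have "\<dots> \<le> B * norm (b x)" unfolding B_def
            using p bk by (intro mult_right_mono powr_mono2) auto
          finally show ?thesis .
        qed
        then have "(\<integral>\<^sup>+x. norm (b x) powr p \<partial>lborel) \<le> (\<integral>\<^sup>+x. ennreal B * ennreal (norm (b x)) \<partial>lborel)"
          using B by (intro nn_integral_mono) (simp add: ennreal_mult[symmetric] ennreal_leI)
        also have "\<dots> = ennreal B * (\<integral>\<^sup>+x. norm (b x) \<partial>lborel)" by (rule nn_integral_cmult) auto
        also have "\<dots> \<le> ennreal B * ennreal (\<eta>' / (B + 1))"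
          using d(2)[OF e(1) elim] unfolding b_def by (intro mult_left_mono) auto
        also have "\<dots> \<le> ennreal \<eta>'"
          using \<eta>' B mult_divide_add_one_le[of B "\<eta>'"] by (simp add: ennreal_mult[symmetric] ennreal_leI)
        finally show ?thesis .
      qed
      have C: "(\<integral>\<^sup>+x. norm (h x) powr p \<partial>lborel) \<le> ennreal \<eta>'"
        using k by (simp add: h_def norm_minus_commute)
      have p0: "0 \<le> p" using p by simp
      have "(\<integral>\<^sup>+x. norm (mollify (e n) f x - f x) powr p \<partial>lborel) \<le>
         ennreal c * ((\<integral>\<^sup>+x. norm (a x) powr p \<partial>lborel) + (\<integral>\<^sup>+x. norm (b x + h x) powr p \<partial>lborel))"
        unfolding eq c_def by (rule nn_integral_powr_add_le[OF p0]) auto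
      also have "\<dots> \<le> ennreal c * (ennreal \<eta>' + ennreal c * ((\<integral>\<^sup>+x. norm (b x) powr p \<partial>lborel) + (\<integral>\<^sup>+x. norm (h x) powr p \<partial>lborel)))"
        unfolding c_def using A by (intro mult_left_mono add_mono nn_integral_powr_add_le[OF p0]) auto
      also have "\<dots> \<le> ennreal c * (ennreal \<eta>' + ennreal c * (ennreal \<eta>' + ennreal \<eta>'))"
        using Bb C by (intro mult_left_mono add_mono) auto
      also have "\<dots> = ennreal (c * (\<eta>' + c * (\<eta>' + \<eta>')))"
        using c \<eta>' by (simp add: ennreal_mult[symmetric] ennreal_plus[symmetric] del: ennreal_plus)
      also have "c * (\<eta>' + c * (\<eta>' + \<eta>')) = \<eta>' * (c * (1 + c * 2))" by (simp add: algebra_simps)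
      also have "\<dots> = \<eta>" using c by (simp add: \<eta>'_def add_pos_pos)
      finally show ?case .
    qed
  qed
qed

section \<open>Local Sobolev functions as limits of continuously differentiable ones\<close>

definition Lp :: "real \<Rightarrow> 'c measure \<Rightarrow> ('c \<Rightarrow> 'b::euclidean_space) \<Rightarrow> bool" where
  "Lp p M f \<longleftrightarrow> f \<in> borel_measurable M \<and> integrable M (\<lambda>x. norm (f x) powr p)"

abbreviation lborel_on :: "'a::euclidean_space set \<Rightarrow> 'a measure" where
  "lborel_on S \<equiv> restrict_space lborel S"

text \<open>Sobolev functions on \<open>S\<close> described by approximation: chain rule, product rule and translation estimates
  pass to the limit from continuously differentiable functions. The approximants live on the whole space;
  only their convergence is restricted to \<open>S\<close>. Almost everywhere convergence is included for the chain rule,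
  where \<open>\<Phi>' (fs n x)\<close> has to converge.\<close>

definition sob :: "real \<Rightarrow> 'a::euclidean_space set \<Rightarrow> ('a \<Rightarrow> real) \<Rightarrow> ('a \<Rightarrow> 'a) \<Rightarrow> bool" where
  "sob p S f F \<longleftrightarrow> f \<in> borel_measurable borel \<and> F \<in> borel_measurable borel \<and>
     Lp p (lborel_on S) f \<and> Lp p (lborel_on S) F \<and>
     (\<exists>fs gs. (\<forall>n. C1 (fs n) (gs n)) \<and>
        Lp_tendsto p (lborel_on S) fs f \<and> Lp_tendsto p (lborel_on S) gs F \<and>
        (AE x in lborel_on S. (\<lambda>n. fs n x) \<longlonglongrightarrow> f x))"

lemma borel_measurable_lborel_on:
  assumes "f \<in> borel_measurable borel" shows "f \<in> borel_measurable (lborel_on S)"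
proof -
  have "f \<in> borel_measurable lborel" using assms unfolding measurable_lborel2 .
  then show ?thesis by (rule measurable_restrict_space1)
qed

lemma Lp_measurable: "Lp p M f \<Longrightarrow> f \<in> borel_measurable M"
  unfolding Lp_def by blast

lemma Lp_integrable: "Lp p M f \<Longrightarrow> integrable M (\<lambda>x. norm (f x) powr p)"
  by (simp add: Lp_def)

lemma Lp_iff_nn_integral:
  "f \<in> borel_measurable M \<Longrightarrow> Lp p M f \<longleftrightarrow> (\<integral>\<^sup>+x. norm (f x) powr p \<partial>M) < \<infinity>"
  by (simp add: Lp_def integrable_iff_bounded)

lemma Lp_add:
  assumes "0 \<le> p" "Lp p M f" "Lp p M g" shows "Lp p M (\<lambda>x. f x + g x)"
proof -
  have [measurable]: "f \<in> borel_measurable M" "g \<in> borel_measurable M"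
    using assms Lp_measurable by blast+
  have "integrable M (\<lambda>x. norm (f x + g x) powr p)"
  proof (rule Bochner_Integration.integrable_bound)
    show "integrable M (\<lambda>x. 2 powr p * (norm (f x) powr p + norm (g x) powr p))"
      using assms by (intro integrable_mult_right Bochner_Integration.integrable_add Lp_integrable)
    show "AE x in M. norm (norm (f x + g x) powr p) \<le> norm (2 powr p * (norm (f x) powr p + norm (g x) powr p))"
      using norm_powr_add_le[OF assms(1)] by (intro AE_I2) simp
  qed measurable
  then show ?thesis unfolding Lp_def by simp
qed

lemma Lp_bound:
  assumes "0 \<le> p" "Lp p M f" "g \<in> borel_measurable M" "\<And>x. x \<in> space M \<Longrightarrow> norm (g x) \<le> B * norm (f x)"
  shows "Lp p M g"
proof -
  have [measurable]: "f \<in> borel_measurable M" "g \<in> borel_measurable M"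
    using assms Lp_measurable by blast+
  have "integrable M (\<lambda>x. norm (g x) powr p)"
  proof (rule Bochner_Integration.integrable_bound[of _ "\<lambda>x. \<bar>B\<bar> powr p * norm (f x) powr p"])
    show "AE x in M. norm (norm (g x) powr p) \<le> norm (\<bar>B\<bar> powr p * norm (f x) powr p)"
    proof (rule AE_I2)
      fix x assume x: "x \<in> space M"
      have "norm (g x) \<le> \<bar>B\<bar> * norm (f x)"
        using assms(4)[OF x] mult_right_mono[OF abs_ge_self[of B] norm_ge_zero[of "f x"]] by linarith
      then have "norm (g x) powr p \<le> (\<bar>B\<bar> * norm (f x)) powr p"
        using assms by (intro powr_mono2) auto
      then show "norm (norm (g x) powr p) \<le> norm (\<bar>B\<bar> powr p * norm (f x) powr p)"
        by (simp add: powr_mult)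
    qed
    show "integrable M (\<lambda>x. \<bar>B\<bar> powr p * norm (f x) powr p)"
      using assms(2) by (intro integrable_mult_right Lp_integrable)
  qed measurable
  then show ?thesis unfolding Lp_def using assms(3) by blast
qed

lemma Lp_const: "emeasure M (space M) < \<infinity> \<Longrightarrow> Lp p M (\<lambda>_. c)"
  by (simp add: Lp_def integrable_iff_bounded ennreal_mult_less_top)

lemma Lp_tendsto_subseq: "Lp_tendsto p M fs f \<Longrightarrow> strict_mono r \<Longrightarrow> Lp_tendsto p M (\<lambda>n. fs (r n)) f"
  unfolding Lp_tendsto_def
  using LIMSEQ_subseq_LIMSEQ[of "\<lambda>n. \<integral>\<^sup>+x. norm (fs n x - f x) powr p \<partial>M" 0 r] by (simp add: o_def)

text \<open>The \<open>p\<close>-th powers of the errors tend to zero in \<open>L\<^sup>1\<close>, and a subsequence of them does so almost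
  everywhere.\<close>

lemma Lp_tendsto_AE_subseq:
  fixes fs :: "nat \<Rightarrow> 'c \<Rightarrow> 'b::euclidean_space"
  assumes p: "0 < p" and t: "Lp_tendsto p M fs f"
    and [measurable]: "\<And>n. fs n \<in> borel_measurable M" "f \<in> borel_measurable M"
  shows "\<exists>r. strict_mono r \<and> (AE x in M. (\<lambda>n. fs (r n) x) \<longlonglongrightarrow> f x)"
proof -
  have "\<forall>\<^sub>F n in sequentially. (\<integral>\<^sup>+x. norm (fs n x - f x) powr p \<partial>M) \<le> ennreal 1"
    using t zero_less_one unfolding Lp_tendsto_def ennreal_tendsto_0_iff by (elim allE impE)
  then obtain N where N: "\<And>n. N \<le> n \<Longrightarrow> (\<integral>\<^sup>+x. norm (fs n x - f x) powr p \<partial>M) \<le> ennreal 1"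
    unfolding eventually_sequentially by blast
  define g where "g n x = norm (fs (n + N) x - f x) powr p" for n x
  have [measurable]: "g n \<in> borel_measurable M" for n unfolding g_def by measurable
  have ig: "integrable M (g n)" for n
  proof -
    have "(\<integral>\<^sup>+x. norm (g n x) \<partial>M) < \<infinity>"
      using N[of "n + N"] by (auto simp: g_def intro: le_less_trans)
    then show ?thesis unfolding integrable_iff_bounded by (simp add: g_def)
  qed
  have "(\<lambda>n. ennreal (LINT x|M. g n x)) \<longlonglongrightarrow> 0"
  proof -
    have "(\<lambda>n. \<integral>\<^sup>+x. norm (fs (n + N) x - f x) powr p \<partial>M) \<longlonglongrightarrow> 0"
      using t unfolding Lp_tendsto_def by (rule LIMSEQ_ignore_initial_segment)
    moreover have "(\<integral>\<^sup>+x. norm (fs (n + N) x - f x) powr p \<partial>M) = ennreal (LINT x|M. g n x)" for n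
      by (subst nn_integral_eq_integral[OF ig, symmetric]) (auto simp: g_def)
    ultimately show ?thesis by simp
  qed
  moreover have "0 \<le> (LINT x|M. g n x)" for n by (simp add: g_def)
  ultimately have "(\<lambda>n. LINT x|M. g n x) \<longlonglongrightarrow> 0"
    using tendsto_ennreal_iff[of "\<lambda>n. LINT x|M. g n x" sequentially 0] by simp
  moreover have "norm (g n x) = g n x" for n x by (simp add: g_def)
  ultimately have "(\<lambda>n. LINT x|M. norm (g n x)) \<longlonglongrightarrow> 0" by simp
  from tendsto_L1_AE_subseq[OF ig this] obtain r where r: "strict_mono r" "AE x in M. (\<lambda>n. g (r n) x) \<longlonglongrightarrow> 0"
    by blast
  show ?thesis
  proof (intro exI[of _ "\<lambda>n. r n + N"] conjI)
    show "strict_mono (\<lambda>n. r n + N)" using r(1) by (simp add: strict_mono_def)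
    show "AE x in M. (\<lambda>n. fs (r n + N) x) \<longlonglongrightarrow> f x"
      using r(2)
    proof eventually_elim
      case (elim x)
      have "(\<lambda>n. g (r n) x powr (1 / p)) \<longlonglongrightarrow> 0"
        by (rule tendsto_zero_powrI[OF elim tendsto_const]) (use p in \<open>auto simp: g_def\<close>)
      then have "(\<lambda>n. norm (fs (r n + N) x - f x)) \<longlonglongrightarrow> 0"
        using p by (simp add: g_def powr_powr)
      then show ?case by (rule LIM_zero_cancel[OF tendsto_norm_zero_cancel])
    qed
  qed
qed

lemma sobI:
  assumes p: "0 < p" and [measurable]: "f \<in> borel_measurable borel" "F \<in> borel_measurable borel"
    and "Lp p (lborel_on S) f" "Lp p (lborel_on S) F"
    and c: "\<And>n. C1 (fs n) (gs n)" and t: "Lp_tendsto p (lborel_on S) fs f" "Lp_tendsto p (lborel_on S) gs F"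
  shows "sob p S f F"
proof -
  have "\<exists>r. strict_mono r \<and> (AE x in lborel_on S. (\<lambda>n. fs (r n) x) \<longlonglongrightarrow> f x)"
    by (rule Lp_tendsto_AE_subseq[OF p t(1)])
      (use C1_continuous[OF c] in \<open>auto intro: borel_measurable_lborel_on borel_measurable_continuous_onI assms\<close>)
  then obtain r where r: "strict_mono r" "AE x in lborel_on S. (\<lambda>n. fs (r n) x) \<longlonglongrightarrow> f x" by blast
  show ?thesis unfolding sob_def
    by (intro conjI assms exI[of _ "\<lambda>n. fs (r n)"] exI[of _ "\<lambda>n. gs (r n)"] allI c
        Lp_tendsto_subseq[OF _ r(1)] t r(2))
qed

lemma Lp_tendsto_mono_const:
  assumes p: "0 \<le> p" and t: "Lp_tendsto p M fs f"
    and [measurable]: "\<And>n. fs n \<in> borel_measurable M" "f \<in> borel_measurable M"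
    and b: "\<And>n x. x \<in> space M \<Longrightarrow> norm (gs n x - g x) \<le> B * norm (fs n x - f x)" and B: "0 \<le> B"
  shows "Lp_tendsto p M gs g"
  unfolding Lp_tendsto_def
proof (rule tendsto_sandwich[OF _ _ tendsto_const])
  show "\<forall>\<^sub>F n in sequentially. (\<integral>\<^sup>+x. norm (gs n x - g x) powr p \<partial>M) \<le>
     ennreal (B powr p) * (\<integral>\<^sup>+x. norm (fs n x - f x) powr p \<partial>M)"
  proof (intro always_eventually allI)
    fix n
    have "(\<integral>\<^sup>+x. norm (gs n x - g x) powr p \<partial>M) \<le> (\<integral>\<^sup>+x. ennreal (B powr p) * ennreal (norm (fs n x - f x) powr p) \<partial>M)"
    proof (rule nn_integral_mono)
      fix x assume x: "x \<in> space M"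
      have "norm (gs n x - g x) powr p \<le> (B * norm (fs n x - f x)) powr p"
        using b[OF x] p by (intro powr_mono2) auto
      then show "ennreal (norm (gs n x - g x) powr p) \<le> ennreal (B powr p) * ennreal (norm (fs n x - f x) powr p)"
        using B by (simp add: powr_mult ennreal_mult[symmetric] ennreal_leI)
    qed
    then show "(\<integral>\<^sup>+x. norm (gs n x - g x) powr p \<partial>M) \<le>
     ennreal (B powr p) * (\<integral>\<^sup>+x. norm (fs n x - f x) powr p \<partial>M)" by (simp add: nn_integral_cmult)
  qed
  have "(\<lambda>n. ennreal (B powr p) * (\<integral>\<^sup>+x. norm (fs n x - f x) powr p \<partial>M)) \<longlonglongrightarrow> ennreal (B powr p) * 0"
    using t unfolding Lp_tendsto_def by (intro ennreal_tendsto_cmult) auto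
  then show "(\<lambda>n. ennreal (B powr p) * (\<integral>\<^sup>+x. norm (fs n x - f x) powr p \<partial>M)) \<longlonglongrightarrow> 0" by simp
qed auto

lemma C1_measurable:
  assumes "C1 f g" shows "f \<in> borel_measurable borel" "g \<in> borel_measurable borel"
  using C1_continuous[OF assms] C1_continuous_grad[OF assms] borel_measurable_continuous_onI by auto

lemma C1_compose:
  assumes "C1 f g" "\<And>s. DERIV \<Phi> s :> \<Phi>' s" "continuous_on UNIV \<Phi>'"
  shows "C1 (\<lambda>x. \<Phi> (f x)) (\<lambda>x. \<Phi>' (f x) *\<^sub>R g x)"
  unfolding C1_def
proof (intro conjI allI)
  show "GDERIV (\<lambda>x. \<Phi> (f x)) x :> \<Phi>' (f x) *\<^sub>R g x" for x
    by (rule GDERIV_DERIV_compose[OF C1_GDERIV[OF assms(1)] assms(2)])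
  show "continuous_on UNIV (\<lambda>x. \<Phi>' (f x) *\<^sub>R g x)"
    by (intro continuous_on_scaleR continuous_on_compose2[OF assms(3)] C1_continuous[OF assms(1)]
        C1_continuous_grad[OF assms(1)]) simp
qed

lemma C1_mult:
  assumes "C1 f g" "C1 f' g'"
  shows "C1 (\<lambda>x. f x * f' x) (\<lambda>x. f x *\<^sub>R g' x + f' x *\<^sub>R g x)"
  unfolding C1_def
  by (intro conjI allI GDERIV_mult continuous_on_add continuous_on_scaleR assms[THEN C1_GDERIV]
      assms[THEN C1_continuous] assms[THEN C1_continuous_grad])

text \<open>The gradients \<open>\<Phi>'(f\<^sub>n) g\<^sub>n\<close> converge because \<open>\<Phi>'(f\<^sub>n) (g\<^sub>n - F)\<close> is bounded by a multiple of \<open>g\<^sub>n - F\<close>, and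
  \<open>(\<Phi>'(f\<^sub>n) - \<Phi>'(f)) F\<close> tends to zero by dominated convergence.\<close>

lemma sob_compose:
  assumes p: "1 \<le> p" and s: "sob p S f F" and S: "S \<in> sets borel" "emeasure lborel S < \<infinity>"
    and \<Phi>: "\<And>s. DERIV \<Phi> s :> \<Phi>' s" "continuous_on UNIV \<Phi>'" and B: "\<And>s. \<bar>\<Phi>' s\<bar> \<le> B"
  shows "sob p S (\<lambda>x. \<Phi> (f x)) (\<lambda>x. \<Phi>' (f x) *\<^sub>R F x)"
proof -
  let ?M = "lborel_on S"
  obtain fs gs where fs: "\<And>n. C1 (fs n) (gs n)" "Lp_tendsto p ?M fs f" "Lp_tendsto p ?M gs F"
    "AE x in ?M. (\<lambda>n. fs n x) \<longlonglongrightarrow> f x"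
    using s unfolding sob_def by blast
  have [measurable]: "f \<in> borel_measurable borel" "F \<in> borel_measurable borel"
    and L: "Lp p ?M f" "Lp p ?M F"
    using s by (auto simp: sob_def)
  have [measurable]: "fs n \<in> borel_measurable borel" "gs n \<in> borel_measurable borel" for n
    using C1_measurable[OF fs(1)] by auto
  have \<Phi>c: "continuous_on UNIV \<Phi>"
    using \<Phi>(1) DERIV_isCont continuous_at_imp_continuous_on by blast
  have [measurable]: "\<Phi> \<in> borel_measurable borel" "\<Phi>' \<in> borel_measurable borel"
    using \<Phi>c \<Phi>(2) borel_measurable_continuous_onI by auto
  note mr = borel_measurable_lborel_on
  have B0: "0 \<le> B" using B[of 0] by linarith
  have lip: "\<bar>\<Phi> a - \<Phi> b\<bar> \<le> B * \<bar>a - b\<bar>" for a b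
    using field_differentiable_bound[of UNIV \<Phi> \<Phi>' B a b] \<Phi>(1) B by (auto simp: norm_minus_commute)
  show ?thesis
  proof (rule sobI)
    show "Lp p ?M (\<lambda>x. \<Phi> (f x))"
    proof -
      have "Lp p ?M (\<lambda>x. (\<Phi> (f x) - \<Phi> 0) + \<Phi> 0)"
      proof (rule Lp_add)
        show "Lp p ?M (\<lambda>x. \<Phi> (f x) - \<Phi> 0)"
          by (rule Lp_bound[OF _ L(1), of _ B]) (use p lip[of _ 0] in \<open>auto intro!: mr\<close>)
        show "Lp p ?M (\<lambda>x. \<Phi> 0)"
          using S by (intro Lp_const) (simp add: emeasure_restrict_space)
      qed (use p in auto)
      then show ?thesis by simp
    qed
    show "Lp p ?M (\<lambda>x. \<Phi>' (f x) *\<^sub>R F x)"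
      by (rule Lp_bound[OF _ L(2), of _ B]) (use p B in \<open>auto intro!: mr mult_right_mono\<close>)
    show "C1 (\<lambda>x. \<Phi> (fs n x)) (\<lambda>x. \<Phi>' (fs n x) *\<^sub>R gs n x)" for n
      by (rule C1_compose[OF fs(1) \<Phi>])
    show "Lp_tendsto p ?M (\<lambda>n x. \<Phi> (fs n x)) (\<lambda>x. \<Phi> (f x))"
      by (rule Lp_tendsto_mono_const[OF _ fs(2), of _ _ B]) (use p lip B0 in \<open>auto intro!: mr\<close>)
    show "Lp_tendsto p ?M (\<lambda>n x. \<Phi>' (fs n x) *\<^sub>R gs n x) (\<lambda>x. \<Phi>' (f x) *\<^sub>R F x)"
    proof -
      have 1: "Lp_tendsto p ?M (\<lambda>n x. \<Phi>' (fs n x) *\<^sub>R (gs n x - F x)) (\<lambda>x. 0)"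
        by (rule Lp_tendsto_mono_const[OF _ fs(3), of _ _ B])
          (use p B B0 in \<open>auto intro!: mr mult_right_mono\<close>)
      have 2: "Lp_tendsto p ?M (\<lambda>n x. \<Phi>' (fs n x) *\<^sub>R F x) (\<lambda>x. \<Phi>' (f x) *\<^sub>R F x)"
      proof -
        have "(\<lambda>n. \<integral>\<^sup>+x. norm (\<Phi>' (fs n x) *\<^sub>R F x - \<Phi>' (f x) *\<^sub>R F x) powr p \<partial>?M) \<longlonglongrightarrow> (\<integral>\<^sup>+x. 0 \<partial>?M)"
        proof (rule nn_integral_dominated_convergence[where w="\<lambda>x. ennreal ((2 * B) powr p * norm (F x) powr p)"])
          have "integrable ?M (\<lambda>x. (2 * B) powr p * norm (F x) powr p)"
            by (intro integrable_mult_right Lp_integrable[OF L(2)])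
          then show "(\<integral>\<^sup>+x. ennreal ((2 * B) powr p * norm (F x) powr p) \<partial>?M) < \<infinity>"
            by (subst nn_integral_eq_integral) (auto intro!: AE_I2 mult_nonneg_nonneg)
          show "AE x in ?M. ennreal (norm (\<Phi>' (fs n x) *\<^sub>R F x - \<Phi>' (f x) *\<^sub>R F x) powr p) \<le> ennreal ((2 * B) powr p * norm (F x) powr p)" for n
          proof (intro AE_I2 ennreal_leI)
            fix x
            have "\<bar>\<Phi>' (fs n x) - \<Phi>' (f x)\<bar> \<le> 2 * B" using B[of "fs n x"] B[of "f x"] by linarith
            then have "norm (\<Phi>' (fs n x) *\<^sub>R F x - \<Phi>' (f x) *\<^sub>R F x) \<le> 2 * B * norm (F x)"
              by (simp add: scaleR_diff_left[symmetric] mult_right_mono)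
            then have "norm (\<Phi>' (fs n x) *\<^sub>R F x - \<Phi>' (f x) *\<^sub>R F x) powr p \<le> (2 * B * norm (F x)) powr p"
              using p by (intro powr_mono2) auto
            then show "norm (\<Phi>' (fs n x) *\<^sub>R F x - \<Phi>' (f x) *\<^sub>R F x) powr p \<le> (2 * B) powr p * norm (F x) powr p"
              using B0 by (simp add: powr_mult)
          qed
          show "AE x in ?M. (\<lambda>n. ennreal (norm (\<Phi>' (fs n x) *\<^sub>R F x - \<Phi>' (f x) *\<^sub>R F x) powr p)) \<longlonglongrightarrow> 0"
            using fs(4)
          proof eventually_elim
            case (elim x)
            have "(\<lambda>n. \<Phi>' (fs n x)) \<longlonglongrightarrow> \<Phi>' (f x)"
              using \<Phi>(2) elim by (auto simp: continuous_on_eq_continuous_at intro: isCont_tendsto_compose)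
            then have "(\<lambda>n. norm (\<Phi>' (fs n x) *\<^sub>R F x - \<Phi>' (f x) *\<^sub>R F x)) \<longlonglongrightarrow> 0"
              by (auto intro!: tendsto_eq_intros)
            then have "(\<lambda>n. norm (\<Phi>' (fs n x) *\<^sub>R F x - \<Phi>' (f x) *\<^sub>R F x) powr p) \<longlonglongrightarrow> 0"
              by (rule tendsto_zero_powrI[OF _ tendsto_const]) (use p in auto)
            then show ?case using tendsto_ennrealI ennreal_0 by metis
          qed
        qed (rule mr; measurable)+
        then show ?thesis by (simp add: Lp_tendsto_def)
      qed
      have "Lp_tendsto p ?M (\<lambda>n x. \<Phi>' (fs n x) *\<^sub>R (gs n x - F x) + \<Phi>' (fs n x) *\<^sub>R F x) (\<lambda>x. 0 + \<Phi>' (f x) *\<^sub>R F x)"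
        by (rule Lp_tendsto_add[OF _ 1 2]) (use p in \<open>auto intro!: mr\<close>)
      then show ?thesis by (simp add: scaleR_diff_right)
    qed
  qed (use p in auto)
qed

lemma Lp_on_UNIV:
  fixes f :: "'a::euclidean_space \<Rightarrow> 'b::euclidean_space"
  assumes S: "S \<in> sets borel" and f: "f \<in> borel_measurable borel" "\<And>x. x \<notin> S \<Longrightarrow> f x = 0"
  shows "(\<integral>\<^sup>+x. norm (f x) powr p \<partial>lborel) = (\<integral>\<^sup>+x. norm (f x) powr p \<partial>lborel_on S)"
  using assms by (subst nn_integral_restrict_space) (auto intro!: nn_integral_cong simp: indicator_def)

text \<open>A cutoff function that vanishes outside \<open>S\<close> turns a Sobolev function on \<open>S\<close> into one on the whole space.\<close>

lemma sob_mult: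
  fixes f :: "'a::euclidean_space \<Rightarrow> real"
  assumes p: "1 \<le> p" and s: "sob p S f F" and S: "S \<in> sets borel"
    and \<zeta>: "C1 \<zeta> Z" "\<And>x. x \<notin> S \<Longrightarrow> \<zeta> x = 0" "\<And>x. x \<notin> S \<Longrightarrow> Z x = 0"
    and B: "\<And>x. \<bar>\<zeta> x\<bar> \<le> B" "\<And>x. norm (Z x) \<le> B"
  shows "sob p UNIV (\<lambda>x. \<zeta> x * f x) (\<lambda>x. \<zeta> x *\<^sub>R F x + f x *\<^sub>R Z x)"
proof -
  let ?M = "lborel_on S"
  obtain fs gs where fs: "\<And>n. C1 (fs n) (gs n)" "Lp_tendsto p ?M fs f" "Lp_tendsto p ?M gs F"
    using s unfolding sob_def by blast
  have [measurable]: "f \<in> borel_measurable borel" "F \<in> borel_measurable borel"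
    and L: "Lp p ?M f" "Lp p ?M F"
    using s by (auto simp: sob_def)
  have [measurable]: "fs n \<in> borel_measurable borel" "gs n \<in> borel_measurable borel" for n
    using C1_measurable[OF fs(1)] by auto
  have [measurable]: "\<zeta> \<in> borel_measurable borel" "Z \<in> borel_measurable borel"
    using C1_measurable[OF \<zeta>(1)] by auto
  note mr = borel_measurable_lborel_on
  have U: "lborel_on UNIV = (lborel :: 'a measure)" by (rule measure_eqI) (auto simp: sets_restrict_space emeasure_restrict_space)
  have B0: "0 \<le> B" using B(1)[of undefined] by linarith
  have p0: "0 \<le> p" using p by simp
  show ?thesis
  proof (rule sobI)
    show "C1 (\<lambda>x. \<zeta> x * fs n x) (\<lambda>x. \<zeta> x *\<^sub>R gs n x + fs n x *\<^sub>R Z x)" for n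
      by (rule C1_mult[OF \<zeta>(1) fs(1)])
    have "Lp p ?M (\<lambda>x. \<zeta> x * f x)"
      by (rule Lp_bound[OF p0 L(1), of _ B]) (use B in \<open>auto intro!: mr mult_right_mono simp: abs_mult\<close>)
    then show "Lp p (lborel_on UNIV) (\<lambda>x. \<zeta> x * f x)"
      unfolding U using Lp_on_UNIV[OF S, of "\<lambda>x. \<zeta> x * f x" p] \<zeta>(2)
      by (simp add: Lp_iff_nn_integral mr)
    have "Lp p ?M (\<lambda>x. \<zeta> x *\<^sub>R F x + f x *\<^sub>R Z x)"
    proof (rule Lp_add[OF p0])
      show "Lp p ?M (\<lambda>x. \<zeta> x *\<^sub>R F x)"
        by (rule Lp_bound[OF p0 L(2), of _ B]) (use B in \<open>auto intro!: mr mult_right_mono\<close>)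
      show "Lp p ?M (\<lambda>x. f x *\<^sub>R Z x)"
        by (rule Lp_bound[OF p0 L(1), of _ B])
          (use B in \<open>auto intro!: mr mult_left_mono simp: mult.commute[of B]\<close>)
    qed
    then show "Lp p (lborel_on UNIV) (\<lambda>x. \<zeta> x *\<^sub>R F x + f x *\<^sub>R Z x)"
      unfolding U using Lp_on_UNIV[OF S, of "\<lambda>x. \<zeta> x *\<^sub>R F x + f x *\<^sub>R Z x" p] \<zeta>(2,3)
      by (simp add: Lp_iff_nn_integral mr)
    have "Lp_tendsto p ?M (\<lambda>n x. \<zeta> x * fs n x) (\<lambda>x. \<zeta> x * f x)"
      by (rule Lp_tendsto_mono_const[OF p0 fs(2), of _ _ B])
        (use B B0 in \<open>auto intro!: mr mult_right_mono simp: abs_mult right_diff_distrib[symmetric]\<close>)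
    then show "Lp_tendsto p (lborel_on UNIV) (\<lambda>n x. \<zeta> x * fs n x) (\<lambda>x. \<zeta> x * f x)"
      unfolding U Lp_tendsto_def using \<zeta>(2)
      by (subst Lp_on_UNIV[OF S]) auto
    have 1: "Lp_tendsto p ?M (\<lambda>n x. \<zeta> x *\<^sub>R gs n x) (\<lambda>x. \<zeta> x *\<^sub>R F x)"
      by (rule Lp_tendsto_mono_const[OF p0 fs(3), of _ _ B])
        (use B B0 in \<open>auto intro!: mr mult_right_mono simp: scaleR_diff_right[symmetric]\<close>)
    have 2: "Lp_tendsto p ?M (\<lambda>n x. fs n x *\<^sub>R Z x) (\<lambda>x. f x *\<^sub>R Z x)"
      by (rule Lp_tendsto_mono_const[OF p0 fs(2), of _ _ B])
        (use B B0 in \<open>auto intro!: mr mult_left_mono simp: scaleR_diff_left[symmetric] mult.commute[of B]\<close>)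
    have "Lp_tendsto p ?M (\<lambda>n x. \<zeta> x *\<^sub>R gs n x + fs n x *\<^sub>R Z x) (\<lambda>x. \<zeta> x *\<^sub>R F x + f x *\<^sub>R Z x)"
      by (rule Lp_tendsto_add[OF p0 1 2]) (auto intro!: mr)
    then show "Lp_tendsto p (lborel_on UNIV) (\<lambda>n x. \<zeta> x *\<^sub>R gs n x + fs n x *\<^sub>R Z x) (\<lambda>x. \<zeta> x *\<^sub>R F x + f x *\<^sub>R Z x)"
      unfolding U Lp_tendsto_def using \<zeta>(2,3)
      by (subst Lp_on_UNIV[OF S]) auto
  qed (use p in auto)
qed

text \<open>Borel functions on the whole space make translations and convolutions measurable; their values outside
  \<open>\<Omega>\<close> are irrelevant because test functions vanish there.\<close>

definition weak_grad :: "'a::euclidean_space set \<Rightarrow> ('a \<Rightarrow> real) \<Rightarrow> ('a \<Rightarrow> 'a) \<Rightarrow> bool" where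
  "weak_grad \<Omega> u G \<longleftrightarrow> u \<in> borel_measurable borel \<and> G \<in> borel_measurable borel \<and>
     (\<forall>\<phi>. test_function \<Omega> \<phi> \<longrightarrow>
        (LINT x|lborel. u x *\<^sub>R grad \<phi> x) = - (LINT x|lborel. \<phi> x *\<^sub>R G x))"

lemma compact_cball_nbhd:
  fixes K :: "'a::euclidean_space set"
  assumes "compact K" "K \<subseteq> \<Omega>" "open \<Omega>"
  obtains r L where "0 < r" "compact L" "L \<subseteq> \<Omega>" "K \<subseteq> L" "\<And>x. x \<in> K \<Longrightarrow> cball x r \<subseteq> L"
proof -
  obtain r where r: "0 < r" "(\<Union>x\<in>K. cball x r) \<subseteq> \<Omega>"
    using compact_subset_open_imp_cball_epsilon_subset[OF assms(1,3,2)] by blast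
  define L where "L = {x + y | x y. x \<in> K \<and> y \<in> cball 0 r}"
  have "compact L" unfolding L_def by (rule compact_sums[OF assms(1)]) simp
  moreover have LU: "L = (\<Union>x\<in>K. cball x r)"
  proof (intro set_eqI iffI)
    fix z assume "z \<in> L"
    then obtain x y where "z = x + y" "x \<in> K" "norm y \<le> r" by (auto simp: L_def)
    then show "z \<in> (\<Union>x\<in>K. cball x r)" by (intro UN_I[of x]) (auto simp: dist_norm)
  next
    fix z assume "z \<in> (\<Union>x\<in>K. cball x r)"
    then obtain x where "x \<in> K" "dist x z \<le> r" by auto
    then show "z \<in> L" unfolding L_def
      by (intro CollectI exI[of _ x] exI[of _ "z - x"]) (auto simp: dist_norm norm_minus_commute)
  qed
  moreover have "K \<subseteq> L" using r(1) unfolding LU by auto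
  ultimately show thesis using r by (intro that[of r L]) auto
qed

lemma test_function_mollifier:
  assumes e: "0 < e" and c: "cball x e \<subseteq> \<Omega>"
  shows "test_function \<Omega> (\<lambda>y. mollifier e (x - y))"
proof -
  have "smooth (\<lambda>y. mollifier e (x - y))"
    using smooth_affine[OF smooth_mollifier[OF e], of 1 x "-1"] by simp
  moreover have "{y. mollifier e (x - y) \<noteq> 0} \<subseteq> cball x e"
  proof
    fix y assume "y \<in> {y. mollifier e (x - y) \<noteq> 0}"
    then show "y \<in> cball x e"
      using mollifier_eq_0[OF e, of "x - y"] by (cases "e \<le> norm (x - y)") (auto simp: dist_norm)
  qed
  then have cl: "closure {y. mollifier e (x - y) \<noteq> 0} \<subseteq> cball x e"
    by (intro closure_minimal) auto
  moreover have "compact (closure {y. mollifier e (x - y) \<noteq> 0})"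
    using cl compact_cball compact_closure bounded_subset by (metis bounded_cball bounded_closure compact_eq_bounded_closed closed_closure)
  ultimately show ?thesis using c unfolding test_function_def by blast
qed

lemma grad_mollifier_shift:
  fixes x :: "'a::euclidean_space"
  assumes e: "0 < e"
  shows "grad (\<lambda>y. mollifier e (x - y)) y = - grad (mollifier e) (x - y)"
proof (rule grad_eq)
  have "((\<lambda>y. mollifier e (x - y)) has_derivative (\<lambda>h. (- h) \<bullet> grad (mollifier e) (x - y))) (at y)"
    by (rule has_derivative_compose[OF _ C1_GDERIV[OF smooth_C1_grad[OF smooth_mollifier[OF e]], unfolded gderiv_def]])
      (auto intro!: derivative_eq_intros)
  then show "GDERIV (\<lambda>y. mollifier e (x - y)) y :> - grad (mollifier e) (x - y)"
    by (simp add: gderiv_def)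
qed

lemma grad_mollifier_eq_0:
  fixes x :: "'a::euclidean_space"
  assumes e: "0 < e" "e < norm x" shows "grad (mollifier e) x = 0"
  by (rule C1_zero_outside[OF smooth_C1_grad[OF smooth_mollifier[OF e(1)]], of "- cball 0 e"])
    (use e in \<open>auto intro!: mollifier_eq_0\<close>)

text \<open>On \<open>K\<close>, the gradient of a mollification of \<open>u\<close> is the mollification of \<open>G\<close>: the shifted mollifier is an
  admissible test function as long as its support stays in \<open>\<Omega>\<close>. Cutting \<open>u\<close> and \<open>G\<close> off outside a compact
  neighbourhood of \<open>K\<close> makes them integrable on the whole space without changing this near \<open>K\<close>.\<close>

lemma weak_grad_imp_sob:
  fixes u :: "'a::euclidean_space \<Rightarrow> real"
  assumes \<Omega>: "open \<Omega>" and wg: "weak_grad \<Omega> u G" and p: "1 \<le> p"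
    and L1: "\<And>K. compact K \<Longrightarrow> K \<subseteq> \<Omega> \<Longrightarrow> Lp 1 (lborel_on K) u \<and> Lp 1 (lborel_on K) G"
    and Lp: "\<And>K. compact K \<Longrightarrow> K \<subseteq> \<Omega> \<Longrightarrow> Lp p (lborel_on K) u \<and> Lp p (lborel_on K) G"
    and K: "compact K" "K \<subseteq> \<Omega>"
  shows "sob p K u G"
proof -
  obtain r L where r: "0 < r" "compact L" "L \<subseteq> \<Omega>" "K \<subseteq> L" "\<And>x. x \<in> K \<Longrightarrow> cball x r \<subseteq> L"
    using compact_cball_nbhd[OF K \<Omega>] by blast
  have [measurable]: "u \<in> borel_measurable borel" "G \<in> borel_measurable borel" using wg by (auto simp: weak_grad_def)
  have [measurable]: "L \<in> sets borel" "K \<in> sets borel" using r(2) K(1) by (auto simp: compact_imp_closed)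
  define v where "v y = indicator L y *\<^sub>R u y" for y
  define V where "V y = indicator L y *\<^sub>R G y" for y
  have [measurable]: "v \<in> borel_measurable borel" "V \<in> borel_measurable borel"
    unfolding v_def V_def by measurable
  have int_ind: "integrable lborel (\<lambda>x. norm (indicator L x *\<^sub>R g x) powr q)"
    if "Lp q (lborel_on L) g" "g \<in> borel_measurable borel" for q and g :: "'a \<Rightarrow> 'b::euclidean_space"
  proof -
    have [measurable]: "g \<in> borel_measurable borel" by fact
    have "(\<integral>\<^sup>+x. norm (indicator L x *\<^sub>R g x) powr q \<partial>lborel) = (\<integral>\<^sup>+x. norm (indicator L x *\<^sub>R g x) powr q \<partial>lborel_on L)"
      by (rule Lp_on_UNIV) (auto simp: indicator_def)
    also have "\<dots> = (\<integral>\<^sup>+x. norm (g x) powr q \<partial>lborel_on L)"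
      by (intro nn_integral_cong) (auto simp: space_restrict_space)
    also have "\<dots> < \<infinity>" using that(1) by (simp add: Lp_def integrable_iff_bounded)
    finally show ?thesis by (simp add: integrable_iff_bounded)
  qed
  have iv: "integrable lborel v" "integrable lborel V"
  proof -
    have "integrable lborel (\<lambda>x. norm (v x))" "integrable lborel (\<lambda>x. norm (V x))"
      using int_ind[of 1 u] int_ind[of 1 G] L1[OF r(2,3)] unfolding v_def V_def
      by (simp_all del: norm_scaleR real_scaleR_def)
    then show "integrable lborel v" "integrable lborel V"
      by (auto intro: integrable_norm_cancel)
  qed
  have ip: "integrable lborel (\<lambda>x. norm (v x) powr p)" "integrable lborel (\<lambda>x. norm (V x) powr p)"
    using int_ind[of p u] int_ind[of p G] Lp[OF r(2,3)] unfolding v_def V_def by auto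
  define e where "e n = r / real (n + 2)" for n
  have e: "0 < e n" "e n < r" for n using r(1) by (auto simp: e_def field_simps add_pos_nonneg)
  have e0: "e \<longlonglongrightarrow> 0"
    unfolding e_def using LIMSEQ_ignore_initial_segment[OF lim_const_over_n[of r], of 2] by simp
  define gs where "gs n x = (LINT y|lborel. v y *\<^sub>R grad (mollifier (e n)) (x - y))" for n x
  have C: "C1 (mollify (e n) v) (gs n)" for n
  proof -
    have "mollifier (e n) x = 0" if "norm x > e n" for x :: 'a
      by (rule mollifier_eq_0[OF e(1)]) (use that in simp)
    from convolution_C1[OF iv(1) smooth_C1_grad[OF smooth_mollifier[OF e(1)]] this]
    show ?thesis by (simp add: mollify_def[abs_def] gs_def[abs_def] mult.commute)
  qed
  have gs_eq: "gs n x = mollify (e n) V x" if x: "x \<in> K" for n x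
  proof -
    have c: "cball x (e n) \<subseteq> L" using r(5)[OF x] e(2)[of n] by (auto simp: subset_iff)
    have "(LINT y|lborel. u y *\<^sub>R grad (\<lambda>y. mollifier (e n) (x - y)) y) = - (LINT y|lborel. mollifier (e n) (x - y) *\<^sub>R G y)"
      using wg test_function_mollifier[OF e(1), of x n \<Omega>] c r(3) unfolding weak_grad_def by auto
    moreover have "u y *\<^sub>R grad (\<lambda>y. mollifier (e n) (x - y)) y = - (v y *\<^sub>R grad (mollifier (e n)) (x - y))" for y
    proof (cases "y \<in> L")
      case True
      then show ?thesis by (simp add: v_def grad_mollifier_shift[OF e(1)])
    next
      case False
      then have "e n < norm (x - y)" using c by (metis dist_norm mem_cball not_le subsetD)
      then show ?thesis by (simp add: grad_mollifier_shift[OF e(1)] grad_mollifier_eq_0[OF e(1)])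
    qed
    moreover have "mollifier (e n) (x - y) *\<^sub>R G y = mollifier (e n) (x - y) *\<^sub>R V y" for y
    proof (cases "y \<in> L")
      case False
      then have "e n < norm (x - y)" using c by (metis dist_norm mem_cball not_le subsetD)
      then show ?thesis by (simp add: mollifier_eq_0[OF e(1)])
    qed (simp add: V_def)
    ultimately show ?thesis by (simp add: gs_def mollify_def)
  qed
  have restr: "(\<integral>\<^sup>+x. h x \<partial>lborel_on K) \<le> (\<integral>\<^sup>+x. h x \<partial>lborel)" for h :: "'a \<Rightarrow> ennreal"
    by (auto simp: nn_integral_restrict_space intro!: nn_integral_mono split: split_indicator)
  show ?thesis
  proof (rule sobI[OF _ _ _ _ _ C])
    have vK: "v x = u x" "V x = G x" if "x \<in> K" for x using that r(4) by (auto simp: v_def V_def)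
    have "(\<lambda>n. \<integral>\<^sup>+x. norm (mollify (e n) v x - v x) powr p \<partial>lborel_on K) \<longlonglongrightarrow> 0"
      by (rule tendsto_sandwich[OF _ _ tendsto_const mollify_Lp_tendsto[OF p iv(1) ip(1) e(1) e0, unfolded Lp_tendsto_def]])
        (intro always_eventually allI restr zero_le)+
    moreover have "(\<integral>\<^sup>+x. norm (mollify (e n) v x - v x) powr p \<partial>lborel_on K) = (\<integral>\<^sup>+x. norm (mollify (e n) v x - u x) powr p \<partial>lborel_on K)" for n
      by (intro nn_integral_cong) (auto simp: space_restrict_space vK)
    ultimately show "Lp_tendsto p (lborel_on K) (\<lambda>n. mollify (e n) v) u"
      by (simp add: Lp_tendsto_def)
    have "(\<lambda>n. \<integral>\<^sup>+x. norm (mollify (e n) V x - V x) powr p \<partial>lborel_on K) \<longlonglongrightarrow> 0"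
      by (rule tendsto_sandwich[OF _ _ tendsto_const mollify_Lp_tendsto[OF p iv(2) ip(2) e(1) e0, unfolded Lp_tendsto_def]])
        (intro always_eventually allI restr zero_le)+
    moreover have "(\<integral>\<^sup>+x. norm (mollify (e n) V x - V x) powr p \<partial>lborel_on K) = (\<integral>\<^sup>+x. norm (gs n x - G x) powr p \<partial>lborel_on K)" for n
      by (intro nn_integral_cong) (auto simp: space_restrict_space vK gs_eq)
    ultimately show "Lp_tendsto p (lborel_on K) gs G"
      by (simp add: Lp_tendsto_def)
  qed (use p Lp[OF K] in auto)
qed

section \<open>Translation estimate and its consequences\<close>

text \<open>The increment is the integral of the directional derivative along the segment; Jensen's inequality
  moves the power inside.\<close>

lemma norm_increment_powr_le:
  fixes f :: "'a::euclidean_space \<Rightarrow> real"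
  assumes c: "C1 f g" and p: "1 \<le> p"
  shows "ennreal (\<bar>f (x + h) - f x\<bar> powr p)
    \<le> ennreal (norm h powr p) * (\<integral>\<^sup>+t. indicator {0..1} t * ennreal (norm (g (x + t *\<^sub>R h)) powr p) \<partial>lborel)"
proof -
  have gc: "continuous_on {0..1} (\<lambda>t::real. norm (g (x + t *\<^sub>R h)))"
    by (intro continuous_intros continuous_on_compose2[OF C1_continuous_grad[OF c]]) auto
  have gcp: "continuous_on {0..1} (\<lambda>t::real. norm (g (x + t *\<^sub>R h)) powr p)"
    using p by (intro continuous_on_powr' gc continuous_intros) auto
  have gh: "continuous_on {0..1} (\<lambda>t::real. h \<bullet> g (x + t *\<^sub>R h))"
    by (intro continuous_intros continuous_on_compose2[OF C1_continuous_grad[OF c]]) auto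
  have ii: "integrable lborel (\<lambda>t. indicator {0..1} t *\<^sub>R k t)" if "continuous_on {0..1} k" for k :: "real \<Rightarrow> real"
    by (rule borel_integrable_compact) (use that in auto)
  have "integral\<^sup>L lborel (\<lambda>t. indicator {0..1} t *\<^sub>R (h \<bullet> g (x + t *\<^sub>R h))) = f (x + 1 *\<^sub>R h) - f (x + 0 *\<^sub>R h)"
  proof (rule integral_FTC_atLeastAtMost)
    fix t :: real
    have "((\<lambda>t. f (x + t *\<^sub>R h)) has_derivative (\<lambda>s. (s *\<^sub>R h) \<bullet> g (x + t *\<^sub>R h))) (at t within {0..1})"
      by (rule has_derivative_compose[OF _ C1_GDERIV[OF c, unfolded gderiv_def]])
        (auto intro!: derivative_eq_intros)
    then show "((\<lambda>t. f (x + t *\<^sub>R h)) has_vector_derivative h \<bullet> g (x + t *\<^sub>R h)) (at t within {0..1})"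
      by (simp add: has_vector_derivative_def)
  qed (use gh in auto)
  then have "\<bar>f (x + h) - f x\<bar> = norm (LINT t|lborel. indicator {0..1} t *\<^sub>R (h \<bullet> g (x + t *\<^sub>R h)))" by simp
  also have "\<dots> \<le> (LINT t|lborel. norm h * (indicator {0..1} t *\<^sub>R norm (g (x + t *\<^sub>R h))))"
  proof (rule lint_norm_le[OF ii[OF gh]])
    show "integrable lborel (\<lambda>t. norm h * (indicator {0..1} t *\<^sub>R norm (g (x + t *\<^sub>R h))))"
      by (intro integrable_mult_right ii[OF gc])
    show "norm (indicator {0..1} t *\<^sub>R (h \<bullet> g (x + t *\<^sub>R h))) \<le> norm h * (indicator {0..1} t *\<^sub>R norm (g (x + t *\<^sub>R h)))" for t :: real
      using Cauchy_Schwarz_ineq2[of h "g (x + t *\<^sub>R h)"] by (auto simp: indicator_def)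
  qed
  also have "\<dots> = norm h * (LINT t|lborel. indicator {0..1} t * norm (g (x + t *\<^sub>R h)))" by simp
  finally have "\<bar>f (x + h) - f x\<bar> powr p \<le> (norm h * (LINT t|lborel. indicator {0..1} t * norm (g (x + t *\<^sub>R h)))) powr p"
    using p by (intro powr_mono2) auto
  also have "\<dots> = norm h powr p * (LINT t|lborel. indicator {0..1} t * norm (g (x + t *\<^sub>R h))) powr p"
    by (rule powr_mult)
  also have "\<dots> \<le> norm h powr p * (LINT t|lborel. indicator {0..1} t * norm (g (x + t *\<^sub>R h)) powr p)"
    using ii[OF gc] ii[OF gcp] p
    by (intro mult_left_mono powr_weighted_integral_le) auto
  finally have "ennreal (\<bar>f (x + h) - f x\<bar> powr p) \<le>
     ennreal (norm h powr p) * ennreal (LINT t|lborel. indicator {0..1} t * norm (g (x + t *\<^sub>R h)) powr p)"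
    by (simp add: ennreal_mult[symmetric] ennreal_leI)
  also have "ennreal (LINT t|lborel. indicator {0..1} t * norm (g (x + t *\<^sub>R h)) powr p) =
      (\<integral>\<^sup>+t. indicator {0..1} t * norm (g (x + t *\<^sub>R h)) powr p \<partial>lborel)"
    using ii[OF gcp] by (intro nn_integral_eq_integral[symmetric]) auto
  also have "\<dots> = (\<integral>\<^sup>+t. indicator {0..1} t * ennreal (norm (g (x + t *\<^sub>R h)) powr p) \<partial>lborel)"
    by (intro nn_integral_cong) (auto simp: indicator_def)
  finally show ?thesis .
qed

text \<open>Fubini after the pointwise bound. Convexity keeps the segments inside \<open>S\<close>, so only the gradient on \<open>S\<close>
  enters.\<close>

lemma C1_translation_estimate:
  fixes f :: "'a::euclidean_space \<Rightarrow> real"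
  assumes c: "C1 f g" and p: "1 \<le> p" and S: "convex S" "S \<in> sets borel"
  shows "(\<integral>\<^sup>+x. indicator S x * indicator S (x + h) * ennreal (\<bar>f (x + h) - f x\<bar> powr p) \<partial>lborel)
    \<le> ennreal (norm h powr p) * (\<integral>\<^sup>+x. indicator S x * ennreal (norm (g x) powr p) \<partial>lborel)"
proof -
  have [measurable]: "g \<in> borel_measurable borel" "f \<in> borel_measurable borel" "S \<in> sets borel"
    using C1_measurable[OF c] S by auto
  let ?G = "\<lambda>x. indicator S x * ennreal (norm (g x) powr p)"
  have "(\<integral>\<^sup>+x. indicator S x * indicator S (x + h) * ennreal (\<bar>f (x + h) - f x\<bar> powr p) \<partial>lborel)
    \<le> (\<integral>\<^sup>+x. (\<integral>\<^sup>+t. ennreal (norm h powr p) * (indicator {0..1::real} t * ?G (x + t *\<^sub>R h)) \<partial>lborel) \<partial>lborel)"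
  proof (rule nn_integral_mono)
    fix x
    show "indicator S x * indicator S (x + h) * ennreal (\<bar>f (x + h) - f x\<bar> powr p) \<le>
       (\<integral>\<^sup>+t. ennreal (norm h powr p) * (indicator {0..1::real} t * ?G (x + t *\<^sub>R h)) \<partial>lborel)"
    proof (cases "x \<in> S \<and> x + h \<in> S")
      case True
      have seg: "x + t *\<^sub>R h \<in> S" if "t \<in> {0..1}" for t :: real
      proof -
        have "(1 - t) *\<^sub>R x + t *\<^sub>R (x + h) \<in> S" using True that S(1) by (intro convexD) auto
        then show ?thesis by (simp add: algebra_simps)
      qed
      have "ennreal (\<bar>f (x + h) - f x\<bar> powr p) \<le> ennreal (norm h powr p) * (\<integral>\<^sup>+t. indicator {0..1} t * ennreal (norm (g (x + t *\<^sub>R h)) powr p) \<partial>lborel)"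
        by (rule norm_increment_powr_le[OF c p])
      also have "\<dots> = ennreal (norm h powr p) * (\<integral>\<^sup>+t. indicator {0..1} t * ?G (x + t *\<^sub>R h) \<partial>lborel)"
      proof (rule arg_cong2[of _ _ _ _ "(*)", OF refl], rule nn_integral_cong)
        fix t :: real
        show "indicator {0..1} t * ennreal (norm (g (x + t *\<^sub>R h)) powr p) = indicator {0..1} t * ?G (x + t *\<^sub>R h)"
          using seg[of t] by (cases "t \<in> {0..1}") auto
      qed
      also have "\<dots> = (\<integral>\<^sup>+t. ennreal (norm h powr p) * (indicator {0..1} t * ?G (x + t *\<^sub>R h)) \<partial>lborel)"
        by (rule nn_integral_cmult[symmetric]) measurable
      finally show ?thesis using True by simp
    qed auto
  qed
  also have "\<dots> = (\<integral>\<^sup>+t. (\<integral>\<^sup>+x. ennreal (norm h powr p) * (indicator {0..1::real} t * ?G (x + t *\<^sub>R h)) \<partial>lborel) \<partial>lborel)"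
    by (rule lborel_pair.Fubini') measurable
  also have "\<dots> = (\<integral>\<^sup>+t. ennreal (norm h powr p) * (indicator {0..1::real} t * (\<integral>\<^sup>+x. ?G x \<partial>lborel)) \<partial>lborel)"
  proof (rule nn_integral_cong)
    fix t :: real
    have "(\<integral>\<^sup>+x. ?G (x + t *\<^sub>R h) \<partial>lborel) = (\<integral>\<^sup>+x. ?G x \<partial>lborel)"
      using lborel_nn_integral_translate[of ?G "t *\<^sub>R h"] by (simp add: add.commute)
    then show "(\<integral>\<^sup>+x. ennreal (norm h powr p) * (indicator {0..1::real} t * ?G (x + t *\<^sub>R h)) \<partial>lborel)
        = ennreal (norm h powr p) * (indicator {0..1::real} t * (\<integral>\<^sup>+x. ?G x \<partial>lborel))"
      by (subst nn_integral_cmult | simp)+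
  qed
  also have "\<dots> = ennreal (norm h powr p) * (\<integral>\<^sup>+x. ?G x \<partial>lborel)"
    by (simp add: nn_integral_cmult nn_integral_multc)
  finally show ?thesis .
qed

text \<open>The factor \<open>8\<^sup>p\<close> comes from splitting the increment into those of an approximant and of the errors.\<close>

lemma sob_translation_estimate:
  fixes f :: "'a::euclidean_space \<Rightarrow> real"
  assumes s: "sob p S f F" and p: "1 \<le> p" and S: "convex S" "S \<in> sets borel"
  shows "(\<integral>\<^sup>+x. indicator S x * indicator S (x + h) * ennreal (\<bar>f (x + h) - f x\<bar> powr p) \<partial>lborel)
    \<le> ennreal (8 powr p * norm h powr p) * (\<integral>\<^sup>+x. indicator S x * ennreal (norm (F x) powr p) \<partial>lborel)"
proof -
  obtain fs gs where fs: "\<And>n. C1 (fs n) (gs n)" "Lp_tendsto p (lborel_on S) fs f" "Lp_tendsto p (lborel_on S) gs F"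
    using s unfolding sob_def by blast
  have [measurable]: "f \<in> borel_measurable borel" "F \<in> borel_measurable borel" "S \<in> sets borel"
    using s S by (auto simp: sob_def)
  have [measurable]: "fs n \<in> borel_measurable borel" "gs n \<in> borel_measurable borel" for n
    using C1_measurable[OF fs(1)] by auto
  have p0: "0 \<le> p" using p by simp
  define c where "c = 2 powr p"
  have c: "1 \<le> c" unfolding c_def using p by (simp add: ge_one_powr_ge_zero)
  define a where "a n = (\<integral>\<^sup>+x. indicator S x * ennreal (norm (fs n x - f x) powr p) \<partial>lborel)" for n
  define b where "b n = (\<integral>\<^sup>+x. indicator S x * ennreal (norm (gs n x - F x) powr p) \<partial>lborel)" for n
  have on: "(\<integral>\<^sup>+x. indicator S x * k x \<partial>lborel) = (\<integral>\<^sup>+x. k x \<partial>lborel_on S)" for k :: "'a \<Rightarrow> ennreal"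
    by (subst nn_integral_restrict_space) (auto simp: mult.commute)
  have a0: "a \<longlonglongrightarrow> 0" and b0: "b \<longlonglongrightarrow> 0"
    using fs(2,3) unfolding a_def b_def on Lp_tendsto_def by auto
  let ?I = "\<lambda>x. indicator S x * indicator S (x + h) :: ennreal"
  let ?D = "\<integral>\<^sup>+x. ?I x * ennreal (\<bar>f (x + h) - f x\<bar> powr p) \<partial>lborel"
  let ?F = "\<integral>\<^sup>+x. indicator S x * ennreal (norm (F x) powr p) \<partial>lborel"
  let ?c = "ennreal c" and ?H = "ennreal (norm h powr p)"
  have two: "ennreal (norm (y + z) powr p) \<le> ?c * (ennreal (norm y powr p) + ennreal (norm z powr p))" for y z :: "'b::real_normed_vector"
    unfolding c_def using norm_powr_add_le[OF p0, of y z]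
    by (simp add: ennreal_mult[symmetric] ennreal_plus[symmetric] ennreal_leI del: ennreal_plus)
  have bound: "?D \<le> ?c * (?c * (a n + a n) + ?H * (?c * (b n + ?F)))" for n
  proof -
    have "?D \<le> (\<integral>\<^sup>+x. ?c * (?c * (?I x * ennreal (norm (fs n (x + h) - f (x + h)) powr p) + ?I x * ennreal (norm (fs n x - f x) powr p)) +
        ?I x * ennreal (\<bar>fs n (x + h) - fs n x\<bar> powr p)) \<partial>lborel)"
    proof (rule nn_integral_mono)
      fix x
      have "ennreal (norm (f (x + h) - f x) powr p)
        \<le> ?c * (ennreal (norm ((f (x + h) - fs n (x + h)) + (fs n x - f x)) powr p) + ennreal (norm (fs n (x + h) - fs n x) powr p))"
        using two[of "(f (x + h) - fs n (x + h)) + (fs n x - f x)" "fs n (x + h) - fs n x"] by simp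
      also have "\<dots> \<le> ?c * (?c * (ennreal (norm (f (x + h) - fs n (x + h)) powr p) + ennreal (norm (fs n x - f x) powr p)) + ennreal (norm (fs n (x + h) - fs n x) powr p))"
        by (intro mult_left_mono add_mono two) auto
      finally show "?I x * ennreal (\<bar>f (x + h) - f x\<bar> powr p) \<le> ?c * (?c * (?I x * ennreal (norm (fs n (x + h) - f (x + h)) powr p) + ?I x * ennreal (norm (fs n x - f x) powr p)) +
        ?I x * ennreal (\<bar>fs n (x + h) - fs n x\<bar> powr p))"
        by (cases "x \<in> S \<and> x + h \<in> S") (auto simp: norm_minus_commute abs_minus_commute)
    qed
    also have "\<dots> = ?c * (?c * ((\<integral>\<^sup>+x. ?I x * ennreal (norm (fs n (x + h) - f (x + h)) powr p) \<partial>lborel) +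
        (\<integral>\<^sup>+x. ?I x * ennreal (norm (fs n x - f x) powr p) \<partial>lborel)) + (\<integral>\<^sup>+x. ?I x * ennreal (\<bar>fs n (x + h) - fs n x\<bar> powr p) \<partial>lborel))"
      by (simp add: nn_integral_cmult nn_integral_add)
    also have "\<dots> \<le> ?c * (?c * (a n + a n) + ?H * (?c * (b n + ?F)))"
    proof (intro mult_left_mono add_mono)
      have "(\<integral>\<^sup>+x. ?I x * ennreal (norm (fs n (x + h) - f (x + h)) powr p) \<partial>lborel)
          \<le> (\<integral>\<^sup>+x. indicator S (h + x) * ennreal (norm (fs n (h + x) - f (h + x)) powr p) \<partial>lborel)"
        by (intro nn_integral_mono) (auto simp: indicator_def add.commute)
      also have "\<dots> = a n" unfolding a_def
        by (rule lborel_nn_integral_translate[of "\<lambda>x. indicator S x * ennreal (norm (fs n x - f x) powr p)"]) measurable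
      finally show "(\<integral>\<^sup>+x. ?I x * ennreal (norm (fs n (x + h) - f (x + h)) powr p) \<partial>lborel) \<le> a n" .
      show "(\<integral>\<^sup>+x. ?I x * ennreal (norm (fs n x - f x) powr p) \<partial>lborel) \<le> a n" unfolding a_def
        by (intro nn_integral_mono) (auto simp: indicator_def)
      have "(\<integral>\<^sup>+x. ?I x * ennreal (\<bar>fs n (x + h) - fs n x\<bar> powr p) \<partial>lborel) \<le> ?H * (\<integral>\<^sup>+x. indicator S x * ennreal (norm (gs n x) powr p) \<partial>lborel)"
        by (rule C1_translation_estimate[OF fs(1) p S])
      also have "\<dots> \<le> ?H * (\<integral>\<^sup>+x. ?c * (indicator S x * ennreal (norm (gs n x - F x) powr p) + indicator S x * ennreal (norm (F x) powr p)) \<partial>lborel)"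
      proof (intro mult_left_mono nn_integral_mono)
        fix x
        show "indicator S x * ennreal (norm (gs n x) powr p) \<le> ?c * (indicator S x * ennreal (norm (gs n x - F x) powr p) + indicator S x * ennreal (norm (F x) powr p))"
          using two[of "gs n x - F x" "F x"] by (cases "x \<in> S") auto
      qed auto
      also have "\<dots> = ?H * (?c * (b n + ?F))" unfolding b_def by (simp add: nn_integral_cmult nn_integral_add)
      finally show "(\<integral>\<^sup>+x. ?I x * ennreal (\<bar>fs n (x + h) - fs n x\<bar> powr p) \<partial>lborel) \<le> ?H * (?c * (b n + ?F))" .
    qed auto
    finally show ?thesis .
  qed
  have "(\<lambda>n. ?c * (?c * (a n + a n) + ?H * (?c * (b n + ?F)))) \<longlonglongrightarrow> ?c * (?c * (0 + 0) + ?H * (?c * (0 + ?F)))"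
    by (intro ennreal_tendsto_cmult tendsto_add a0 b0 tendsto_const) auto
  then have "?D \<le> ?c * (?c * (0 + 0) + ?H * (?c * (0 + ?F)))"
    by (rule LIMSEQ_le_const) (use bound in auto)
  also have "\<dots> = ennreal (c * c * norm h powr p) * ?F"
    using c by (simp add: ennreal_mult mult_ac)
  also have "\<dots> \<le> ennreal (8 powr p * norm h powr p) * ?F"
  proof -
    have "c * c = 4 powr p" unfolding c_def by (simp add: powr_mult[symmetric])
    also have "\<dots> \<le> 8 powr p" using p by (intro powr_mono2) auto
    finally show ?thesis by (intro mult_right_mono ennreal_leI) auto
  qed
  finally show ?thesis .
qed

text \<open>Half of \<open>\<parallel>f\<parallel>\<^sup>p\<close> is absorbed when the averaging ball has \<open>2 \<cdot> 2\<^sup>p\<close> times the volume of the support, which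
  determines its radius and this constant.\<close>

definition faber_krahn_const :: "'a::euclidean_space itself \<Rightarrow> real \<Rightarrow> real" where
  "faber_krahn_const _ p = 2 * 2 powr p * (2 * 2 powr p / unit_ball_vol DIM('a)) powr (p / DIM('a))"

lemma nn_integral_translate_swap:
  fixes f :: "'a::euclidean_space \<Rightarrow> ennreal"
  assumes [measurable]: "f \<in> borel_measurable borel" "A \<in> sets borel" "B \<in> sets borel"
  shows "(\<integral>\<^sup>+h. indicator B h * (\<integral>\<^sup>+x. indicator A x * f (x + h) \<partial>lborel) \<partial>lborel)
    = (\<integral>\<^sup>+x. indicator A x * (\<integral>\<^sup>+h. indicator B h * f (x + h) \<partial>lborel) \<partial>lborel)"
proof -
  have "(\<integral>\<^sup>+h. indicator B h * (\<integral>\<^sup>+x. indicator A x * f (x + h) \<partial>lborel) \<partial>lborel)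
     = (\<integral>\<^sup>+h. (\<integral>\<^sup>+x. indicator B h * (indicator A x * f (x + h)) \<partial>lborel) \<partial>lborel)"
    by (intro nn_integral_cong nn_integral_cmult[symmetric]) measurable
  also have "\<dots> = (\<integral>\<^sup>+x. (\<integral>\<^sup>+h. indicator B h * (indicator A x * f (x + h)) \<partial>lborel) \<partial>lborel)"
    by (rule lborel_pair.Fubini') measurable
  also have "\<dots> = (\<integral>\<^sup>+x. (\<integral>\<^sup>+h. indicator A x * (indicator B h * f (x + h)) \<partial>lborel) \<partial>lborel)"
    by (intro nn_integral_cong) (simp add: mult.left_commute)
  also have "\<dots> = (\<integral>\<^sup>+x. indicator A x * (\<integral>\<^sup>+h. indicator B h * f (x + h) \<partial>lborel) \<partial>lborel)"
    by (intro nn_integral_cong nn_integral_cmult) measurable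
  finally show ?thesis .
qed

text \<open>On average over a ball \<open>B\<close> of larger volume than \<open>A\<close>, a shift moves much of \<open>A\<close> off itself. Average \<open>\<bar>f(x)\<bar>\<^sup>p \<le> 2\<^sup>p (\<bar>f(x+h) - f(x)\<bar>\<^sup>p + \<bar>f(x+h)\<bar>\<^sup>p)\<close> over \<open>x \<in> A\<close> and \<open>h \<in> B\<close>:
  after exchanging the integrals the last term is at most \<open>2\<^sup>p \<bar>A\<bar> / \<bar>B\<bar>\<close> times the left-hand side.\<close>

lemma faber_krahn_translation:
  fixes f :: "'a::euclidean_space \<Rightarrow> real"
  assumes p: "1 \<le> p" and [measurable]: "f \<in> borel_measurable borel" "A \<in> sets borel"
    and A: "emeasure lborel A < \<infinity>" "\<And>x. x \<notin> A \<Longrightarrow> f x = 0"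
    and I: "integrable lborel (\<lambda>x. \<bar>f x\<bar> powr p)" and E: "0 \<le> E"
    and tr: "\<And>h. (\<integral>\<^sup>+x. ennreal (\<bar>f (x + h) - f x\<bar> powr p) \<partial>lborel) \<le> ennreal (norm h powr p * E)"
  shows "(LINT x|lborel. \<bar>f x\<bar> powr p)
    \<le> faber_krahn_const TYPE('a) p * measure lborel A powr (p / DIM('a)) * E"
proof (cases "measure lborel A = 0")
  case True
  then have "emeasure lborel A = 0" using A(1) by (simp add: emeasure_eq_ennreal_measure)
  then have "AE x in lborel. x \<notin> A" by (intro AE_not_in) (auto simp: null_sets_def)
  then have "AE x in lborel. \<bar>f x\<bar> powr p = 0"
    by eventually_elim (use A(2) p in simp)
  then have "(LINT x|lborel. \<bar>f x\<bar> powr p) = (LINT x|(lborel::'a measure). (0::real))"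
    by (intro integral_cong_AE) auto
  then show ?thesis using True p by simp
next
  case False
  define m where "m = measure lborel A"
  have m: "0 < m" using False by (simp add: m_def less_le)
  have em: "emeasure lborel A = ennreal m" using A(1) by (simp add: m_def emeasure_eq_ennreal_measure)
  define I' where "I' = (LINT x|lborel. \<bar>f x\<bar> powr p)"
  have I0: "0 \<le> I'" by (simp add: I'_def)
  have nnI: "(\<integral>\<^sup>+x. ennreal (\<bar>f x\<bar> powr p) \<partial>lborel) = ennreal I'"
    unfolding I'_def by (rule nn_integral_eq_integral[OF I]) auto
  define c where "c = 2 powr p"
  have c: "0 < c" by (simp add: c_def)
  \<comment> \<open>The averaging ball has volume \<open>V\<close>, so that the term to be absorbed is \<open>c m / V = 1 / 2\<close> of the left-hand side.\<close>
  define V where "V = 2 * c * m"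
  have V: "0 < V" using c m by (simp add: V_def)
  have uv: "0 < unit_ball_vol (real DIM('a))" by simp
  then have uv': "unit_ball_vol (real DIM('a)) \<noteq> 0" by linarith
  define r where "r = (V / unit_ball_vol (real DIM('a))) powr (1 / DIM('a))"
  have q: "0 < V / unit_ball_vol (real DIM('a))" using V uv by (rule divide_pos_pos)
  have r: "0 < r" unfolding r_def powr_gt_zero using q by linarith
  have "r ^ DIM('a) = r powr real DIM('a)" by (rule powr_realpow[OF r, symmetric])
  also have "\<dots> = (V / unit_ball_vol (real DIM('a))) powr 1"
    unfolding r_def powr_powr by simp
  also have "\<dots> = V / unit_ball_vol (real DIM('a))" using q by (intro powr_one) linarith
  finally have "r ^ DIM('a) = V / unit_ball_vol (real DIM('a))" .
  then have "unit_ball_vol (real DIM('a)) * r ^ DIM('a) = V"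
    using uv' by (metis nonzero_mult_div_cancel_left times_divide_eq_right)
  then have Bv: "emeasure lborel (ball (0::'a) r) = ennreal V"
    using r by (simp add: emeasure_ball)
  have [measurable]: "ball (0::'a) r \<in> sets borel" by simp
  have pt: "ennreal I' \<le> ennreal c * (ennreal (norm h powr p * E) + (\<integral>\<^sup>+x. indicator A x * ennreal (\<bar>f (x + h)\<bar> powr p) \<partial>lborel))" for h
  proof -
    have "ennreal I' = (\<integral>\<^sup>+x. indicator A x * ennreal (\<bar>f x\<bar> powr p) \<partial>lborel)"
      unfolding nnI[symmetric] using A(2) p by (intro nn_integral_cong) (auto simp: indicator_def)
    also have "\<dots> \<le> (\<integral>\<^sup>+x. ennreal c * (ennreal (\<bar>f (x + h) - f x\<bar> powr p) + indicator A x * ennreal (\<bar>f (x + h)\<bar> powr p)) \<partial>lborel)"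
    proof (rule nn_integral_mono)
      fix x
      have "\<bar>f x\<bar> powr p \<le> c * (\<bar>f (x + h) - f x\<bar> powr p + \<bar>f (x + h)\<bar> powr p)"
        using norm_powr_add_le[of p "- (f (x + h) - f x)" "f (x + h)"] p by (simp add: c_def abs_minus_commute)
      then have "ennreal (\<bar>f x\<bar> powr p) \<le> ennreal c * (ennreal (\<bar>f (x + h) - f x\<bar> powr p) + ennreal (\<bar>f (x + h)\<bar> powr p))"
        using c by (simp add: ennreal_mult[symmetric] ennreal_plus[symmetric] ennreal_leI del: ennreal_plus)
      then show "indicator A x * ennreal (\<bar>f x\<bar> powr p) \<le> ennreal c * (ennreal (\<bar>f (x + h) - f x\<bar> powr p) + indicator A x * ennreal (\<bar>f (x + h)\<bar> powr p))"
        by (cases "x \<in> A") auto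
    qed
    also have "\<dots> = ennreal c * ((\<integral>\<^sup>+x. ennreal (\<bar>f (x + h) - f x\<bar> powr p) \<partial>lborel) + (\<integral>\<^sup>+x. indicator A x * ennreal (\<bar>f (x + h)\<bar> powr p) \<partial>lborel))"
      by (simp add: nn_integral_cmult nn_integral_add)
    also have "\<dots> \<le> ennreal c * (ennreal (norm h powr p * E) + (\<integral>\<^sup>+x. indicator A x * ennreal (\<bar>f (x + h)\<bar> powr p) \<partial>lborel))"
      by (intro mult_left_mono add_mono tr) auto
    finally show ?thesis .
  qed
  have "ennreal (V * I') = (\<integral>\<^sup>+h. indicator (ball (0::'a) r) h * ennreal I' \<partial>lborel)"
    using Bv V I0 by (simp add: nn_integral_multc ennreal_mult)
  also have "\<dots> \<le> (\<integral>\<^sup>+h. ennreal c * (ennreal (r powr p * E) * indicator (ball (0::'a) r) h +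
      indicator (ball 0 r) h * (\<integral>\<^sup>+x. indicator A x * ennreal (\<bar>f (x + h)\<bar> powr p) \<partial>lborel)) \<partial>lborel)"
  proof (rule nn_integral_mono)
    fix h :: 'a
    show "indicator (ball 0 r) h * ennreal I' \<le> ennreal c * (ennreal (r powr p * E) * indicator (ball (0::'a) r) h +
      indicator (ball 0 r) h * (\<integral>\<^sup>+x. indicator A x * ennreal (\<bar>f (x + h)\<bar> powr p) \<partial>lborel))"
    proof (cases "h \<in> ball 0 r")
      case True
      have "norm h powr p * E \<le> r powr p * E"
        using True p E by (intro mult_right_mono powr_mono2) auto
      then have "ennreal c * (ennreal (norm h powr p * E) + (\<integral>\<^sup>+x. indicator A x * ennreal (\<bar>f (x + h)\<bar> powr p) \<partial>lborel))
         \<le> ennreal c * (ennreal (r powr p * E) + (\<integral>\<^sup>+x. indicator A x * ennreal (\<bar>f (x + h)\<bar> powr p) \<partial>lborel))"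
        by (intro mult_left_mono add_mono ennreal_leI) auto
      then show ?thesis using pt[of h] True by simp
    qed simp
  qed
  also have "\<dots> = ennreal c * (ennreal (r powr p * E) * ennreal V +
      (\<integral>\<^sup>+h. indicator (ball 0 r) h * (\<integral>\<^sup>+x. indicator A x * ennreal (\<bar>f (x + h)\<bar> powr p) \<partial>lborel) \<partial>lborel))"
    by (simp add: nn_integral_cmult nn_integral_add Bv)
  also have "(\<integral>\<^sup>+h. indicator (ball 0 r) h * (\<integral>\<^sup>+x. indicator A x * ennreal (\<bar>f (x + h)\<bar> powr p) \<partial>lborel) \<partial>lborel)
     = (\<integral>\<^sup>+x. indicator A x * (\<integral>\<^sup>+h. indicator (ball 0 r) h * ennreal (\<bar>f (x + h)\<bar> powr p) \<partial>lborel) \<partial>lborel)"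
    by (rule nn_integral_translate_swap[of "\<lambda>x. ennreal (\<bar>f x\<bar> powr p)"]) auto
  also have "\<dots> \<le> (\<integral>\<^sup>+x. indicator A x * ennreal I' \<partial>lborel)"
  proof (intro nn_integral_mono mult_left_mono)
    fix x
    have "(\<integral>\<^sup>+h. indicator (ball 0 r) h * ennreal (\<bar>f (x + h)\<bar> powr p) \<partial>lborel) \<le> (\<integral>\<^sup>+h. ennreal (\<bar>f (x + h)\<bar> powr p) \<partial>lborel)"
      by (intro nn_integral_mono) (auto simp: indicator_def)
    also have "\<dots> = ennreal I'" unfolding nnI[symmetric]
      by (rule lborel_nn_integral_translate[of "\<lambda>x. ennreal (\<bar>f x\<bar> powr p)"]) auto
    finally show "(\<integral>\<^sup>+h. indicator (ball 0 r) h * ennreal (\<bar>f (x + h)\<bar> powr p) \<partial>lborel) \<le> ennreal I'" .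
  qed auto
  also have "\<dots> = ennreal m * ennreal I'" by (simp add: nn_integral_multc em)
  finally have "ennreal (V * I') \<le> ennreal c * (ennreal (r powr p * E) * ennreal V + ennreal m * ennreal I')"
    by (simp add: add_left_mono mult_left_mono)
  also have "\<dots> = ennreal (c * (r powr p * E * V + m * I'))"
    using c V m I0 E by (simp add: ennreal_mult[symmetric] ennreal_plus[symmetric] del: ennreal_plus)
  finally have "V * I' \<le> c * (r powr p * E * V + m * I')"
    by (rule ennreal_le_iff[THEN iffD1, rotated]) (use c V m I0 E in simp)
  then have "V * I' \<le> V * (2 * c * (r powr p * E))"
    using c m by (simp add: V_def algebra_simps)
  then have "I' \<le> 2 * c * (r powr p * E)" using V by simp
  also have "r powr p = (2 * c / unit_ball_vol DIM('a)) powr (p / DIM('a)) * m powr (p / DIM('a))"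
    using c m uv by (simp add: r_def powr_powr V_def powr_mult[symmetric])
  finally show ?thesis by (simp add: I'_def faber_krahn_const_def c_def m_def mult_ac)
qed

lemma sob_faber_krahn:
  fixes f :: "'a::euclidean_space \<Rightarrow> real"
  assumes p: "1 \<le> p" and s: "sob p UNIV f F" and A: "A \<in> sets borel" "emeasure lborel A < \<infinity>" "\<And>x. x \<notin> A \<Longrightarrow> f x = 0"
  shows "(LINT x|lborel. \<bar>f x\<bar> powr p)
    \<le> faber_krahn_const TYPE('a) p * measure lborel A powr (p / DIM('a)) * (8 powr p * (LINT x|lborel. norm (F x) powr p))"
proof (rule faber_krahn_translation[OF p _ A])
  have U: "lborel_on UNIV = (lborel :: 'a measure)"
    by (rule measure_eqI) (auto simp: sets_restrict_space emeasure_restrict_space)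
  have L: "Lp p lborel f" "Lp p lborel F" "f \<in> borel_measurable borel" using s by (auto simp: sob_def U)
  show "f \<in> borel_measurable borel" by fact
  show "integrable lborel (\<lambda>x. \<bar>f x\<bar> powr p)" using Lp_integrable[OF L(1)] by simp
  show "0 \<le> 8 powr p * (LINT x|lborel. norm (F x) powr p)" by simp
  fix h
  have "(\<integral>\<^sup>+x. norm (F x) powr p \<partial>lborel) = ennreal (LINT x|lborel. norm (F x) powr p)"
    by (rule nn_integral_eq_integral[OF Lp_integrable[OF L(2)]]) auto
  then show "(\<integral>\<^sup>+x. ennreal (\<bar>f (x + h) - f x\<bar> powr p) \<partial>lborel) \<le> ennreal (norm h powr p * (8 powr p * (LINT x|lborel. norm (F x) powr p)))"
    using sob_translation_estimate[OF s p, of h] by (simp add: ennreal_mult mult_ac)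
qed

text \<open>De Giorgi's isoperimetric inequality. Each pair in \<open>A1 \<times> A2\<close> contributes an increment of at least \<open>\<delta>\<close>;
  writing the pair as \<open>(x, x + h)\<close> and integrating the translation estimate over all \<open>\<bar>h\<bar> \<le> 2R\<close> bounds the
  total.\<close>

lemma sob_isoperimetric:
  fixes w :: "'a::euclidean_space \<Rightarrow> real"
  assumes s: "sob 1 (cball x0 R) w W" and R: "0 < R" and \<delta>: "0 < \<delta>"
    and A: "A1 \<in> sets borel" "A1 \<subseteq> cball x0 R" "\<And>x. x \<in> A1 \<Longrightarrow> w x \<le> a"
    and A': "A2 \<in> sets borel" "A2 \<subseteq> cball x0 R" "\<And>x. x \<in> A2 \<Longrightarrow> a + \<delta> \<le> w x"
  shows "\<delta> * measure lborel A1 * measure lborel A2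
     \<le> 16 * R * measure lborel (cball (0::'a) (2 * R)) * (LINT x|lborel_on (cball x0 R). norm (W x))"
proof -
  let ?B = "cball x0 R" and ?D = "cball (0::'a) (2 * R)"
  have [measurable]: "?D \<in> sets borel" by simp
  have [measurable]: "w \<in> borel_measurable borel" "W \<in> borel_measurable borel" "A1 \<in> sets borel" "A2 \<in> sets borel"
    using s A A' by (auto simp: sob_def)
  have fin: "emeasure lborel S = ennreal (measure lborel S)" if "S \<subseteq> cball z r" for S z and r :: real
  proof -
    have "emeasure lborel S \<le> emeasure lborel (cball z r)" using that by (intro emeasure_mono) auto
    also have "\<dots> < \<infinity>" using emeasure_lborel_cball_finite by auto
    finally show ?thesis by (simp add: emeasure_eq_ennreal_measure)
  qed
  define J where "J = (LINT x|lborel_on ?B. norm (W x))"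
  have iW: "integrable (lborel_on ?B) (\<lambda>x. norm (W x))"
    using s Lp_integrable[of 1 "lborel_on ?B" W] by (simp add: sob_def)
  have nJ: "(\<integral>\<^sup>+x. indicator ?B x * ennreal (norm (W x) powr 1) \<partial>lborel) = ennreal J"
  proof -
    have "(\<integral>\<^sup>+x. indicator ?B x * ennreal (norm (W x) powr 1) \<partial>lborel) = (\<integral>\<^sup>+x. ennreal (norm (W x)) \<partial>lborel_on ?B)"
      by (subst nn_integral_restrict_space) (auto simp: mult.commute)
    then show ?thesis unfolding J_def by (simp add: nn_integral_eq_integral[OF iW])
  qed
  have J0: "0 \<le> J" by (simp add: J_def)
  have "ennreal \<delta> * (ennreal (measure lborel A1) * ennreal (measure lborel A2)) =
      ennreal \<delta> * (\<integral>\<^sup>+x. indicator A1 x * ennreal (measure lborel A2) \<partial>lborel)"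
    by (simp add: nn_integral_multc fin[OF A(2)])
  also have "(\<integral>\<^sup>+x. indicator A1 x * ennreal (measure lborel A2) \<partial>lborel) =
      (\<integral>\<^sup>+x. indicator A1 x * (\<integral>\<^sup>+h. indicator ?D h * indicator A2 (x + h) \<partial>lborel) \<partial>lborel)"
  proof (intro nn_integral_cong)
    fix x
    show "indicator A1 x * ennreal (measure lborel A2) = indicator A1 x * (\<integral>\<^sup>+h. indicator ?D h * indicator A2 (x + h) \<partial>lborel)"
    proof (cases "x \<in> A1")
      case True
      have "(\<integral>\<^sup>+h. indicator ?D h * indicator A2 (x + h) \<partial>lborel) = (\<integral>\<^sup>+h. indicator A2 (x + h) \<partial>lborel)"
      proof (intro nn_integral_cong)
        fix h
        show "indicator ?D h * indicator A2 (x + h) = (indicator A2 (x + h) :: ennreal)"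
        proof (cases "x + h \<in> A2")
          case True
          then have "dist x0 (x + h) \<le> R" "dist x0 x \<le> R" using A A' \<open>x \<in> A1\<close> by auto
          then have "dist x (x + h) \<le> 2 * R" using dist_triangle3[of x "x + h" x0] by linarith
          then show ?thesis by (simp add: dist_norm)
        qed simp
      qed
      also have "\<dots> = emeasure lborel A2"
        using lborel_nn_integral_translate[of "indicator A2" x] by simp
      finally show ?thesis by (simp add: fin[OF A'(2)])
    qed simp
  qed
  also have "\<dots> = (\<integral>\<^sup>+h. indicator ?D h * (\<integral>\<^sup>+x. indicator A1 x * indicator A2 (x + h) \<partial>lborel) \<partial>lborel)"
    by (rule nn_integral_translate_swap[symmetric]) auto
  also have "ennreal \<delta> * \<dots> \<le> (\<integral>\<^sup>+h. indicator ?D h * (ennreal (16 * R) * ennreal J) \<partial>lborel)"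
  proof (subst nn_integral_cmult[symmetric])
    show "(\<lambda>h. indicator ?D h * (\<integral>\<^sup>+x. indicator A1 x * indicator A2 (x + h) \<partial>lborel)) \<in> borel_measurable lborel"
      by measurable
    show "(\<integral>\<^sup>+h. ennreal \<delta> * (indicator ?D h * (\<integral>\<^sup>+x. indicator A1 x * indicator A2 (x + h) \<partial>lborel)) \<partial>lborel)
       \<le> (\<integral>\<^sup>+h. indicator ?D h * (ennreal (16 * R) * ennreal J) \<partial>lborel)"
    proof (rule nn_integral_mono)
      fix h :: 'a
      show "ennreal \<delta> * (indicator ?D h * (\<integral>\<^sup>+x. indicator A1 x * indicator A2 (x + h) \<partial>lborel)) \<le> indicator ?D h * (ennreal (16 * R) * ennreal J)"
      proof (cases "h \<in> ?D")
        case True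
        have "ennreal \<delta> * (\<integral>\<^sup>+x. indicator A1 x * indicator A2 (x + h) \<partial>lborel) = (\<integral>\<^sup>+x. ennreal \<delta> * (indicator A1 x * indicator A2 (x + h)) \<partial>lborel)"
          by (rule nn_integral_cmult[symmetric]) measurable
        also have "\<dots> \<le> (\<integral>\<^sup>+x. indicator ?B x * indicator ?B (x + h) * ennreal (\<bar>w (x + h) - w x\<bar> powr 1) \<partial>lborel)"
        proof (rule nn_integral_mono)
          fix x
          show "ennreal \<delta> * (indicator A1 x * indicator A2 (x + h)) \<le> indicator ?B x * indicator ?B (x + h) * ennreal (\<bar>w (x + h) - w x\<bar> powr 1)"
          proof (cases "x \<in> A1 \<and> x + h \<in> A2")
            case True
            then have "w x \<le> a" "a + \<delta> \<le> w (x + h)" "x \<in> ?B" "x + h \<in> ?B" using A A' by blast+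
            then show ?thesis using True by (auto intro!: ennreal_leI)
          qed auto
        qed
        also have "\<dots> \<le> ennreal (8 powr 1 * norm h powr 1) * (\<integral>\<^sup>+x. indicator ?B x * ennreal (norm (W x) powr 1) \<partial>lborel)"
          by (rule sob_translation_estimate[OF s]) auto
        also have "\<dots> = ennreal (8 * norm h) * ennreal J" unfolding nJ by simp
        also have "\<dots> \<le> ennreal (16 * R) * ennreal J"
          using True by (intro mult_right_mono ennreal_leI) auto
        finally show ?thesis using True by simp
      qed simp
    qed
  qed
  also have "\<dots> = ennreal (measure lborel ?D) * (ennreal (16 * R) * ennreal J)"
    by (simp add: nn_integral_multc fin[OF order_refl])
  finally have "ennreal (\<delta> * (measure lborel A1 * measure lborel A2)) \<le> ennreal (measure lborel ?D * (16 * R * J))"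
    using \<delta> R J0 by (simp add: ennreal_mult)
  then have "\<delta> * (measure lborel A1 * measure lborel A2) \<le> measure lborel ?D * (16 * R * J)"
    using R J0 by (subst (asm) ennreal_le_iff) auto
  then show ?thesis by (simp add: J_def mult_ac)
qed

section \<open>Truncations and cutoff functions\<close>

text \<open>A continuously differentiable convex replacement for the positive part of \<open>s - k\<close>: its derivative rises
  linearly from \<open>0\<close> to \<open>1\<close> on the interval from \<open>k\<close> to \<open>k + \<delta>\<close>.\<close>

definition ramp :: "real \<Rightarrow> real \<Rightarrow> real \<Rightarrow> real" where
  "ramp k \<delta> s = ((max 0 (s - k))\<^sup>2 - (max 0 (s - k - \<delta>))\<^sup>2) / (2 * \<delta>)"

definition ramp' :: "real \<Rightarrow> real \<Rightarrow> real \<Rightarrow> real" where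
  "ramp' k \<delta> s = (max 0 (s - k) - max 0 (s - k - \<delta>)) / \<delta>"

lemma DERIV_pos_part_square: "DERIV (\<lambda>s::real. (max 0 s)\<^sup>2) s :> 2 * max 0 s"
proof -
  consider "s < 0" | "s = 0" | "0 < s" by linarith
  then show ?thesis
  proof cases
    case 1
    have "DERIV (\<lambda>s::real. 0) s :> 2 * max 0 s" using 1 by simp
    then show ?thesis
      by (rule has_field_derivative_transform_within_open[where S="{..<0}"]) (use 1 in auto)
  next
    case 3
    have "DERIV (\<lambda>s::real. s\<^sup>2) s :> 2 * max 0 s" using 3 by (auto intro!: derivative_eq_intros)
    then show ?thesis
      by (rule has_field_derivative_transform_within_open[where S="{0<..}"]) (use 3 in auto)
  next
    case 2
    have "((\<lambda>h::real. (max 0 h)\<^sup>2 / h) \<longlongrightarrow> 0) (at 0)"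
    proof (rule tendsto_0_le[where K=1])
      show "((\<lambda>h::real. h) \<longlongrightarrow> 0) (at 0)" by simp
      show "\<forall>\<^sub>F x in at 0. norm ((max 0 x)\<^sup>2 / x) \<le> norm (x::real) * 1"
        by (intro always_eventually allI) (auto simp: max_def power2_eq_square abs_mult)
    qed
    then show ?thesis using 2 by (simp add: DERIV_def)
  qed
qed

lemma ramp_DERIV: "\<delta> \<noteq> 0 \<Longrightarrow> DERIV (ramp k \<delta>) s :> ramp' k \<delta> s"
  unfolding ramp_def[abs_def] ramp'_def
  by (rule derivative_eq_intros DERIV_chain2[OF DERIV_pos_part_square] refl | simp)+ (simp add: field_simps)

lemma ramp'_continuous: "continuous_on UNIV (ramp' k \<delta>)"
  unfolding ramp'_def[abs_def] divide_inverse by (intro continuous_intros)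

context
  fixes k \<delta> s :: real assumes \<delta>: "0 < \<delta>"
begin

lemma ramp'_bounds: "0 \<le> ramp' k \<delta> s" "ramp' k \<delta> s \<le> 1"
  using \<delta> by (auto simp: ramp'_def max_def field_simps)

lemma ramp'_eq_0: "s \<le> k \<Longrightarrow> ramp' k \<delta> s = 0"
  using \<delta> by (auto simp: ramp'_def max_def)

lemma ramp'_eq_1: "k + \<delta> \<le> s \<Longrightarrow> ramp' k \<delta> s = 1"
  using \<delta> by (auto simp: ramp'_def max_def)

lemma ramp_eq_0: "s \<le> k \<Longrightarrow> ramp k \<delta> s = 0"
  using \<delta> by (auto simp: ramp_def max_def)

lemma ramp_eq_linear: "k + \<delta> \<le> s \<Longrightarrow> ramp k \<delta> s = s - k - \<delta> / 2"
  using \<delta> by (auto simp: ramp_def max_def field_simps power2_eq_square)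

lemma ramp_nonneg: "0 \<le> ramp k \<delta> s"
  using \<delta> unfolding ramp_def by (intro divide_nonneg_pos) (auto simp: max_def intro: power_mono)

lemma ramp_ge: "max 0 (s - (k + \<delta>)) \<le> ramp k \<delta> s"
  using ramp_nonneg ramp_eq_linear \<delta> by (cases "k + \<delta> \<le> s") auto

text \<open>By convexity, a function that vanishes at \<open>k\<close> lies below \<open>(s - k)\<close> times its slope at \<open>s\<close>. This is what
  makes the right-hand side of Caccioppoli's inequality carry the same weight \<open>ramp'\<close> as the left.\<close>

lemma ramp_le: "ramp k \<delta> s \<le> max 0 (s - k) * ramp' k \<delta> s"
proof (cases "k + \<delta> \<le> s")
  case True
  then show ?thesis using ramp_eq_linear ramp'_eq_1 \<delta> by auto
next
  case False
  then show ?thesis using \<delta> by (auto simp: ramp_def ramp'_def max_def power2_eq_square divide_simps)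
qed

end

text \<open>The primitive of a tent function of height two on the unit interval.\<close>

definition cutoff :: "real \<Rightarrow> real" where
  "cutoff t = 2 * (ramp 0 (1/2) t - ramp (1/2) (1/2) t)"

definition cutoff' :: "real \<Rightarrow> real" where
  "cutoff' t = 2 * (ramp' 0 (1/2) t - ramp' (1/2) (1/2) t)"

lemma cutoff_DERIV: "DERIV cutoff t :> cutoff' t"
  unfolding cutoff_def[abs_def] cutoff'_def
  by (auto intro!: derivative_eq_intros ramp_DERIV)

lemma cutoff'_continuous: "continuous_on UNIV cutoff'"
  unfolding cutoff'_def[abs_def] by (intro continuous_intros ramp'_continuous)

lemma cutoff_eq: "t \<le> 0 \<Longrightarrow> cutoff t = 0" "1 \<le> t \<Longrightarrow> cutoff t = 1"
  by (auto simp: cutoff_def ramp_def max_def power2_eq_square field_simps)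

lemma cutoff_bounds: "0 \<le> cutoff t" "cutoff t \<le> 1"
proof -
  have "mono cutoff"
  proof (rule monoI)
    fix x y :: real assume "x \<le> y"
    then show "cutoff x \<le> cutoff y"
      by (rule DERIV_nonneg_imp_nondecreasing)
        (use cutoff_DERIV in \<open>force simp: cutoff'_def ramp'_def max_def\<close>)
  qed
  then show "0 \<le> cutoff t" "cutoff t \<le> 1"
    using monoD[of cutoff "min t 0" t] monoD[of cutoff t "max t 1"] cutoff_eq by auto
qed

lemma cutoff'_bounds: "\<bar>cutoff' t\<bar> \<le> 2" "t \<le> 0 \<Longrightarrow> cutoff' t = 0"
  by (auto simp: cutoff'_def ramp'_def max_def)

text \<open>Apply the one-dimensional cutoff to an affine function of \<open>\<bar>x - x0\<bar>\<^sup>2\<close>, which is smooth at the centre.\<close>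

lemma ball_cutoff:
  fixes x0 :: "'a::euclidean_space"
  assumes R: "0 < R1" "R1 < R2"
  obtains \<eta> Z where "C1 \<eta> Z" "\<And>x. 0 \<le> \<eta> x" "\<And>x. \<eta> x \<le> 1" "\<And>x. x \<in> cball x0 R1 \<Longrightarrow> \<eta> x = 1"
    "\<And>x. x \<notin> cball x0 R2 \<Longrightarrow> \<eta> x = 0" "\<And>x. x \<notin> cball x0 R2 \<Longrightarrow> Z x = 0" "\<And>x. norm (Z x) \<le> 4 / (R2 - R1)"
proof -
  define D where "D = R2\<^sup>2 - R1\<^sup>2"
  have D: "D = (R2 - R1) * (R2 + R1)" by (simp add: D_def power2_eq_square algebra_simps)
  have D0: "0 < D" unfolding D using R by simp
  define t where "t x = (R2\<^sup>2 - (x - x0) \<bullet> (x - x0)) / D" for x :: 'a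
  define T where "T x = (- 2 / D) *\<^sub>R (x - x0)" for x :: 'a
  have "C1 t T" unfolding C1_def
  proof (intro conjI allI)
    show "continuous_on UNIV T" unfolding T_def by (intro continuous_intros)
    show "GDERIV t x :> T x" for x
    proof -
      have "((\<lambda>x. (x - x0) \<bullet> (x - x0)) has_derivative (\<lambda>h. 2 * (h \<bullet> (x - x0)))) (at x)"
        by (auto intro!: derivative_eq_intros simp: inner_commute)
      then have "((\<lambda>x. (1 / D) * (R2\<^sup>2 - (x - x0) \<bullet> (x - x0))) has_derivative (\<lambda>h. (1 / D) * (0 - 2 * (h \<bullet> (x - x0))))) (at x)"
        by (intro has_derivative_mult_right has_derivative_diff has_derivative_const)
      then show ?thesis unfolding gderiv_def t_def T_def by simp
    qed
  qed
  then have C: "C1 (\<lambda>x. cutoff (t x)) (\<lambda>x. cutoff' (t x) *\<^sub>R T x)"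
    by (rule C1_compose[OF _ cutoff_DERIV cutoff'_continuous])
  have sq: "(x - x0) \<bullet> (x - x0) = (dist x0 x)\<^sup>2" for x
    by (simp add: dot_square_norm dist_norm norm_minus_commute)
  have out: "t x \<le> 0" if "x \<notin> cball x0 R2" for x
  proof -
    have "R2\<^sup>2 \<le> (dist x0 x)\<^sup>2" using that R by (intro power_mono) auto
    then show ?thesis using D0 by (simp add: t_def sq divide_le_0_iff)
  qed
  show thesis
  proof (rule that[OF C])
    show "cutoff (t x) = 1" if "x \<in> cball x0 R1" for x
    proof (rule cutoff_eq(2))
      have "(dist x0 x)\<^sup>2 \<le> R1\<^sup>2" using that R by (intro power_mono) auto
      then show "1 \<le> t x" using D0 by (simp add: t_def sq D_def)
    qed
    show "norm (cutoff' (t x) *\<^sub>R T x) \<le> 4 / (R2 - R1)" for x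
    proof (cases "x \<in> cball x0 R2")
      case True
      have "norm (cutoff' (t x) *\<^sub>R T x) \<le> 2 * (2 / D * R2)"
        unfolding T_def norm_scaleR using True D0 R cutoff'_bounds(1)[of "t x"]
        by (intro mult_mono) (auto simp: dist_norm norm_minus_commute intro!: divide_right_mono)
      also have "\<dots> = 4 / (R2 - R1) * (R2 / (R2 + R1))" by (simp add: D)
      also have "\<dots> \<le> 4 / (R2 - R1) * 1" using R by (intro mult_left_mono) auto
      finally show ?thesis by simp
    next
      case False
      then show ?thesis using out cutoff'_bounds(2) R by simp
    qed
  qed (use out cutoff_bounds cutoff_eq(1) cutoff'_bounds(2) in auto)
qed

section \<open>Energy estimates for the equation\<close>

text \<open>The equation \<open>div j = 0\<close> with the structure of the \<open>p\<close>-Laplacian. The flux is just a vector field tied to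
  the gradient by two inequalities. Functions are Borel on the whole space, and their values outside \<open>\<Omega>\<close> are
  irrelevant.\<close>

locale quasilinear_equation =
  fixes \<Omega> :: "'a::euclidean_space set" and p c0 C0 :: real
    and u :: "'a \<Rightarrow> real" and G j :: "'a \<Rightarrow> 'a"
  assumes open_\<Omega>: "open \<Omega>" and p: "1 < p" and c0: "0 < c0" and C0: "0 < C0"
    and weak_grad: "weak_grad \<Omega> u G"
    and L1: "\<And>K. compact K \<Longrightarrow> K \<subseteq> \<Omega> \<Longrightarrow> Lp 1 (lborel_on K) u \<and> Lp 1 (lborel_on K) G"
    and Lp: "\<And>K. compact K \<Longrightarrow> K \<subseteq> \<Omega> \<Longrightarrow> Lp p (lborel_on K) u \<and> Lp p (lborel_on K) G"
    and j_measurable: "j \<in> borel_measurable borel"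
    and coercive: "AE x in lborel. x \<in> \<Omega> \<longrightarrow> c0 * norm (G x) powr p - C0 \<le> j x \<bullet> G x"
    and growth: "AE x in lborel. x \<in> \<Omega> \<longrightarrow> norm (j x) \<le> C0 * (norm (G x) powr (p - 1) + 1)"
    and div_free: "\<And>\<phi>. test_function \<Omega> \<phi> \<Longrightarrow> (LINT x|lborel. j x \<bullet> grad \<phi> x) = 0"
begin

lemma fields_measurable [measurable]: "u \<in> borel_measurable borel" "G \<in> borel_measurable borel" "j \<in> borel_measurable borel"
  using weak_grad j_measurable by (auto simp: weak_grad_def)

lemma p_facts: "1 \<le> p" "0 \<le> p" "0 < p" using p by auto

lemma sob_compact: "compact K \<Longrightarrow> K \<subseteq> \<Omega> \<Longrightarrow> sob p K u G"
  by (rule weak_grad_imp_sob[OF open_\<Omega> weak_grad p_facts(1) L1 Lp])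

lemma sob_1_compact: "compact K \<Longrightarrow> K \<subseteq> \<Omega> \<Longrightarrow> sob 1 K u G"
  by (rule weak_grad_imp_sob[OF open_\<Omega> weak_grad order_refl L1 L1])

lemma compact_measurable: "compact K \<Longrightarrow> K \<in> sets (borel :: 'a measure)"
  by (simp add: compact_imp_closed borel_closed)

lemma AE_on: "AE x in lborel. x \<in> \<Omega> \<longrightarrow> P x \<Longrightarrow> K \<subseteq> \<Omega> \<Longrightarrow> K \<in> sets borel \<Longrightarrow> AE x in lborel_on K. P x"
  by (subst AE_restrict_space_iff) (auto elim!: eventually_mono)

lemma finite_on: "compact K \<Longrightarrow> emeasure (lborel_on K) (space (lborel_on K)) < \<infinity>" for K :: "'a set"
  using emeasure_compact_finite[of K]
  by (simp add: emeasure_restrict_space space_restrict_space compact_measurable)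

lemma integrable_const_on: "compact K \<Longrightarrow> integrable (lborel_on K) (\<lambda>_. c::real)" for K :: "'a set"
  using finite_on[of K] by (cases "c = 0") (auto simp: integrable_iff_bounded ennreal_mult_less_top)

lemma flux_mult_le:
  assumes "0 < \<kappa>" "norm J \<le> C0 * (norm g powr (p - 1) + 1)"
  shows "norm J * norm y \<le> C0 * \<kappa> * (norm g powr p + 1) + C0 * 2 * \<kappa> powr (1 - p) * norm y powr p"
proof -
  have "norm J * norm y \<le> C0 * (norm g powr (p - 1) * norm y + 1 * norm y)"
    using mult_right_mono[OF assms(2), of "norm y"] by (simp add: algebra_simps)
  also have "\<dots> \<le> C0 * ((\<kappa> * norm g powr p + \<kappa> powr (1 - p) * norm y powr p) + (\<kappa> + \<kappa> powr (1 - p) * norm y powr p))"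
    using powr_mult_le_split[of "norm g" "norm y" \<kappa> p] le_powr_split[of "norm y" \<kappa> p] assms(1) p C0
    by (intro mult_left_mono add_mono) auto
  finally show ?thesis by (simp add: algebra_simps)
qed

lemma flux_integrable:
  fixes y :: "'a \<Rightarrow> 'b::euclidean_space"
  assumes K: "compact K" "K \<subseteq> \<Omega>" and y: "Lp p (lborel_on K) y"
  shows "integrable (lborel_on K) (\<lambda>x. norm (j x) * norm (y x))"
proof (rule Bochner_Integration.integrable_bound)
  have iG: "integrable (lborel_on K) (\<lambda>x. norm (G x) powr p)" using Lp[OF K] Lp_integrable by blast
  show "integrable (lborel_on K) (\<lambda>x. C0 * 1 * (norm (G x) powr p + 1) + C0 * 2 * 1 powr (1 - p) * norm (y x) powr p)"
    by (intro Bochner_Integration.integrable_add integrable_mult_right iG integrable_const_on K Lp_integrable y)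
  have [measurable]: "y \<in> borel_measurable (lborel_on K)" by (rule Lp_measurable[OF y])
  have [measurable]: "j \<in> borel_measurable (lborel_on K)" by (rule borel_measurable_lborel_on) measurable
  show "(\<lambda>x. norm (j x) * norm (y x)) \<in> borel_measurable (lborel_on K)" by measurable
  show "AE x in lborel_on K. norm (norm (j x) * norm (y x)) \<le> norm (C0 * 1 * (norm (G x) powr p + 1) + C0 * 2 * 1 powr (1 - p) * norm (y x) powr p)"
    using AE_on[OF growth K(2) compact_measurable[OF K(1)]]
  proof eventually_elim
    case (elim x)
    from flux_mult_le[OF zero_less_one elim, of "y x"]
    have "norm (j x) * norm (y x) \<le> C0 * 1 * (norm (G x) powr p + 1) + C0 * 2 * 1 powr (1 - p) * norm (y x) powr p" .
    then show ?case by (simp add: abs_mult)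
  qed
qed

lemma flux_inner_integrable:
  assumes K: "compact K" "K \<subseteq> \<Omega>" and y: "Lp p (lborel_on K) y"
  shows "integrable (lborel_on K) (\<lambda>x. j x \<bullet> y x)"
proof (rule Bochner_Integration.integrable_bound[OF flux_integrable[OF assms]])
  have [measurable]: "y \<in> borel_measurable (lborel_on K)" by (rule Lp_measurable[OF y])
  have [measurable]: "j \<in> borel_measurable (lborel_on K)" by (rule borel_measurable_lborel_on) measurable
  show "(\<lambda>x. j x \<bullet> y x) \<in> borel_measurable (lborel_on K)" by measurable
  show "AE x in lborel_on K. norm (j x \<bullet> y x) \<le> norm (norm (j x) * norm (y x))"
    by (intro AE_I2) (simp add: Cauchy_Schwarz_ineq2)
qed

text \<open>The weight \<open>\<kappa>\<close> in Young's inequality is chosen first, so that the part with \<open>\<bar>j\<bar>\<close> is small, and then the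
  \<open>L\<^sup>p\<close> error is sent to zero.\<close>

lemma flux_tendsto_0:
  fixes ys :: "nat \<Rightarrow> 'a \<Rightarrow> 'b::euclidean_space"
  assumes K: "compact K" "K \<subseteq> \<Omega>" and t: "Lp_tendsto p (lborel_on K) ys y"
    and m: "\<And>n. ys n \<in> borel_measurable (lborel_on K)" "y \<in> borel_measurable (lborel_on K)"
  shows "(\<lambda>n. \<integral>\<^sup>+x. norm (j x) * norm (ys n x - y x) \<partial>lborel_on K) \<longlonglongrightarrow> 0"
  unfolding ennreal_tendsto_0_iff
proof (intro allI impI)
  fix \<eta> :: real assume \<eta>: "0 < \<eta>"
  note [measurable] = m
  have [measurable]: "G \<in> borel_measurable (lborel_on K)" by (rule borel_measurable_lborel_on) measurable
  define I where "I = (LINT x|lborel_on K. norm (G x) powr p + 1)"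
  have iG: "integrable (lborel_on K) (\<lambda>x. norm (G x) powr p + 1)"
    using Lp[OF K] Lp_integrable by (intro Bochner_Integration.integrable_add integrable_const_on K) blast
  have I0: "0 \<le> I" by (simp add: I_def)
  define \<kappa> where "\<kappa> = \<eta> / 2 / (C0 * (I + 1))"
  have \<kappa>: "0 < \<kappa>" using \<eta> C0 I0 by (simp add: \<kappa>_def)
  define B where "B = C0 * 2 * \<kappa> powr (1 - p)"
  have B: "0 < B" using C0 \<kappa> by (simp add: B_def)
  have "\<forall>\<^sub>F n in sequentially. (\<integral>\<^sup>+x. norm (ys n x - y x) powr p \<partial>lborel_on K) \<le> ennreal (\<eta> / 2 / B)"
    using t \<eta> B unfolding Lp_tendsto_def ennreal_tendsto_0_iff by (elim allE impE) auto
  then show "\<forall>\<^sub>F n in sequentially. (\<integral>\<^sup>+x. norm (j x) * norm (ys n x - y x) \<partial>lborel_on K) \<le> ennreal \<eta>"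
  proof eventually_elim
    case (elim n)
    have "(\<integral>\<^sup>+x. norm (j x) * norm (ys n x - y x) \<partial>lborel_on K) \<le>
       (\<integral>\<^sup>+x. ennreal (C0 * \<kappa>) * ennreal (norm (G x) powr p + 1) + ennreal B * ennreal (norm (ys n x - y x) powr p) \<partial>lborel_on K)"
      using AE_on[OF growth K(2) compact_measurable[OF K(1)]]
    proof (intro nn_integral_mono_AE, eventually_elim)
      case (elim x)
      from flux_mult_le[OF \<kappa> elim(2), of "ys n x - y x"]
      have "norm (j x) * norm (ys n x - y x) \<le> C0 * \<kappa> * (norm (G x) powr p + 1) + B * norm (ys n x - y x) powr p"
        by (simp add: B_def)
      then show ?case using C0 \<kappa> B
        by (simp add: ennreal_mult[symmetric] ennreal_plus[symmetric] ennreal_leI del: ennreal_plus)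
    qed
    also have "\<dots> = ennreal (C0 * \<kappa>) * ennreal I + ennreal B * (\<integral>\<^sup>+x. norm (ys n x - y x) powr p \<partial>lborel_on K)"
      unfolding I_def using nn_integral_eq_integral[OF iG] by (simp add: nn_integral_add nn_integral_cmult)
    also have "\<dots> \<le> ennreal (C0 * \<kappa>) * ennreal I + ennreal B * ennreal (\<eta> / 2 / B)"
      using elim by (intro add_mono mult_left_mono) auto
    also have "\<dots> = ennreal (C0 * \<kappa> * I + \<eta> / 2)"
      using C0 \<kappa> B I0 \<eta> by (simp add: ennreal_mult[symmetric] ennreal_plus[symmetric] del: ennreal_plus)
    also have "\<dots> \<le> ennreal \<eta>"
    proof (rule ennreal_leI)
      have "C0 * \<kappa> * I = I * (\<eta> / 2 / (I + 1))" using C0 by (simp add: \<kappa>_def)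
      also have "\<dots> \<le> \<eta> / 2" by (rule mult_divide_add_one_le[OF I0]) (use \<eta> in simp)
      finally show "C0 * \<kappa> * I + \<eta> / 2 \<le> \<eta>" by simp
    qed
    finally show ?case .
  qed
qed

lemma integral_on:
  fixes f :: "'a \<Rightarrow> 'b::euclidean_space"
  assumes "compact K" "\<And>x. x \<notin> K \<Longrightarrow> f x = 0"
  shows "(LINT x|lborel. f x) = (LINT x|lborel_on K. f x)"
proof -
  have "indicator K x *\<^sub>R f x = f x" for x using assms(2)[of x] by (cases "x \<in> K") auto
  then show ?thesis using compact_measurable[OF assms(1)] by (subst integral_restrict_space) auto
qed

text \<open>Mollification turns a continuously differentiable function into a test function, and the gradients
  converge uniformly, which suffices since \<open>j\<close> is locally integrable.\<close>

lemma div_free_C1: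
  assumes \<phi>: "C1 \<phi> g" and K: "compact K" "K \<subseteq> \<Omega>" and z: "\<And>x. x \<notin> K \<Longrightarrow> \<phi> x = 0"
  shows "(LINT x|lborel. j x \<bullet> g x) = 0"
proof -
  obtain r L where r: "0 < r" "compact L" "L \<subseteq> \<Omega>" "K \<subseteq> L" "\<And>x. x \<in> K \<Longrightarrow> cball x r \<subseteq> L"
    using compact_cball_nbhd[OF K open_\<Omega>] by blast
  obtain R where R: "K \<subseteq> cball 0 R"
    using compact_imp_bounded[OF K(1)] unfolding bounded_iff by (metis mem_cball_0 subsetI)
  have \<phi>R: "\<phi> x = 0" if "norm x > R" for x using z[of x] R that by (metis mem_cball_0 not_le subsetD)
  have gz: "g x = 0" if "x \<notin> K" for x
    by (rule C1_zero_outside[OF \<phi>, of "- K"]) (use z K(1) compact_imp_closed that in auto)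
  have gR: "g x = 0" if "norm x > R" for x using gz[of x] R that by (metis mem_cball_0 not_le subsetD)
  have i\<phi>: "integrable lborel \<phi>"
    by (rule integrable_continuous_compact_support[OF zero_less_one C1_continuous[OF \<phi>] \<phi>R])
  have ig: "integrable lborel g"
    by (rule integrable_continuous_compact_support[OF zero_less_one C1_continuous_grad[OF \<phi>] gR])
  have [measurable]: "\<phi> \<in> borel_measurable borel" "g \<in> borel_measurable borel" using C1_measurable[OF \<phi>] by auto
  define I where "I = (LINT x|lborel_on L. norm (j x) * norm (1::real))"
  have iI: "integrable (lborel_on L) (\<lambda>x. norm (j x) * norm (1::real))"
    by (rule flux_integrable[OF r(2,3)]) (rule Lp_const[OF finite_on[OF r(2)]])
  have I0: "0 \<le> I" by (simp add: I_def)
  have "\<bar>LINT x|lborel. j x \<bullet> g x\<bar> \<le> \<eta>" if \<eta>: "0 < \<eta>" for \<eta>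
  proof -
    define \<eta>' where "\<eta>' = \<eta> / (I + 1)"
    have \<eta>': "0 < \<eta>'" using \<eta> I0 by (simp add: \<eta>'_def)
    obtain d where d: "d > 0" "\<And>x y. norm (x - y) < d \<Longrightarrow> norm (g x - g y) < \<eta>'"
      using compact_support_uniformly_continuous[OF C1_continuous_grad[OF \<phi>] gR \<eta>'] by metis
    define e where "e = min d r / 2"
    have e: "0 < e" "e < d" "e < r" using d r by (auto simp: e_def)
    define \<psi> where "\<psi> x = (LINT y|lborel. \<phi> y * mollifier e (x - y))" for x
    have me: "mollifier e x = 0" if "norm x > e" for x :: 'a
      by (rule mollifier_eq_0[OF e(1)]) (use that in simp)
    have sm: "smooth \<psi>" unfolding \<psi>_def by (rule smooth_convolution[OF i\<phi> smooth_mollifier[OF e(1)] me])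
    have C: "C1 \<psi> (mollify e g)"
    proof -
      have "C1 (\<lambda>x. LINT y|lborel. mollifier e y * \<phi> (x - y)) (\<lambda>x. LINT y|lborel. mollifier e y *\<^sub>R g (x - y))"
        by (rule convolution_C1[OF integrable_mollifier[OF e(1)] \<phi> \<phi>R])
      moreover have "(\<lambda>x. LINT y|lborel. mollifier e y *\<^sub>R g (x - y)) = mollify e g"
        using mollify_eq_reflect[OF e(1), of g] by auto
      moreover have "(\<lambda>x. LINT y|lborel. mollifier e y * \<phi> (x - y)) = \<psi>"
        using mollify_eq_reflect[OF e(1), of \<phi>] by (auto simp: \<psi>_def mollify_def mult.commute)
      ultimately show ?thesis by simp
    qed
    have supp: "\<psi> x = 0" if "x \<notin> (\<Union>y\<in>K. cball y e)" for x
    proof -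
      have zz: "\<phi> y * mollifier e (x - y) = 0" for y
      proof (cases "y \<in> K")
        case True
        then have "e < norm (x - y)" using that by (auto simp: dist_norm norm_minus_commute not_le)
        then show ?thesis using me by simp
      qed (simp add: z)
      show ?thesis unfolding \<psi>_def zz by simp
    qed
    have sub: "(\<Union>y\<in>K. cball y e) \<subseteq> L"
      using r(5) e(3) by (auto simp: subset_iff) 
    have suppL: "\<psi> x = 0" if "x \<notin> L" for x
      by (rule supp) (use sub that in blast)
    have cl: "closure {x. \<psi> x \<noteq> 0} \<subseteq> L"
      using compact_imp_closed[OF r(2)] by (intro closure_minimal) (auto dest: suppL intro: ccontr)
    have "compact (closure {x. \<psi> x \<noteq> 0})"
      using cl compact_imp_bounded[OF r(2)] by (simp add: compact_eq_bounded_closed bounded_subset)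
    then have "test_function \<Omega> \<psi>" using sm cl r(3) by (auto simp: test_function_def)
    then have "(LINT x|lborel. j x \<bullet> grad \<psi> x) = 0" by (rule div_free)
    moreover have "grad \<psi> = mollify e g" using grad_eq[OF C1_GDERIV[OF C]] by auto
    ultimately have 0: "(LINT x|lborel. j x \<bullet> mollify e g x) = 0" by simp
    have gL: "g x = 0" if "x \<notin> L" for x using gz r(4) that by blast
    have mL: "mollify e g x = 0" if "x \<notin> L" for x
      by (rule C1_zero_outside[OF C, of "- L"]) (use suppL that r(2) in \<open>auto simp: compact_imp_closed\<close>)
    have close: "norm (mollify e g x - g x) \<le> \<eta>'" for x
      by (rule mollify_in_ball[OF e(1) ig]) (use d(2) e in \<open>auto simp: norm_minus_commute intro!: AE_I2 less_imp_le\<close>)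
    obtain Bg where Bg: "\<And>x. norm (g x) \<le> Bg"
      using compact_support_bounded[OF C1_continuous_grad[OF \<phi>] gR] by blast
    have Lg: "Lp p (lborel_on L) g"
      by (rule Lp_bound[OF p_facts(2) Lp_const[OF finite_on[OF r(2)], of p "1::real"], of _ Bg])
        (use Bg in \<open>auto intro!: borel_measurable_lborel_on\<close>)
    have Lm: "Lp p (lborel_on L) (mollify e g)"
    proof -
      have "Lp p (lborel_on L) (\<lambda>x. (mollify e g x - g x) + g x)"
      proof (rule Lp_add[OF p_facts(2) _ Lg])
        show "Lp p (lborel_on L) (\<lambda>x. mollify e g x - g x)"
          by (rule Lp_bound[OF p_facts(2) Lp_const[OF finite_on[OF r(2)], of p "1::real"], of _ \<eta>'])
            (use close C1_measurable[OF C] in \<open>auto intro!: borel_measurable_lborel_on\<close>)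
      qed
      then show ?thesis by simp
    qed
    have eqs: "(LINT x|lborel. j x \<bullet> g x) = (LINT x|lborel_on L. j x \<bullet> g x)"
      "(LINT x|lborel. j x \<bullet> mollify e g x) = (LINT x|lborel_on L. j x \<bullet> mollify e g x)"
      by (auto intro!: integral_on r(2) simp: gL mL)
    have "(LINT x|lborel. j x \<bullet> g x) = (LINT x|lborel_on L. j x \<bullet> g x) - (LINT x|lborel_on L. j x \<bullet> mollify e g x)"
      using 0 eqs by simp
    also have "\<dots> = (LINT x|lborel_on L. j x \<bullet> g x - j x \<bullet> mollify e g x)"
      by (rule Bochner_Integration.integral_diff[symmetric]) (rule flux_inner_integrable[OF r(2,3)], fact)+
    finally have "\<bar>LINT x|lborel. j x \<bullet> g x\<bar> = norm (LINT x|lborel_on L. j x \<bullet> g x - j x \<bullet> mollify e g x)" by simp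
    also have "\<dots> \<le> (LINT x|lborel_on L. \<eta>' * (norm (j x) * norm (1::real)))"
    proof (rule lint_norm_le)
      show "integrable (lborel_on L) (\<lambda>x. j x \<bullet> g x - j x \<bullet> mollify e g x)"
        by (intro Bochner_Integration.integrable_diff flux_inner_integrable r Lg Lm)
      show "integrable (lborel_on L) (\<lambda>x. \<eta>' * (norm (j x) * norm (1::real)))" by (intro integrable_mult_right iI)
      fix x
      have "norm (j x \<bullet> g x - j x \<bullet> mollify e g x) \<le> norm (j x) * norm (mollify e g x - g x)"
        using Cauchy_Schwarz_ineq2[of "j x" "g x - mollify e g x"] by (simp add: inner_diff_right norm_minus_commute)
      also have "\<dots> \<le> norm (j x) * \<eta>'" using close by (intro mult_left_mono) auto
      finally show "norm (j x \<bullet> g x - j x \<bullet> mollify e g x) \<le> \<eta>' * (norm (j x) * norm (1::real))" by (simp add: mult.commute)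
    qed
    also have "\<dots> = I * (\<eta> / (I + 1))" by (simp add: I_def \<eta>'_def)
    also have "\<dots> \<le> \<eta>" by (rule mult_divide_add_one_le[OF I0]) (use \<eta> in simp)
    finally show ?thesis .
  qed
  then have "\<bar>LINT x|lborel. j x \<bullet> g x\<bar> \<le> 0" by (rule field_le_epsilon[of _ 0, simplified]) auto
  then show ?thesis by simp
qed

text \<open>The equation tested with \<open>\<zeta> \<Phi>(u)\<close>. Approximants of \<open>\<Phi>(u)\<close> give admissible test functions, and the
  growth of \<open>j\<close> is exactly what is needed to pass to the limit in \<open>L\<^sup>p\<close>.\<close>

lemma energy_identity:
  assumes \<zeta>: "C1 \<zeta> Z" and K: "compact K" "K \<subseteq> \<Omega>" and z: "\<And>x. x \<notin> K \<Longrightarrow> \<zeta> x = 0"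
    and \<Phi>: "\<And>s. DERIV \<Phi> s :> \<Phi>' s" "continuous_on UNIV \<Phi>'" and B: "\<And>s. \<bar>\<Phi>' s\<bar> \<le> B"
  shows "integrable (lborel_on K) (\<lambda>x. \<zeta> x * \<Phi>' (u x) * (j x \<bullet> G x))" (is ?i1)
    and "integrable (lborel_on K) (\<lambda>x. \<Phi> (u x) * (j x \<bullet> Z x))" (is ?i2)
    and "(LINT x|lborel_on K. \<zeta> x * \<Phi>' (u x) * (j x \<bullet> G x)) = - (LINT x|lborel_on K. \<Phi> (u x) * (j x \<bullet> Z x))" (is ?eq)
proof -
  have Km[measurable]: "K \<in> sets borel" by (rule compact_measurable[OF K(1)])
  have "sob p K (\<lambda>x. \<Phi> (u x)) (\<lambda>x. \<Phi>' (u x) *\<^sub>R G x)"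
    using emeasure_compact_finite[OF K(1)]
    by (intro sob_compose[OF p_facts(1) sob_compact[OF K] Km _ \<Phi> B]) auto
  then obtain fs gs where fs: "\<And>n. C1 (fs n) (gs n)" "Lp_tendsto p (lborel_on K) fs (\<lambda>x. \<Phi> (u x))"
    "Lp_tendsto p (lborel_on K) gs (\<lambda>x. \<Phi>' (u x) *\<^sub>R G x)"
    and L: "Lp p (lborel_on K) (\<lambda>x. \<Phi> (u x))" "Lp p (lborel_on K) (\<lambda>x. \<Phi>' (u x) *\<^sub>R G x)"
    unfolding sob_def by blast
  obtain R where R: "K \<subseteq> cball 0 R"
    using compact_imp_bounded[OF K(1)] unfolding bounded_iff by (metis mem_cball_0 subsetI)
  have \<zeta>R: "\<zeta> x = 0" if "norm x > R" for x using z[of x] R that by (metis mem_cball_0 not_le subsetD)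
  have Zz: "Z x = 0" if "x \<notin> K" for x
    by (rule C1_zero_outside[OF \<zeta>, of "- K"]) (use z K(1) compact_imp_closed that in auto)
  have ZR: "Z x = 0" if "norm x > R" for x using Zz[of x] R that by (metis mem_cball_0 not_le subsetD)
  obtain B1 where B1: "\<And>x. norm (\<zeta> x) \<le> B1" using compact_support_bounded[OF C1_continuous[OF \<zeta>] \<zeta>R] by blast
  obtain B2 where B2: "\<And>x. norm (Z x) \<le> B2" using compact_support_bounded[OF C1_continuous_grad[OF \<zeta>] ZR] by blast
  define w where "w x = \<zeta> x *\<^sub>R (\<Phi>' (u x) *\<^sub>R G x) + \<Phi> (u x) *\<^sub>R Z x" for x
  define ws where "ws n x = \<zeta> x *\<^sub>R gs n x + fs n x *\<^sub>R Z x" for n x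
  have [measurable]: "\<zeta> \<in> borel_measurable (lborel_on K)" "Z \<in> borel_measurable (lborel_on K)"
    using C1_measurable[OF \<zeta>] borel_measurable_lborel_on by auto
  have [measurable]: "fs n \<in> borel_measurable (lborel_on K)" "gs n \<in> borel_measurable (lborel_on K)" for n
    using C1_measurable[OF fs(1)] borel_measurable_lborel_on by auto
  have [measurable]: "(\<lambda>x. \<Phi> (u x)) \<in> borel_measurable (lborel_on K)" "(\<lambda>x. \<Phi>' (u x) *\<^sub>R G x) \<in> borel_measurable (lborel_on K)"
    using L Lp_measurable by blast+
  have bz: "norm (\<zeta> x *\<^sub>R y) \<le> B1 * norm y" for x and y :: 'a using B1[of x] by (simp add: mult_right_mono)
  have bZ: "norm (s *\<^sub>R Z x) \<le> B2 * norm s" for x and s :: real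
    using mult_left_mono[OF B2[of x], of "\<bar>s\<bar>"] by (simp add: mult.commute)
  have B1': "0 \<le> B1" using B1[of undefined] norm_ge_zero order_trans by blast
  have B2': "0 \<le> B2" using B2[of undefined] norm_ge_zero order_trans by blast
  have Lz: "Lp p (lborel_on K) (\<lambda>x. \<zeta> x *\<^sub>R (\<Phi>' (u x) *\<^sub>R G x))"
    by (rule Lp_bound[OF p_facts(2) L(2), of _ B1]) (measurable, rule bz)
  have LZ: "Lp p (lborel_on K) (\<lambda>x. \<Phi> (u x) *\<^sub>R Z x)"
    by (rule Lp_bound[OF p_facts(2) L(1), of _ B2]) (measurable, rule bZ)
  have i1: "integrable (lborel_on K) (\<lambda>x. j x \<bullet> (\<zeta> x *\<^sub>R (\<Phi>' (u x) *\<^sub>R G x)))" by (rule flux_inner_integrable[OF K Lz])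
  have i2: "integrable (lborel_on K) (\<lambda>x. j x \<bullet> (\<Phi> (u x) *\<^sub>R Z x))" by (rule flux_inner_integrable[OF K LZ])
  show ?i1 using i1 by (simp add: mult.assoc)
  show ?i2 using i2 by simp
  have iw: "integrable (lborel_on K) (\<lambda>x. j x \<bullet> w x)"
    unfolding w_def inner_add_right by (intro Bochner_Integration.integrable_add i1 i2)
  have t: "Lp_tendsto p (lborel_on K) ws w"
    unfolding ws_def w_def
  proof (rule Lp_tendsto_add[OF p_facts(2)])
    show "Lp_tendsto p (lborel_on K) (\<lambda>n x. \<zeta> x *\<^sub>R gs n x) (\<lambda>x. \<zeta> x *\<^sub>R (\<Phi>' (u x) *\<^sub>R G x))"
      by (rule Lp_tendsto_mono_const[OF p_facts(2) fs(3), of _ _ B1])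
        (use bz B1' in \<open>simp_all only: scaleR_diff_right[symmetric]\<close>, measurable)
    show "Lp_tendsto p (lborel_on K) (\<lambda>n x. fs n x *\<^sub>R Z x) (\<lambda>x. \<Phi> (u x) *\<^sub>R Z x)"
      by (rule Lp_tendsto_mono_const[OF p_facts(2) fs(2), of _ _ B2])
        (use bZ B2' in \<open>simp_all only: scaleR_diff_left[symmetric]\<close>, measurable)
  qed measurable
  have ws0: "(LINT x|lborel_on K. j x \<bullet> ws n x) = 0" for n
  proof -
    have "(LINT x|lborel. j x \<bullet> ws n x) = 0"
      unfolding ws_def by (rule div_free_C1[OF C1_mult[OF \<zeta> fs(1)] K]) (simp add: z)
    then show ?thesis by (subst (asm) integral_on[OF K(1)]) (auto simp: ws_def z Zz)
  qed
  have cont: "continuous_on UNIV (ws n)" for n unfolding ws_def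
    by (intro continuous_intros C1_continuous[OF fs(1)] C1_continuous_grad[OF fs(1)] C1_continuous[OF \<zeta>] C1_continuous_grad[OF \<zeta>])
  have iws: "integrable (lborel_on K) (\<lambda>x. j x \<bullet> ws n x)" for n
  proof (rule flux_inner_integrable[OF K])
    have "ws n x = 0" if "norm x > R" for x using \<zeta>R ZR that by (simp add: ws_def)
    then obtain Bn where "\<And>x. norm (ws n x) \<le> Bn" using compact_support_bounded[OF cont] by metis
    then show "Lp p (lborel_on K) (ws n)"
      by (intro Lp_bound[OF p_facts(2) Lp_const[OF finite_on[OF K(1)], of p "1::real"], of _ Bn])
        (use borel_measurable_continuous_onI[OF cont] in \<open>auto intro!: borel_measurable_lborel_on\<close>)
  qed
  have [measurable]: "w \<in> borel_measurable (lborel_on K)" "ws n \<in> borel_measurable (lborel_on K)" for n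
    unfolding w_def ws_def by measurable
  have "ennreal \<bar>LINT x|lborel_on K. j x \<bullet> w x\<bar> \<le> (\<integral>\<^sup>+x. norm (j x) * norm (ws n x - w x) \<partial>lborel_on K)" for n
  proof -
    have "\<bar>LINT x|lborel_on K. j x \<bullet> w x\<bar> = norm (LINT x|lborel_on K. j x \<bullet> ws n x - j x \<bullet> w x)"
      using ws0[of n] iws[of n] iw by simp
    also have "ennreal \<dots> \<le> (\<integral>\<^sup>+x. norm (j x \<bullet> ws n x - j x \<bullet> w x) \<partial>lborel_on K)"
      by (intro integral_norm_bound_ennreal Bochner_Integration.integrable_diff iws iw)
    also have "\<dots> \<le> (\<integral>\<^sup>+x. norm (j x) * norm (ws n x - w x) \<partial>lborel_on K)"
      using Cauchy_Schwarz_ineq2 by (intro nn_integral_mono ennreal_leI) (simp add: inner_diff_right[symmetric])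
    finally show ?thesis .
  qed
  then have "ennreal \<bar>LINT x|lborel_on K. j x \<bullet> w x\<bar> \<le> 0"
    by (intro LIMSEQ_le_const[OF flux_tendsto_0[OF K t]]) auto
  then have "(LINT x|lborel_on K. j x \<bullet> w x) = 0" by simp
  then have "(LINT x|lborel_on K. j x \<bullet> (\<zeta> x *\<^sub>R (\<Phi>' (u x) *\<^sub>R G x))) + (LINT x|lborel_on K. j x \<bullet> (\<Phi> (u x) *\<^sub>R Z x)) = 0"
    unfolding w_def inner_add_right by (simp only: Bochner_Integration.integral_add[OF i1 i2])
  then show ?eq by (simp add: mult.assoc)
qed

end

context quasilinear_equation
begin

text \<open>The cutoff enters with an integer power \<open>N \<ge> p\<close>, which spares real powers of the cutoff and their
  derivative.\<close>

definition caccioppoli_exp :: nat where "caccioppoli_exp = nat \<lceil>p\<rceil>"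

definition caccioppoli_eps :: real where
  "caccioppoli_eps = c0 / (2 * caccioppoli_exp * C0)"

definition caccioppoli_const :: real where
  "caccioppoli_const = 2 / c0 * (C0 + c0 / 2 + 2 * caccioppoli_exp * C0 * caccioppoli_eps powr (1 - p))"

lemma exp_ge_p: "p \<le> caccioppoli_exp" "1 \<le> caccioppoli_exp"
  using p by (auto simp: caccioppoli_exp_def) linarith+

lemma eps_pos: "0 < caccioppoli_eps"
  using c0 C0 exp_ge_p by (simp add: caccioppoli_eps_def)

lemma caccioppoli_const_pos: "0 < caccioppoli_const"
  unfolding caccioppoli_const_def using c0 C0
  by (intro mult_pos_pos add_pos_nonneg) auto

text \<open>Splits the cross term so that \<open>\<bar>Du\<bar>\<^sup>p\<close> keeps the full factor \<open>\<eta>\<^sup>N\<close> and can be absorbed.\<close>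

lemma cutoff_split:
  fixes e s t :: real
  assumes e: "0 \<le> e" "e \<le> 1" and "0 \<le> s" "0 \<le> t" "0 < \<kappa>"
  shows "e ^ (caccioppoli_exp - 1) * t * (s powr (p - 1) + 1)
    \<le> \<kappa> * (e ^ caccioppoli_exp * s powr p) + \<kappa> + 2 * \<kappa> powr (1 - p) * t powr p"
proof (cases "e = 0")
  case True
  show ?thesis
  proof (cases "caccioppoli_exp = 1")
    case False
    then have z: "e ^ (caccioppoli_exp - 1) = 0" using True exp_ge_p(2) by simp
    have "0 \<le> \<kappa> * (e ^ caccioppoli_exp * s powr p) + \<kappa> + 2 * \<kappa> powr (1 - p) * t powr p"
      using assms by (intro add_nonneg_nonneg mult_nonneg_nonneg) auto
    then show ?thesis unfolding z by simp
  next
    case True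
    then show ?thesis using exp_ge_p(1) p by simp
  qed
next
  case False
  then have e0: "0 < e" using e by simp
  define N where "N = caccioppoli_exp"
  have N: "p \<le> real N" "1 \<le> N" using exp_ge_p by (auto simp: N_def)
  have eN: "e ^ (N - 1) * e = e ^ N" using N(2) by (metis One_nat_def Suc_diff_le diff_Suc_1 mult.commute power_Suc)
  have small: "e ^ (N - 1) * e powr (1 - p) \<le> 1"
  proof -
    have "e ^ (N - 1) * e powr (1 - p) = e powr (real (N - 1) + (1 - p))"
      using e0 by (simp add: powr_add powr_realpow)
    also have "\<dots> = e powr (real N - p)" using N(2) by (simp add: of_nat_diff)
    also have "\<dots> \<le> 1 powr (real N - p)" using e0 e N by (intro powr_mono2) auto
    finally show ?thesis by simp
  qed
  have 1: "e ^ (N - 1) * (s powr (p - 1) * t) \<le> \<kappa> * (e ^ N * s powr p) + \<kappa> powr (1 - p) * t powr p"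
  proof -
    \<comment> \<open>The weight \<open>\<kappa> e\<close> completes the power of \<open>e\<close> in front of \<open>s\<^sup>p\<close> and leaves \<open>e\<^sup>N\<^sup>-\<^sup>p \<le> 1\<close> in front of \<open>t\<^sup>p\<close>.\<close>
    have "e ^ (N - 1) * (s powr (p - 1) * t) \<le> e ^ (N - 1) * (\<kappa> * e * s powr p + (\<kappa> * e) powr (1 - p) * t powr p)"
      using assms e0 p by (intro mult_left_mono powr_mult_le_split) auto
    also have "\<dots> = \<kappa> * ((e ^ (N - 1) * e) * s powr p) + (e ^ (N - 1) * e powr (1 - p)) * (\<kappa> powr (1 - p) * t powr p)"
      by (simp add: algebra_simps powr_mult)
    also have "\<dots> \<le> \<kappa> * (e ^ N * s powr p) + 1 * (\<kappa> powr (1 - p) * t powr p)"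
      unfolding eN using small by (intro add_left_mono mult_right_mono) auto
    finally show ?thesis by simp
  qed
  have 2: "e ^ (N - 1) * t \<le> \<kappa> + \<kappa> powr (1 - p) * t powr p"
  proof -
    have "e ^ (N - 1) * t \<le> 1 * t" using assms by (intro mult_right_mono power_le_one) auto
    also have "\<dots> \<le> \<kappa> + \<kappa> powr (1 - p) * t powr p" using le_powr_split[of t \<kappa> p] assms p by simp
    finally show ?thesis .
  qed
  show ?thesis using 1 2 unfolding N_def[symmetric] by (simp add: algebra_simps)
qed

lemma pos_part_powr_integrable:
  assumes K: "compact K" "K \<subseteq> \<Omega>"
  shows "integrable (lborel_on K) (\<lambda>x. (max 0 (u x - k)) powr p)"
proof -
  have "Lp p (lborel_on K) (\<lambda>x. u x + (- k))"
    using Lp[OF K] by (intro Lp_add[OF p_facts(2)] Lp_const finite_on K) auto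
  then have "Lp p (lborel_on K) (\<lambda>x. max 0 (u x - k))"
    by (rule Lp_bound[OF p_facts(2), of _ _ _ 1]) (auto intro!: borel_measurable_lborel_on)
  then show ?thesis using Lp_integrable by fastforce
qed

lemma integrable_bounded_factor:
  assumes "integrable M f" "g \<in> borel_measurable M" "\<And>x. 0 \<le> g x" "\<And>x. g x \<le> (1::real)" "\<And>x. 0 \<le> f x"
  shows "integrable M (\<lambda>x. g x * f x)"
proof (rule Bochner_Integration.integrable_bound[OF assms(1)])
  show "(\<lambda>x. g x * f x) \<in> borel_measurable M" using assms by measurable
  show "AE x in M. norm (g x * f x) \<le> norm (f x)"
    using assms by (intro AE_I2) (simp add: abs_mult mult_left_le_one_le)
qed

text \<open>Test with \<open>\<eta>\<^sup>N ramp(u)\<close>. Coercivity bounds the left-hand side from below by \<open>\<eta>\<^sup>N ramp'(u) \<bar>Du\<bar>\<^sup>p\<close>, and the cross term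
  with \<open>D\<eta>\<close> is split by Young's inequality. The weight \<open>ramp'(u)\<close> survives on the right and confines
  the inhomogeneous terms to the super-level set.\<close>

lemma caccioppoli:
  fixes \<eta> :: "'a \<Rightarrow> real" and Z :: "'a \<Rightarrow> 'a" and k \<Lambda> :: real
  assumes \<eta>: "C1 \<eta> Z" "\<And>x. 0 \<le> \<eta> x" "\<And>x. \<eta> x \<le> 1" "\<And>x. x \<notin> K \<Longrightarrow> \<eta> x = 0" "\<And>x. norm (Z x) \<le> \<Lambda>"
    and K: "compact K" "K \<subseteq> \<Omega>" and \<delta>: "0 < \<delta>"
  shows "(LINT x|lborel_on K. \<eta> x ^ caccioppoli_exp * (ramp' k \<delta> (u x) * norm (G x) powr p))
     \<le> caccioppoli_const * (LINT x|lborel_on K. ramp' k \<delta> (u x) * (1 + (\<Lambda> * max 0 (u x - k)) powr p))"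
proof -
  define N where "N = caccioppoli_exp"
  have N: "1 \<le> N" using exp_ge_p by (simp add: N_def)
  let ?M = "lborel_on K"
  let ?R = "\<lambda>x. ramp' k \<delta> (u x)"
  let ?t = "\<lambda>x. \<Lambda> * max 0 (u x - k)"
  have \<Lambda>: "0 \<le> \<Lambda>" using \<eta>(5)[of undefined] norm_ge_zero order_trans by blast
  define \<kappa> where "\<kappa> = caccioppoli_eps"
  have \<kappa>: "0 < \<kappa>" using eps_pos by (simp add: \<kappa>_def)
  note Rb = ramp'_bounds[OF \<delta>]
  have [measurable]: "ramp' k \<delta> \<in> borel_measurable borel" "ramp k \<delta> \<in> borel_measurable borel"
    using ramp'_continuous borel_measurable_continuous_onI DERIV_isCont[OF ramp_DERIV] \<delta> continuous_at_imp_continuous_on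
    by (blast, metis less_irrefl)
  have [measurable]: "\<eta> \<in> borel_measurable borel" "Z \<in> borel_measurable borel" using C1_measurable[OF \<eta>(1)] by auto
  note mr = borel_measurable_lborel_on
  have Cz: "C1 (\<lambda>x. \<eta> x ^ N) (\<lambda>x. (real N * \<eta> x ^ (N - 1)) *\<^sub>R Z x)"
    by (rule C1_compose[OF \<eta>(1)]) (auto intro!: derivative_eq_intros continuous_intros)
  have zK: "\<eta> x ^ N = 0" if "x \<notin> K" for x using \<eta>(4)[OF that] N by simp
  have Rabs: "\<bar>ramp' k \<delta> s\<bar> \<le> 1" for s using Rb[of k s] by simp
  have d0: "\<delta> \<noteq> 0" using \<delta> by simp
  note E = energy_identity[OF Cz K zK ramp_DERIV[OF d0, where k=k] ramp'_continuous Rabs]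
  have \<eta>N: "0 \<le> \<eta> x ^ N" "\<eta> x ^ N \<le> 1" for x using \<eta>(2,3) by (auto intro: power_le_one)
  have iG: "integrable ?M (\<lambda>x. norm (G x) powr p)" using Lp[OF K] Lp_integrable by blast
  have iX: "integrable ?M (\<lambda>x. \<eta> x ^ N * (?R x * norm (G x) powr p))"
    by (intro integrable_bounded_factor iG) (auto intro!: mr mult_nonneg_nonneg simp: Rb \<eta>N)
  have iR: "integrable ?M (\<lambda>x. ?R x * 1)"
    by (intro integrable_bounded_factor integrable_const_on K) (auto intro!: mr simp: Rb)
  have it: "integrable ?M (\<lambda>x. ?t x powr p)"
    using integrable_mult_right[OF pos_part_powr_integrable[OF K, of k], of "\<Lambda> powr p"] by (simp add: powr_mult)
  have iRt: "integrable ?M (\<lambda>x. ?R x * ?t x powr p)"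
    by (intro integrable_bounded_factor it) (auto intro!: mr simp: Rb)
  define X where "X = (LINT x|?M. \<eta> x ^ N * (?R x * norm (G x) powr p))"
  define A where "A = (LINT x|?M. ?R x * 1)"
  define T where "T = (LINT x|?M. ?R x * ?t x powr p)"
  have A0: "0 \<le> A" unfolding A_def using Rb by (intro Bochner_Integration.integral_nonneg) auto
  have T0: "0 \<le> T" unfolding T_def using Rb by (intro Bochner_Integration.integral_nonneg) auto
  have "c0 * X - C0 * A = (LINT x|?M. c0 * (\<eta> x ^ N * (?R x * norm (G x) powr p)) - C0 * (?R x * 1))"
    unfolding X_def A_def using iX iR by simp
  also have "\<dots> \<le> (LINT x|?M. \<eta> x ^ N * ?R x * (j x \<bullet> G x))"
  proof (rule integral_mono_AE)
    show "integrable ?M (\<lambda>x. c0 * (\<eta> x ^ N * (?R x * norm (G x) powr p)) - C0 * (?R x * 1))"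
      using iX iR by (intro Bochner_Integration.integrable_diff integrable_mult_right)
    show "integrable ?M (\<lambda>x. \<eta> x ^ N * ?R x * (j x \<bullet> G x))" by (rule E(1))
    show "AE x in ?M. c0 * (\<eta> x ^ N * (?R x * norm (G x) powr p)) - C0 * (?R x * 1) \<le> \<eta> x ^ N * ?R x * (j x \<bullet> G x)"
      using AE_on[OF coercive K(2) compact_measurable[OF K(1)]]
    proof eventually_elim
      case (elim x)
      have "\<eta> x ^ N * ?R x * (c0 * norm (G x) powr p - C0) \<le> \<eta> x ^ N * ?R x * (j x \<bullet> G x)"
        using elim Rb \<eta>N by (intro mult_left_mono mult_nonneg_nonneg) auto
      moreover have "\<eta> x ^ N * (C0 * ?R x) \<le> C0 * ?R x"
        using \<eta>N[of x] Rb[of k "u x"] C0 by (intro mult_left_le_one_le) auto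
      ultimately show ?case by (simp add: algebra_simps)
    qed
  qed
  also have "\<dots> = - (LINT x|?M. ramp k \<delta> (u x) * (j x \<bullet> ((real N * \<eta> x ^ (N - 1)) *\<^sub>R Z x)))"
    by (rule E(3))
  also have "\<dots> \<le> \<bar>LINT x|?M. ramp k \<delta> (u x) * (j x \<bullet> ((real N * \<eta> x ^ (N - 1)) *\<^sub>R Z x))\<bar>" by simp
  also have "\<dots> \<le> (LINT x|?M. \<bar>ramp k \<delta> (u x) * (j x \<bullet> ((real N * \<eta> x ^ (N - 1)) *\<^sub>R Z x))\<bar>)"
    using integral_norm_bound[of ?M "\<lambda>x. ramp k \<delta> (u x) * (j x \<bullet> ((real N * \<eta> x ^ (N - 1)) *\<^sub>R Z x))"] by simp
  also have "\<dots> \<le> (LINT x|?M. real N * C0 * (\<kappa> * (\<eta> x ^ N * (?R x * norm (G x) powr p)) + \<kappa> * (?R x * 1) + 2 * \<kappa> powr (1 - p) * (?R x * ?t x powr p)))"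
  proof (rule integral_mono_AE)
    show "integrable ?M (\<lambda>x. \<bar>ramp k \<delta> (u x) * (j x \<bullet> ((real N * \<eta> x ^ (N - 1)) *\<^sub>R Z x))\<bar>)"
      using E(2) by (rule integrable_abs)
    show "integrable ?M (\<lambda>x. real N * C0 * (\<kappa> * (\<eta> x ^ N * (?R x * norm (G x) powr p)) + \<kappa> * (?R x * 1) + 2 * \<kappa> powr (1 - p) * (?R x * ?t x powr p)))"
      by (intro integrable_mult_right Bochner_Integration.integrable_add iX iR iRt)
    show "AE x in ?M. \<bar>ramp k \<delta> (u x) * (j x \<bullet> ((real N * \<eta> x ^ (N - 1)) *\<^sub>R Z x))\<bar> \<le>
        real N * C0 * (\<kappa> * (\<eta> x ^ N * (?R x * norm (G x) powr p)) + \<kappa> * (?R x * 1) + 2 * \<kappa> powr (1 - p) * (?R x * ?t x powr p))"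
      using AE_on[OF growth K(2) compact_measurable[OF K(1)]]
    proof eventually_elim
      case (elim x)
      have t0: "0 \<le> ?t x" using \<Lambda> by simp
      have e0: "0 \<le> \<eta> x ^ (N - 1)" using \<eta>(2) by simp
      have "\<bar>ramp k \<delta> (u x) * (j x \<bullet> ((real N * \<eta> x ^ (N - 1)) *\<^sub>R Z x))\<bar>
         = ramp k \<delta> (u x) * (real N * \<eta> x ^ (N - 1)) * \<bar>j x \<bullet> Z x\<bar>"
        using ramp_nonneg[OF \<delta>, of k "u x"] \<eta>(2) by (simp add: abs_mult)
      also have "\<dots> \<le> (max 0 (u x - k) * ?R x) * (real N * \<eta> x ^ (N - 1)) * (C0 * (norm (G x) powr (p - 1) + 1) * \<Lambda>)"
      proof (intro mult_mono ramp_le[OF \<delta>] order_refl)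
        have "\<bar>j x \<bullet> Z x\<bar> \<le> norm (j x) * norm (Z x)" by (rule Cauchy_Schwarz_ineq2)
        also have "\<dots> \<le> C0 * (norm (G x) powr (p - 1) + 1) * \<Lambda>"
          using elim \<eta>(5)[of x] C0 by (intro mult_mono) auto
        finally show "\<bar>j x \<bullet> Z x\<bar> \<le> C0 * (norm (G x) powr (p - 1) + 1) * \<Lambda>" .
      qed (use e0 Rb in auto)
      also have "\<dots> = real N * C0 * (?R x * (\<eta> x ^ (N - 1) * ?t x * (norm (G x) powr (p - 1) + 1)))"
        by (simp only: mult_ac)
      also have "\<dots> \<le> real N * C0 * (?R x * (\<kappa> * (\<eta> x ^ N * norm (G x) powr p) + \<kappa> + 2 * \<kappa> powr (1 - p) * ?t x powr p))"
        using cutoff_split[OF \<eta>(2,3) norm_ge_zero t0 \<kappa>, of x "G x"] C0 Rb unfolding N_def by (intro mult_left_mono) auto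
      finally show ?case by (simp add: algebra_simps)
    qed
  qed
  also have "\<dots> = real N * C0 * (\<kappa> * X + \<kappa> * A + 2 * \<kappa> powr (1 - p) * T)"
    unfolding X_def A_def T_def using iX iR iRt
    by (simp only: integral_mult_right_zero Bochner_Integration.integral_add Bochner_Integration.integrable_add integrable_mult_right)
  finally have main: "c0 * X - C0 * A \<le> real N * C0 * (\<kappa> * X + \<kappa> * A + 2 * \<kappa> powr (1 - p) * T)" .
  \<comment> \<open>The choice of \<open>\<kappa>\<close> lets half of the energy be absorbed on the left.\<close>
  have k2: "real N * C0 * \<kappa> = c0 / 2" using C0 N by (simp add: \<kappa>_def caccioppoli_eps_def N_def[symmetric])
  have eq: "real N * C0 * (\<kappa> * X + \<kappa> * A + 2 * \<kappa> powr (1 - p) * T) = (real N * C0 * \<kappa>) * X + (real N * C0 * \<kappa>) * A + (2 * real N * C0 * \<kappa> powr (1 - p)) * T"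
    by (simp add: algebra_simps)
  have "c0 * X - C0 * A \<le> c0 / 2 * X + c0 / 2 * A + (2 * real N * C0 * \<kappa> powr (1 - p)) * T"
    using main unfolding eq k2 .
  then have "c0 / 2 * X \<le> (C0 + c0 / 2) * A + (2 * real N * C0 * \<kappa> powr (1 - p)) * T"
    unfolding distrib_right by linarith
  also have "\<dots> \<le> (C0 + c0 / 2 + 2 * real N * C0 * \<kappa> powr (1 - p)) * A + (C0 + c0 / 2 + 2 * real N * C0 * \<kappa> powr (1 - p)) * T"
  proof (rule add_mono)
    have "0 \<le> 2 * real N * C0 * \<kappa> powr (1 - p)" using C0 by simp
    then show "(C0 + c0 / 2) * A \<le> (C0 + c0 / 2 + 2 * real N * C0 * \<kappa> powr (1 - p)) * A"
      "(2 * real N * C0 * \<kappa> powr (1 - p)) * T \<le> (C0 + c0 / 2 + 2 * real N * C0 * \<kappa> powr (1 - p)) * T"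
      using A0 T0 C0 c0 by (auto intro!: mult_right_mono)
  qed
  also have "\<dots> = c0 / 2 * caccioppoli_const * (A + T)"
  proof -
    have cc: "c0 / 2 * caccioppoli_const = C0 + c0 / 2 + 2 * real N * C0 * \<kappa> powr (1 - p)"
      using c0 by (simp add: caccioppoli_const_def N_def \<kappa>_def)
    show ?thesis unfolding cc by (rule distrib_left[symmetric])
  qed
  finally have "X \<le> caccioppoli_const * (A + T)" using c0 by simp
  also have "A + T = (LINT x|?M. ?R x * (1 + ?t x powr p))"
    unfolding A_def T_def using iR iRt by (simp add: distrib_left)
  finally show ?thesis unfolding X_def N_def .
qed

definition super_level :: "'a set \<Rightarrow> real \<Rightarrow> 'a set" where
  "super_level S k = {x \<in> S. k < u x}"

lemma super_level_measurable [measurable]: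
  assumes [measurable]: "S \<in> sets borel" shows "super_level S k \<in> sets borel"
proof -
  have "{x \<in> space borel. x \<in> S \<and> k < u x} \<in> sets borel" by measurable
  then show ?thesis by (simp add: super_level_def)
qed

definition excess :: "'a set \<Rightarrow> real \<Rightarrow> real" where
  "excess S k = (LINT x|lborel_on S. (max 0 (u x - k)) powr p)"

definition level_const :: real where
  "level_const = 2 powr p * (caccioppoli_const + real caccioppoli_exp powr p)"

lemma finite_super_level: "compact K \<Longrightarrow> emeasure lborel (super_level K k) < \<infinity>"
  using emeasure_mono[of "super_level K k" K lborel] emeasure_compact_finite[of K] compact_measurable[of K]
  by (auto simp: super_level_def intro: le_less_trans)

lemma ramp'_integral_le:
  assumes K: "compact K" "K \<subseteq> \<Omega>" and \<delta>: "0 < \<delta>" and \<Lambda>: "0 \<le> \<Lambda>"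
  shows "(LINT x|lborel_on K. ramp' k \<delta> (u x) * (1 + (\<Lambda> * max 0 (u x - k)) powr p))
    \<le> measure lborel (super_level K k) + \<Lambda> powr p * excess K k"
    and "integrable (lborel_on K) (\<lambda>x. ramp' k \<delta> (u x) * (1 + (\<Lambda> * max 0 (u x - k)) powr p))"
proof -
  let ?M = "lborel_on K"
  note mr = borel_measurable_lborel_on
  have [measurable]: "K \<in> sets borel" by (rule compact_measurable[OF K(1)])
  have [measurable]: "ramp' k \<delta> \<in> borel_measurable borel"
    using ramp'_continuous borel_measurable_continuous_onI by blast
  have i1: "integrable ?M (\<lambda>x. (\<Lambda> * max 0 (u x - k)) powr p)"
    using integrable_mult_right[OF pos_part_powr_integrable[OF K, of k], of "\<Lambda> powr p"] by (simp add: powr_mult)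
  have i2: "integrable ?M (\<lambda>x. 1 + (\<Lambda> * max 0 (u x - k)) powr p)"
    by (intro Bochner_Integration.integrable_add integrable_const_on K i1)
  show i: "integrable ?M (\<lambda>x. ramp' k \<delta> (u x) * (1 + (\<Lambda> * max 0 (u x - k)) powr p))"
    by (intro integrable_bounded_factor i2) (auto intro!: mr simp: ramp'_bounds[OF \<delta>] add_nonneg_nonneg)
  have ii: "integrable ?M (\<lambda>x. indicator (super_level K k) x * (1::real))"
    by (intro integrable_bounded_factor integrable_const_on K) (auto intro!: mr simp: indicator_def)
  have "(LINT x|?M. ramp' k \<delta> (u x) * (1 + (\<Lambda> * max 0 (u x - k)) powr p))
     \<le> (LINT x|?M. indicator (super_level K k) x * (1::real) + \<Lambda> powr p * (max 0 (u x - k)) powr p)"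
  proof (rule integral_mono[OF i])
    show "integrable ?M (\<lambda>x. indicator (super_level K k) x * (1::real) + \<Lambda> powr p * (max 0 (u x - k)) powr p)"
      by (intro Bochner_Integration.integrable_add ii integrable_mult_right pos_part_powr_integrable K)
    fix x assume "x \<in> space ?M"
    then have x: "x \<in> K" by (simp add: space_restrict_space)
    show "ramp' k \<delta> (u x) * (1 + (\<Lambda> * max 0 (u x - k)) powr p) \<le> indicator (super_level K k) x * (1::real) + \<Lambda> powr p * (max 0 (u x - k)) powr p"
    proof (cases "k < u x")
      case True
      then have "ramp' k \<delta> (u x) * (1 + (\<Lambda> * max 0 (u x - k)) powr p) \<le> 1 * (1 + (\<Lambda> * max 0 (u x - k)) powr p)"
        using ramp'_bounds[OF \<delta>] by (intro mult_right_mono) (auto simp: add_nonneg_nonneg)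
      then show ?thesis using True x by (simp add: super_level_def powr_mult)
    next
      case False
      then show ?thesis using ramp'_eq_0[OF \<delta>, of "u x" k] by simp
    qed
  qed
  also have "\<dots> = measure lborel (super_level K k) + \<Lambda> powr p * excess K k"
  proof -
    have "(LINT x|?M. indicator (super_level K k) x * (1::real)) = (LINT x|lborel. indicator K x *\<^sub>R (indicator (super_level K k) x * (1::real)))"
      by (rule integral_restrict_space) simp
    also have "\<dots> = (LINT x|lborel. indicator (super_level K k) x)"
      by (intro Bochner_Integration.integral_cong refl) (auto simp: super_level_def indicator_def)
    also have "\<dots> = measure lborel (super_level K k)" by simp
    finally show ?thesis
      unfolding excess_def using ii pos_part_powr_integrable[OF K, of k]
      by (subst Bochner_Integration.integral_add) auto
  qed
  finally show "(LINT x|?M. ramp' k \<delta> (u x) * (1 + (\<Lambda> * max 0 (u x - k)) powr p))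
    \<le> measure lborel (super_level K k) + \<Lambda> powr p * excess K k" .
qed

text \<open>Faber-Krahn applied to \<open>\<eta>\<^sup>N ramp(u)\<close>, which vanishes outside the super-level set and dominates
  \<open>(u - k - \<delta>)\<^sup>+\<close> on \<open>S\<close>; Caccioppoli's inequality bounds its gradient.\<close>

lemma level_estimate:
  fixes k :: real
  assumes K: "compact K" "K \<subseteq> \<Omega>" and \<delta>: "0 < \<delta>" and S: "compact S" "S \<subseteq> K"
    and \<eta>: "C1 \<eta> Z" "\<And>x. 0 \<le> \<eta> x" "\<And>x. \<eta> x \<le> 1" "\<And>x. x \<notin> K \<Longrightarrow> \<eta> x = 0" "\<And>x. norm (Z x) \<le> \<Lambda>"
      "\<And>x. x \<in> S \<Longrightarrow> \<eta> x = 1"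
  shows "excess S (k + \<delta>) \<le> faber_krahn_const TYPE('a) p * 8 powr p * level_const
    * measure lborel (super_level K k) powr (p / DIM('a)) * (measure lborel (super_level K k) + \<Lambda> powr p * excess K k)"
proof -
  define N where "N = caccioppoli_exp"
  have N: "1 \<le> N" "p \<le> N" using exp_ge_p by (auto simp: N_def)
  let ?M = "lborel_on K"
  let ?t = "\<lambda>x. \<Lambda> * max 0 (u x - k)"
  note mr = borel_measurable_lborel_on
  have Km[measurable]: "K \<in> sets borel" "S \<in> sets borel" using compact_measurable K(1) S(1) by auto
  have \<Lambda>: "0 \<le> \<Lambda>" using \<eta>(5)[of undefined] norm_ge_zero order_trans by blast
  have d0: "\<delta> \<noteq> 0" using \<delta> by simp
  note Rb = ramp'_bounds[OF \<delta>]
  have Rabs: "\<bar>ramp' k \<delta> s\<bar> \<le> 1" for s using Rb[of k s] by simp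
  have [measurable]: "ramp' k \<delta> \<in> borel_measurable borel"
    using ramp'_continuous borel_measurable_continuous_onI by blast
  have [measurable]: "\<eta> \<in> borel_measurable borel" "Z \<in> borel_measurable borel" using C1_measurable[OF \<eta>(1)] by auto
  define z where "z x = (real N * \<eta> x ^ (N - 1)) *\<^sub>R Z x" for x
  have Cz: "C1 (\<lambda>x. \<eta> x ^ N) z" unfolding z_def
    by (rule C1_compose[OF \<eta>(1)]) (auto intro!: derivative_eq_intros continuous_intros)
  have Zz: "Z x = 0" if "x \<notin> K" for x
    by (rule C1_zero_outside[OF \<eta>(1), of "- K"]) (use \<eta>(4) K(1) compact_imp_closed that in auto)
  have \<eta>N: "0 \<le> \<eta> x ^ n" "\<eta> x ^ n \<le> 1" for x n using \<eta>(2,3) by (auto intro: power_le_one)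
  have zb: "norm (z x) \<le> real N * \<Lambda>" for x
  proof -
    have "norm (z x) = real N * (\<eta> x ^ (N - 1) * norm (Z x))" using \<eta>N[of x "N - 1"] by (simp add: z_def)
    also have "\<dots> \<le> real N * (1 * \<Lambda>)" using \<eta>N \<eta>(5) by (intro mult_left_mono mult_mono) auto
    finally show ?thesis by simp
  qed
  have "sob p K (\<lambda>x. ramp k \<delta> (u x)) (\<lambda>x. ramp' k \<delta> (u x) *\<^sub>R G x)"
    using emeasure_compact_finite[OF K(1)]
    by (intro sob_compose[OF p_facts(1) sob_compact[OF K] Km(1) _ ramp_DERIV[OF d0] ramp'_continuous Rabs]) auto
  define f where "f x = \<eta> x ^ N * ramp k \<delta> (u x)" for x
  define F where "F x = \<eta> x ^ N *\<^sub>R (ramp' k \<delta> (u x) *\<^sub>R G x) + ramp k \<delta> (u x) *\<^sub>R z x" for x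
  have sf: "sob p UNIV f F" unfolding f_def F_def
  proof (rule sob_mult[OF p_facts(1) \<open>sob p K _ _\<close> Km(1) Cz])
    show "\<eta> x ^ N = 0" if "x \<notin> K" for x using \<eta>(4)[OF that] N by simp
    show "z x = 0" if "x \<notin> K" for x using Zz[OF that] by (simp add: z_def)
    show "\<bar>\<eta> x ^ N\<bar> \<le> 1 + real N * \<Lambda>" for x using \<eta>N[of x N] \<Lambda> by (simp add: add_increasing2)
    show "norm (z x) \<le> 1 + real N * \<Lambda>" for x using zb[of x] by linarith
  qed
  have fz: "f x = 0" if "x \<notin> super_level K k" for x
    using that \<eta>(4)[of x] N ramp_eq_0[OF \<delta>, of "u x" k] by (auto simp: f_def super_level_def not_less)
  have Fz: "F x = 0" if "x \<notin> K" for x using \<eta>(4)[OF that] Zz[OF that] N by (simp add: F_def z_def)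
  have U: "lborel_on UNIV = (lborel :: 'a measure)"
    by (rule measure_eqI) (auto simp: sets_restrict_space emeasure_restrict_space)
  have Lf: "Lp p lborel f" "Lp p lborel F" using sf by (auto simp: sob_def U)
  have Fp: "norm (F x) powr p \<le> 2 powr p * (\<eta> x ^ N * (ramp' k \<delta> (u x) * norm (G x) powr p) + real N powr p * (ramp' k \<delta> (u x) * (1 + ?t x powr p)))" for x
  proof -
    have R01: "0 \<le> ramp' k \<delta> (u x)" "ramp' k \<delta> (u x) \<le> 1" using Rb by auto
    have le1: "a powr p \<le> a" if "0 \<le> a" "a \<le> 1" for a :: real
      using powr_mono'[of 1 p a] that p by simp
    have "norm (\<eta> x ^ N *\<^sub>R (ramp' k \<delta> (u x) *\<^sub>R G x)) powr p = (\<eta> x ^ N) powr p * (ramp' k \<delta> (u x) powr p * norm (G x) powr p)"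
      using \<eta>N R01 by (simp add: powr_mult)
    also have "\<dots> \<le> \<eta> x ^ N * (ramp' k \<delta> (u x) * norm (G x) powr p)"
      using \<eta>N R01 by (intro mult_mono le1) auto
    finally have 1: "norm (\<eta> x ^ N *\<^sub>R (ramp' k \<delta> (u x) *\<^sub>R G x)) powr p \<le> \<eta> x ^ N * (ramp' k \<delta> (u x) * norm (G x) powr p)" .
    have "norm (ramp k \<delta> (u x) *\<^sub>R z x) \<le> (max 0 (u x - k) * ramp' k \<delta> (u x)) * (real N * \<Lambda>)"
      unfolding norm_scaleR using ramp_nonneg[OF \<delta>] ramp_le[OF \<delta>] zb R01 by (intro mult_mono) auto
    then have "norm (ramp k \<delta> (u x) *\<^sub>R z x) powr p \<le> ((max 0 (u x - k) * ramp' k \<delta> (u x)) * (real N * \<Lambda>)) powr p"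
      using p by (intro powr_mono2) auto
    also have "\<dots> = real N powr p * (ramp' k \<delta> (u x) powr p * ?t x powr p)"
      by (simp add: powr_mult mult_ac)
    also have "\<dots> \<le> real N powr p * (ramp' k \<delta> (u x) * (1 + ?t x powr p))"
      using R01 by (intro mult_left_mono mult_mono le1) auto
    finally have 2: "norm (ramp k \<delta> (u x) *\<^sub>R z x) powr p \<le> real N powr p * (ramp' k \<delta> (u x) * (1 + ?t x powr p))" .
    have "norm (F x) powr p \<le> 2 powr p * (norm (\<eta> x ^ N *\<^sub>R (ramp' k \<delta> (u x) *\<^sub>R G x)) powr p + norm (ramp k \<delta> (u x) *\<^sub>R z x) powr p)"
      unfolding F_def by (rule norm_powr_add_le[OF p_facts(2)])
    also have "\<dots> \<le> 2 powr p * (\<eta> x ^ N * (ramp' k \<delta> (u x) * norm (G x) powr p) + real N powr p * (ramp' k \<delta> (u x) * (1 + ?t x powr p)))"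
      using 1 2 by (intro mult_left_mono add_mono) auto
    finally show ?thesis .
  qed
  define Q where "Q = measure lborel (super_level K k) + \<Lambda> powr p * excess K k"
  note rl = ramp'_integral_le[OF K \<delta> \<Lambda>, of k]
  have iG: "integrable ?M (\<lambda>x. norm (G x) powr p)" using Lp[OF K] Lp_integrable by blast
  have iX: "integrable ?M (\<lambda>x. \<eta> x ^ N * (ramp' k \<delta> (u x) * norm (G x) powr p))"
    by (intro integrable_bounded_factor iG) (auto intro!: mr mult_nonneg_nonneg simp: Rb \<eta>N)
  have "(LINT x|lborel. norm (F x) powr p) = (LINT x|?M. norm (F x) powr p)"
    by (rule integral_on[OF K(1)]) (use Fz p in simp)
  also have "\<dots> \<le> (LINT x|?M. 2 powr p * (\<eta> x ^ N * (ramp' k \<delta> (u x) * norm (G x) powr p) + real N powr p * (ramp' k \<delta> (u x) * (1 + ?t x powr p))))"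
  proof (rule integral_mono)
    show "integrable ?M (\<lambda>x. norm (F x) powr p)"
    proof (subst integrable_restrict_space)
      show "integrable lborel (\<lambda>x. indicator K x *\<^sub>R norm (F x) powr p)"
        by (rule integrable_mult_indicator[OF _ Lp_integrable[OF Lf(2)]]) simp
    qed simp
    show "integrable ?M (\<lambda>x. 2 powr p * (\<eta> x ^ N * (ramp' k \<delta> (u x) * norm (G x) powr p) + real N powr p * (ramp' k \<delta> (u x) * (1 + ?t x powr p))))"
      by (intro integrable_mult_right Bochner_Integration.integrable_add iX rl(2))
  qed (rule Fp)
  also have "\<dots> = 2 powr p * ((LINT x|?M. \<eta> x ^ N * (ramp' k \<delta> (u x) * norm (G x) powr p)) + real N powr p * (LINT x|?M. ramp' k \<delta> (u x) * (1 + ?t x powr p)))"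
    using iX rl(2) by (simp only: integral_mult_right_zero Bochner_Integration.integral_add integrable_mult_right)
  also have "\<dots> \<le> 2 powr p * (caccioppoli_const * Q + real N powr p * Q)"
  proof (intro mult_left_mono add_mono)
    have "(LINT x|?M. \<eta> x ^ N * (ramp' k \<delta> (u x) * norm (G x) powr p)) \<le> caccioppoli_const * (LINT x|?M. ramp' k \<delta> (u x) * (1 + ?t x powr p))"
      unfolding N_def by (rule caccioppoli[OF \<eta>(1-5) K \<delta>])
    also have "\<dots> \<le> caccioppoli_const * Q"
      using rl(1) caccioppoli_const_pos unfolding Q_def by (intro mult_left_mono) auto
    finally show "(LINT x|?M. \<eta> x ^ N * (ramp' k \<delta> (u x) * norm (G x) powr p)) \<le> caccioppoli_const * Q" .
    show "(LINT x|?M. ramp' k \<delta> (u x) * (1 + ?t x powr p)) \<le> Q" using rl(1) by (simp add: Q_def)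
  qed auto
  finally have FQ: "(LINT x|lborel. norm (F x) powr p) \<le> level_const * Q"
    by (simp add: level_const_def N_def algebra_simps)
  have "excess S (k + \<delta>) = (LINT x|lborel. indicator S x *\<^sub>R (max 0 (u x - (k + \<delta>))) powr p)"
    unfolding excess_def by (rule integral_restrict_space) simp
  also have "\<dots> \<le> (LINT x|lborel. \<bar>f x\<bar> powr p)"
  proof (rule integral_mono')
    show "integrable lborel (\<lambda>x. \<bar>f x\<bar> powr p)" using Lp_integrable[OF Lf(1)] by simp
    fix x
    show "indicator S x *\<^sub>R (max 0 (u x - (k + \<delta>))) powr p \<le> \<bar>f x\<bar> powr p"
    proof (cases "x \<in> S")
      case True
      then have "max 0 (u x - (k + \<delta>)) \<le> \<bar>f x\<bar>" using ramp_ge[OF \<delta>, where k=k and s="u x"] ramp_nonneg[OF \<delta>, of k "u x"] \<eta>(6) by (simp add: f_def)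
      then show ?thesis using True p by (auto intro!: powr_mono2)
    qed simp
  qed auto
  also have "\<dots> \<le> faber_krahn_const TYPE('a) p * measure lborel (super_level K k) powr (p / DIM('a)) * (8 powr p * (LINT x|lborel. norm (F x) powr p))"
    by (rule sob_faber_krahn[OF p_facts(1) sf _ finite_super_level[OF K(1)] fz]) measurable
  also have "\<dots> \<le> faber_krahn_const TYPE('a) p * measure lborel (super_level K k) powr (p / DIM('a)) * (8 powr p * (level_const * Q))"
    using FQ by (intro mult_left_mono mult_nonneg_nonneg) (auto simp: faber_krahn_const_def)
  finally show ?thesis by (simp add: Q_def mult_ac)
qed

end

section \<open>De Giorgi iteration\<close>

text \<open>By induction \<open>Y\<^sub>n \<le> \<nu> q\<^sup>n\<close> with \<open>q = b\<^sup>-\<^sup>1\<^sup>/\<^sup>a\<close>: this ratio makes \<open>b q\<^sup>a = 1\<close>, so the growing factor \<open>b\<^sup>n\<close> is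
  compensated exactly.\<close>

lemma fast_geometric_convergence:
  fixes Y :: "nat \<Rightarrow> real"
  assumes Y: "\<And>n. 0 \<le> Y n" and rec: "\<And>n. Y (Suc n) \<le> C * b ^ n * Y n powr (1 + a)"
    and C: "0 < C" and b: "1 < b" and a: "0 < a"
    and Y0: "Y 0 \<le> (b powr (- 1 / a) / C) powr (1 / a)"
  shows "Y \<longlonglongrightarrow> 0"
proof -
  define q where "q = b powr (- 1 / a)"
  have q: "0 < q" "q < 1" using a b by (auto simp: q_def powr_less_one)
  define \<nu> where "\<nu> = (q / C) powr (1 / a)"
  have \<nu>: "0 < \<nu>" using q C by (simp add: \<nu>_def)
  have \<nu>a: "C * \<nu> powr a = q" using q C a by (simp add: \<nu>_def powr_powr)
  have qa: "b * q powr a = 1"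
  proof -
    have "q powr a = b powr (-1)" using a by (simp add: q_def powr_powr)
    then show ?thesis using b by (simp add: powr_minus)
  qed
  have bound: "Y n \<le> \<nu> * q ^ n" for n
  proof (induction n)
    case 0 then show ?case using Y0 by (simp add: \<nu>_def q_def)
  next
    case (Suc n)
    have "Y (Suc n) \<le> C * b ^ n * Y n powr (1 + a)" by (rule rec)
    also have "\<dots> \<le> C * b ^ n * (\<nu> * q ^ n) powr (1 + a)"
      using Suc C b Y[of n] a by (intro mult_left_mono powr_mono2) auto
    also have "(\<nu> * q ^ n) powr (1 + a) = (\<nu> * q ^ n) * (\<nu> powr a * (q powr a) ^ n)"
    proof -
      have "(\<nu> * q ^ n) powr (1 + a) = (\<nu> * q ^ n) * (\<nu> * q ^ n) powr a"
        using \<nu> q by (simp add: powr_add)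
      also have "(\<nu> * q ^ n) powr a = \<nu> powr a * (q powr a) ^ n"
        using q by (simp add: powr_mult powr_realpow[symmetric] powr_powr mult.commute)
      finally show ?thesis .
    qed
    also have "C * b ^ n * ((\<nu> * q ^ n) * (\<nu> powr a * (q powr a) ^ n)) = (C * \<nu> powr a) * (\<nu> * q ^ n) * (b * q powr a) ^ n"
      by (simp add: power_mult_distrib mult_ac)
    also have "\<dots> = \<nu> * q ^ Suc n" unfolding \<nu>a qa by simp
    finally show ?case .
  qed
  have "(\<lambda>n. \<nu> * q ^ n) \<longlonglongrightarrow> 0"
    using tendsto_mult_right_zero[OF LIMSEQ_power_zero[of q], of \<nu>] q by simp
  then show ?thesis
    by (rule tendsto_sandwich[OF _ _ tendsto_const, rotated 2]) (use Y bound in auto)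
qed

context quasilinear_equation
begin

lemma excess_nonneg: "0 \<le> excess S k"
  unfolding excess_def by simp

lemma excess_mono:
  assumes "compact K" "K \<subseteq> \<Omega>" "compact S" "S \<subseteq> K" "k \<le> l"
  shows "excess S l \<le> excess K k"
proof -
  have [measurable]: "K \<in> sets borel" "S \<in> sets borel" using compact_measurable assms by auto
  have "excess S l = (LINT x|lborel. indicator S x *\<^sub>R (max 0 (u x - l)) powr p)"
    unfolding excess_def by (rule integral_restrict_space) simp
  also have "\<dots> \<le> (LINT x|lborel. indicator K x *\<^sub>R (max 0 (u x - k)) powr p)"
  proof (rule integral_mono')
    show "integrable lborel (\<lambda>x. indicator K x *\<^sub>R (max 0 (u x - k)) powr p)"
      using pos_part_powr_integrable[OF assms(1,2), of k] by (subst (asm) integrable_restrict_space) auto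
    fix x
    have "(max 0 (u x - l)) powr p \<le> (max 0 (u x - k)) powr p" using p assms(5) by (intro powr_mono2) auto
    then show "indicator S x *\<^sub>R (max 0 (u x - l)) powr p \<le> indicator K x *\<^sub>R (max 0 (u x - k)) powr p"
      using assms(4) by (auto simp: indicator_def)
  qed auto
  also have "\<dots> = excess K k"
    unfolding excess_def by (rule integral_restrict_space[symmetric]) simp
  finally show ?thesis .
qed

text \<open>Chebyshev's inequality.\<close>

lemma super_level_le_excess:
  assumes K: "compact K" "K \<subseteq> \<Omega>" and \<delta>: "0 < \<delta>"
  shows "measure lborel (super_level K (k + \<delta>)) * \<delta> powr p \<le> excess K k"
proof -
  have [measurable]: "K \<in> sets borel" using compact_measurable K by auto
  have "measure lborel (super_level K (k + \<delta>)) * \<delta> powr p = (LINT x|lborel. indicator (super_level K (k + \<delta>)) x *\<^sub>R \<delta> powr p)"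
    using finite_super_level[OF K(1), of "k + \<delta>"] by (subst integral_scaleR_left) (auto simp: less_top)
  also have "\<dots> \<le> (LINT x|lborel. indicator K x *\<^sub>R (max 0 (u x - k)) powr p)"
  proof (rule integral_mono')
    show "integrable lborel (\<lambda>x. indicator K x *\<^sub>R (max 0 (u x - k)) powr p)"
      using pos_part_powr_integrable[OF K, of k] by (subst (asm) integrable_restrict_space) auto
    fix x
    show "indicator (super_level K (k + \<delta>)) x *\<^sub>R \<delta> powr p \<le> indicator K x *\<^sub>R (max 0 (u x - k)) powr p"
      using \<delta> p by (auto simp: super_level_def indicator_def intro!: powr_mono2)
  qed auto
  also have "\<dots> = excess K k"
    unfolding excess_def by (rule integral_restrict_space[symmetric]) simp
  finally show ?thesis .
qed

definition ball_const :: real where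
  "ball_const = faber_krahn_const TYPE('a) p * 8 powr p * level_const"

lemma ball_const_pos: "0 < ball_const"
proof -
  have "0 < unit_ball_vol (real DIM('a))" by simp
  then have "0 < 2 * 2 powr p / unit_ball_vol (real DIM('a))" by (intro divide_pos_pos) auto
  then have z: "0 < (2 * 2 powr p / unit_ball_vol (real DIM('a))) powr (p / real DIM('a))"
    unfolding powr_gt_zero by linarith
  then have "0 < faber_krahn_const TYPE('a) p"
    unfolding faber_krahn_const_def by (intro mult_pos_pos z) auto
  moreover have "0 < level_const" unfolding level_const_def
    using caccioppoli_const_pos by (intro mult_pos_pos add_pos_nonneg) auto
  ultimately show ?thesis unfolding ball_const_def by simp
qed

lemma ball_level_estimate:
  assumes R: "0 < R1" "R1 < R2" and K: "cball x0 R2 \<subseteq> \<Omega>" and \<delta>: "0 < \<delta>"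
  shows "excess (cball x0 R1) (k + \<delta>) \<le> ball_const
    * measure lborel (super_level (cball x0 R2) k) powr (p / DIM('a))
    * (measure lborel (super_level (cball x0 R2) k) + (4 / (R2 - R1)) powr p * excess (cball x0 R2) k)"
proof -
  obtain \<eta> Z where eta: "C1 \<eta> Z" "\<And>x. 0 \<le> \<eta> x" "\<And>x. \<eta> x \<le> 1" "\<And>x. x \<in> cball x0 R1 \<Longrightarrow> \<eta> x = 1"
    "\<And>x. x \<notin> cball x0 R2 \<Longrightarrow> \<eta> x = 0" "\<And>x. norm (Z x) \<le> 4 / (R2 - R1)"
    using ball_cutoff[OF R, of x0] by metis
  show ?thesis unfolding ball_const_def
    by (rule level_estimate[OF compact_cball K \<delta> compact_cball _ eta(1,2,3,5,6,4)]) (use R in auto)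
qed

definition dg_const :: real where
  "dg_const = 2 * ball_const * 8 powr (p * (1 + p / DIM('a)))"

definition dg_base :: real where
  "dg_base = 2 powr (p * (1 + p / DIM('a)))"

definition dg_nu :: real where
  "dg_nu = (dg_base powr (- 1 / (p / DIM('a))) / dg_const) powr (1 / (p / DIM('a)))"

lemma dg_pos: "0 < dg_const" "1 < dg_base" "0 < dg_nu"
proof -
  show c: "0 < dg_const" using ball_const_pos by (simp add: dg_const_def)
  have "0 < p * (1 + p / DIM('a))" using p by (intro mult_pos_pos add_pos_nonneg) auto
  then show b: "1 < dg_base" unfolding dg_base_def by (intro gr_one_powr) auto
  show "0 < dg_nu" using c b unfolding dg_nu_def by simp
qed

text \<open>Normalised excesses over increasing levels on decreasing balls. The condition \<open>R \<le> \<mu>\<close> lets the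
  gradient term of the level estimate dominate the inhomogeneous one, and the normalisation removes all
  dependence on \<open>R\<close> and \<open>\<mu>\<close>.\<close>

lemma dg_step:
  fixes x0 :: 'a and k :: real and n :: nat
  assumes R: "0 < R" and \<mu>: "R \<le> \<mu>" and K: "cball x0 (2 * R) \<subseteq> \<Omega>"
  defines "Y \<equiv> \<lambda>n. excess (cball x0 (R * (1 + (1/2) ^ n))) (k + \<mu> * (1 - (1/2) ^ n)) / (\<mu> powr p * R ^ DIM('a))"
  shows "Y (Suc n) \<le> dg_const * dg_base ^ n * Y n powr (1 + p / DIM('a))"
proof -
  define a where "a = p / real DIM('a)"
  have a: "0 < a" using p by (simp add: a_def)
  define h where "h = (1/2::real) ^ n"
  have h: "0 < h" "h \<le> 1" by (auto simp: h_def power_le_one)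
  define R1 where "R1 = R * (1 + h / 2)"
  define R2 where "R2 = R * (1 + h)"
  define k1 where "k1 = k + \<mu> * (1 - h)"
  \<comment> \<open>The level rises by \<open>2\<delta>\<close>: the first half pays for Chebyshev's inequality, the second for the level estimate.\<close>
  define \<delta> where "\<delta> = \<mu> * h / 4"
  define D where "D = R ^ DIM('a)"
  have \<mu>0: "0 < \<mu>" using R \<mu> by simp
  have \<delta>: "0 < \<delta>" using \<mu>0 h by (simp add: \<delta>_def)
  have D: "0 < D" using R by (simp add: D_def)
  have R12: "0 < R1" "R1 < R2" "R2 - R1 = R * h / 2" using R h by (auto simp: R1_def R2_def field_simps add_pos_pos)
  have R2K: "cball x0 R2 \<subseteq> \<Omega>"
  proof -
    have "R2 \<le> 2 * R" using R h by (simp add: R2_def)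
    then have "cball x0 R2 \<subseteq> cball x0 (2 * R)" by (rule subset_cball)
    then show ?thesis using K by blast
  qed
  define y where "y = excess (cball x0 R2) k1 / (\<mu> powr p * D)"
  have y0: "0 \<le> y" using excess_nonneg D by (simp add: y_def)
  have ex: "excess (cball x0 R2) k1 = y * (\<mu> powr p * D)" using \<mu>0 D by (simp add: y_def)
  define m where "m = measure lborel (super_level (cball x0 R2) (k1 + \<delta>))"
  have m0: "0 \<le> m" by (simp add: m_def)
  have m: "m \<le> (4 / h) powr p * y * D"
  proof -
    have "m * \<delta> powr p \<le> y * (\<mu> powr p * D)"
      using super_level_le_excess[OF _ R2K \<delta>, of k1] unfolding m_def ex by simp
    then have "m \<le> y * (\<mu> powr p * D) / \<delta> powr p" using \<delta> by (simp add: pos_le_divide_eq)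
    also have "\<dots> = (\<mu> / \<delta>) powr p * y * D" by (simp add: powr_divide)
    also have "\<mu> / \<delta> = 4 / h" using \<mu>0 by (simp add: \<delta>_def)
    finally show ?thesis .
  qed
  have "excess (cball x0 R1) (k1 + \<delta> + \<delta>) \<le> ball_const * m powr a * (m + (4 / (R2 - R1)) powr p * excess (cball x0 R2) (k1 + \<delta>))"
    unfolding m_def a_def by (rule ball_level_estimate[OF R12(1,2) R2K \<delta>])
  also have "\<dots> \<le> ball_const * ((4 / h) powr p * y * D) powr a * ((4 / h) powr p * y * D + (8 / (R * h)) powr p * (y * (\<mu> powr p * D)))"
  proof (intro mult_mono add_mono)
    show "m powr a \<le> ((4 / h) powr p * y * D) powr a" using m m0 a by (intro powr_mono2) auto
    show "(4 / (R2 - R1)) powr p \<le> (8 / (R * h)) powr p" unfolding R12(3) by simp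
    show "excess (cball x0 R2) (k1 + \<delta>) \<le> y * (\<mu> powr p * D)"
      unfolding ex[symmetric] using \<delta> R2K by (intro excess_mono) auto
  qed (use m m0 ball_const_pos y0 D excess_nonneg in auto)
  also have "\<dots> \<le> ball_const * ((8 / h) powr p * y * D) powr a * (2 * ((8 / h) powr p * y * D * (\<mu> / R) powr p))"
  proof (intro mult_mono)
    have le: "(4 / h) powr p * y * D \<le> (8 / h) powr p * y * D"
      using h y0 D p by (intro mult_right_mono powr_mono2) (auto intro: divide_right_mono)
    then show "((4 / h) powr p * y * D) powr a \<le> ((8 / h) powr p * y * D) powr a"
      using a y0 D by (intro powr_mono2) auto
    have "(4 / h) powr p * y * D \<le> (8 / h) powr p * y * D * (\<mu> / R) powr p"
    proof -
      have "1 \<le> (\<mu> / R) powr p" using \<mu> R p by (intro ge_one_powr_ge_zero) auto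
      then have "(8 / h) powr p * y * D * 1 \<le> (8 / h) powr p * y * D * (\<mu> / R) powr p"
        using y0 D by (intro mult_left_mono) auto
      then show ?thesis using le by simp
    qed
    moreover have "(8 / (R * h)) powr p * (y * (\<mu> powr p * D)) = (8 / h) powr p * y * D * (\<mu> / R) powr p"
      by (simp add: powr_divide powr_mult mult_ac)
    ultimately show "(4 / h) powr p * y * D + (8 / (R * h)) powr p * (y * (\<mu> powr p * D)) \<le> 2 * ((8 / h) powr p * y * D * (\<mu> / R) powr p)"
      by linarith
  qed (use ball_const_pos y0 D in auto)
  also have "\<dots> = 2 * ball_const * (((8 / h) powr p * y) powr a * ((8 / h) powr p * y)) * (D powr a * (\<mu> / R) powr p * D)"
    by (simp add: powr_mult mult_ac)
  also have "D powr a * (\<mu> / R) powr p * D = \<mu> powr p * D"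
  proof -
    have "D powr a = R powr p" using R by (simp add: D_def a_def powr_realpow[symmetric] powr_powr)
    then show ?thesis using R by (simp add: powr_divide)
  qed
  also have "((8 / h) powr p * y) powr a * ((8 / h) powr p * y) = ((8 / h) powr p * y) powr (1 + a)"
    using y0 by (cases "y = 0") (auto simp: powr_add)
  also have "\<dots> = (8 / h) powr (p * (1 + a)) * y powr (1 + a)" by (simp add: powr_mult powr_powr)
  also have "(8 / h) powr (p * (1 + a)) = 8 powr (p * (1 + a)) * dg_base ^ n"
  proof -
    have "8 / h = 8 * 2 ^ n" by (simp add: h_def power_divide)
    then have "(8 / h) powr (p * (1 + a)) = 8 powr (p * (1 + a)) * (2 ^ n) powr (p * (1 + a))"
      by (simp add: powr_mult)
    also have "(2 ^ n) powr (p * (1 + a)) = dg_base ^ n"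
      by (simp add: dg_base_def a_def powr_realpow[symmetric] powr_powr mult.commute)
    finally show ?thesis .
  qed
  finally have main: "excess (cball x0 R1) (k1 + \<delta> + \<delta>) \<le> dg_const * dg_base ^ n * y powr (1 + a) * (\<mu> powr p * D)"
    by (simp add: dg_const_def a_def mult_ac)
  have Yn: "Y n = y" unfolding Y_def y_def R2_def k1_def D_def h_def ..
  have "k1 + \<delta> + \<delta> = k + \<mu> * (1 - (1/2) ^ Suc n)" by (simp add: k1_def \<delta>_def h_def algebra_simps)
  moreover have "R1 = R * (1 + (1/2) ^ Suc n)" by (simp add: R1_def h_def)
  ultimately have "Y (Suc n) = excess (cball x0 R1) (k1 + \<delta> + \<delta>) / (\<mu> powr p * D)"
    by (simp add: Y_def D_def)
  also have "\<dots> \<le> dg_const * dg_base ^ n * y powr (1 + a)"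
    using main \<mu>0 D by (simp add: pos_divide_le_eq)
  finally show ?thesis by (simp add: Yn a_def)
qed

text \<open>The excesses over the levels \<open>k + \<mu> (1 - 2\<^sup>-\<^sup>n)\<close> on balls of radius \<open>R (1 + 2\<^sup>-\<^sup>n)\<close> tend to zero, and each of them
  bounds the excess over \<open>k + \<mu>\<close> on the ball of radius \<open>R\<close>.\<close>

theorem de_giorgi_sup_bound:
  assumes R: "0 < R" and \<mu>: "R \<le> \<mu>" and K: "cball x0 (2 * R) \<subseteq> \<Omega>"
    and small: "excess (cball x0 (2 * R)) k \<le> dg_nu * \<mu> powr p * R ^ DIM('a)"
  shows "AE x in lborel. x \<in> cball x0 R \<longrightarrow> u x \<le> k + \<mu>"
proof -
  define Y where "Y n = excess (cball x0 (R * (1 + (1/2) ^ n))) (k + \<mu> * (1 - (1/2) ^ n)) / (\<mu> powr p * R ^ DIM('a))" for n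
  have \<mu>0: "0 < \<mu>" using R \<mu> by simp
  define D where "D = \<mu> powr p * R ^ DIM('a)"
  have D: "0 < D" using R \<mu>0 by (simp add: D_def)
  have "Y \<longlonglongrightarrow> 0"
  proof (rule fast_geometric_convergence)
    show "0 \<le> Y n" for n using excess_nonneg R by (simp add: Y_def)
    show "Y (Suc n) \<le> dg_const * dg_base ^ n * Y n powr (1 + p / DIM('a))" for n
      unfolding Y_def by (rule dg_step[OF R \<mu> K])
    show "0 < p / DIM('a)" using p by simp
    have "Y 0 = excess (cball x0 (2 * R)) k / D" by (simp add: Y_def D_def mult.commute)
    also have "\<dots> \<le> dg_nu" using small D by (simp add: D_def pos_divide_le_eq mult.assoc)
    finally show "Y 0 \<le> (dg_base powr (- 1 / (p / DIM('a))) / dg_const) powr (1 / (p / DIM('a)))"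
      by (simp only: dg_nu_def)
  qed (use dg_pos in auto)
  then have lim: "(\<lambda>n. Y n * D) \<longlonglongrightarrow> 0" by (rule tendsto_mult_left_zero)
  have RK: "cball x0 R \<subseteq> \<Omega>" using subset_cball[of R "2 * R" x0] R K by auto
  have "excess (cball x0 R) (k + \<mu>) \<le> Y n * D" for n
  proof -
    have h: "0 \<le> (1/2::real) ^ n" "(1/2::real) ^ n \<le> 1" by (auto simp: power_le_one)
    have "excess (cball x0 R) (k + \<mu>) \<le> excess (cball x0 (R * (1 + (1/2) ^ n))) (k + \<mu> * (1 - (1/2) ^ n))"
    proof (rule excess_mono)
      have "R * (1 + (1/2) ^ n) \<le> R * 2" using h R by (intro mult_left_mono) auto
      then show "cball x0 (R * (1 + (1/2) ^ n)) \<subseteq> \<Omega>" using subset_cball[of _ "2 * R" x0] K by (auto simp: mult.commute)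
      show "cball x0 R \<subseteq> cball x0 (R * (1 + (1/2) ^ n))" using R h by (intro subset_cball) simp
      show "k + \<mu> * (1 - (1/2) ^ n) \<le> k + \<mu>" using \<mu>0 h by simp
    qed auto
    also have "\<dots> = Y n * D" using D unfolding Y_def D_def[symmetric] by simp
    finally show ?thesis .
  qed
  then have "excess (cball x0 R) (k + \<mu>) \<le> 0" by (intro LIMSEQ_le_const[OF lim]) auto
  then have z: "excess (cball x0 R) (k + \<mu>) = 0" using excess_nonneg by (simp add: order_antisym)
  have "AE x in lborel_on (cball x0 R). (max 0 (u x - (k + \<mu>))) powr p = 0"
    using z integral_nonneg_eq_0_iff_AE[OF pos_part_powr_integrable[OF _ RK, of "k + \<mu>"]]
    by (simp add: excess_def)
  then have "AE x in lborel_on (cball x0 R). u x \<le> k + \<mu>"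
    by eventually_elim (simp add: max_def split: if_splits)
  then show ?thesis by (subst (asm) AE_restrict_space_iff) auto
qed

end

section \<open>Reduction of the oscillation\<close>

context quasilinear_equation
begin

definition vol :: "real \<Rightarrow> real" where
  "vol r = unit_ball_vol (real DIM('a)) * r ^ DIM('a)"

lemma measure_cball: "0 \<le> r \<Longrightarrow> measure lborel (cball (x::'a) r) = vol r"
  by (simp add: vol_def content_cball)

lemma vol_pos: "0 < r \<Longrightarrow> 0 < vol r"
  by (simp add: vol_def)

lemma vol_double: "vol (2 * r) = 2 ^ DIM('a) * vol r"
  by (simp add: vol_def power_mult_distrib)

lemma measure_mono_on:
  assumes "compact K" "S \<subseteq> T" "T \<subseteq> K" "S \<in> sets borel" "T \<in> sets borel"
  shows "measure lborel S \<le> measure lborel (T :: 'a set)"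
proof (rule measure_mono_fmeasurable[OF assms(2)])
  show "T \<in> fmeasurable lborel"
    using emeasure_mono[OF assms(3), of lborel] emeasure_compact_finite[OF assms(1)] compact_measurable[OF assms(1)] assms(5)
    by (auto simp: fmeasurable_def intro: le_less_trans)
qed (use assms in auto)

lemma super_level_subset: "super_level S k \<subseteq> S"
  by (auto simp: super_level_def)

lemma excess_le:
  assumes K: "compact K" "K \<subseteq> \<Omega>" and H: "0 \<le> H" and AE: "AE x in lborel. x \<in> K \<longrightarrow> u x \<le> k + H"
  shows "excess K k \<le> H powr p * measure lborel (super_level K k)"
proof -
  have [measurable]: "K \<in> sets borel" using compact_measurable K by auto
  have "excess K k = (LINT x|lborel. indicator K x *\<^sub>R (max 0 (u x - k)) powr p)"
    unfolding excess_def by (rule integral_restrict_space) simp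
  also have "\<dots> \<le> (LINT x|lborel. indicator (super_level K k) x *\<^sub>R H powr p)"
  proof (rule integral_mono_AE)
    show "integrable lborel (\<lambda>x. indicator K x *\<^sub>R (max 0 (u x - k)) powr p)"
      using pos_part_powr_integrable[OF K, of k] by (subst (asm) integrable_restrict_space) auto
    show "integrable lborel (\<lambda>x. indicator (super_level K k) x *\<^sub>R H powr p)"
      using finite_super_level[OF K(1), of k] by (intro integrable_scaleR_left) (auto simp: less_top)
    show "AE x in lborel. indicator K x *\<^sub>R (max 0 (u x - k)) powr p \<le> indicator (super_level K k) x *\<^sub>R H powr p"
      using AE
    proof eventually_elim
      case (elim x)
      then show ?case using p H by (auto simp: super_level_def indicator_def intro!: powr_mono2)
    qed
  qed
  also have "\<dots> = H powr p * measure lborel (super_level K k)"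
    using finite_super_level[OF K(1), of k] by (subst integral_scaleR_left) (auto simp: less_top)
  finally show ?thesis .
qed

definition grad_const :: real where
  "grad_const = caccioppoli_const * (1 + 2 powr p)"

lemma grad_const_pos: "0 < grad_const"
  unfolding grad_const_def using caccioppoli_const_pos by (intro mult_pos_pos add_pos_nonneg) auto

text \<open>Caccioppoli's inequality on a fixed pair of balls, where \<open>u - k \<le> H\<close> and the inhomogeneous terms are
  dominated because \<open>H \<ge> R\<close>.\<close>

lemma gradient_bound:
  assumes R: "0 < R" and K: "cball x0 (4 * R) \<subseteq> \<Omega>" and H: "R \<le> H" and \<delta>: "0 < \<delta>"
    and AE: "AE x in lborel. x \<in> cball x0 (4 * R) \<longrightarrow> u x \<le> k + H"
  shows "integrable (lborel_on (cball x0 (2 * R))) (\<lambda>x. ramp' k \<delta> (u x) * norm (G x) powr p)" (is ?i)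
    and "(LINT x|lborel_on (cball x0 (2 * R)). ramp' k \<delta> (u x) * norm (G x) powr p)
      \<le> grad_const * (H / R) powr p * vol (4 * R)" (is ?b)
proof -
  let ?K = "cball x0 (4 * R)" and ?B = "cball x0 (2 * R)"
  have BK: "?B \<subseteq> ?K" using R by (intro subset_cball) simp
  obtain \<eta> Z where eta: "C1 \<eta> Z" "\<And>x. 0 \<le> \<eta> x" "\<And>x. \<eta> x \<le> 1" "\<And>x. x \<in> ?B \<Longrightarrow> \<eta> x = 1"
    "\<And>x. x \<notin> ?K \<Longrightarrow> \<eta> x = 0" "\<And>x. norm (Z x) \<le> 4 / (4 * R - 2 * R)"
    using ball_cutoff[of "2 * R" "4 * R" x0] R by (metis mult_less_cancel_right_pos mult_pos_pos numeral_less_iff semiring_norm(76) semiring_norm(78) zero_less_numeral)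
  have \<Lambda>: "4 / (4 * R - 2 * R) = 2 / R" by simp
  note mr = borel_measurable_lborel_on
  note Rb = ramp'_bounds[OF \<delta>]
  have [measurable]: "ramp' k \<delta> \<in> borel_measurable borel"
    using ramp'_continuous borel_measurable_continuous_onI by blast
  have [measurable]: "\<eta> \<in> borel_measurable borel" using C1_measurable[OF eta(1)] by auto
  have [measurable]: "?B \<in> sets borel" "?K \<in> sets borel" by auto
  have iG: "integrable (lborel_on S) (\<lambda>x. norm (G x) powr p)" if "compact S" "S \<subseteq> \<Omega>" for S using Lp[OF that] Lp_integrable by blast
  have BO: "?B \<subseteq> \<Omega>" using BK K by blast
  show i: ?i by (intro integrable_bounded_factor iG BO) (auto intro!: mr simp: Rb)
  have \<eta>N: "0 \<le> \<eta> x ^ n" "\<eta> x ^ n \<le> 1" for x n using eta(2,3) by (auto intro: power_le_one)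
  have iX: "integrable (lborel_on ?K) (\<lambda>x. \<eta> x ^ caccioppoli_exp * (ramp' k \<delta> (u x) * norm (G x) powr p))"
    by (intro integrable_bounded_factor iG K) (auto intro!: mr mult_nonneg_nonneg simp: Rb \<eta>N)
  have HR: "1 \<le> (H / R) powr p" using R H p by (intro ge_one_powr_ge_zero) auto
  have sl: "measure lborel (super_level ?K k) \<le> vol (4 * R)"
    using measure_mono_on[of ?K "super_level ?K k" ?K] super_level_subset measure_cball[of "4 * R" x0] R by simp
  have v0: "0 < vol (4 * R)" using R vol_pos by simp
  have "(LINT x|lborel_on ?B. ramp' k \<delta> (u x) * norm (G x) powr p)
    = (LINT x|lborel. indicator ?B x *\<^sub>R (ramp' k \<delta> (u x) * norm (G x) powr p))"
    by (rule integral_restrict_space) simp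
  also have "\<dots> \<le> (LINT x|lborel. indicator ?K x *\<^sub>R (\<eta> x ^ caccioppoli_exp * (ramp' k \<delta> (u x) * norm (G x) powr p)))"
  proof (rule integral_mono')
    show "integrable lborel (\<lambda>x. indicator ?K x *\<^sub>R (\<eta> x ^ caccioppoli_exp * (ramp' k \<delta> (u x) * norm (G x) powr p)))"
      using iX by (subst (asm) integrable_restrict_space) auto
    fix x
    show "indicator ?B x *\<^sub>R (ramp' k \<delta> (u x) * norm (G x) powr p) \<le> indicator ?K x *\<^sub>R (\<eta> x ^ caccioppoli_exp * (ramp' k \<delta> (u x) * norm (G x) powr p))"
    proof (cases "x \<in> ?B")
      case True
      then have "x \<in> ?K" using BK by blast
      then show ?thesis using eta(4)[OF True] True by simp
    next
      case False
      then show ?thesis using Rb \<eta>N by (auto simp: indicator_def)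
    qed
    show "0 \<le> indicator ?K x *\<^sub>R (\<eta> x ^ caccioppoli_exp * (ramp' k \<delta> (u x) * norm (G x) powr p))"
      using Rb \<eta>N by (auto simp: indicator_def)
  qed
  also have "\<dots> = (LINT x|lborel_on ?K. \<eta> x ^ caccioppoli_exp * (ramp' k \<delta> (u x) * norm (G x) powr p))"
    by (rule integral_restrict_space[symmetric]) simp
  also have "\<dots> \<le> caccioppoli_const * (LINT x|lborel_on ?K. ramp' k \<delta> (u x) * (1 + (2 / R * max 0 (u x - k)) powr p))"
    by (rule caccioppoli[OF eta(1,2,3,5) _ compact_cball K \<delta>]) (use eta(6) \<Lambda> in auto)
  also have "\<dots> \<le> caccioppoli_const * (measure lborel (super_level ?K k) + (2 / R) powr p * excess ?K k)"
    using caccioppoli_const_pos R by (intro mult_left_mono ramp'_integral_le[OF _ K \<delta>]) auto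
  also have "\<dots> \<le> caccioppoli_const * (vol (4 * R) * (H / R) powr p + (2 / R) powr p * (H powr p * vol (4 * R)))"
  proof (intro mult_left_mono add_mono)
    have "vol (4 * R) * 1 \<le> vol (4 * R) * (H / R) powr p" using HR v0 by (intro mult_left_mono) auto
    then show "measure lborel (super_level ?K k) \<le> vol (4 * R) * (H / R) powr p" using sl by simp
    have "excess ?K k \<le> H powr p * measure lborel (super_level ?K k)"
      by (rule excess_le[OF _ K _ AE]) (use R H in auto)
    also have "\<dots> \<le> H powr p * vol (4 * R)" using sl by (intro mult_left_mono) auto
    finally show "excess ?K k \<le> H powr p * vol (4 * R)" .
  qed (use caccioppoli_const_pos in auto)
  also have "\<dots> = grad_const * (H / R) powr p * vol (4 * R)"
    by (simp add: grad_const_def powr_divide algebra_simps)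
  finally show ?b .
qed

definition shrink_const :: real where
  "shrink_const = 256 * 2 ^ DIM('a)"

text \<open>Passing from the level \<open>k\<close> to \<open>k + H/2\<close> costs measure: the isoperimetric inequality for \<open>u\<close> truncated between
  the two levels bounds the upper set by the integral of \<open>\<bar>Du\<bar>\<close> over the strip in between. Young's inequality
  splits this into the measure of the strip and the \<open>p\<close>-energy, with the ratio controlled by \<open>\<theta>\<close>.\<close>

lemma shrink_step:
  assumes R: "0 < R" and K: "cball x0 (4 * R) \<subseteq> \<Omega>" and H: "R \<le> H" and \<theta>: "0 < \<theta>"
    and AE: "AE x in lborel. x \<in> cball x0 (4 * R) \<longrightarrow> u x \<le> k + H"
    and half: "vol (2 * R) / 2 \<le> measure lborel {x \<in> cball x0 (2 * R). u x \<le> k}"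
  defines "A \<equiv> \<lambda>l. measure lborel (super_level (cball x0 (2 * R)) l)"
  shows "A (k + H / 2) \<le> shrink_const * ((A k - A (k + H / 2)) / \<theta> + \<theta> powr (p - 1) * grad_const * 2 ^ DIM('a) * vol (2 * R))"
proof -
  let ?K = "cball x0 (4 * R)" and ?B = "cball x0 (2 * R)"
  let ?M = "lborel_on ?B"
  have BK: "?B \<subseteq> ?K" using R by (intro subset_cball) simp
  then have BO: "?B \<subseteq> \<Omega>" using K by blast
  have [measurable]: "?B \<in> sets borel" by auto
  define \<delta> where "\<delta> = H / 4"
  have H0: "0 < H" using R H by simp
  have \<delta>: "0 < \<delta>" "\<delta> \<noteq> 0" using H0 by (auto simp: \<delta>_def)
  note Rb = ramp'_bounds[OF \<delta>(1)]
  \<comment> \<open>A smoothed truncation, constant below \<open>k\<close> and above \<open>k + 2\<delta> = k + H/2\<close>, between which it rises by \<open>\<delta>\<close>.\<close>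
  define T where "T s = ramp k \<delta> s - ramp (k + \<delta>) \<delta> s" for s
  define T' where "T' s = ramp' k \<delta> s - ramp' (k + \<delta>) \<delta> s" for s
  have T'c: "continuous_on UNIV T'" unfolding T'_def by (intro continuous_intros ramp'_continuous)
  have [measurable]: "T' \<in> borel_measurable borel" "ramp' k \<delta> \<in> borel_measurable borel"
    using T'c ramp'_continuous borel_measurable_continuous_onI by auto
  have T'0: "0 \<le> T' s" for s using \<delta> by (auto simp: T'_def ramp'_def max_def field_simps)
  have T'R: "T' s \<le> ramp' k \<delta> s" for s using Rb[of "k + \<delta>" s] by (simp add: T'_def)
  have T'1: "T' s \<le> 1" for s using T'R[of s] Rb[of k s] by linarith
  have T'z: "T' s = 0" if "s \<le> k \<or> k + H / 2 < s" for s
    using that \<delta> by (auto simp: T'_def ramp'_def max_def \<delta>_def)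
  have DT: "DERIV T s :> T' s" for s
    unfolding T_def[abs_def] T'_def using \<delta>(2) by (auto intro!: derivative_eq_intros ramp_DERIV)
  have s1: "sob 1 ?B (\<lambda>x. T (u x)) (\<lambda>x. T' (u x) *\<^sub>R G x)"
    using emeasure_compact_finite[of ?B] T'0 T'1
    by (intro sob_compose[OF order_refl sob_1_compact[OF _ BO] _ _ DT T'c, of 1]) auto
  define J where "J = (LINT x|?M. norm (T' (u x) *\<^sub>R G x))"
  define A2 where "A2 = super_level ?B (k + H / 2)"
  define A1 where "A1 = {x \<in> ?B. u x \<le> k}"
  have [measurable]: "A1 \<in> sets borel"
  proof -
    have "{x \<in> space borel. x \<in> ?B \<and> u x \<le> k} \<in> sets borel" by measurable
    then show ?thesis by (simp add: A1_def)
  qed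
  have "\<delta> * measure lborel A1 * measure lborel A2 \<le> 16 * (2 * R) * measure lborel (cball (0::'a) (2 * (2 * R))) * J"
    unfolding J_def
  proof (rule sob_isoperimetric[OF s1, where a=0])
    show "T (u x) \<le> 0" if "x \<in> A1" for x
      using that ramp_eq_0[OF \<delta>(1)] \<delta>(1) by (simp add: A1_def T_def)
    show "0 + \<delta> \<le> T (u x)" if "x \<in> A2" for x
      using that ramp_eq_linear[OF \<delta>(1), of k "u x"] ramp_eq_linear[OF \<delta>(1), of "k + \<delta>" "u x"] H0
      by (simp add: A2_def super_level_def T_def \<delta>_def)
  qed (use R \<delta> in \<open>auto simp: A1_def A2_def super_level_def intro!: super_level_measurable\<close>)
  moreover have "measure lborel (cball (0::'a) (2 * (2 * R))) = vol (4 * R)"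
    using measure_cball[of "4 * R" 0] R by simp
  ultimately have iso: "\<delta> * measure lborel A1 * measure lborel A2 \<le> 32 * R * vol (4 * R) * J" by simp
  define h where "h = H / R"
  have h: "0 < h" using H0 R by (simp add: h_def)
  \<comment> \<open>Scaling the Young weight by \<open>H / R\<close> makes both resulting terms proportional to \<open>H / R\<close>.\<close>
  define \<kappa> where "\<kappa> = h / \<theta>"
  have \<kappa>: "0 < \<kappa>" using h \<theta> by (simp add: \<kappa>_def)
  define D where "D = super_level ?B k - A2"
  have Dm[measurable]: "D \<in> sets borel" unfolding D_def A2_def by (intro sets.Diff super_level_measurable) auto
  have Dsub: "D \<subseteq> ?B" by (auto simp: D_def super_level_def)
  have mD: "measure lborel D = A k - A (k + H / 2)"
    unfolding D_def A2_def A_def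
  proof (rule measure_Diff)
    show "emeasure lborel (super_level ?B k) \<noteq> \<infinity>" using finite_super_level[of ?B k] by simp
    show "super_level ?B (k + H / 2) \<subseteq> super_level ?B k" using H0 by (auto simp: super_level_def)
  qed (auto intro!: super_level_measurable)
  note gb = gradient_bound[OF R K H \<delta>(1) AE]
  have iD: "integrable ?M (\<lambda>x. indicator D x * (1::real))"
    by (intro integrable_bounded_factor integrable_const_on compact_cball)
      (auto intro!: borel_measurable_lborel_on simp: indicator_def)
  have "J \<le> (LINT x|?M. \<kappa> * (indicator D x * 1) + \<kappa> powr (1 - p) * (ramp' k \<delta> (u x) * norm (G x) powr p))"
    unfolding J_def
  proof (rule integral_mono')
    show "integrable ?M (\<lambda>x. \<kappa> * (indicator D x * 1) + \<kappa> powr (1 - p) * (ramp' k \<delta> (u x) * norm (G x) powr p))"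
      by (intro Bochner_Integration.integrable_add integrable_mult_right iD gb(1))
    fix x assume "x \<in> space ?M"
    then have x: "x \<in> ?B" by (simp add: space_restrict_space)
    show "norm (T' (u x) *\<^sub>R G x) \<le> \<kappa> * (indicator D x * 1) + \<kappa> powr (1 - p) * (ramp' k \<delta> (u x) * norm (G x) powr p)"
    proof (cases "T' (u x) = 0")
      case True
      then show ?thesis using \<kappa> Rb by (simp add: indicator_def)
    next
      case False
      then have "k < u x" "u x \<le> k + H / 2" using T'z[of "u x"] by force+
      then have xD: "x \<in> D" using x by (auto simp: D_def A2_def super_level_def)
      have "norm (T' (u x) *\<^sub>R G x) = T' (u x) * norm (G x)" using T'0 by simp
      also have "\<dots> \<le> T' (u x) * (\<kappa> + \<kappa> powr (1 - p) * norm (G x) powr p)"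
        using T'0 le_powr_split[of "norm (G x)" \<kappa> p] \<kappa> p by (intro mult_left_mono) auto
      also have "\<dots> = T' (u x) * \<kappa> + \<kappa> powr (1 - p) * (T' (u x) * norm (G x) powr p)" by (simp add: algebra_simps)
      also have "\<dots> \<le> 1 * \<kappa> + \<kappa> powr (1 - p) * (ramp' k \<delta> (u x) * norm (G x) powr p)"
        using T'1 T'R \<kappa> by (intro add_mono mult_right_mono mult_left_mono) auto
      finally show ?thesis using xD by simp
    qed
  next
    fix x show "0 \<le> \<kappa> * (indicator D x * 1) + \<kappa> powr (1 - p) * (ramp' k \<delta> (u x) * norm (G x) powr p)"
      using \<kappa> Rb by (intro add_nonneg_nonneg mult_nonneg_nonneg) auto
  qed
  also have "\<dots> = \<kappa> * (LINT x|?M. indicator D x * 1) + \<kappa> powr (1 - p) * (LINT x|?M. ramp' k \<delta> (u x) * norm (G x) powr p)"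
    using iD gb(1) by (simp only: integral_mult_right_zero Bochner_Integration.integral_add integrable_mult_right)
  also have "(LINT x|?M. indicator D x * (1::real)) = measure lborel D"
  proof -
    have "(LINT x|?M. indicator D x * (1::real)) = (LINT x|lborel. indicator ?B x *\<^sub>R (indicator D x * (1::real)))"
      by (rule integral_restrict_space) simp
    also have "\<dots> = (LINT x|lborel. indicator D x)"
      by (intro Bochner_Integration.integral_cong refl) (use Dsub in \<open>auto simp: indicator_def\<close>)
    also have "\<dots> = measure lborel D" by simp
    finally show ?thesis .
  qed
  also have "\<kappa> powr (1 - p) * (LINT x|?M. ramp' k \<delta> (u x) * norm (G x) powr p) \<le> \<kappa> powr (1 - p) * (grad_const * h powr p * vol (4 * R))"
    using gb(2) by (intro mult_left_mono) (auto simp: h_def)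
  also have "\<kappa> powr (1 - p) * (grad_const * h powr p * vol (4 * R)) = h * (\<theta> powr (p - 1) * grad_const * vol (4 * R))"
  proof -
    have "\<kappa> powr (1 - p) * h powr p = h * \<theta> powr (p - 1)"
      using h \<theta> by (simp add: \<kappa>_def powr_divide powr_diff field_simps)
    then show ?thesis by (simp add: mult_ac)
  qed
  finally have J: "J \<le> h * ((A k - A (k + H / 2)) / \<theta> + \<theta> powr (p - 1) * grad_const * vol (4 * R))" (is "_ \<le> h * ?Q")
    by (simp add: \<kappa>_def mD algebra_simps diff_divide_distrib)
  define V where "V = vol (2 * R)"
  have V: "0 < V" using R vol_pos by (simp add: V_def)
  have V4: "vol (4 * R) = 2 ^ DIM('a) * V" unfolding V_def using vol_double[of "2 * R"] by simp
  have "H / 4 * (V / 2) * A (k + H / 2) \<le> \<delta> * measure lborel A1 * measure lborel A2"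
    unfolding A_def A2_def \<delta>_def using half H0 V by (intro mult_mono) (auto simp: V_def A1_def intro: less_imp_le)
  also have "\<dots> \<le> 32 * R * vol (4 * R) * J" by (rule iso)
  also have "\<dots> \<le> 32 * R * vol (4 * R) * (h * ?Q)"
    using J R V by (intro mult_left_mono) (auto simp: V4)
  also have "\<dots> = (H * V / 8) * (shrink_const * ?Q)"
    using R by (simp add: h_def shrink_const_def V4)
  finally have "(H * V / 8) * A (k + H / 2) \<le> (H * V / 8) * (shrink_const * ?Q)" by simp
  then have "A (k + H / 2) \<le> shrink_const * ?Q" using H0 V by simp
  then show ?thesis by (simp only: V4 V_def mult.assoc)
qed

lemma sub_level_mono:
  fixes k l :: real
  assumes "k \<le> l"
  shows "measure lborel {x \<in> cball (x0::'a) r. u x \<le> k} \<le> measure lborel {x \<in> cball x0 r. u x \<le> l}"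
proof (rule measure_mono_on[OF compact_cball])
  show "{x \<in> cball x0 r. u x \<le> l} \<subseteq> cball x0 r" by auto
  have [measurable]: "cball x0 r \<in> sets borel" by simp
  have "{x \<in> space borel. x \<in> cball x0 r \<and> u x \<le> m} \<in> sets borel" for m by measurable
  then show "{x \<in> cball x0 r. u x \<le> k} \<in> sets borel" "{x \<in> cball x0 r. u x \<le> l} \<in> sets borel" by simp_all
qed (use assms in auto)

text \<open>Apply the preceding estimate at the dyadic levels \<open>M - \<omega> / 2\<^sup>i\<^sup>+\<^sup>1\<close> for \<open>i < s\<close> and add up. The measures of
  the strips telescope, so the sum is at most one volume, while the last super-level set is counted \<open>s\<close>
  times.\<close>

lemma shrink:
  fixes s :: nat and M \<omega> \<theta> :: real
  assumes R: "0 < R" and K: "cball x0 (4 * R) \<subseteq> \<Omega>" and \<theta>: "0 < \<theta>" and s: "0 < s"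
    and \<omega>: "R * 2 ^ (s + 1) \<le> \<omega>"
    and AE: "AE x in lborel. x \<in> cball x0 (4 * R) \<longrightarrow> u x \<le> M"
    and half: "vol (2 * R) / 2 \<le> measure lborel {x \<in> cball x0 (2 * R). u x \<le> M - \<omega> / 2}"
  shows "measure lborel (super_level (cball x0 (2 * R)) (M - \<omega> / 2 ^ (s + 1)))
    \<le> shrink_const * (1 / (\<theta> * s) + \<theta> powr (p - 1) * grad_const * 2 ^ DIM('a)) * vol (2 * R)"
proof -
  define H where "H i = \<omega> / 2 ^ (i + 1)" for i :: nat
  define A where "A i = measure lborel (super_level (cball x0 (2 * R)) (M - H i))" for i
  define V where "V = vol (2 * R)"
  have V: "0 < V" using R vol_pos by (simp add: V_def)
  have \<omega>0: "0 < \<omega>" using \<omega> R by (meson less_le_trans mult_pos_pos zero_less_numeral zero_less_power)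
  have HR: "R \<le> H i" if "i \<le> s" for i
  proof -
    have "R * 2 ^ (i + 1) \<le> R * 2 ^ (s + 1)" using that R by (intro mult_left_mono power_increasing) auto
    then show ?thesis using \<omega> by (simp add: H_def pos_le_divide_eq)
  qed
  have HS: "H (Suc i) = H i / 2" for i by (simp add: H_def)
  have H0: "0 < H i" for i using \<omega>0 by (simp add: H_def)
  have Hle: "H i \<le> \<omega> / 2" for i
    using \<omega>0 by (simp add: H_def field_simps)
  have A0: "0 \<le> A i" for i by (simp add: A_def)
  have AV: "A i \<le> V" for i
  proof -
    have "A i \<le> measure lborel (cball x0 (2 * R))"
      unfolding A_def by (rule measure_mono_on[OF compact_cball super_level_subset order_refl])
        (simp_all add: super_level_measurable)
    then show ?thesis using measure_cball[of "2 * R" x0] R by (simp add: V_def)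
  qed
  have AS: "A (Suc i) \<le> A i" for i
    unfolding A_def
  proof (rule measure_mono_on[OF compact_cball _ super_level_subset])
    show "super_level (cball x0 (2 * R)) (M - H (Suc i)) \<subseteq> super_level (cball x0 (2 * R)) (M - H i)"
      using H0[of i] by (auto simp: HS super_level_def)
  qed (simp_all add: super_level_measurable)
  have dec: "A s \<le> A i" if "i \<le> s" for i
    using that by (induction rule: dec_induct) (auto intro: order_trans AS)
  have "\<exists>i<s. A i - A (Suc i) \<le> V / s"
  proof (rule ccontr)
    assume "\<not> (\<exists>i<s. A i - A (Suc i) \<le> V / s)"
    then have "V / s < A i - A (Suc i)" if "i < s" for i using that by force
    then have "(\<Sum>i<s. V / s) < (\<Sum>i<s. A i - A (Suc i))" using s by (intro sum_strict_mono) auto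
    also have "\<dots> = A 0 - A s" by (rule sum_lessThan_telescope')
    also have "\<dots> \<le> V" using A0[of s] AV[of 0] by linarith
    finally show False using s by simp
  qed
  then obtain i where i: "i < s" "A i - A (Suc i) \<le> V / s" by blast
  have "A s \<le> A (Suc i)" using i by (intro dec) simp
  also have "A (Suc i) = measure lborel (super_level (cball x0 (2 * R)) (M - H i + H i / 2))"
    by (simp add: A_def HS)
  also have "\<dots> \<le> shrink_const * ((A i - A (Suc i)) / \<theta> + \<theta> powr (p - 1) * grad_const * 2 ^ DIM('a) * V)"
  proof -
    have "vol (2 * R) / 2 \<le> measure lborel {x \<in> cball x0 (2 * R). u x \<le> M - H i}"
      using half sub_level_mono[of "M - \<omega> / 2" "M - H i" x0 "2 * R"] Hle[of i] by linarith
    moreover have "AE x in lborel. x \<in> cball x0 (4 * R) \<longrightarrow> u x \<le> (M - H i) + H i" using AE by simp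
    moreover have "A (Suc i) = measure lborel (super_level (cball x0 (2 * R)) (M - H i + H i / 2))"
      by (simp add: A_def HS)
    ultimately show ?thesis
      using shrink_step[OF R K HR \<theta>, of i "M - H i"] i(1) by (simp add: A_def V_def)
  qed
  also have "\<dots> \<le> shrink_const * ((V / s) / \<theta> + \<theta> powr (p - 1) * grad_const * 2 ^ DIM('a) * V)"
    using i(2) \<theta> by (intro mult_left_mono add_right_mono divide_right_mono) (auto simp: shrink_const_def)
  also have "\<dots> = shrink_const * (1 / (\<theta> * s) + \<theta> powr (p - 1) * grad_const * 2 ^ DIM('a)) * V"
    by (simp add: algebra_simps)
  finally show ?thesis by (simp add: A_def H_def V_def)
qed

text \<open>First \<open>\<theta>\<close>, then \<open>s\<close> make the super-level set small enough for the sup bound to lower the supremum.\<close>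

lemma sup_reduction:
  "\<exists>s::nat. \<forall>x0 R M \<omega>. 0 < R \<longrightarrow> cball x0 (4 * R) \<subseteq> \<Omega> \<longrightarrow> R * 2 ^ (s + 2) \<le> \<omega> \<longrightarrow>
     (AE x in lborel. x \<in> cball x0 (4 * R) \<longrightarrow> u x \<le> M) \<longrightarrow>
     vol (2 * R) / 2 \<le> measure lborel {x \<in> cball x0 (2 * R). u x \<le> M - \<omega> / 2} \<longrightarrow>
     (AE x in lborel. x \<in> cball x0 R \<longrightarrow> u x \<le> M - \<omega> / 2 ^ (s + 2))"
proof -
  define c where "c = shrink_const * (unit_ball_vol (real DIM('a)) * 2 ^ DIM('a))"
  have "0 < unit_ball_vol (real DIM('a))" by simp
  then have c: "0 < c" unfolding c_def shrink_const_def by (intro mult_pos_pos) auto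
  \<comment> \<open>The sup bound with \<open>\<mu> = H / 2\<close> tolerates a super-level set of measure \<open>t c R\<^sup>d\<close>.\<close>
  define t where "t = dg_nu * (1/2) powr p / c"
  have t: "0 < t" using dg_pos(3) c by (simp add: t_def)
  define g where "g = grad_const * 2 ^ DIM('a)"
  have g: "0 < g" using grad_const_pos by (simp add: g_def)
  define \<theta> where "\<theta> = (t / (2 * g)) powr (1 / (p - 1))"
  have \<theta>: "0 < \<theta>" using t g by (simp add: \<theta>_def)
  have \<theta>p: "\<theta> powr (p - 1) * g = t / 2" using t g p by (simp add: \<theta>_def powr_powr)
  obtain s0 :: nat where s0: "2 / (\<theta> * t) < real s0" using reals_Archimedean2 by blast
  have "0 < 2 / (\<theta> * t)" using \<theta> t by simp
  then have s: "0 < s0" using s0 by linarith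
  have st: "1 / (\<theta> * s0) \<le> t / 2" using s0 \<theta> t s by (simp add: field_simps)
  show ?thesis
  proof (intro exI[of _ s0] allI impI)
    fix x0 R M \<omega>
    assume R: "0 < R" and K: "cball x0 (4 * R) \<subseteq> \<Omega>" and \<omega>: "R * 2 ^ (s0 + 2) \<le> \<omega>"
      and AE: "AE x in lborel. x \<in> cball x0 (4 * R) \<longrightarrow> u x \<le> M"
      and half: "vol (2 * R) / 2 \<le> measure lborel {x \<in> cball x0 (2 * R). u x \<le> M - \<omega> / 2}"
    let ?B = "cball x0 (2 * R)"
    have sub: "?B \<subseteq> cball x0 (4 * R)" using R by (intro subset_cball) simp
    then have BO: "?B \<subseteq> \<Omega>" using K by blast
    define H where "H = \<omega> / 2 ^ (s0 + 1)"
    define h where "h = \<omega> / 2 ^ (s0 + 2)"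
    have Hh: "h = H / 2" by (simp add: h_def H_def)
    have h: "R \<le> h" using \<omega> by (simp add: h_def pos_le_divide_eq)
    have H0: "0 < H" using h R Hh by simp
    have "R * 2 ^ (s0 + 1) \<le> R * 2 ^ (s0 + 2)" using R by simp
    then have "R * 2 ^ (s0 + 1) \<le> \<omega>" using \<omega> by simp
    from shrink[OF R K \<theta> s this AE half]
    have "measure lborel (super_level ?B (M - H)) \<le> shrink_const * (1 / (\<theta> * s0) + \<theta> powr (p - 1) * g) * vol (2 * R)"
      by (simp add: H_def g_def mult.assoc)
    also have "\<dots> \<le> shrink_const * (t / 2 + t / 2) * vol (2 * R)"
      using st \<theta>p R vol_pos[of "2 * R"] by (intro mult_right_mono mult_left_mono) (auto simp: shrink_const_def)
    also have "\<dots> = t * c * R ^ DIM('a)" by (simp add: c_def vol_def power_mult_distrib)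
    also have "\<dots> = dg_nu * (1/2) powr p * R ^ DIM('a)" using c by (simp add: t_def)
    finally have m: "measure lborel (super_level ?B (M - H)) \<le> dg_nu * (1/2) powr p * R ^ DIM('a)" .
    have AEB: "AE x in lborel. x \<in> ?B \<longrightarrow> u x \<le> (M - H) + H"
      using AE by eventually_elim (use sub in \<open>metis diff_add_cancel subsetD\<close>)
    have "excess ?B (M - H) \<le> H powr p * measure lborel (super_level ?B (M - H))"
      by (rule excess_le[OF _ BO _ AEB]) (use H0 in auto)
    also have "\<dots> \<le> H powr p * (dg_nu * (1/2) powr p * R ^ DIM('a))" using m by (intro mult_left_mono) auto
    also have "\<dots> = dg_nu * h powr p * R ^ DIM('a)" by (simp add: Hh powr_divide)
    finally have fin: "AE x in lborel. x \<in> cball x0 R \<longrightarrow> u x \<le> (M - H) + h"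
      by (rule de_giorgi_sup_bound[OF R h BO])
    have e: "(M - H) + h = M - h" using Hh by simp
    show "AE x in lborel. x \<in> cball x0 R \<longrightarrow> u x \<le> M - \<omega> / 2 ^ (s0 + 2)"
      using fin unfolding e unfolding h_def .
  qed
qed

end

context quasilinear_equation
begin

lemma equation_neg: "quasilinear_equation \<Omega> p c0 C0 (\<lambda>x. - u x) (\<lambda>x. - G x) (\<lambda>x. - j x)"
proof
  show "weak_grad \<Omega> (\<lambda>x. - u x) (\<lambda>x. - G x)"
    using weak_grad by (auto simp: weak_grad_def)
  have neg: "Lp q M (\<lambda>x. - f x)" if "Lp q M f" for q and M :: "'a measure" and f :: "'a \<Rightarrow> 'b::euclidean_space"
    using that by (simp add: Lp_def)
  show "Lp 1 (lborel_on K) (\<lambda>x. - u x) \<and> Lp 1 (lborel_on K) (\<lambda>x. - G x)" if "compact K" "K \<subseteq> \<Omega>" for K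
    by (intro conjI neg conjunct1[OF L1[OF that]] conjunct2[OF L1[OF that]])
  show "Lp p (lborel_on K) (\<lambda>x. - u x) \<and> Lp p (lborel_on K) (\<lambda>x. - G x)" if "compact K" "K \<subseteq> \<Omega>" for K
    by (intro conjI neg conjunct1[OF Lp[OF that]] conjunct2[OF Lp[OF that]])
  show "(LINT x|lborel. - j x \<bullet> grad \<phi> x) = 0" if "test_function \<Omega> \<phi>" for \<phi>
    using div_free[OF that] by simp
qed (use open_\<Omega> p c0 C0 coercive growth in auto)

text \<open>Either \<open>u\<close> or \<open>-u\<close> lies below the middle of its range on half of the ball. The second term of the maximum
  covers an oscillation that is not large compared with the radius.\<close>

lemma oscillation_step:
  "\<exists>\<sigma>. 0 < \<sigma> \<and> \<sigma> < 1 \<and> (\<forall>x0 R a b. 0 < R \<longrightarrow> cball x0 (4 * R) \<subseteq> \<Omega> \<longrightarrow>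
     (AE x in lborel. x \<in> cball x0 (4 * R) \<longrightarrow> a \<le> u x \<and> u x \<le> b) \<longrightarrow>
     (\<exists>a' b'. (AE x in lborel. x \<in> cball x0 R \<longrightarrow> a' \<le> u x \<and> u x \<le> b') \<and>
        b' - a' \<le> max ((1 - \<sigma>) * (b - a)) (R / \<sigma>)))"
proof -
  obtain s :: nat where s: "\<And>x0 R M \<omega>. 0 < R \<Longrightarrow> cball x0 (4 * R) \<subseteq> \<Omega> \<Longrightarrow> R * 2 ^ (s + 2) \<le> \<omega> \<Longrightarrow>
     (AE x in lborel. x \<in> cball x0 (4 * R) \<longrightarrow> u x \<le> M) \<Longrightarrow>
     vol (2 * R) / 2 \<le> measure lborel {x \<in> cball x0 (2 * R). u x \<le> M - \<omega> / 2} \<Longrightarrow>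
     (AE x in lborel. x \<in> cball x0 R \<longrightarrow> u x \<le> M - \<omega> / 2 ^ (s + 2))"
    using sup_reduction by blast
  obtain s' :: nat where s': "\<And>x0 R M \<omega>. 0 < R \<Longrightarrow> cball x0 (4 * R) \<subseteq> \<Omega> \<Longrightarrow> R * 2 ^ (s' + 2) \<le> \<omega> \<Longrightarrow>
     (AE x in lborel. x \<in> cball x0 (4 * R) \<longrightarrow> - u x \<le> M) \<Longrightarrow>
     vol (2 * R) / 2 \<le> measure lborel {x \<in> cball x0 (2 * R). - u x \<le> M - \<omega> / 2} \<Longrightarrow>
     (AE x in lborel. x \<in> cball x0 R \<longrightarrow> - u x \<le> M - \<omega> / 2 ^ (s' + 2))"
    using quasilinear_equation.sup_reduction[OF equation_neg] by blast
  define S where "S = max s s'"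
  define \<sigma> where "\<sigma> = 1 / (2::real) ^ (S + 2)"
  have "(1::real) < 2 ^ (S + 2)" by (rule one_less_power) auto
  then have \<sigma>: "0 < \<sigma>" "\<sigma> < 1" by (auto simp: \<sigma>_def)
  have p2: "(2::real) ^ (s + 2) \<le> 2 ^ (S + 2)" "(2::real) ^ (s' + 2) \<le> 2 ^ (S + 2)"
    by (rule power_increasing; simp add: S_def)+
  show ?thesis
  proof (rule exI[of _ \<sigma>], intro conjI allI impI \<sigma>)
    fix x0 R a b
    assume R: "0 < R" and K: "cball x0 (4 * R) \<subseteq> \<Omega>"
      and AE: "AE x in lborel. x \<in> cball x0 (4 * R) \<longrightarrow> a \<le> u x \<and> u x \<le> b"
    define \<omega> where "\<omega> = b - a"
    have sub: "cball x0 R \<subseteq> cball x0 (4 * R)" using R by (intro subset_cball) simp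
    have AER: "AE x in lborel. x \<in> cball x0 R \<longrightarrow> a \<le> u x \<and> u x \<le> b"
      using AE by eventually_elim (use sub in blast)
    have Rs: "R / \<sigma> = R * 2 ^ (S + 2)" by (simp add: \<sigma>_def)
    show "\<exists>a' b'. (AE x in lborel. x \<in> cball x0 R \<longrightarrow> a' \<le> u x \<and> u x \<le> b') \<and> b' - a' \<le> max ((1 - \<sigma>) * (b - a)) (R / \<sigma>)"
    proof (cases "\<omega> \<le> R / \<sigma>")
      case True
      then show ?thesis using AER by (intro exI[of _ a] exI[of _ b]) (auto simp: \<omega>_def)
    next
      case False
      then have \<omega>: "R * 2 ^ (S + 2) \<le> \<omega>" using Rs by simp
      have "0 < R * 2 ^ (S + 2)" using R by simp
      then have \<omega>0: "0 < \<omega>" using \<omega> by linarith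
      have \<omega>s: "R * 2 ^ (s + 2) \<le> \<omega>" "R * 2 ^ (s' + 2) \<le> \<omega>"
        using \<omega> mult_left_mono[OF p2(1), of R] mult_left_mono[OF p2(2), of R] R by linarith+
      have quot: "\<sigma> * \<omega> \<le> \<omega> / 2 ^ (s + 2)" "\<sigma> * \<omega> \<le> \<omega> / 2 ^ (s' + 2)"
        using divide_left_mono[OF p2(1), of \<omega>] divide_left_mono[OF p2(2), of \<omega>] \<omega>0 by (simp_all add: \<sigma>_def)
      let ?B = "cball x0 (2 * R)"
      let ?U = "{x \<in> ?B. u x \<le> b - \<omega> / 2}" and ?L = "{x \<in> ?B. - u x \<le> - a - \<omega> / 2}"
      have [measurable]: "?B \<in> sets borel" by simp
      have "{x \<in> space borel. x \<in> ?B \<and> u x \<le> b - \<omega> / 2} \<in> sets borel" by measurable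
      then have mU: "?U \<in> sets borel" by simp
      have "{x \<in> space borel. x \<in> ?B \<and> - u x \<le> - a - \<omega> / 2} \<in> sets borel" by measurable
      then have mL: "?L \<in> sets borel" by simp
      have un: "?B = ?U \<union> ?L" by (auto simp: \<omega>_def field_simps)
      have "vol (2 * R) = measure lborel ?B" using measure_cball[of "2 * R" x0] R by simp
      also have "\<dots> = measure lborel (?U \<union> ?L)" using un by (rule arg_cong)
      also have "\<dots> \<le> measure lborel ?U + measure lborel ?L"
        by (rule measure_Un_le) (use mU mL in auto)
      finally consider "vol (2 * R) / 2 \<le> measure lborel ?U" | "vol (2 * R) / 2 \<le> measure lborel ?L" by linarith
      then show ?thesis
      proof cases
        case 1
        have "AE x in lborel. x \<in> cball x0 (4 * R) \<longrightarrow> u x \<le> b" using AE by eventually_elim blast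
        from s[OF R K \<omega>s(1) this 1]
        have "AE x in lborel. x \<in> cball x0 R \<longrightarrow> a \<le> u x \<and> u x \<le> b - \<sigma> * \<omega>"
          using AER by eventually_elim (use quot(1) in force)
        then show ?thesis by (intro exI[of _ a] exI[of _ "b - \<sigma> * \<omega>"]) (auto simp: \<omega>_def algebra_simps)
      next
        case 2
        have "AE x in lborel. x \<in> cball x0 (4 * R) \<longrightarrow> - u x \<le> - a" using AE by eventually_elim simp
        from s'[OF R K \<omega>s(2) this 2]
        have "AE x in lborel. x \<in> cball x0 R \<longrightarrow> a + \<sigma> * \<omega> \<le> u x \<and> u x \<le> b"
          using AER by eventually_elim (use quot(2) in force)
        then show ?thesis by (intro exI[of _ "a + \<sigma> * \<omega>"] exI[of _ b]) (auto simp: \<omega>_def algebra_simps)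
      qed
    qed
  qed
qed

lemma oscillation_decay:
  "\<exists>\<theta> C. 0 < \<theta> \<and> \<theta> \<le> 1 \<and> 0 < C \<and> (\<forall>x0 R a b r. 0 < R \<longrightarrow> cball x0 R \<subseteq> \<Omega> \<longrightarrow> a \<le> b \<longrightarrow>
     (AE x in lborel. x \<in> cball x0 R \<longrightarrow> a \<le> u x \<and> u x \<le> b) \<longrightarrow> 0 < r \<longrightarrow> r \<le> R \<longrightarrow>
     (\<exists>a' b'. (AE x in lborel. x \<in> cball x0 r \<longrightarrow> a' \<le> u x \<and> u x \<le> b') \<and>
        b' - a' \<le> C * (b - a + R) * (r / R) powr \<theta>))"
proof -
  obtain \<sigma> where \<sigma>: "0 < \<sigma>" "\<sigma> < 1"
    and step: "\<And>x0 R a b. 0 < R \<Longrightarrow> cball x0 (4 * R) \<subseteq> \<Omega> \<Longrightarrow>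
     (AE x in lborel. x \<in> cball x0 (4 * R) \<longrightarrow> a \<le> u x \<and> u x \<le> b) \<Longrightarrow>
     (\<exists>a' b'. (AE x in lborel. x \<in> cball x0 R \<longrightarrow> a' \<le> u x \<and> u x \<le> b') \<and>
        b' - a' \<le> max ((1 - \<sigma>) * (b - a)) (R / \<sigma>))"
    using oscillation_step by blast
  \<comment> \<open>The lower bound \<open>1/4\<close> makes the radius, which also bounds the oscillation, decay at the rate \<open>q\<close>, and gives \<open>\<theta> \<le> 1\<close>.\<close>
  define q where "q = max (1 - \<sigma>) (1/4)"
  have q: "0 < q" "q < 1" "1/4 \<le> q" "1 - \<sigma> \<le> q" using \<sigma> by (auto simp: q_def)
  define \<theta> where "\<theta> = - log 4 q"
  have q4: "q = 4 powr (- \<theta>)" using q by (simp add: \<theta>_def)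
  have \<theta>: "0 < \<theta>" using q by (simp add: \<theta>_def)
  have \<theta>1: "\<theta> \<le> 1"
  proof -
    have "4 powr (-1) = (1/4::real)" by (simp add: powr_minus)
    then have "4 powr (-1) \<le> 4 powr (- \<theta>)" using q(3) unfolding q4[symmetric] by simp
    then show ?thesis by (subst (asm) powr_le_cancel_iff) auto
  qed
  define C where "C = 4 / \<sigma>"
  have C: "0 < C" using \<sigma> by (simp add: C_def)
  show ?thesis
  proof (rule exI[of _ \<theta>], rule exI[of _ C], intro conjI allI impI \<theta> \<theta>1 C)
    fix x0 R a b r
    assume R: "0 < R" and K: "cball x0 R \<subseteq> \<Omega>" and ab: "a \<le> b"
      and AE: "AE x in lborel. x \<in> cball x0 R \<longrightarrow> a \<le> u x \<and> u x \<le> b" and r: "0 < r" "r \<le> R"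
    define L where "L = (b - a + R) / \<sigma>"
    have L: "b - a \<le> L" "R / \<sigma> \<le> L" "0 < L"
    proof -
      have "(b - a) * \<sigma> \<le> (b - a) * 1" using ab \<sigma> by (intro mult_left_mono) auto
      then show "b - a \<le> L" using R \<sigma> by (simp add: L_def pos_le_divide_eq)
      show "R / \<sigma> \<le> L" unfolding L_def using ab \<sigma> by (intro divide_right_mono) auto
      then show "0 < L" using R \<sigma> by (smt (verit) divide_pos_pos)
    qed
    have iter: "\<exists>a' b'. (AE x in lborel. x \<in> cball x0 (R / 4 ^ n) \<longrightarrow> a' \<le> u x \<and> u x \<le> b') \<and> b' - a' \<le> L * q ^ n" for n
    proof (induction n)
      case 0
      then show ?case using AE L by (intro exI[of _ a] exI[of _ b]) simp
    next
      case (Suc n)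
      then obtain a' b' where ih: "AE x in lborel. x \<in> cball x0 (R / 4 ^ n) \<longrightarrow> a' \<le> u x \<and> u x \<le> b'" "b' - a' \<le> L * q ^ n" by blast
      have R4: "4 * (R / 4 ^ Suc n) = R / 4 ^ n" by simp
      have "R / 4 ^ n \<le> R / 1" using R by (intro divide_left_mono) auto
      then have "cball x0 (R / 4 ^ n) \<subseteq> cball x0 R" by (intro subset_cball) simp
      then have "cball x0 (4 * (R / 4 ^ Suc n)) \<subseteq> \<Omega>" using K unfolding R4 by blast
      from step[OF _ this, of a' b', unfolded R4, OF _ ih(1)] R
      obtain a'' b'' where st: "AE x in lborel. x \<in> cball x0 (R / 4 ^ Suc n) \<longrightarrow> a'' \<le> u x \<and> u x \<le> b''"
        "b'' - a'' \<le> max ((1 - \<sigma>) * (b' - a')) (R / 4 ^ Suc n / \<sigma>)" by auto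
      have "(1 - \<sigma>) * (b' - a') \<le> q * (L * q ^ n)"
      proof -
        have "(1 - \<sigma>) * (b' - a') \<le> (1 - \<sigma>) * (L * q ^ n)" using ih(2) \<sigma> by (intro mult_left_mono) auto
        also have "\<dots> \<le> q * (L * q ^ n)" using q L by (intro mult_right_mono) auto
        finally show ?thesis .
      qed
      moreover have "R / 4 ^ Suc n / \<sigma> \<le> q * (L * q ^ n)"
      proof -
        have "R / 4 ^ Suc n / \<sigma> = R / \<sigma> * (1/4) ^ Suc n" by (simp add: power_divide)
        also have "\<dots> \<le> L * q ^ Suc n" using L q by (intro mult_mono power_mono) auto
        finally show ?thesis by (simp add: mult_ac)
      qed
      ultimately have "b'' - a'' \<le> L * q ^ Suc n" using st(2) by (simp add: mult_ac)
      then show ?case using st(1) by blast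
    qed
    have "\<exists>N. R / 4 ^ N < r"
    proof -
      obtain N where "(1/4::real) ^ N < r / R" using real_arch_pow_inv[of "r / R" "1/4"] R r by auto
      then show ?thesis using R by (intro exI[of _ N]) (simp add: power_divide field_simps)
    qed
    then obtain N where N: "R / 4 ^ N < r" "\<And>i. i < N \<Longrightarrow> r \<le> R / 4 ^ i"
      using exists_least_iff[of "\<lambda>N. R / 4 ^ N < r"] by (auto simp: not_less)
    have "N \<noteq> 0" using N(1) r by (intro notI) simp
    then obtain n where n: "N = Suc n" using not0_implies_Suc by blast
    have rn: "r \<le> R / 4 ^ n" using N(2) n by simp
    have sub: "cball x0 r \<subseteq> cball x0 (R / 4 ^ n)" using rn by (rule subset_cball)
    obtain a' b' where ih: "AE x in lborel. x \<in> cball x0 (R / 4 ^ n) \<longrightarrow> a' \<le> u x \<and> u x \<le> b'" "b' - a' \<le> L * q ^ n"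
      using iter by blast
    have "q ^ n = ((1/4) ^ n) powr \<theta>"
    proof -
      have "q ^ n = (4 powr (- \<theta>)) powr real n" using q by (simp add: q4[symmetric] powr_realpow)
      also have "\<dots> = (4 powr (- real n)) powr \<theta>" by (simp add: powr_powr mult.commute)
      also have "4 powr (- real n) = (1/4::real) ^ n" by (simp add: powr_minus powr_realpow power_divide inverse_eq_divide)
      finally show ?thesis .
    qed
    also have "\<dots> \<le> (4 * (r / R)) powr \<theta>"
    proof (rule powr_mono2)
      have "R < r * 4 ^ Suc n" using N(1) n by (simp add: field_simps)
      then show "(1/4) ^ n \<le> 4 * (r / R)" using R by (simp add: field_simps power_divide)
    qed (use \<theta> in auto)
    also have "\<dots> = 4 powr \<theta> * (r / R) powr \<theta>" by (rule powr_mult)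
    also have "\<dots> \<le> 4 * (r / R) powr \<theta>"
      using powr_mono[OF \<theta>1, of 4] by (intro mult_right_mono) auto
    finally have "L * q ^ n \<le> L * (4 * (r / R) powr \<theta>)" using L by (intro mult_left_mono) auto
    also have "\<dots> = C * (b - a + R) * (r / R) powr \<theta>" by (simp add: L_def C_def)
    finally have "b' - a' \<le> C * (b - a + R) * (r / R) powr \<theta>" using ih(2) by linarith
    moreover have "AE x in lborel. x \<in> cball x0 r \<longrightarrow> a' \<le> u x \<and> u x \<le> b'"
      using ih(1) by eventually_elim (use sub in blast)
    ultimately show "\<exists>a' b'. (AE x in lborel. x \<in> cball x0 r \<longrightarrow> a' \<le> u x \<and> u x \<le> b') \<and>
        b' - a' \<le> C * (b - a + R) * (r / R) powr \<theta>" by blast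
  qed
qed

text \<open>The excess over level zero is finite on compact sets, so a large \<open>\<mu>\<close> meets the smallness condition of the
  sup bound uniformly in the centre.\<close>

lemma local_upper_bound:
  assumes L: "compact L" "L \<subseteq> \<Omega>" and R: "0 < R"
  obtains B where "0 < B" "\<And>x0. cball x0 (2 * R) \<subseteq> L \<Longrightarrow> AE x in lborel. x \<in> cball x0 R \<longrightarrow> u x \<le> B"
proof -
  define D where "D = dg_nu * R ^ DIM('a)"
  have D: "0 < D" using dg_pos(3) R by (simp add: D_def)
  define B where "B = max R ((excess L 0 / D) powr (1 / p))"
  have B: "R \<le> B" by (simp add: B_def)
  have "excess L 0 / D = ((excess L 0 / D) powr (1 / p)) powr p"
    using p excess_nonneg[of L 0] D by (simp add: powr_powr)
  also have "\<dots> \<le> B powr p" using p by (intro powr_mono2) (auto simp: B_def)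
  finally have ex: "excess L 0 \<le> dg_nu * B powr p * R ^ DIM('a)"
    using D by (simp add: pos_divide_le_eq D_def mult_ac)
  show thesis
  proof (rule that[of B])
    show "0 < B" using B R by simp
    fix x0 assume K: "cball x0 (2 * R) \<subseteq> L"
    have "excess (cball x0 (2 * R)) 0 \<le> excess L 0" by (rule excess_mono[OF L _ K]) auto
    then have "excess (cball x0 (2 * R)) 0 \<le> dg_nu * B powr p * R ^ DIM('a)" using ex by linarith
    from de_giorgi_sup_bound[OF R B _ this] K L(2)
    show "AE x in lborel. x \<in> cball x0 R \<longrightarrow> u x \<le> B" by auto
  qed
qed

lemma local_oscillation:
  "\<exists>\<theta>. 0 < \<theta> \<and> \<theta> \<le> 1 \<and> (\<forall>K. compact K \<longrightarrow> K \<subseteq> \<Omega> \<longrightarrow> (\<exists>R L. 0 < R \<and> 0 \<le> L \<and>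
     (\<forall>x\<in>K. \<forall>r. 0 < r \<longrightarrow> r \<le> R \<longrightarrow> (\<exists>a b. (AE y in lborel. y \<in> cball x r \<longrightarrow> a \<le> u y \<and> u y \<le> b) \<and>
        b - a \<le> L * r powr \<theta>))))"
proof -
  obtain \<theta> C where \<theta>: "0 < \<theta>" "\<theta> \<le> 1" and C: "0 < C" and decay: "\<And>x0 R a b r. 0 < R \<Longrightarrow> cball x0 R \<subseteq> \<Omega> \<Longrightarrow> a \<le> b \<Longrightarrow>
     (AE x in lborel. x \<in> cball x0 R \<longrightarrow> a \<le> u x \<and> u x \<le> b) \<Longrightarrow> 0 < r \<Longrightarrow> r \<le> R \<Longrightarrow>
     (\<exists>a' b'. (AE x in lborel. x \<in> cball x0 r \<longrightarrow> a' \<le> u x \<and> u x \<le> b') \<and>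
        b' - a' \<le> C * (b - a + R) * (r / R) powr \<theta>)"
    using oscillation_decay by blast
  show ?thesis
  proof (rule exI[of _ \<theta>], intro conjI allI impI \<theta>)
    fix K :: "'a set" assume K: "compact K" "K \<subseteq> \<Omega>"
    obtain r0 L where r0: "0 < r0" "compact L" "L \<subseteq> \<Omega>" "\<And>x. x \<in> K \<Longrightarrow> cball x r0 \<subseteq> L"
      using compact_cball_nbhd[OF K open_\<Omega>] by metis
    define R where "R = r0 / 2"
    have R: "0 < R" using r0 by (simp add: R_def)
    obtain B where B: "0 < B" "\<And>x0. cball x0 (2 * R) \<subseteq> L \<Longrightarrow> AE x in lborel. x \<in> cball x0 R \<longrightarrow> u x \<le> B"
      using local_upper_bound[OF r0(2,3) R] by metis
    obtain B' where B': "0 < B'" "\<And>x0. cball x0 (2 * R) \<subseteq> L \<Longrightarrow> AE x in lborel. x \<in> cball x0 R \<longrightarrow> - u x \<le> B'"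
      using quasilinear_equation.local_upper_bound[OF equation_neg r0(2,3) R] by metis
    define M where "M = C * (B - (- B') + R) * (1 / R) powr \<theta>"
    have M: "0 \<le> M" using C B(1) B'(1) R by (simp add: M_def)
    show "\<exists>R L. 0 < R \<and> 0 \<le> L \<and>
     (\<forall>x\<in>K. \<forall>r. 0 < r \<longrightarrow> r \<le> R \<longrightarrow> (\<exists>a b. (AE y in lborel. y \<in> cball x r \<longrightarrow> a \<le> u y \<and> u y \<le> b) \<and>
        b - a \<le> L * r powr \<theta>))"
    proof (rule exI[of _ R], rule exI[of _ M], intro conjI ballI allI impI R M)
      fix x r assume x: "x \<in> K" and r: "0 < r" "r \<le> R"
      have c: "cball x (2 * R) \<subseteq> L" using r0(4)[OF x] by (simp add: R_def)
      have "cball x R \<subseteq> cball x (2 * R)" using R by (intro subset_cball) simp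
      then have cR: "cball x R \<subseteq> \<Omega>" using c r0(3) by blast
      have "AE y in lborel. y \<in> cball x R \<longrightarrow> - B' \<le> u y \<and> u y \<le> B"
        using B(2)[OF c] B'(2)[OF c] by eventually_elim auto
      from decay[OF R cR _ this r] B(1) B'(1)
      obtain a b where "AE y in lborel. y \<in> cball x r \<longrightarrow> a \<le> u y \<and> u y \<le> b"
        "b - a \<le> C * (B - (- B') + R) * (r / R) powr \<theta>" by force
      moreover have "(r / R) powr \<theta> = (1 / R) powr \<theta> * r powr \<theta>"
        by (simp add: powr_divide)
      ultimately show "\<exists>a b. (AE y in lborel. y \<in> cball x r \<longrightarrow> a \<le> u y \<and> u y \<le> b) \<and> b - a \<le> M * r powr \<theta>"
        by (auto simp: M_def mult.assoc)
    qed
  qed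
qed

lemma AE_cball_ex:
  assumes "AE y in lborel. y \<in> cball (x::'a) r \<longrightarrow> P y" "0 < r"
  shows "\<exists>y. P y"
proof (rule ccontr)
  assume "\<nexists>y. P y"
  then have "AE y in lborel. y \<notin> cball x r" using assms(1) by simp
  then have "emeasure lborel (cball x r) = 0"
    by (subst (asm) AE_iff_measurable[of "cball x r"]) auto
  then show False using content_cball_pos[OF assms(2), of x] by (simp add: measure_def)
qed

text \<open>A representative that is defined pointwise, without reference to the exceptional null sets of the
  oscillation estimates.\<close>

definition ess_limsup :: "'a \<Rightarrow> real" where
  "ess_limsup x = Inf {b. \<exists>r>0. AE y in lborel. y \<in> cball x r \<longrightarrow> u y \<le> b}"

lemma ess_limsup_between:
  assumes AE: "AE y in lborel. y \<in> cball z r \<longrightarrow> a \<le> u y \<and> u y \<le> b" and x: "dist z x < r"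
  shows "a \<le> ess_limsup x" "ess_limsup x \<le> b"
proof -
  let ?S = "{b. \<exists>r>0. AE y in lborel. y \<in> cball x r \<longrightarrow> u y \<le> b}"
  define \<rho> where "\<rho> = r - dist z x"
  have \<rho>: "0 < \<rho>" using x by (simp add: \<rho>_def)
  have sub: "cball x \<rho> \<subseteq> cball z r"
  proof
    fix y assume "y \<in> cball x \<rho>"
    then show "y \<in> cball z r" using dist_triangle[of z y x] by (simp add: \<rho>_def)
  qed
  have "AE y in lborel. y \<in> cball x \<rho> \<longrightarrow> u y \<le> b" using AE by eventually_elim (use sub in blast)
  then have b: "b \<in> ?S" using \<rho> by blast
  have lower: "a \<le> b'" if "b' \<in> ?S" for b'
  proof -
    obtain \<rho>' where \<rho>': "0 < \<rho>'" "AE y in lborel. y \<in> cball x \<rho>' \<longrightarrow> u y \<le> b'" using \<open>b' \<in> ?S\<close> by blast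
    have "AE y in lborel. y \<in> cball x (min \<rho> \<rho>') \<longrightarrow> a \<le> u y \<and> u y \<le> b'"
      using AE \<rho>'(2) by eventually_elim (use sub in auto)
    from AE_cball_ex[OF this] \<rho> \<rho>'(1) show ?thesis by force
  qed
  show "a \<le> ess_limsup x" unfolding ess_limsup_def using b lower by (intro cInf_greatest) auto
  show "ess_limsup x \<le> b" unfolding ess_limsup_def using b lower by (intro cInf_lower bdd_belowI) auto
qed

text \<open>The oscillation estimates control the essential limes superior \<open>v\<close> at every point, since it lies between any
  essential bounds on a surrounding ball. On a compact set, countably many finite covers by small balls show
  \<open>v = u\<close> almost everywhere.\<close>

theorem hoelder_representative:
  "\<exists>v. continuous_on \<Omega> v \<and> (AE x in lborel. x \<in> \<Omega> \<longrightarrow> v x = u x) \<and> locally_Hoelder_on \<Omega> v"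
proof -
  obtain \<theta> where \<theta>: "0 < \<theta>" "\<theta> \<le> 1" and osc: "\<And>K. compact K \<Longrightarrow> K \<subseteq> \<Omega> \<Longrightarrow> (\<exists>R L. 0 < R \<and> 0 \<le> L \<and>
     (\<forall>x\<in>K. \<forall>r. 0 < r \<longrightarrow> r \<le> R \<longrightarrow> (\<exists>a b. (AE y in lborel. y \<in> cball x r \<longrightarrow> a \<le> u y \<and> u y \<le> b) \<and>
        b - a \<le> L * r powr \<theta>)))"
    using local_oscillation by blast
  let ?v = ess_limsup
  have small: "\<exists>\<rho>>0. \<rho> \<le> R \<and> L * \<rho> powr \<theta> < e" if "0 < R" "0 \<le> L" "0 < e" for R L e :: real
  proof (intro exI[of _ "min R ((e / (2 * (L + 1))) powr (1 / \<theta>))"] conjI)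
    let ?\<rho> = "min R ((e / (2 * (L + 1))) powr (1 / \<theta>))"
    show "0 < ?\<rho>" using that by simp
    have "?\<rho> powr \<theta> \<le> ((e / (2 * (L + 1))) powr (1 / \<theta>)) powr \<theta>"
      using \<theta> that by (intro powr_mono2) auto
    also have "\<dots> = e / (2 * (L + 1))" using \<theta> that by (simp add: powr_powr)
    finally have "L * ?\<rho> powr \<theta> \<le> L * (e / (2 * (L + 1)))" using that by (intro mult_left_mono) auto
    also have "\<dots> = L * (e / 2 / (L + 1))" by simp
    also have "\<dots> \<le> e / 2" by (rule mult_divide_add_one_le) (use that in auto)
    also have "\<dots> < e" using that by simp
    finally show "L * ?\<rho> powr \<theta> < e" .
  qed simp
  have cont: "continuous_on \<Omega> ?v"
    unfolding continuous_on_iff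
  proof (intro ballI allI impI)
    fix x and e :: real assume x: "x \<in> \<Omega>" and e: "0 < e"
    obtain R L where RL: "0 < R" "0 \<le> L" "\<And>r. 0 < r \<Longrightarrow> r \<le> R \<Longrightarrow> (\<exists>a b. (AE y in lborel. y \<in> cball x r \<longrightarrow> a \<le> u y \<and> u y \<le> b) \<and> b - a \<le> L * r powr \<theta>)"
      using osc[of "{x}"] x by auto
    obtain \<rho> where \<rho>: "0 < \<rho>" "\<rho> \<le> R" "L * \<rho> powr \<theta> < e" using small[OF RL(1,2) e] by blast
    obtain a b where ab: "AE y in lborel. y \<in> cball x \<rho> \<longrightarrow> a \<le> u y \<and> u y \<le> b" "b - a \<le> L * \<rho> powr \<theta>"
      using RL(3)[OF \<rho>(1,2)] by blast
    show "\<exists>d>0. \<forall>x'\<in>\<Omega>. dist x' x < d \<longrightarrow> dist (?v x') (?v x) < e"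
    proof (intro exI[of _ \<rho>] conjI ballI impI \<rho>)
      fix y assume "dist y x < \<rho>"
      then have "a \<le> ?v y" "?v y \<le> b" using ess_limsup_between[OF ab(1), of y] by (auto simp: dist_commute)
      moreover have "a \<le> ?v x" "?v x \<le> b" using ess_limsup_between[OF ab(1), of x] \<rho> by auto
      ultimately show "dist (?v y) (?v x) < e" using ab(2) \<rho>(3) by (simp add: dist_real_def)
    qed
  qed
  have hoelder: "\<exists>L. \<forall>x\<in>K. \<forall>y\<in>K. dist (?v x) (?v y) \<le> L * dist x y powr \<theta>" if K: "compact K" "K \<subseteq> \<Omega>" for K
  proof -
    obtain R L where RL: "0 < R" "0 \<le> L" "\<And>x r. x \<in> K \<Longrightarrow> 0 < r \<Longrightarrow> r \<le> R \<Longrightarrow> (\<exists>a b. (AE y in lborel. y \<in> cball x r \<longrightarrow> a \<le> u y \<and> u y \<le> b) \<and> b - a \<le> L * r powr \<theta>)"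
      using osc[OF K] by blast
    have "compact (?v ` K)" by (rule compact_continuous_image[OF continuous_on_subset[OF cont K(2)] K(1)])
    then have "bounded (?v ` K)" by (rule compact_imp_bounded)
    then obtain B where B: "\<And>x. x \<in> K \<Longrightarrow> \<bar>?v x\<bar> \<le> B" unfolding bounded_iff by auto
    \<comment> \<open>The second summand serves pairs of points farther apart than \<open>R / 2\<close>, where boundedness suffices.\<close>
    define M where "M = L * 2 powr \<theta> + 2 * \<bar>B\<bar> * (2 / R) powr \<theta>"
    have "dist (?v x) (?v y) \<le> M * dist x y powr \<theta>" if x: "x \<in> K" and y: "y \<in> K" for x y
    proof (cases "x = y")
      case False
      define d where "d = dist x y"
      have d: "0 < d" using False by (simp add: d_def)
      have M': "L * 2 powr \<theta> * d powr \<theta> \<le> M * d powr \<theta>" "2 * \<bar>B\<bar> * (2 / R) powr \<theta> * d powr \<theta> \<le> M * d powr \<theta>"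
        using RL by (auto simp: M_def intro!: mult_right_mono)
      show ?thesis
      proof (cases "2 * d \<le> R")
        case True
        obtain a b where ab: "AE z in lborel. z \<in> cball x (2 * d) \<longrightarrow> a \<le> u z \<and> u z \<le> b" "b - a \<le> L * (2 * d) powr \<theta>"
          using RL(3)[OF x _ True] d by auto
        have "a \<le> ?v y" "?v y \<le> b" using ess_limsup_between[OF ab(1), of y] d by (auto simp: d_def)
        moreover have "a \<le> ?v x" "?v x \<le> b" using ess_limsup_between[OF ab(1), of x] d by auto
        ultimately have "dist (?v x) (?v y) \<le> L * (2 * d) powr \<theta>" using ab(2) by (simp add: dist_real_def)
        also have "\<dots> = L * 2 powr \<theta> * d powr \<theta>" by (simp add: powr_mult)
        finally show ?thesis using M'(1) by (simp add: d_def)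
      next
        case F: False
        have "dist (?v x) (?v y) \<le> 2 * \<bar>B\<bar> * 1" using B[OF x] B[OF y] by (simp add: dist_real_def)
        also have "\<dots> \<le> 2 * \<bar>B\<bar> * (2 / R * d) powr \<theta>"
          using F RL(1) \<theta> by (intro mult_left_mono ge_one_powr_ge_zero) (auto simp: field_simps)
        also have "\<dots> = 2 * \<bar>B\<bar> * (2 / R) powr \<theta> * d powr \<theta>" by (simp only: powr_mult mult.assoc)
        finally show ?thesis using M'(2) by (simp add: d_def)
      qed
    qed simp
    then show ?thesis by blast
  qed
  have AEK: "AE x in lborel. x \<in> K \<longrightarrow> ?v x = u x" if K: "compact K" "K \<subseteq> \<Omega>" for K
  proof -
    obtain R L where RL: "0 < R" "0 \<le> L" "\<And>x r. x \<in> K \<Longrightarrow> 0 < r \<Longrightarrow> r \<le> R \<Longrightarrow> (\<exists>a b. (AE y in lborel. y \<in> cball x r \<longrightarrow> a \<le> u y \<and> u y \<le> b) \<and> b - a \<le> L * r powr \<theta>)"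
      using osc[OF K] by blast
    have approx: "AE y in lborel. y \<in> K \<longrightarrow> \<bar>?v y - u y\<bar> \<le> e" if e: "0 < e" for e
    proof -
      obtain \<rho> where \<rho>: "0 < \<rho>" "\<rho> \<le> R" "L * \<rho> powr \<theta> < e" using small[OF RL(1,2) e] by blast
      have "K \<subseteq> (\<Union>x\<in>K. ball x \<rho>)" using \<rho> by auto
      then obtain F where F: "F \<subseteq> K" "finite F" "K \<subseteq> (\<Union>x\<in>F. ball x \<rho>)"
        using compactE_image[OF K(1), of K "\<lambda>x. ball x \<rho>"] by auto
      have "AE y in lborel. y \<in> ball x \<rho> \<longrightarrow> \<bar>?v y - u y\<bar> \<le> e" if "x \<in> F" for x
      proof -
        obtain a b where ab: "AE z in lborel. z \<in> cball x \<rho> \<longrightarrow> a \<le> u z \<and> u z \<le> b" "b - a \<le> L * \<rho> powr \<theta>"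
          using RL(3)[of x \<rho>] F(1) \<open>x \<in> F\<close> \<rho> by blast
        show ?thesis using ab(1)
        proof eventually_elim
          case (elim y)
          show ?case
          proof
            assume y: "y \<in> ball x \<rho>"
            have "a \<le> ?v y" "?v y \<le> b" using ess_limsup_between[OF ab(1), of y] y by auto
            moreover have "a \<le> u y" "u y \<le> b" using elim y by auto
            ultimately show "\<bar>?v y - u y\<bar> \<le> e" using ab(2) \<rho>(3) by linarith
          qed
        qed
      qed
      then have "AE y in lborel. \<forall>x\<in>F. y \<in> ball x \<rho> \<longrightarrow> \<bar>?v y - u y\<bar> \<le> e"
        using F(2) by (intro AE_finite_allI) auto
      then show ?thesis by eventually_elim (use F(3) in blast)
    qed
    have "AE y in lborel. \<forall>n::nat. y \<in> K \<longrightarrow> \<bar>?v y - u y\<bar> \<le> 1 / real (Suc n)"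
      unfolding AE_all_countable by (intro allI approx) simp
    then show ?thesis
    proof eventually_elim
      case (elim y)
      show ?case
      proof
        assume y: "y \<in> K"
        have "\<bar>?v y - u y\<bar> \<le> 0"
        proof (rule field_le_epsilon)
          fix e :: real assume "0 < e"
          then obtain n where "1 / real (Suc n) < e" using nat_approx_posE by blast
          moreover have "\<bar>?v y - u y\<bar> \<le> 1 / real (Suc n)" using elim y by blast
          ultimately show "\<bar>?v y - u y\<bar> \<le> 0 + e" by linarith
        qed
        then show "?v y = u y" by simp
      qed
    qed
  qed
  obtain D :: "nat \<Rightarrow> 'a set" where D: "\<And>n. compact (D n)" "\<And>n. D n \<subseteq> \<Omega>" "\<Union>(range D) = \<Omega>"
    using open_Union_compact_subsets[OF open_\<Omega>] by metis
  have "AE x in lborel. \<forall>n. x \<in> D n \<longrightarrow> ?v x = u x"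
    unfolding AE_all_countable by (intro allI AEK D)
  then have "AE x in lborel. x \<in> \<Omega> \<longrightarrow> ?v x = u x"
    by eventually_elim (use D(3) in blast)
  then show ?thesis using cont hoelder \<theta> unfolding locally_Hoelder_on_def by blast
qed

end

section \<open>The structure of the flux on the Hamilton-Jacobi set\<close>

locale mfg_hamiltonian =
  fixes \<Omega> :: "'a::euclidean_space set"
    and H :: "'a \<Rightarrow> 'a \<Rightarrow> real \<Rightarrow> real"
    and \<alpha> \<beta> \<tau> \<delta> \<epsilon> \<gamma> C :: real
  assumes H_differentiable:
      "\<And>x p \<mu>. x \<in> \<Omega> \<Longrightarrow> \<mu> > 0 \<Longrightarrow> (\<lambda>q. H x q \<mu>) differentiable (at p)"
    and parameters: "\<alpha> > 1" "0 \<le> \<tau>" "\<tau> < 1" "\<beta> > \<tau> / (\<alpha> - 1)"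
      "\<delta> = (\<beta> + \<tau>) / \<alpha>" "\<epsilon> > 0" "\<beta> - \<delta> > \<epsilon>" "\<gamma> = (\<beta> + 1) / \<delta>" "C > 0"
    and growth:
      "\<And>x p \<mu>. x \<in> \<Omega> \<Longrightarrow> \<mu> > 0 \<Longrightarrow>
         norm (D\<^sub>p H x p \<mu>) \<le> C * (1 / \<mu> + 1 / \<mu> powr \<tau>) * norm p powr (\<alpha> - 1)
                            + C * (\<mu> powr (\<beta> - \<delta>) + 1 / \<mu>)"
    and coercivity:
      "\<And>x p \<mu>. x \<in> \<Omega> \<Longrightarrow> \<mu> > 0 \<Longrightarrow>
         D\<^sub>p H x p \<mu> \<bullet> p \<ge> inverse C * (1 / (\<mu> powr \<tau> + 1)) * norm p powr \<alpha>
                         - C * (\<mu> powr (\<beta> - \<delta> - \<epsilon>) + 1) * norm p"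
    and H_zero_lower:
      "\<And>x \<mu>. x \<in> \<Omega> \<Longrightarrow> \<mu> > 0 \<Longrightarrow> H x 0 \<mu> \<ge> - C * (\<mu> powr \<beta> + 1)"
    and H_zero_upper:
      "\<And>x \<mu>. x \<in> \<Omega> \<Longrightarrow> \<mu> \<ge> C \<Longrightarrow> H x 0 \<mu> \<le> - inverse C * \<mu> powr \<beta>"
begin

lemma exponents:
  shows "0 < \<beta>" "0 < \<delta>" "\<delta> < \<beta>" "1 < \<gamma>" "\<delta> * \<alpha> = \<beta> + \<tau>" "\<delta> * \<gamma> = \<beta> + 1"
proof -
  have "0 \<le> \<tau> / (\<alpha> - 1)" using parameters by simp
  then show b: "0 < \<beta>" using parameters by linarith
  then show d: "0 < \<delta>" using parameters by simp
  show db: "\<delta> < \<beta>" using parameters by linarith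
  have "\<delta> < \<beta> + 1" using db by linarith
  then show "1 < \<gamma>" unfolding parameters(8) using d by (simp only: less_divide_eq_1_pos)
  show "\<delta> * \<alpha> = \<beta> + \<tau>" using parameters by simp
  show "\<delta> * \<gamma> = \<beta> + 1" using d parameters by simp
qed

lemma H_ray_DERIV:
  assumes "x \<in> \<Omega>" "0 < \<mu>"
  shows "DERIV (\<lambda>t. H x (t *\<^sub>R p) \<mu>) t :> D\<^sub>p H x (t *\<^sub>R p) \<mu> \<bullet> p"
proof -
  have "GDERIV (\<lambda>q. H x q \<mu>) (t *\<^sub>R p) :> D\<^sub>p H x (t *\<^sub>R p) \<mu>"
    unfolding D\<^sub>p_def by (rule GDERIV_grad[OF H_differentiable[OF assms]])
  then have "((\<lambda>t. H x (t *\<^sub>R p) \<mu>) has_derivative (\<lambda>s. (s *\<^sub>R p) \<bullet> D\<^sub>p H x (t *\<^sub>R p) \<mu>)) (at t)"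
    unfolding gderiv_def
    by (rule has_derivative_compose[rotated]) (auto intro!: derivative_eq_intros)
  moreover have "(\<lambda>s. (s *\<^sub>R p) \<bullet> D\<^sub>p H x (t *\<^sub>R p) \<mu>) = (*) (D\<^sub>p H x (t *\<^sub>R p) \<mu> \<bullet> p)"
    by (auto simp: fun_eq_iff inner_commute)
  ultimately show ?thesis by (simp only: has_field_derivative_def)
qed

text \<open>Integrate the coercivity condition along the ray from \<open>0\<close> to \<open>p\<close>. Monotonicity of the difference avoids the
  integral: \<open>H(x,tp,\<mu>)\<close> minus the primitive of the lower bound is nondecreasing in \<open>t\<close>.\<close>

lemma H_lower:
  assumes x: "x \<in> \<Omega>" and \<mu>: "0 < \<mu>"
  shows "- C * (\<mu> powr \<beta> + 1) + inverse C / \<alpha> * (1 / (\<mu> powr \<tau> + 1)) * norm p powr \<alpha>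
    - C * (\<mu> powr (\<beta> - \<delta> - \<epsilon>) + 1) * norm p \<le> H x p \<mu>"
proof -
  define c where "c = inverse C * (1 / (\<mu> powr \<tau> + 1)) * norm p powr \<alpha>"
  define B where "B = C * (\<mu> powr (\<beta> - \<delta> - \<epsilon>) + 1) * norm p"
  define \<psi> where "\<psi> t = H x (t *\<^sub>R p) \<mu> - c / \<alpha> * t powr \<alpha> + B * t" for t
  have "\<psi> 0 \<le> \<psi> 1"
  proof (rule DERIV_nonneg_imp_increasing_open[of 0 1 \<psi>])
    fix t :: real assume t: "0 < t" "t < 1"
    have tt: "t * t powr (\<alpha> - 1) = t powr \<alpha>" using t by (simp add: powr_diff)
    have n: "norm (t *\<^sub>R p) = t * norm p" using t by simp
    have "t * (c * t powr (\<alpha> - 1) - B) = c * (t * t powr (\<alpha> - 1)) - B * t" by (simp add: algebra_simps)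
    also have "\<dots> = inverse C * (1 / (\<mu> powr \<tau> + 1)) * norm (t *\<^sub>R p) powr \<alpha> - C * (\<mu> powr (\<beta> - \<delta> - \<epsilon>) + 1) * norm (t *\<^sub>R p)"
      unfolding tt n powr_mult c_def B_def by (simp only: mult_ac)
    also have "\<dots> \<le> D\<^sub>p H x (t *\<^sub>R p) \<mu> \<bullet> (t *\<^sub>R p)" by (rule coercivity[OF x \<mu>])
    also have "\<dots> = t * (D\<^sub>p H x (t *\<^sub>R p) \<mu> \<bullet> p)" by simp
    finally have "t * (c * t powr (\<alpha> - 1) - B) \<le> t * (D\<^sub>p H x (t *\<^sub>R p) \<mu> \<bullet> p)" .
    then have "c * t powr (\<alpha> - 1) - B \<le> D\<^sub>p H x (t *\<^sub>R p) \<mu> \<bullet> p" using t by simp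
    moreover have "DERIV \<psi> t :> D\<^sub>p H x (t *\<^sub>R p) \<mu> \<bullet> p - c / \<alpha> * (\<alpha> * t powr (\<alpha> - 1)) + B"
      unfolding \<psi>_def[abs_def] using t
      by (auto intro!: derivative_eq_intros H_ray_DERIV[OF x \<mu>])
    moreover have "c / \<alpha> * (\<alpha> * t powr (\<alpha> - 1)) = c * t powr (\<alpha> - 1)" using parameters(1) by simp
    ultimately have "DERIV \<psi> t :> D\<^sub>p H x (t *\<^sub>R p) \<mu> \<bullet> p - c / \<alpha> * (\<alpha> * t powr (\<alpha> - 1)) + B
      \<and> 0 \<le> D\<^sub>p H x (t *\<^sub>R p) \<mu> \<bullet> p - c / \<alpha> * (\<alpha> * t powr (\<alpha> - 1)) + B" by linarith
    then show "\<exists>y. DERIV \<psi> t :> y \<and> 0 \<le> y" by blast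
  next
    have "continuous_on {0..1} (\<lambda>t. H x (t *\<^sub>R p) \<mu>)"
      using DERIV_isCont[OF H_ray_DERIV[OF x \<mu>]] by (intro continuous_at_imp_continuous_on) blast
    then show "continuous_on {0..1} \<psi>" unfolding \<psi>_def[abs_def]
      using parameters by (intro continuous_intros continuous_on_powr') auto
  qed simp
  moreover have "\<psi> 0 = H x 0 \<mu>" "\<psi> 1 = H x p \<mu> - c / \<alpha> + B" by (simp_all add: \<psi>_def)
  moreover have "c / \<alpha> = inverse C / \<alpha> * (1 / (\<mu> powr \<tau> + 1)) * norm p powr \<alpha>" by (simp add: c_def)
  ultimately show ?thesis using H_zero_lower[OF x \<mu>] unfolding B_def by linarith
qed

text \<open>Mean value theorem along the same ray.\<close>

lemma H_upper:
  assumes x: "x \<in> \<Omega>" and \<mu>: "0 < \<mu>"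
  shows "H x p \<mu> \<le> H x 0 \<mu> + (C * (1 / \<mu> + 1 / \<mu> powr \<tau>) * norm p powr (\<alpha> - 1) + C * (\<mu> powr (\<beta> - \<delta>) + 1 / \<mu>)) * norm p"
proof -
  have "\<exists>z::real. 0 < z \<and> z < 1 \<and> H x (1 *\<^sub>R p) \<mu> - H x (0 *\<^sub>R p) \<mu> = (1 - 0) * (D\<^sub>p H x (z *\<^sub>R p) \<mu> \<bullet> p)"
    by (rule MVT2) (use H_ray_DERIV[OF x \<mu>] in auto)
  then obtain z :: real where z: "0 < z" "z < 1" "H x p \<mu> - H x 0 \<mu> = D\<^sub>p H x (z *\<^sub>R p) \<mu> \<bullet> p" by auto
  have "D\<^sub>p H x (z *\<^sub>R p) \<mu> \<bullet> p \<le> norm (D\<^sub>p H x (z *\<^sub>R p) \<mu>) * norm p" by (rule norm_cauchy_schwarz)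
  also have "\<dots> \<le> (C * (1 / \<mu> + 1 / \<mu> powr \<tau>) * norm (z *\<^sub>R p) powr (\<alpha> - 1) + C * (\<mu> powr (\<beta> - \<delta>) + 1 / \<mu>)) * norm p"
    by (intro mult_right_mono growth[OF x \<mu>]) auto
  also have "\<dots> \<le> (C * (1 / \<mu> + 1 / \<mu> powr \<tau>) * norm p powr (\<alpha> - 1) + C * (\<mu> powr (\<beta> - \<delta>) + 1 / \<mu>)) * norm p"
    using z parameters \<mu>
    by (intro mult_right_mono add_right_mono mult_left_mono powr_mono2)
      (auto simp: mult_left_le_one_le intro!: mult_nonneg_nonneg add_nonneg_nonneg)
  finally show ?thesis using z(3) by linarith
qed

lemma flux_norm_le:
  assumes x: "x \<in> \<Omega>" and \<mu>: "0 < \<mu>"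
  shows "norm (\<mu> *\<^sub>R D\<^sub>p H x p \<mu>) \<le> C * (1 + \<mu> powr (1 - \<tau>)) * norm p powr (\<alpha> - 1) + C * (\<mu> powr (\<beta> - \<delta> + 1) + 1)"
proof -
  have "norm (\<mu> *\<^sub>R D\<^sub>p H x p \<mu>) = \<mu> * norm (D\<^sub>p H x p \<mu>)" using \<mu> by simp
  also have "\<dots> \<le> \<mu> * (C * (1 / \<mu> + 1 / \<mu> powr \<tau>) * norm p powr (\<alpha> - 1) + C * (\<mu> powr (\<beta> - \<delta>) + 1 / \<mu>))"
    using \<mu> by (intro mult_left_mono growth[OF x \<mu>]) auto
  also have "\<dots> = C * (\<mu> * (1 / \<mu>) + \<mu> * (1 / \<mu> powr \<tau>)) * norm p powr (\<alpha> - 1) + C * (\<mu> * \<mu> powr (\<beta> - \<delta>) + \<mu> * (1 / \<mu>))"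
    by (simp only: algebra_simps)
  also have "\<mu> * (1 / \<mu> powr \<tau>) = \<mu> powr (1 - \<tau>)" using \<mu> by (simp add: powr_diff)
  also have "\<mu> * \<mu> powr (\<beta> - \<delta>) = \<mu> powr (\<beta> - \<delta> + 1)" using \<mu> by (simp add: powr_add)
  also have "\<mu> * (1 / \<mu>) = 1" using \<mu> by simp
  finally show ?thesis .
qed

lemma powr_le_max:
  fixes a e \<mu> :: real
  assumes "0 < \<mu>" "0 \<le> a" "a \<le> e"
  shows "\<mu> powr a + 1 \<le> 2 * (max 1 \<mu>) powr e"
proof -
  have "\<mu> powr a \<le> (max 1 \<mu>) powr a" using assms by (intro powr_mono2) auto
  moreover have "(max 1 \<mu>) powr a \<le> (max 1 \<mu>) powr e" using assms by (intro powr_mono) auto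
  moreover have "1 \<le> (max 1 \<mu>) powr e" using assms by (intro ge_one_powr_ge_zero) auto
  ultimately show ?thesis by linarith
qed

text \<open>After scaling \<open>\<bar>p\<bar> = S max(1,\<mu>)\<^sup>\<delta>\<close>, every term in the lower bound for \<open>H\<close> is at most a multiple of
  \<open>max(1,\<mu>)\<^sup>\<beta>\<close>, and the leading one carries \<open>S\<^sup>\<alpha>\<close> against a remainder linear in \<open>S\<close>. The threshold \<open>1\<close> instead of
  \<open>0\<close> leaves room for limits in which \<open>H\<close> tends to a nonpositive value.\<close>

lemma gradient_le_density:
  "\<exists>K\<ge>1. \<forall>x\<in>\<Omega>. \<forall>p \<mu>. 0 < \<mu> \<longrightarrow> H x p \<mu> \<le> 1 \<longrightarrow> norm p \<le> K * (max 1 \<mu>) powr \<delta>"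
proof -
  define c where "c = inverse C / (2 * \<alpha>)"
  have c: "0 < c" using parameters by (simp add: c_def)
  define K where "K = max 1 (((1 + 4 * C) / c) powr (1 / (\<alpha> - 1)))"
  have "norm p \<le> K * (max 1 \<mu>) powr \<delta>" if x: "x \<in> \<Omega>" and \<mu>: "0 < \<mu>" and h: "H x p \<mu> \<le> 1" for x p \<mu>
  proof -
    define w where "w = max 1 \<mu>"
    have w: "1 \<le> w" by (simp add: w_def)
    define S where "S = norm p / w powr \<delta>"
    have S: "0 \<le> S" by (simp add: S_def)
    have np: "norm p = S * w powr \<delta>" using w by (simp add: S_def)
    have npa: "norm p powr \<alpha> = S powr \<alpha> * w powr (\<beta> + \<tau>)"
      unfolding np powr_mult powr_powr exponents(5) ..
    have b1: "\<mu> powr \<beta> + 1 \<le> 2 * w powr \<beta>" unfolding w_def using exponents \<mu> by (intro powr_le_max) auto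
    have b2: "\<mu> powr \<tau> + 1 \<le> 2 * w powr \<tau>" unfolding w_def using parameters \<mu> by (intro powr_le_max) auto
    have b3: "\<mu> powr (\<beta> - \<delta> - \<epsilon>) + 1 \<le> 2 * w powr (\<beta> - \<delta>)" unfolding w_def using parameters \<mu> by (intro powr_le_max) auto
    have W: "0 < w powr \<beta>" using w by simp
    have t1: "C * (\<mu> powr \<beta> + 1) \<le> 2 * C * w powr \<beta>" using b1 parameters by simp
    have t3: "C * (\<mu> powr (\<beta> - \<delta> - \<epsilon>) + 1) * norm p \<le> 2 * C * S * w powr \<beta>"
    proof -
      have "C * (\<mu> powr (\<beta> - \<delta> - \<epsilon>) + 1) * norm p \<le> C * (2 * w powr (\<beta> - \<delta>)) * norm p"
        using b3 parameters by (intro mult_right_mono mult_left_mono) auto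
      also have "\<dots> = 2 * C * S * (w powr (\<beta> - \<delta>) * w powr \<delta>)" by (simp add: np)
      also have "w powr (\<beta> - \<delta>) * w powr \<delta> = w powr \<beta>" by (simp add: powr_add[symmetric])
      finally show ?thesis .
    qed
    have t2: "c * S powr \<alpha> * w powr \<beta> \<le> inverse C / \<alpha> * (1 / (\<mu> powr \<tau> + 1)) * norm p powr \<alpha>"
    proof -
      have "c * S powr \<alpha> * w powr \<beta> = inverse C / \<alpha> * (1 / (2 * w powr \<tau>)) * norm p powr \<alpha>"
        using w by (simp add: c_def npa powr_add field_simps)
      also have "\<dots> \<le> inverse C / \<alpha> * (1 / (\<mu> powr \<tau> + 1)) * norm p powr \<alpha>"
      proof (intro mult_right_mono mult_left_mono)
        have "0 < \<mu> powr \<tau> + 1" by (simp add: add_nonneg_pos)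
        then show "1 / (2 * w powr \<tau>) \<le> 1 / (\<mu> powr \<tau> + 1)" using b2 by (intro frac_le) auto
        show "0 \<le> inverse C / \<alpha>" using parameters(1,9) by simp
      qed simp
      finally show ?thesis .
    qed
    have "1 \<le> w powr \<beta>" using w exponents by (intro ge_one_powr_ge_zero) auto
    then have "c * S powr \<alpha> * w powr \<beta> \<le> w powr \<beta> + 2 * C * w powr \<beta> + 2 * C * S * w powr \<beta>"
      using H_lower[OF x \<mu>, of p] h t1 t2 t3 by linarith
    also have "\<dots> = (1 + 2 * C + 2 * C * S) * w powr \<beta>" by (simp add: algebra_simps)
    finally have main: "c * S powr \<alpha> \<le> 1 + 2 * C + 2 * C * S" using W by simp
    have "S \<le> K"
    proof (cases "S \<le> 1")
      case False
      then have S1: "1 < S" by simp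
      have "1 + 2 * C \<le> (1 + 2 * C) * S" using S1 parameters by (simp add: mult_left_le)
      then have "c * S powr \<alpha> \<le> (1 + 4 * C) * S" using main by (simp add: algebra_simps)
      then have "c * S powr (\<alpha> - 1) \<le> 1 + 4 * C" using S1 by (simp add: powr_diff field_simps)
      then have "S powr (\<alpha> - 1) \<le> (1 + 4 * C) / c" using c by (simp add: pos_le_divide_eq mult.commute)
      then have "(S powr (\<alpha> - 1)) powr (1 / (\<alpha> - 1)) \<le> ((1 + 4 * C) / c) powr (1 / (\<alpha> - 1))"
        using parameters by (intro powr_mono2) auto
      then show ?thesis using S1 parameters by (simp add: powr_powr K_def)
    qed (simp add: K_def)
    then show ?thesis using np w unfolding w_def[symmetric] by (simp add: mult_right_mono)
  qed
  then show ?thesis by (intro exI[of _ K]) (auto simp: K_def)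
qed

text \<open>With \<open>\<bar>p\<bar> = S \<mu>\<^sup>\<delta>\<close> and \<open>\<mu>\<close> large, the upper bound for \<open>H\<close> is \<open>\<mu>\<^sup>\<beta>\<close> times a quantity that is negative for
  small \<open>S\<close>.\<close>

lemma density_le_gradient:
  "\<exists>\<kappa>>0. \<kappa> \<le> 1 \<and> (\<forall>x\<in>\<Omega>. \<forall>p \<mu>. 1 \<le> \<mu> \<longrightarrow> C \<le> \<mu> \<longrightarrow> 0 \<le> H x p \<mu> \<longrightarrow> \<kappa> * \<mu> powr \<delta> \<le> norm p)"
proof -
  define \<kappa> where "\<kappa> = min 1 (1 / (4 * C\<^sup>2))"
  have \<kappa>: "0 < \<kappa>" "\<kappa> \<le> 1" "4 * C * \<kappa> \<le> inverse C"
  proof -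
    show "0 < \<kappa>" "\<kappa> \<le> 1" using parameters by (auto simp: \<kappa>_def)
    have "4 * C * \<kappa> \<le> 4 * C * (1 / (4 * C\<^sup>2))" using parameters by (intro mult_left_mono) (auto simp: \<kappa>_def)
    also have "\<dots> = inverse C" using parameters by (simp add: power2_eq_square field_simps)
    finally show "4 * C * \<kappa> \<le> inverse C" .
  qed
  have "\<kappa> * \<mu> powr \<delta> \<le> norm p" if x: "x \<in> \<Omega>" and \<mu>: "1 \<le> \<mu>" "C \<le> \<mu>" and h: "0 \<le> H x p \<mu>" for x p \<mu>
  proof (rule ccontr)
    assume neg: "\<not> \<kappa> * \<mu> powr \<delta> \<le> norm p"
    have \<mu>0: "0 < \<mu>" using \<mu> by simp
    define S where "S = norm p / \<mu> powr \<delta>"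
    have S: "0 \<le> S" by (simp add: S_def)
    have np: "norm p = S * \<mu> powr \<delta>" using \<mu>0 by (simp add: S_def)
    have Sk: "S < \<kappa>" using neg \<mu>0 by (simp add: np not_le)
    have W: "0 < \<mu> powr \<beta>" using \<mu>0 by simp
    have b1: "1 / \<mu> \<le> 1 / \<mu> powr \<tau>"
      using powr_mono[of \<tau> 1 \<mu>] \<mu> parameters by (intro divide_left_mono) auto
    have b2: "1 / \<mu> \<le> \<mu> powr (\<beta> - \<delta>)"
    proof -
      have "1 / \<mu> \<le> 1" using \<mu> by simp
      also have "1 \<le> \<mu> powr (\<beta> - \<delta>)" using \<mu> exponents by (intro ge_one_powr_ge_zero) auto
      finally show ?thesis .
    qed
    have pa: "norm p powr (\<alpha> - 1) * norm p = S powr \<alpha> * \<mu> powr (\<beta> + \<tau>)"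
    proof -
      have "norm p powr (\<alpha> - 1) * norm p = norm p powr \<alpha>"
        using parameters(1) by (cases "norm p = 0") (auto simp: powr_diff)
      also have "\<dots> = S powr \<alpha> * \<mu> powr (\<beta> + \<tau>)" unfolding np powr_mult powr_powr exponents(5) ..
      finally show ?thesis .
    qed
    have "0 \<le> - inverse C * \<mu> powr \<beta> + (C * (1 / \<mu> + 1 / \<mu> powr \<tau>) * norm p powr (\<alpha> - 1) + C * (\<mu> powr (\<beta> - \<delta>) + 1 / \<mu>)) * norm p"
      using h H_upper[OF x \<mu>0, of p] H_zero_upper[OF x \<mu>(2)] by linarith
    also have "\<dots> \<le> - inverse C * \<mu> powr \<beta> + (C * (1 / \<mu> powr \<tau> + 1 / \<mu> powr \<tau>) * norm p powr (\<alpha> - 1) + C * (\<mu> powr (\<beta> - \<delta>) + \<mu> powr (\<beta> - \<delta>))) * norm p"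
      using b1 b2 parameters by (intro add_left_mono mult_right_mono add_mono mult_left_mono) auto
    also have "\<dots> = - inverse C * \<mu> powr \<beta> + 2 * C * (1 / \<mu> powr \<tau>) * (norm p powr (\<alpha> - 1) * norm p) + 2 * C * \<mu> powr (\<beta> - \<delta>) * norm p"
      by (simp add: algebra_simps)
    also have "\<dots> = - inverse C * \<mu> powr \<beta> + 2 * C * S powr \<alpha> * (1 / \<mu> powr \<tau> * \<mu> powr (\<beta> + \<tau>)) + 2 * C * S * (\<mu> powr (\<beta> - \<delta>) * \<mu> powr \<delta>)"
      unfolding pa by (simp add: np)
    also have "1 / \<mu> powr \<tau> * \<mu> powr (\<beta> + \<tau>) = \<mu> powr \<beta>" using \<mu>0 by (simp add: powr_add)
    also have "\<mu> powr (\<beta> - \<delta>) * \<mu> powr \<delta> = \<mu> powr \<beta>" by (simp add: powr_add[symmetric])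
    also have "- inverse C * \<mu> powr \<beta> + 2 * C * S powr \<alpha> * \<mu> powr \<beta> + 2 * C * S * \<mu> powr \<beta> = (2 * C * S powr \<alpha> + 2 * C * S - inverse C) * \<mu> powr \<beta>"
      by (simp add: algebra_simps)
    finally have "inverse C \<le> 2 * C * S powr \<alpha> + 2 * C * S" using W by (simp add: zero_le_mult_iff)
    also have "\<dots> \<le> 2 * C * S + 2 * C * S"
      using powr_mono'[of 1 \<alpha> S] S Sk \<kappa> parameters by (intro add_right_mono mult_left_mono) auto
    also have "\<dots> < 4 * C * \<kappa>" using Sk parameters by simp
    finally show False using \<kappa>(3) by simp
  qed
  then show ?thesis using \<kappa> by blast
qed

text \<open>For large density the quotient \<open>S = \<bar>p\<bar> / \<mu>\<^sup>\<delta>\<close> lies between two positive constants, so powers of \<open>\<mu>\<close> can be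
  traded for powers of \<open>\<bar>p\<bar>\<close>. The gap \<open>\<epsilon>\<close> makes the lower order term in the coercivity condition negligible.\<close>

lemma flux_structure_large:
  "\<exists>M\<ge>1. \<exists>c>0. \<exists>A>0. \<forall>x\<in>\<Omega>. \<forall>p \<mu>. M \<le> \<mu> \<longrightarrow> H x p \<mu> = 0 \<longrightarrow>
     c * norm p powr \<gamma> \<le> (\<mu> *\<^sub>R D\<^sub>p H x p \<mu>) \<bullet> p \<and> norm (\<mu> *\<^sub>R D\<^sub>p H x p \<mu>) \<le> A * norm p powr (\<gamma> - 1)"
proof -
  obtain K where K: "1 \<le> K" "\<And>x p \<mu>. x \<in> \<Omega> \<Longrightarrow> 0 < \<mu> \<Longrightarrow> H x p \<mu> \<le> 1 \<Longrightarrow> norm p \<le> K * (max 1 \<mu>) powr \<delta>"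
    using gradient_le_density by blast
  obtain \<kappa> where \<kappa>: "0 < \<kappa>" "\<kappa> \<le> 1" "\<And>x p \<mu>. x \<in> \<Omega> \<Longrightarrow> 1 \<le> \<mu> \<Longrightarrow> C \<le> \<mu> \<Longrightarrow> 0 \<le> H x p \<mu> \<Longrightarrow> \<kappa> * \<mu> powr \<delta> \<le> norm p"
    using density_le_gradient by blast
  have C: "0 < C" by (rule parameters)
  \<comment> \<open>From \<open>\<mu> = E\<close> on, the lower order term is at most half of the coercive one.\<close>
  define E where "E = (8 * C\<^sup>2 / \<kappa> powr (\<alpha> - 1)) powr (1 / \<epsilon>)"
  define M where "M = max (max 1 C) E"
  have M: "1 \<le> M" "C \<le> M" "E \<le> M" by (auto simp: M_def)
  define c where "c = \<kappa> powr \<alpha> / (4 * C * K powr \<gamma>)"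
  have c: "0 < c" using \<kappa> C K(1) by (simp add: c_def)
  define A where "A = (2 * C * K powr (\<alpha> - 1) + 2 * C) / \<kappa> powr (\<gamma> - 1)"
  have A: "0 < A" using \<kappa> C K(1) unfolding A_def by (intro divide_pos_pos add_pos_pos mult_pos_pos) auto
  have "c * norm p powr \<gamma> \<le> (\<mu> *\<^sub>R D\<^sub>p H x p \<mu>) \<bullet> p \<and> norm (\<mu> *\<^sub>R D\<^sub>p H x p \<mu>) \<le> A * norm p powr (\<gamma> - 1)"
    if x: "x \<in> \<Omega>" and \<mu>: "M \<le> \<mu>" and h: "H x p \<mu> = 0" for x p \<mu>
  proof -
    have \<mu>1: "1 \<le> \<mu>" "C \<le> \<mu>" "E \<le> \<mu>" "0 < \<mu>" using \<mu> M by linarith+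
    have mx: "max 1 \<mu> = \<mu>" using \<mu>1 by simp
    define S where "S = norm p / \<mu> powr \<delta>"
    have np: "norm p = S * \<mu> powr \<delta>" using \<mu>1 by (simp add: S_def)
    have S: "\<kappa> \<le> S" "S \<le> K"
      using \<kappa>(3)[OF x \<mu>1(1,2), of p] K(2)[OF x \<mu>1(4), of p] h \<mu>1(4)
      by (auto simp: S_def mx pos_le_divide_eq pos_divide_le_eq)
    have S0: "0 < S" using S \<kappa> by linarith
    have npg: "norm p powr \<gamma> = S powr \<gamma> * \<mu> powr (\<beta> + 1)"
      unfolding np powr_mult powr_powr exponents(6) ..
    have npa: "norm p powr \<alpha> = S powr \<alpha> * \<mu> powr (\<beta> + \<tau>)"
      unfolding np powr_mult powr_powr exponents(5) ..
    have tau: "\<mu> powr \<tau> + 1 \<le> 2 * \<mu> powr \<tau>"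
      using powr_le_max[OF \<mu>1(4) parameters(2) order_refl] by (simp add: mx)
    have e1: "\<mu> powr (\<beta> - \<delta> - \<epsilon>) + 1 \<le> 2 * \<mu> powr (\<beta> - \<delta> - \<epsilon>)"
      using powr_le_max[OF \<mu>1(4), of "\<beta> - \<delta> - \<epsilon>" "\<beta> - \<delta> - \<epsilon>"] parameters by (simp add: mx)
    have eps: "2 * C * \<mu> powr (- \<epsilon>) \<le> \<kappa> powr (\<alpha> - 1) / (4 * C)"
    proof -
      have "8 * C\<^sup>2 / \<kappa> powr (\<alpha> - 1) = E powr \<epsilon>" using C \<kappa> parameters by (simp add: E_def powr_powr)
      also have "\<dots> \<le> \<mu> powr \<epsilon>" using \<mu>1 parameters by (intro powr_mono2) (auto simp: E_def)
      finally have "8 * C\<^sup>2 \<le> \<mu> powr \<epsilon> * \<kappa> powr (\<alpha> - 1)" using \<kappa> by (simp add: pos_divide_le_eq)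
      then show ?thesis using C \<mu>1 by (simp add: powr_minus field_simps power2_eq_square)
    qed
    have "c * norm p powr \<gamma> \<le> (\<mu> *\<^sub>R D\<^sub>p H x p \<mu>) \<bullet> p"
    proof -
      have "c * norm p powr \<gamma> \<le> c * (K powr \<gamma> * \<mu> powr (\<beta> + 1))"
        unfolding npg using c S S0 exponents(4) by (intro mult_left_mono mult_right_mono powr_mono2) auto
      also have "\<dots> = \<kappa> * \<kappa> powr (\<alpha> - 1) / (4 * C) * \<mu> powr (\<beta> + 1)"
        using K(1) \<kappa> by (simp add: c_def powr_diff)
      also have "\<dots> \<le> S * (\<kappa> powr (\<alpha> - 1) / (2 * C) - \<kappa> powr (\<alpha> - 1) / (4 * C)) * \<mu> powr (\<beta> + 1)"
      proof (intro mult_right_mono)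
        have "\<kappa> * \<kappa> powr (\<alpha> - 1) / (4 * C) \<le> S * (\<kappa> powr (\<alpha> - 1) / (4 * C))"
          using S C by (simp add: divide_right_mono mult_right_mono)
        then show "\<kappa> * \<kappa> powr (\<alpha> - 1) / (4 * C) \<le> S * (\<kappa> powr (\<alpha> - 1) / (2 * C) - \<kappa> powr (\<alpha> - 1) / (4 * C))"
          by simp
      qed auto
      also have "\<dots> \<le> S * (S powr (\<alpha> - 1) / (2 * C) - 2 * C * \<mu> powr (- \<epsilon>)) * \<mu> powr (\<beta> + 1)"
        using S S0 \<kappa> C eps parameters
        by (intro mult_right_mono mult_left_mono diff_mono divide_right_mono powr_mono2) auto
      also have "\<dots> = \<mu> * (inverse C * (1 / (2 * \<mu> powr \<tau>)) * norm p powr \<alpha> - C * (2 * \<mu> powr (\<beta> - \<delta> - \<epsilon>)) * norm p)"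
        unfolding npa unfolding np using S0 \<mu>1(4) C
        by (simp add: powr_add powr_diff powr_minus field_simps)
      also have "\<dots> \<le> \<mu> * (inverse C * (1 / (\<mu> powr \<tau> + 1)) * norm p powr \<alpha> - C * (\<mu> powr (\<beta> - \<delta> - \<epsilon>) + 1) * norm p)"
      proof (intro mult_left_mono diff_mono mult_right_mono)
        have "0 < \<mu> powr \<tau> + 1" by (simp add: add_nonneg_pos)
        then show "1 / (2 * \<mu> powr \<tau>) \<le> 1 / (\<mu> powr \<tau> + 1)" using tau by (intro frac_le) auto
      qed (use \<mu>1(4) C e1 in auto)
      also have "\<dots> \<le> \<mu> * (D\<^sub>p H x p \<mu> \<bullet> p)"
        using coercivity[OF x \<mu>1(4), of p] \<mu>1(4) by (intro mult_left_mono) auto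
      finally show ?thesis by simp
    qed
    moreover have "norm (\<mu> *\<^sub>R D\<^sub>p H x p \<mu>) \<le> A * norm p powr (\<gamma> - 1)"
    proof -
      have ex: "\<delta> * (\<gamma> - 1) = \<beta> - \<delta> + 1" using exponents(6) by (simp add: algebra_simps)
      have ex2: "1 - \<tau> + \<delta> * (\<alpha> - 1) = \<beta> - \<delta> + 1" using exponents(5) by (simp add: algebra_simps)
      have m1: "1 + \<mu> powr (1 - \<tau>) \<le> 2 * \<mu> powr (1 - \<tau>)"
        using ge_one_powr_ge_zero[OF \<mu>1(1), of "1 - \<tau>"] parameters by simp
      have m2: "\<mu> powr (\<beta> - \<delta> + 1) + 1 \<le> 2 * \<mu> powr (\<beta> - \<delta> + 1)"
        using ge_one_powr_ge_zero[OF \<mu>1(1), of "\<beta> - \<delta> + 1"] exponents by simp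
      have "norm (\<mu> *\<^sub>R D\<^sub>p H x p \<mu>) \<le> C * (1 + \<mu> powr (1 - \<tau>)) * norm p powr (\<alpha> - 1) + C * (\<mu> powr (\<beta> - \<delta> + 1) + 1)"
        by (rule flux_norm_le[OF x \<mu>1(4)])
      also have "\<dots> \<le> C * (2 * \<mu> powr (1 - \<tau>)) * (K * \<mu> powr \<delta>) powr (\<alpha> - 1) + C * (2 * \<mu> powr (\<beta> - \<delta> + 1))"
        using m1 m2 C S S0 parameters
        by (intro add_mono mult_mono powr_mono2) (auto simp: np intro!: mult_right_mono)
      also have "\<dots> = 2 * C * K powr (\<alpha> - 1) * (\<mu> powr (1 - \<tau>) * \<mu> powr (\<delta> * (\<alpha> - 1))) + 2 * C * \<mu> powr (\<beta> - \<delta> + 1)"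
        by (simp add: powr_mult powr_powr mult_ac)
      also have "\<mu> powr (1 - \<tau>) * \<mu> powr (\<delta> * (\<alpha> - 1)) = \<mu> powr (\<beta> - \<delta> + 1)"
        by (simp add: powr_add[symmetric] ex2)
      also have "2 * C * K powr (\<alpha> - 1) * \<mu> powr (\<beta> - \<delta> + 1) + 2 * C * \<mu> powr (\<beta> - \<delta> + 1)
          = A * (\<kappa> powr (\<gamma> - 1) * \<mu> powr (\<beta> - \<delta> + 1))"
      proof -
        have Ak: "A * \<kappa> powr (\<gamma> - 1) = 2 * C * K powr (\<alpha> - 1) + 2 * C" using \<kappa>(1) by (simp add: A_def)
        show ?thesis unfolding mult.assoc[symmetric] Ak by (simp only: distrib_right)
      qed
      also have "\<dots> \<le> A * norm p powr (\<gamma> - 1)"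
        unfolding np powr_mult powr_powr ex using A S \<kappa> exponents(4)
        by (intro mult_left_mono mult_right_mono powr_mono2) auto
      finally show ?thesis .
    qed
    ultimately show ?thesis by blast
  qed
  then show ?thesis using M(1) c A by blast
qed

text \<open>For bounded density both the gradient and the flux are bounded, so the inequalities hold with a large
  constant. A value of the extension at density zero is a limit of such bounded fluxes.\<close>

theorem flux_structure:
  "\<exists>c>0. \<exists>A>0. \<forall>x\<in>\<Omega>. \<forall>p \<mu> h y. 0 \<le> \<mu> \<longrightarrow> h \<in> graph_ext (H x) p \<mu> \<longrightarrow> h \<le> 0 \<longrightarrow> (0 < \<mu> \<longrightarrow> h = 0) \<longrightarrow>
     y \<in> graph_ext (\<lambda>p \<mu>. \<mu> *\<^sub>R D\<^sub>p H x p \<mu>) p \<mu> \<longrightarrow>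
     c * norm p powr \<gamma> - A \<le> y \<bullet> p \<and> norm y \<le> A * (norm p powr (\<gamma> - 1) + 1)"
proof -
  obtain K where K: "1 \<le> K" "\<And>x p \<mu>. x \<in> \<Omega> \<Longrightarrow> 0 < \<mu> \<Longrightarrow> H x p \<mu> \<le> 1 \<Longrightarrow> norm p \<le> K * (max 1 \<mu>) powr \<delta>"
    using gradient_le_density by blast
  obtain M c A where M: "1 \<le> M" and c: "0 < c" and A: "0 < A"
    and large: "\<And>x p \<mu>. x \<in> \<Omega> \<Longrightarrow> M \<le> \<mu> \<Longrightarrow> H x p \<mu> = 0 \<Longrightarrow>
     c * norm p powr \<gamma> \<le> (\<mu> *\<^sub>R D\<^sub>p H x p \<mu>) \<bullet> p \<and> norm (\<mu> *\<^sub>R D\<^sub>p H x p \<mu>) \<le> A * norm p powr (\<gamma> - 1)"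
    using flux_structure_large by blast
  have C: "0 < C" by (rule parameters)
  define P where "P = K * M powr \<delta>"
  have P: "0 \<le> P" using K by (simp add: P_def)
  define J where "J = C * (1 + M powr (1 - \<tau>)) * (P + 1) powr (\<alpha> - 1) + C * (M powr (\<beta> - \<delta> + 1) + 1)"
  have J: "0 \<le> J" using C unfolding J_def by (intro add_nonneg_nonneg mult_nonneg_nonneg) auto
  have small: "norm (\<mu> *\<^sub>R D\<^sub>p H x p \<mu>) \<le> J" if "x \<in> \<Omega>" "0 < \<mu>" "\<mu> \<le> M" "norm p \<le> P + 1" for x p \<mu>
  proof -
    have "norm (\<mu> *\<^sub>R D\<^sub>p H x p \<mu>) \<le> C * (1 + \<mu> powr (1 - \<tau>)) * norm p powr (\<alpha> - 1) + C * (\<mu> powr (\<beta> - \<delta> + 1) + 1)"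
      by (rule flux_norm_le[OF that(1,2)])
    also have "\<dots> \<le> J" unfolding J_def using that C parameters exponents
      by (intro add_mono mult_mono powr_mono2 order_refl) (auto intro!: add_nonneg_nonneg)
    finally show ?thesis .
  qed
  define A' where "A' = A + J + J * P + c * P powr \<gamma>"
  have A': "0 < A'" "A \<le> A'" "J \<le> A'" "J * P + c * P powr \<gamma> \<le> A'"
  proof -
    have "0 \<le> J * P" "0 \<le> c * P powr \<gamma>" using J P c by auto
    then show "0 < A'" "A \<le> A'" "J \<le> A'" "J * P + c * P powr \<gamma> \<le> A'" using A J unfolding A'_def by linarith+
  qed
  have conclude: "c * norm p powr \<gamma> - A' \<le> y \<bullet> p \<and> norm y \<le> A' * (norm p powr (\<gamma> - 1) + 1)"
    if p: "norm p \<le> P" and y: "norm y \<le> J" for p y :: 'a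
  proof
    have "norm y * norm p \<le> J * P" using p y J by (intro mult_mono) auto
    then have "- (J * P) \<le> y \<bullet> p" using Cauchy_Schwarz_ineq2[of y p] by linarith
    moreover have "c * norm p powr \<gamma> \<le> c * P powr \<gamma>" using p c exponents by (intro mult_left_mono powr_mono2) auto
    ultimately show "c * norm p powr \<gamma> - A' \<le> y \<bullet> p" using A'(4) by linarith
    have "norm y \<le> A' * 1" using y A'(3) by simp
    also have "\<dots> \<le> A' * (norm p powr (\<gamma> - 1) + 1)" using A' by (intro mult_left_mono) auto
    finally show "norm y \<le> A' * (norm p powr (\<gamma> - 1) + 1)" .
  qed
  have "c * norm p powr \<gamma> - A' \<le> y \<bullet> p \<and> norm y \<le> A' * (norm p powr (\<gamma> - 1) + 1)"
    if x: "x \<in> \<Omega>" and \<mu>: "0 \<le> \<mu>" and h: "h \<in> graph_ext (H x) p \<mu>" "h \<le> 0" "0 < \<mu> \<longrightarrow> h = 0"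
      and y: "y \<in> graph_ext (\<lambda>p \<mu>. \<mu> *\<^sub>R D\<^sub>p H x p \<mu>) p \<mu>" for x p \<mu> h y
  proof (cases "\<mu> = 0")
    case False
    then have \<mu>0: "0 < \<mu>" using \<mu> by simp
    then have h0: "H x p \<mu> = 0" and y': "y = \<mu> *\<^sub>R D\<^sub>p H x p \<mu>" using h y by (auto simp: graph_ext_def)
    show ?thesis
    proof (cases "M \<le> \<mu>")
      case True
      have "norm y \<le> A * norm p powr (\<gamma> - 1)" "c * norm p powr \<gamma> \<le> y \<bullet> p" using large[OF x True h0] y' by auto
      moreover have "A * norm p powr (\<gamma> - 1) \<le> A' * (norm p powr (\<gamma> - 1) + 1)"
        using A A' by (intro mult_mono) auto
      ultimately show ?thesis using A'(1) by auto
    next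
      case False
      have "norm p \<le> K * (max 1 \<mu>) powr \<delta>" using K(2)[OF x \<mu>0] h0 by simp
      also have "\<dots> \<le> P" unfolding P_def using False M K(1) exponents by (intro mult_left_mono powr_mono2) auto
      finally have p: "norm p \<le> P" .
      show ?thesis using small[OF x \<mu>0, of p] False p y' by (intro conclude p) auto
    qed
  next
    case True
    from h(1) True obtain Q N where Q: "\<And>k::nat. 0 < N k" "Q \<longlonglongrightarrow> p" "N \<longlonglongrightarrow> 0" "(\<lambda>k. H x (Q k) (N k)) \<longlonglongrightarrow> h"
      by (auto simp: graph_ext_def)
    \<comment> \<open>At density zero the gradient is bounded because \<open>H\<close> is below \<open>1\<close> along the approximating sequence.\<close>
    have "\<forall>\<^sub>F k in sequentially. H x (Q k) (N k) < 1" using Q(4) h(2) by (intro order_tendstoD(2)) auto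
    moreover have "\<forall>\<^sub>F k in sequentially. N k < 1" using Q(3) by (rule order_tendstoD) simp
    ultimately have ev: "\<forall>\<^sub>F k in sequentially. norm (Q k) \<le> P"
    proof eventually_elim
      case (elim k)
      have "norm (Q k) \<le> K * (max 1 (N k)) powr \<delta>" using K(2)[OF x Q(1)[of k], of "Q k"] elim by simp
      also have "\<dots> \<le> P" unfolding P_def using elim M K(1) exponents by (intro mult_left_mono powr_mono2) auto
      finally show ?case .
    qed
    have p: "norm p \<le> P" by (rule tendsto_upperbound[OF tendsto_norm[OF Q(2)] ev]) simp
    from y True obtain Q' N' where Q': "\<And>k::nat. 0 < N' k" "Q' \<longlonglongrightarrow> p" "N' \<longlonglongrightarrow> 0" "(\<lambda>k. N' k *\<^sub>R D\<^sub>p H x (Q' k) (N' k)) \<longlonglongrightarrow> y"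
      by (auto simp: graph_ext_def)
    have "\<forall>\<^sub>F k in sequentially. norm (Q' k) < P + 1" using tendsto_norm[OF Q'(2)] p by (intro order_tendstoD(2)) auto
    moreover have "\<forall>\<^sub>F k in sequentially. N' k < 1" using Q'(3) by (rule order_tendstoD) simp
    ultimately have ev': "\<forall>\<^sub>F k in sequentially. norm (N' k *\<^sub>R D\<^sub>p H x (Q' k) (N' k)) \<le> J"
      by eventually_elim (use M in \<open>intro small x Q'(1); simp\<close>)
    have "norm y \<le> J" by (rule tendsto_upperbound[OF tendsto_norm[OF Q'(4)] ev']) simp
    then show ?thesis by (rule conclude[OF p])
  qed
  then show ?thesis using c A'(1) by blast
qed

end

section \<open>From Lebesgue to Borel representatives\<close>

lemma AE_lebesgue_on_iff:
  fixes \<Omega> :: "'a::euclidean_space set"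
  assumes "\<Omega> \<in> sets lebesgue"
  shows "(AE x in lebesgue_on \<Omega>. P x) \<longleftrightarrow> (AE x in lborel. x \<in> \<Omega> \<longrightarrow> P x)"
  using assms by (simp add: AE_restrict_space_iff AE_completion_iff)

text \<open>A Lebesgue measurable real function agrees almost everywhere with a Borel function; apply this to each
  coordinate.\<close>

lemma lebesgue_on_borel_representative:
  fixes f :: "'a::euclidean_space \<Rightarrow> 'b::euclidean_space"
  assumes \<Omega>: "\<Omega> \<in> sets lebesgue" and f: "f \<in> borel_measurable (lebesgue_on \<Omega>)"
  obtains g where "g \<in> borel_measurable borel" "AE x in lborel. x \<in> \<Omega> \<longrightarrow> f x = g x"
proof -
  define F where "F x = (if x \<in> \<Omega> then f x else 0)" for x
  have F: "F \<in> borel_measurable lebesgue"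
    unfolding F_def using f \<Omega> by (subst borel_measurable_if) auto
  have "\<exists>g'. g' \<in> borel_measurable lborel \<and> (AE x in lborel. F x \<bullet> b = g' x)" for b
  proof -
    have "(\<lambda>x. F x \<bullet> b) \<in> borel_measurable lebesgue" using F by measurable
    from completion_ex_borel_measurable_real[OF this] show ?thesis by blast
  qed
  then obtain G where G: "\<And>b. G b \<in> borel_measurable lborel" "\<And>b. AE x in lborel. F x \<bullet> b = G b x"
    by metis
  define g where "g x = (\<Sum>b\<in>Basis. G b x *\<^sub>R b)" for x
  have [measurable]: "G b \<in> borel_measurable borel" for b using G(1)[of b] by simp
  have gm: "g \<in> borel_measurable borel" unfolding g_def by measurable
  have "AE x in lborel. \<forall>b\<in>Basis. F x \<bullet> b = G b x"
    by (rule AE_finite_allI) (use G in auto)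
  then have "AE x in lborel. x \<in> \<Omega> \<longrightarrow> f x = g x"
  proof eventually_elim
    case (elim x)
    then have "F x = g x" unfolding g_def by (subst euclidean_representation[symmetric]) simp
    then show ?case by (auto simp: F_def split: if_splits)
  qed
  then show thesis using that gm by blast
qed

lemma Lp_loc_imp_Lp:
  fixes f :: "'a::euclidean_space \<Rightarrow> 'b::euclidean_space"
  assumes f: "Lp_loc \<Omega> q f" and g: "g \<in> borel_measurable borel" "AE x in lborel. x \<in> \<Omega> \<longrightarrow> f x = g x"
    and K: "compact K" "K \<subseteq> \<Omega>"
  shows "Lp q (lborel_on K) g"
proof -
  have [measurable]: "g \<in> borel_measurable borel" by (rule g)
  have Km[measurable]: "K \<in> sets borel" using K by (simp add: compact_imp_closed borel_closed)
  then have Kl: "K \<in> sets lebesgue" by simp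
  have "integrable (lebesgue_on K) (\<lambda>x. norm (f x) powr q)" using f K by (simp add: Lp_loc_def)
  then have fin: "(\<integral>\<^sup>+x. norm (f x) powr q \<partial>lebesgue_on K) < \<infinity>" by (simp add: integrable_iff_bounded)
  have "AE x in lebesgue_on K. f x = g x"
    unfolding AE_lebesgue_on_iff[OF Kl] using g(2) by eventually_elim (use K in blast)
  then have "(\<integral>\<^sup>+x. norm (g x) powr q \<partial>lebesgue_on K) = (\<integral>\<^sup>+x. norm (f x) powr q \<partial>lebesgue_on K)"
    by (intro nn_integral_cong_AE) (auto elim!: eventually_mono)
  with fin have "(\<integral>\<^sup>+x. norm (g x) powr q \<partial>lebesgue_on K) < \<infinity>" by simp
  moreover have "(\<integral>\<^sup>+x. norm (g x) powr q \<partial>lebesgue_on K) = (\<integral>\<^sup>+x. norm (g x) powr q \<partial>lborel_on K)"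
    using Kl by (simp add: nn_integral_restrict_space nn_integral_completion)
  ultimately show ?thesis by (subst Lp_iff_nn_integral) (auto intro: borel_measurable_lborel_on)
qed

lemma test_function_grad:
  assumes "test_function \<Omega> \<phi>"
  shows "C1 \<phi> (grad \<phi>)" "x \<notin> \<Omega> \<Longrightarrow> \<phi> x = 0" "x \<notin> \<Omega> \<Longrightarrow> grad \<phi> x = 0"
proof -
  let ?S = "closure {x. \<phi> x \<noteq> 0}"
  show c: "C1 \<phi> (grad \<phi>)" using assms by (intro smooth_C1_grad) (simp add: test_function_def)
  have z: "\<phi> x = 0" if "x \<in> - ?S" for x
  proof (rule ccontr)
    assume "\<phi> x \<noteq> 0"
    then have "x \<in> {x. \<phi> x \<noteq> 0}" by (rule CollectI)
    then have "x \<in> ?S" by (rule subsetD[OF closure_subset])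
    with that show False by (simp only: Compl_iff simp_thms)
  qed
  have sub: "?S \<subseteq> \<Omega>" using assms unfolding test_function_def by (elim conjE)
  have out: "x \<in> - ?S" if "x \<notin> \<Omega>" using that sub by (meson ComplI subsetD)
  show "\<phi> x = 0" if "x \<notin> \<Omega>" by (rule z[OF out[OF that]])
  show "grad \<phi> x = 0" if "x \<notin> \<Omega>"
    by (rule C1_zero_outside[OF c open_Compl[OF closed_closure] z out[OF that]])
qed

lemma integral_lebesgue_on_eq_lborel:
  fixes f :: "'a::euclidean_space \<Rightarrow> 'b::euclidean_space"
  assumes \<Omega>: "\<Omega> \<in> sets lebesgue" and g: "g \<in> borel_measurable borel"
    and AE: "AE x in lborel. x \<in> \<Omega> \<longrightarrow> f x = g x" and z: "\<And>x. x \<notin> \<Omega> \<Longrightarrow> g x = 0"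
    and f: "f \<in> borel_measurable (lebesgue_on \<Omega>)"
  shows "(LINT x|lebesgue_on \<Omega>. f x) = (LINT x|lborel. g x)"
proof -
  have gm: "g \<in> borel_measurable lborel" using g by simp
  have gl: "g \<in> borel_measurable (lebesgue_on \<Omega>)"
    using measurable_completion[OF gm] by (rule measurable_restrict_space1)
  have "(LINT x|lebesgue_on \<Omega>. f x) = (LINT x|lebesgue_on \<Omega>. g x)"
    by (rule integral_cong_AE[OF f gl]) (use AE \<Omega> in \<open>simp add: AE_lebesgue_on_iff\<close>)
  also have "\<dots> = (LINT x|lebesgue. indicator \<Omega> x *\<^sub>R g x)"
    using \<Omega> by (subst integral_restrict_space) auto
  also have "\<dots> = (LINT x|lebesgue. g x)"
    by (intro Bochner_Integration.integral_cong refl) (use z in \<open>auto simp: indicator_def\<close>)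
  also have "\<dots> = (LINT x|lborel. g x)" by (rule integral_completion[OF gm])
  finally show ?thesis .
qed

theorem theorem1p1:
  fixes \<Omega> :: "'a::euclidean_space set"
    and H :: "'a \<Rightarrow> 'a \<Rightarrow> real \<Rightarrow> real"
    and \<alpha> \<beta> \<tau> \<delta> \<epsilon> \<gamma> C :: real
    and m u :: "'a \<Rightarrow> real"
  assumes "open \<Omega>" and "connected \<Omega>"
    and H_measurable:
      "(\<lambda>(x, p, \<mu>). H x p \<mu>) \<in> borel_measurable (lebesgue_on (\<Omega> \<times> UNIV \<times> {0<..}))"
    and H_differentiable:
      "\<And>x p \<mu>. x \<in> \<Omega> \<Longrightarrow> \<mu> > 0 \<Longrightarrow> (\<lambda>q. H x q \<mu>) differentiable (at p)"
    and H_continuous: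
      "AE x in lebesgue_on \<Omega>. continuous_on (UNIV \<times> {0<..}) (\<lambda>(p, \<mu>). H x p \<mu>)"
      "AE x in lebesgue_on \<Omega>. continuous_on (UNIV \<times> {0<..}) (\<lambda>(p, \<mu>). D\<^sub>p H x p \<mu>)"
    and parameters: "\<alpha> > 1" "0 \<le> \<tau>" "\<tau> < 1" "\<beta> > \<tau> / (\<alpha> - 1)"
      "\<delta> = (\<beta> + \<tau>) / \<alpha>" "\<epsilon> > 0" "\<beta> - \<delta> > \<epsilon>" "\<gamma> = (\<beta> + 1) / \<delta>" "C > 0"
    and growth:
      "\<And>x p \<mu>. x \<in> \<Omega> \<Longrightarrow> \<mu> > 0 \<Longrightarrow>
         norm (D\<^sub>p H x p \<mu>) \<le> C * (1 / \<mu> + 1 / \<mu> powr \<tau>) * norm p powr (\<alpha> - 1)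
                            + C * (\<mu> powr (\<beta> - \<delta>) + 1 / \<mu>)"
    and coercivity:
      "\<And>x p \<mu>. x \<in> \<Omega> \<Longrightarrow> \<mu> > 0 \<Longrightarrow>
         D\<^sub>p H x p \<mu> \<bullet> p \<ge> inverse C * (1 / (\<mu> powr \<tau> + 1)) * norm p powr \<alpha>
                         - C * (\<mu> powr (\<beta> - \<delta> - \<epsilon>) + 1) * norm p"
    and H_zero_lower:
      "\<And>x \<mu>. x \<in> \<Omega> \<Longrightarrow> \<mu> > 0 \<Longrightarrow> H x 0 \<mu> \<ge> - C * (\<mu> powr \<beta> + 1)"
    and H_zero_upper:
      "\<And>x \<mu>. x \<in> \<Omega> \<Longrightarrow> \<mu> \<ge> C \<Longrightarrow> H x 0 \<mu> \<le> - inverse C * \<mu> powr \<beta>"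
    and solution: "mfg_solution \<Omega> H \<beta> \<gamma> m u"
  shows "\<exists>v. continuous_on \<Omega> v \<and> (AE x in lebesgue_on \<Omega>. v x = u x) \<and> locally_Hoelder_on \<Omega> v"
proof -
  interpret mfg_hamiltonian \<Omega> H \<alpha> \<beta> \<tau> \<delta> \<epsilon> \<gamma> C
    by unfold_locales (fact H_differentiable parameters growth coercivity H_zero_lower H_zero_upper)+
  have \<Omega>: "\<Omega> \<in> sets lebesgue" using \<open>open \<Omega>\<close> by auto
  note AE_iff = AE_lebesgue_on_iff[OF \<Omega>]
  obtain Du h j where
    m0: "AE x in lborel. x \<in> \<Omega> \<longrightarrow> 0 \<le> m x" and W: "W1_loc \<Omega> \<gamma> u Du"
    and h: "admissible \<Omega> H Du m h" "AE x in lborel. x \<in> \<Omega> \<longrightarrow> h x \<le> 0"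
      "AE x in lborel. x \<in> \<Omega> \<longrightarrow> 0 < m x \<longrightarrow> h x = 0"
    and j: "admissible \<Omega> (\<lambda>x p \<mu>. \<mu> *\<^sub>R D\<^sub>p H x p \<mu>) Du m j"
      "\<And>\<phi>. test_function \<Omega> \<phi> \<Longrightarrow> (LINT x|lebesgue_on \<Omega>. j x \<bullet> grad \<phi> x) = 0"
    using solution unfolding mfg_solution_def AE_iff by blast
  have um: "u \<in> borel_measurable (lebesgue_on \<Omega>)" and Dum: "Du \<in> borel_measurable (lebesgue_on \<Omega>)"
    and jm: "j \<in> borel_measurable (lebesgue_on \<Omega>)"
    using W j(1) by (auto simp: W1_loc_def Lp_loc_def admissible_def)
  obtain u' where u': "u' \<in> borel_measurable borel" "AE x in lborel. x \<in> \<Omega> \<longrightarrow> u x = u' x"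
    using lebesgue_on_borel_representative[OF \<Omega> um] by blast
  obtain G where G: "G \<in> borel_measurable borel" "AE x in lborel. x \<in> \<Omega> \<longrightarrow> Du x = G x"
    using lebesgue_on_borel_representative[OF \<Omega> Dum] by blast
  obtain j' where j': "j' \<in> borel_measurable borel" "AE x in lborel. x \<in> \<Omega> \<longrightarrow> j x = j' x"
    using lebesgue_on_borel_representative[OF \<Omega> jm] by blast
  obtain c A where c: "0 < c" and A: "0 < A" and flux: "\<And>x p \<mu> h y. x \<in> \<Omega> \<Longrightarrow> 0 \<le> \<mu> \<Longrightarrow> h \<in> graph_ext (H x) p \<mu> \<Longrightarrow> h \<le> 0 \<Longrightarrow> (0 < \<mu> \<longrightarrow> h = 0) \<Longrightarrow>
     y \<in> graph_ext (\<lambda>p \<mu>. \<mu> *\<^sub>R D\<^sub>p H x p \<mu>) p \<mu> \<Longrightarrow>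
     c * norm p powr \<gamma> - A \<le> y \<bullet> p \<and> norm y \<le> A * (norm p powr (\<gamma> - 1) + 1)"
    using flux_structure by blast
  have hx: "AE x in lborel. x \<in> \<Omega> \<longrightarrow> h x \<in> graph_ext (H x) (Du x) (m x)"
    and jx: "AE x in lborel. x \<in> \<Omega> \<longrightarrow> j x \<in> graph_ext (\<lambda>p \<mu>. \<mu> *\<^sub>R D\<^sub>p H x p \<mu>) (Du x) (m x)"
    using h(1) j(1) unfolding admissible_def AE_iff by blast+
  have st: "AE x in lborel. x \<in> \<Omega> \<longrightarrow> c * norm (G x) powr \<gamma> - A \<le> j' x \<bullet> G x \<and> norm (j' x) \<le> A * (norm (G x) powr (\<gamma> - 1) + 1)"
    using hx jx m0 h(2,3) G(2) j'(2)
  proof eventually_elim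
    case (elim x)
    show ?case
    proof
      assume x: "x \<in> \<Omega>"
      show "c * norm (G x) powr \<gamma> - A \<le> j' x \<bullet> G x \<and> norm (j' x) \<le> A * (norm (G x) powr (\<gamma> - 1) + 1)"
        using flux[OF x, of "m x" "h x" "Du x" "j x"] elim x by simp
    qed
  qed
  have ms: "(\<lambda>x. f x *\<^sub>R k x) \<in> borel_measurable (lebesgue_on \<Omega>)"
    if "f \<in> borel_measurable (lebesgue_on \<Omega>)" "k \<in> borel_measurable (lebesgue_on \<Omega>)"
    for f :: "'a \<Rightarrow> real" and k :: "'a \<Rightarrow> 'a"
    using that by measurable
  have tl: "\<phi> \<in> borel_measurable (lebesgue_on \<Omega>)" "grad \<phi> \<in> borel_measurable (lebesgue_on \<Omega>)"
    "\<phi> \<in> borel_measurable borel" "grad \<phi> \<in> borel_measurable borel"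
    if "test_function \<Omega> \<phi>" for \<phi>
  proof -
    show b: "\<phi> \<in> borel_measurable borel" "grad \<phi> \<in> borel_measurable borel"
      using C1_measurable[OF test_function_grad(1)[OF that]] by auto
    have "\<phi> \<in> borel_measurable lborel" "grad \<phi> \<in> borel_measurable lborel" using b by auto
    then show "\<phi> \<in> borel_measurable (lebesgue_on \<Omega>)" "grad \<phi> \<in> borel_measurable (lebesgue_on \<Omega>)"
      by (auto intro!: measurable_restrict_space1 measurable_completion)
  qed
  have wg: "weak_grad \<Omega> u' G"
    unfolding weak_grad_def
  proof (intro conjI allI impI u'(1) G(1))
    fix \<phi> :: "'a \<Rightarrow> real" assume \<phi>: "test_function \<Omega> \<phi>"
    note [measurable] = u'(1) G(1) tl(3,4)[OF \<phi>]
    have "(LINT x|lebesgue_on \<Omega>. u x *\<^sub>R grad \<phi> x) = (LINT x|lborel. u' x *\<^sub>R grad \<phi> x)"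
    proof (rule integral_lebesgue_on_eq_lborel[OF \<Omega>])
      show "(\<lambda>x. u' x *\<^sub>R grad \<phi> x) \<in> borel_measurable borel" by measurable
      show "AE x in lborel. x \<in> \<Omega> \<longrightarrow> u x *\<^sub>R grad \<phi> x = u' x *\<^sub>R grad \<phi> x" using u'(2) by eventually_elim simp
      show "u' x *\<^sub>R grad \<phi> x = 0" if "x \<notin> \<Omega>" for x using test_function_grad(3)[OF \<phi> that] by simp
      show "(\<lambda>x. u x *\<^sub>R grad \<phi> x) \<in> borel_measurable (lebesgue_on \<Omega>)" by (rule ms[OF um tl(2)[OF \<phi>]])
    qed
    moreover have "(LINT x|lebesgue_on \<Omega>. \<phi> x *\<^sub>R Du x) = (LINT x|lborel. \<phi> x *\<^sub>R G x)"
    proof (rule integral_lebesgue_on_eq_lborel[OF \<Omega>])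
      show "(\<lambda>x. \<phi> x *\<^sub>R G x) \<in> borel_measurable borel" by measurable
      show "AE x in lborel. x \<in> \<Omega> \<longrightarrow> \<phi> x *\<^sub>R Du x = \<phi> x *\<^sub>R G x" using G(2) by eventually_elim simp
      show "\<phi> x *\<^sub>R G x = 0" if "x \<notin> \<Omega>" for x using test_function_grad(2)[OF \<phi> that] by simp
      show "(\<lambda>x. \<phi> x *\<^sub>R Du x) \<in> borel_measurable (lebesgue_on \<Omega>)" by (rule ms[OF tl(1)[OF \<phi>] Dum])
    qed
    moreover have "(LINT x|lebesgue_on \<Omega>. u x *\<^sub>R grad \<phi> x) = - (LINT x|lebesgue_on \<Omega>. \<phi> x *\<^sub>R Du x)"
      using W \<phi> unfolding W1_loc_def has_weak_gradient_def by blast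
    ultimately show "(LINT x|lborel. u' x *\<^sub>R grad \<phi> x) = - (LINT x|lborel. \<phi> x *\<^sub>R G x)" by simp
  qed
  have df: "(LINT x|lborel. j' x \<bullet> grad \<phi> x) = 0" if \<phi>: "test_function \<Omega> \<phi>" for \<phi>
  proof -
    note [measurable] = j'(1) tl(3,4)[OF \<phi>]
    have "(LINT x|lebesgue_on \<Omega>. j x \<bullet> grad \<phi> x) = (LINT x|lborel. j' x \<bullet> grad \<phi> x)"
    proof (rule integral_lebesgue_on_eq_lborel[OF \<Omega>])
      show "(\<lambda>x. j' x \<bullet> grad \<phi> x) \<in> borel_measurable borel" by measurable
      show "AE x in lborel. x \<in> \<Omega> \<longrightarrow> j x \<bullet> grad \<phi> x = j' x \<bullet> grad \<phi> x" using j'(2) by eventually_elim simp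
      show "j' x \<bullet> grad \<phi> x = 0" if "x \<notin> \<Omega>" for x using test_function_grad(3)[OF \<phi> that] by simp
      show "(\<lambda>x. j x \<bullet> grad \<phi> x) \<in> borel_measurable (lebesgue_on \<Omega>)"
        using jm tl(2)[OF \<phi>] by (rule borel_measurable_inner)
    qed
    then show ?thesis using j(2)[OF \<phi>] by simp
  qed
  have loc: "Lp_loc \<Omega> 1 u" "Lp_loc \<Omega> 1 Du" "Lp_loc \<Omega> \<gamma> u" "Lp_loc \<Omega> \<gamma> Du"
    using W unfolding W1_loc_def has_weak_gradient_def by blast+
  have eq: "quasilinear_equation \<Omega> \<gamma> c A u' G j'"
  proof
    show "Lp 1 (lborel_on K) u' \<and> Lp 1 (lborel_on K) G" if "compact K" "K \<subseteq> \<Omega>" for K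
      by (intro conjI Lp_loc_imp_Lp[OF loc(1) u' that] Lp_loc_imp_Lp[OF loc(2) G that])
    show "Lp \<gamma> (lborel_on K) u' \<and> Lp \<gamma> (lborel_on K) G" if "compact K" "K \<subseteq> \<Omega>" for K
      by (intro conjI Lp_loc_imp_Lp[OF loc(3) u' that] Lp_loc_imp_Lp[OF loc(4) G that])
    show "AE x in lborel. x \<in> \<Omega> \<longrightarrow> c * norm (G x) powr \<gamma> - A \<le> j' x \<bullet> G x" using st by eventually_elim blast
    show "AE x in lborel. x \<in> \<Omega> \<longrightarrow> norm (j' x) \<le> A * (norm (G x) powr (\<gamma> - 1) + 1)" using st by eventually_elim blast
  qed (fact \<open>open \<Omega>\<close> exponents(4) c A wg j'(1) df)+
  obtain v where v: "continuous_on \<Omega> v" "AE x in lborel. x \<in> \<Omega> \<longrightarrow> v x = u' x" "locally_Hoelder_on \<Omega> v"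
    using quasilinear_equation.hoelder_representative[OF eq] by blast
  have "AE x in lborel. x \<in> \<Omega> \<longrightarrow> v x = u x" using v(2) u'(2) by eventually_elim simp
  then show ?thesis using v(1,3) unfolding AE_iff by blast
qed

end
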